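(* Let $1<\alpha\le 2$, let $L$ be the spectrally positive $\alpha$-stable Lévy process normalized by $\ln \mathbb{E}[e^{i\lambda L_1}]=(i\lambda)^\alpha e^{-i\pi\alpha\,\mathrm{sgn}(\lambda)}$ ($\lambda\in\mathbb{R}$), let $L^{(\mathrm{ex})}$ be its normalized excursion on $[0,1]$, and set $\mathcal{A}_{\mathrm{ex}}=\int_0^1 L^{(\mathrm{ex})}_t\,dt$. Then for every $\lambda\ge 0$, $$\int_0^{+\infty}(1-e^{-\lambda t})\, \mathbb{E}\left[e^{-t^{1+\frac{1}{\alpha}} \mathcal{A}_{\mathrm{ex}}}\right] t^{-(1+\frac{1}{\alpha})}\,dt =\alpha\,\Gamma\left(1-\frac{1}{\alpha}\right) \left( \frac{\Phi_\alpha'(0)}{\Phi_\alpha(0)}-\frac{\Phi_\alpha'(\lambda)}{\Phi_\alpha(\lambda)}\right),$$ where $\Phi_\alpha$ is the M-Wright function $$\Phi_\alpha(x)= \frac{1}{\pi}\sum_{n=0}^{+\infty} \frac{(-1)^{n}}{n!}\Gamma\left(\frac{1+n}{1+\alpha}\right)\sin\left(\pi\frac{1+n}{1+\alpha}\right) (1+\alpha)^{\frac{n-\alpha}{1+\alpha}} x^n.$$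
   Context: $L$ is an $\alpha$-stable Lévy process without negative jumps, $1<\alpha\le 2$, realized on the Skorokhod space of càdlàg paths. Powers of complex numbers are principal branches; the normalization is equivalent to $\mathbb{E}[e^{-\lambda L_1}]=e^{\lambda^\alpha}$ for $\lambda\ge0$ (so for $\alpha=2$, $L=\sqrt2\,B$ with $B$ a standard Brownian motion). $\mathbb{P}_x$ is the law of $L$ started at $L_0=x$, $\mathbb{P}=\mathbb{P}_0$, $(\mathcal{F}_t)_{t\ge0}$ is the natural filtration, and $T_0=\inf\{t\ge0: L_t=0\}$. Normalized excursion: its law $\mathbb{P}^{\uparrow\,1}_{0,0}$ is the law of the bridge of $L$ of length $1$ from $0$ to $0$ conditioned to stay positive. It is characterized by: for every $s<1$, its restriction to $\mathcal{F}_s$ is the (weak) limit as $x\downarrow0$ of $\mathbb{P}_x(\,\cdot\mid T_0=1)$ restricted to $\mathcal{F}_s$. *)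

theory Defs
  imports "HOL-Probability.Probability"
begin

section \<open>Cadlag paths and the Skorokhod topology\<close>

definition cadlag_on :: "real set \<Rightarrow> (real \<Rightarrow> real) \<Rightarrow> bool" where
  "cadlag_on I \<omega> \<longleftrightarrow>
     (\<forall>t\<in>I. (\<omega> \<longlongrightarrow> \<omega> t) (at t within (I \<inter> {t<..})) \<and>
            (\<exists>l. (\<omega> \<longlongrightarrow> l) (at t within (I \<inter> {..<t}))))"

text \<open>Paths with time set \<open>I\<close> are functions that are \<^const>\<open>undefined\<close> outside \<open>I\<close>.\<close>

definition cadlag_paths :: "real set \<Rightarrow> (real \<Rightarrow> real) set" where
  "cadlag_paths I = {\<omega> \<in> extensional I. cadlag_on I \<omega>}"

definition path_space :: "real set \<Rightarrow> (real \<Rightarrow> real) measure" where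
  "path_space I = restrict_space (Pi\<^sub>M I (\<lambda>_. borel)) (cadlag_paths I)"

lemma space_path_space [simp]: "space (path_space I) = cadlag_paths I"
  by (auto simp: path_space_def space_restrict_space space_PiM cadlag_paths_def PiE_def)

text \<open>The \<open>J\<^sub>1\<close> distance on the paths over \<open>[0, s]\<close>. An increasing bijection of an interval is
  automatically a homeomorphism.\<close>

definition time_change :: "real \<Rightarrow> (real \<Rightarrow> real) \<Rightarrow> bool" where
  "time_change s \<mu> \<longleftrightarrow> strict_mono_on {0..s} \<mu> \<and> bij_betw \<mu> {0..s} {0..s}"

definition skorokhod_close ::
    "real \<Rightarrow> (real \<Rightarrow> real) \<Rightarrow> (real \<Rightarrow> real) \<Rightarrow> real set" where
  "skorokhod_close s x y =
     {e. 0 < e \<and> (\<exists>\<mu>. time_change s \<mu> \<and> (\<forall>t\<in>{0..s}. \<bar>\<mu> t - t\<bar> \<le> e \<and> \<bar>x t - y (\<mu> t)\<bar> \<le> e))}"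

definition skorokhod_dist :: "real \<Rightarrow> (real \<Rightarrow> real) \<Rightarrow> (real \<Rightarrow> real) \<Rightarrow> real" where
  "skorokhod_dist s x y =
     (if x \<in> cadlag_paths {0..s} \<and> y \<in> cadlag_paths {0..s} then Inf (skorokhod_close s x y) else 0)"

definition skorokhod_topology :: "real \<Rightarrow> (real \<Rightarrow> real) topology" where
  "skorokhod_topology s = Metric_space.mtopology (cadlag_paths {0..s}) (skorokhod_dist s)"

lemma cadlag_on_bounded:
  assumes "cadlag_on {0..s} \<omega>"
  shows "\<exists>C. \<forall>t\<in>{0..s}. \<bar>\<omega> t\<bar> \<le> C"
proof -
  let ?I = "{0..s}"
  have "\<exists>U C. open U \<and> t \<in> U \<and> (\<forall>u\<in>U \<inter> ?I. \<bar>\<omega> u\<bar> \<le> C)" if t: "t \<in> ?I" for t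
  proof -
    from assms t obtain l where
      r: "(\<omega> \<longlongrightarrow> \<omega> t) (at t within (?I \<inter> {t<..}))" and
      l: "(\<omega> \<longlongrightarrow> l) (at t within (?I \<inter> {..<t}))"
      unfolding cadlag_on_def by blast
    let ?C = "\<bar>\<omega> t\<bar> + \<bar>l\<bar> + 1"
    have "eventually (\<lambda>u. dist (\<omega> u) (\<omega> t) < 1) (at t within (?I \<inter> {t<..}))"
      using tendstoD[OF r] by simp
    then obtain U where U: "open U" "t \<in> U"
        "\<And>u. u \<in> U \<Longrightarrow> u \<noteq> t \<Longrightarrow> u \<in> ?I \<inter> {t<..} \<Longrightarrow> dist (\<omega> u) (\<omega> t) < 1"
      unfolding eventually_at_topological by blast
    have "eventually (\<lambda>u. dist (\<omega> u) l < 1) (at t within (?I \<inter> {..<t}))"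
      using tendstoD[OF l] by simp
    then obtain V where V: "open V" "t \<in> V"
        "\<And>u. u \<in> V \<Longrightarrow> u \<noteq> t \<Longrightarrow> u \<in> ?I \<inter> {..<t} \<Longrightarrow> dist (\<omega> u) l < 1"
      unfolding eventually_at_topological by blast
    have "\<bar>\<omega> u\<bar> \<le> ?C" if u: "u \<in> (U \<inter> V) \<inter> ?I" for u
    proof (cases u t rule: linorder_cases)
      case less
      then have "dist (\<omega> u) l < 1" using u V(3) by auto
      then show ?thesis by (simp add: dist_real_def)
    next
      case equal
      then show ?thesis by simp
    next
      case greater
      then have "dist (\<omega> u) (\<omega> t) < 1" using u U(3) by auto
      then show ?thesis by (simp add: dist_real_def)
    qed
    then show ?thesis
      using U V by (intro exI[of _ "U \<inter> V"] exI[of _ ?C]) auto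
  qed
  then obtain U C where UC: "\<And>t. t \<in> ?I \<Longrightarrow> open (U t)" "\<And>t. t \<in> ?I \<Longrightarrow> t \<in> U t"
      "\<And>t u. t \<in> ?I \<Longrightarrow> u \<in> U t \<inter> ?I \<Longrightarrow> \<bar>\<omega> u\<bar> \<le> C t"
    by metis
  have "compact ?I" by simp
  then obtain T where T: "T \<subseteq> ?I" "finite T" "?I \<subseteq> (\<Union>t\<in>T. U t)"
    by (rule compactE_image[of ?I ?I U]) (use UC in auto)
  have "\<bar>\<omega> u\<bar> \<le> (\<Sum>t\<in>T. \<bar>C t\<bar>)" if "u \<in> ?I" for u
  proof -
    from that T obtain t where t: "t \<in> T" "u \<in> U t" by blast
    then have "\<bar>\<omega> u\<bar> \<le> C t" using UC(3)[of t u] that T by auto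
    also have "\<dots> \<le> \<bar>C t\<bar>" by simp
    also have "\<dots> \<le> (\<Sum>t\<in>T. \<bar>C t\<bar>)" using T t by (intro member_le_sum) auto
    finally show ?thesis .
  qed
  then show ?thesis by blast
qed

lemma time_change_id: "time_change s (\<lambda>t. t)"
  by (auto simp: time_change_def strict_mono_on_def bij_betw_def inj_on_def)

lemma time_change_inv:
  assumes "time_change s \<mu>"
  obtains \<nu> where "time_change s \<nu>" "\<And>t. t \<in> {0..s} \<Longrightarrow> \<mu> (\<nu> t) = t"
proof -
  let ?\<nu> = "inv_into {0..s} \<mu>"
  have m: "strict_mono_on {0..s} \<mu>" and b: "bij_betw \<mu> {0..s} {0..s}"
    using assms by (auto simp: time_change_def)
  have b': "bij_betw ?\<nu> {0..s} {0..s}" by (rule bij_betw_inv_into[OF b])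
  have r: "\<mu> (?\<nu> t) = t" if "t \<in> {0..s}" for t
    using b that by (metis bij_betw_inv_into_right)
  have "strict_mono_on {0..s} ?\<nu>"
  proof (rule strict_mono_onI)
    fix a c :: real assume ac: "a \<in> {0..s}" "c \<in> {0..s}" "a < c"
    have i: "?\<nu> a \<in> {0..s}" "?\<nu> c \<in> {0..s}"
      using bij_betwE[OF b'] ac by blast+
    show "?\<nu> a < ?\<nu> c"
    proof (rule ccontr)
      assume "\<not> ?\<nu> a < ?\<nu> c"
      then have "\<mu> (?\<nu> c) \<le> \<mu> (?\<nu> a)"
        using m i by (metis strict_mono_onD less_eq_real_def not_less)
      then show False using r ac by simp
    qed
  qed
  then show ?thesis using b' r by (intro that[of ?\<nu>]) (auto simp: time_change_def)
qed

lemma skorokhod_close_nonempty: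
  assumes "x \<in> cadlag_paths {0..s}" "y \<in> cadlag_paths {0..s}"
  shows "skorokhod_close s x y \<noteq> {}"
proof -
  from assms obtain C D where C: "\<forall>t\<in>{0..s}. \<bar>x t\<bar> \<le> C" and D: "\<forall>t\<in>{0..s}. \<bar>y t\<bar> \<le> D"
    using cadlag_on_bounded unfolding cadlag_paths_def by blast
  have "\<bar>x t - y t\<bar> \<le> \<bar>C\<bar> + \<bar>D\<bar> + 1" if "t \<in> {0..s}" for t
    using bspec[OF C that] bspec[OF D that] by linarith
  then have "\<bar>C\<bar> + \<bar>D\<bar> + 1 \<in> skorokhod_close s x y"
    using time_change_id[of s]
    by (auto simp: skorokhod_close_def intro!: exI[of _ "\<lambda>t. t"])
  then show ?thesis by blast
qed

lemma skorokhod_close_sym: "skorokhod_close s x y \<subseteq> skorokhod_close s y x"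
proof
  fix e assume "e \<in> skorokhod_close s x y"
  then obtain \<mu> where e: "0 < e" and m: "time_change s \<mu>"
    and h: "\<And>t. t \<in> {0..s} \<Longrightarrow> \<bar>\<mu> t - t\<bar> \<le> e \<and> \<bar>x t - y (\<mu> t)\<bar> \<le> e"
    by (auto simp: skorokhod_close_def)
  from time_change_inv[OF m] obtain \<nu> where n: "time_change s \<nu>"
    and r: "\<And>t. t \<in> {0..s} \<Longrightarrow> \<mu> (\<nu> t) = t" by blast
  have "\<bar>\<nu> t - t\<bar> \<le> e \<and> \<bar>y t - x (\<nu> t)\<bar> \<le> e" if t: "t \<in> {0..s}" for t
  proof -
    have "\<nu> t \<in> {0..s}" using n t by (auto simp: time_change_def dest: bij_betwE)
    from h[OF this] r[OF t] show ?thesis by (simp add: abs_minus_commute)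
  qed
  then show "e \<in> skorokhod_close s y x" using e n by (auto simp: skorokhod_close_def)
qed

lemma skorokhod_close_add:
  assumes "d \<in> skorokhod_close s x y" "e \<in> skorokhod_close s y z"
  shows "d + e \<in> skorokhod_close s x z"
proof -
  from assms obtain \<mu> \<nu> where d: "0 < d" "0 < e" and m: "time_change s \<mu>" "time_change s \<nu>"
    and h: "\<And>t. t \<in> {0..s} \<Longrightarrow> \<bar>\<mu> t - t\<bar> \<le> d \<and> \<bar>x t - y (\<mu> t)\<bar> \<le> d"
    and k: "\<And>t. t \<in> {0..s} \<Longrightarrow> \<bar>\<nu> t - t\<bar> \<le> e \<and> \<bar>y t - z (\<nu> t)\<bar> \<le> e"
    by (auto simp: skorokhod_close_def)
  have i: "\<mu> t \<in> {0..s}" if "t \<in> {0..s}" for t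
    using m that by (auto simp: time_change_def dest: bij_betwE)
  have "strict_mono_on {0..s} (\<lambda>t. \<nu> (\<mu> t))"
    using m i unfolding time_change_def by (intro strict_mono_onI) (metis strict_mono_onD)
  moreover have "bij_betw (\<lambda>t. \<nu> (\<mu> t)) {0..s} {0..s}"
    using m bij_betw_trans[of \<mu> _ _ \<nu>] by (auto simp: time_change_def comp_def)
  ultimately have "time_change s (\<lambda>t. \<nu> (\<mu> t))" by (simp add: time_change_def)
  moreover have "\<bar>\<nu> (\<mu> t) - t\<bar> \<le> d + e \<and> \<bar>x t - z (\<nu> (\<mu> t))\<bar> \<le> d + e" if "t \<in> {0..s}" for t
    using h[OF that] k[OF i[OF that]] by linarith
  ultimately show ?thesis using d by (auto simp: skorokhod_close_def)
qed

lemma bdd_below_skorokhod_close: "bdd_below (skorokhod_close s x y)"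
  by (rule bdd_belowI[of _ 0]) (auto simp: skorokhod_close_def)

lemma skorokhod_dist_eq_0D:
  assumes x: "x \<in> cadlag_paths {0..s}" and y: "y \<in> cadlag_paths {0..s}"
    and d: "skorokhod_dist s x y = 0"
  shows "x = y"
proof -
  have close: "\<exists>\<mu>. time_change s \<mu> \<and> (\<forall>t\<in>{0..s}. \<bar>\<mu> t - t\<bar> \<le> e \<and> \<bar>x t - y (\<mu> t)\<bar> \<le> e)"
    if e: "0 < e" for e
  proof -
    have "Inf (skorokhod_close s x y) < e" using d e x y by (simp add: skorokhod_dist_def)
    then obtain e' where "e' \<in> skorokhod_close s x y" "e' < e"
      using cInf_lessD[OF skorokhod_close_nonempty[OF x y]] by blast
    then show ?thesis unfolding skorokhod_close_def by (fastforce intro: order_trans)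
  qed
  have "x t = y t" if t: "t \<in> {0..s}" for t
  proof (cases "t = s")
    case True
    have top: "\<mu> s = s" if m: "time_change s \<mu>" for \<mu>
    proof -
      have s: "s \<in> {0..s}" using t True by auto
      then obtain u where u: "u \<in> {0..s}" "\<mu> u = s"
        using m unfolding time_change_def bij_betw_def by (metis imageE)
      have "\<mu> s \<in> {0..s}" using m s by (auto simp: time_change_def dest: bij_betwE)
      moreover have "u < s \<Longrightarrow> \<mu> u < \<mu> s"
        using m u s by (auto simp: time_change_def intro: strict_mono_onD)
      ultimately show ?thesis using u by (cases "u = s") auto
    qed
    have "\<bar>x s - y s\<bar> \<le> 0 + e" if "0 < e" for e
      using close[OF that] top t True by fastforce
    then have "\<bar>x s - y s\<bar> \<le> 0" by (rule field_le_epsilon)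
    then show ?thesis using True by simp
  next
    case False
    then have ts: "t < s" using t by auto
    have cx: "(x \<longlongrightarrow> x t) (at t within ({0..s} \<inter> {t<..}))"
      and cy: "(y \<longlongrightarrow> y t) (at t within ({0..s} \<inter> {t<..}))"
      using x y t by (auto simp: cadlag_paths_def cadlag_on_def)
    have "\<bar>x t - y t\<bar> \<le> 0 + e" if e: "0 < e" for e
    proof -
      have e3: "0 < e / 3" using e by simp
      obtain d1 where d1: "0 < d1"
        "\<And>u. u \<in> {0..s} \<inter> {t<..} \<Longrightarrow> dist u t < d1 \<Longrightarrow> dist (x u) (x t) < e / 3"
        using tendstoD[OF cx e3] unfolding eventually_at by auto
      obtain d2 where d2: "0 < d2"
        "\<And>u. u \<in> {0..s} \<inter> {t<..} \<Longrightarrow> dist u t < d2 \<Longrightarrow> dist (y u) (y t) < e / 3"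
        using tendstoD[OF cy e3] unfolding eventually_at by auto
      define h where "h = min (min d1 d2) (s - t) / 2"
      have h: "0 < h" "h < d1" "2 * h \<le> d2" "2 * h \<le> s - t"
        using d1(1) d2(1) ts by (auto simp: h_def min_def)
      define u where "u = t + h"
      have u: "u \<in> {0..s}" using h t by (auto simp: u_def)
      have "0 < min (e / 3) (h / 2)" using e h by simp
      from close[OF this] obtain \<mu> where m: "time_change s \<mu>"
        and k: "\<And>t. t \<in> {0..s} \<Longrightarrow> \<bar>\<mu> t - t\<bar> \<le> min (e / 3) (h / 2) \<and> \<bar>x t - y (\<mu> t)\<bar> \<le> min (e / 3) (h / 2)"
        by blast
      have mu: "\<mu> u \<in> {0..s}" using m u by (auto simp: time_change_def dest: bij_betwE)
      have k1: "\<bar>\<mu> u - u\<bar> \<le> h / 2" "\<bar>x u - y (\<mu> u)\<bar> \<le> e / 3" using k[OF u] by auto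
      have "dist (x u) (x t) < e / 3"
        using h u by (intro d1(2)) (auto simp: u_def dist_real_def)
      moreover have "dist (y (\<mu> u)) (y t) < e / 3"
        proof (rule d2(2))
        have b: "\<mu> u - u \<le> h / 2" "u - \<mu> u \<le> h / 2" using k1(1) by linarith+
        show "\<mu> u \<in> {0..s} \<inter> {t<..}" using b(2) h mu by (auto simp: u_def)
        show "dist (\<mu> u) t < d2" using b h by (auto simp: u_def dist_real_def abs_less_iff)
      qed
      ultimately show ?thesis using k1(2) unfolding dist_real_def by linarith
    qed
    then have "\<bar>x t - y t\<bar> \<le> 0" by (rule field_le_epsilon)
    then show ?thesis by simp
  qed
  then show ?thesis
    using x y by (intro extensionalityI[of x "{0..s}" y]) (auto simp: cadlag_paths_def)
qed

lemma Metric_space_skorokhod: "Metric_space (cadlag_paths {0..s}) (skorokhod_dist s)"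
proof
  fix x y
  show "skorokhod_dist s x y = skorokhod_dist s y x"
    unfolding skorokhod_dist_def
    using equalityI[OF skorokhod_close_sym[of s x y] skorokhod_close_sym[of s y x]] by simp
  show "0 \<le> skorokhod_dist s x y"
    unfolding skorokhod_dist_def using skorokhod_close_nonempty[of x s y]
    by (auto intro!: cInf_greatest simp: skorokhod_close_def)
next
  fix x y assume xy: "x \<in> cadlag_paths {0..s}" "y \<in> cadlag_paths {0..s}"
  have "skorokhod_dist s x x = 0"
  proof (rule antisym)
    have "skorokhod_dist s x x \<le> 0 + e" if "0 < e" for e
    proof -
      have "e \<in> skorokhod_close s x x"
        using that time_change_id[of s] by (auto simp: skorokhod_close_def intro!: exI[of _ "\<lambda>t. t"])
      then show ?thesis
        using xy bdd_below_skorokhod_close by (simp add: skorokhod_dist_def cInf_lower)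
    qed
    then show "skorokhod_dist s x x \<le> 0" by (rule field_le_epsilon)
    show "0 \<le> skorokhod_dist s x x"
      unfolding skorokhod_dist_def using skorokhod_close_nonempty[of x s x]
      by (auto intro!: cInf_greatest simp: skorokhod_close_def)
  qed
  then show "skorokhod_dist s x y = 0 \<longleftrightarrow> x = y"
    using skorokhod_dist_eq_0D[OF xy] by auto
next
  fix x y z
  assume xyz: "x \<in> cadlag_paths {0..s}" "y \<in> cadlag_paths {0..s}" "z \<in> cadlag_paths {0..s}"
  have "skorokhod_dist s x z \<le> (skorokhod_dist s x y + skorokhod_dist s y z) + e" if "0 < e" for e
  proof -
    have "Inf (skorokhod_close s x y) < skorokhod_dist s x y + e / 2"
      and "Inf (skorokhod_close s y z) < skorokhod_dist s y z + e / 2"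
      using that xyz by (simp_all add: skorokhod_dist_def)
    then obtain a b where a: "a \<in> skorokhod_close s x y" "a < skorokhod_dist s x y + e / 2"
      and b: "b \<in> skorokhod_close s y z" "b < skorokhod_dist s y z + e / 2"
      using cInf_lessD[OF skorokhod_close_nonempty] xyz by meson
    have "skorokhod_dist s x z \<le> a + b"
      using skorokhod_close_add[OF a(1) b(1)] xyz bdd_below_skorokhod_close
      by (simp add: skorokhod_dist_def cInf_lower)
    then show ?thesis using a b by linarith
  qed
  then show "skorokhod_dist s x z \<le> skorokhod_dist s x y + skorokhod_dist s y z"
    by (rule field_le_epsilon)
qed


section \<open>Restriction of a law to \<open>\<F>\<^sub>s\<close> and weak convergence\<close>

text \<open>Restricting a law on path space to the natural sigma-algebra \<open>\<F>\<^sub>s = \<sigma>(L\<^sub>u, u \<le> s)\<close> is the same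
  as pushing it forward to the paths over \<open>[0, s]\<close>.\<close>

definition law_upto :: "real \<Rightarrow> (real \<Rightarrow> real) measure \<Rightarrow> (real \<Rightarrow> real) measure" where
  "law_upto s Q = distr Q (path_space {0..s}) (\<lambda>\<omega>. restrict \<omega> {0..s})"

definition weak_limit_upto ::
    "real \<Rightarrow> ('i \<Rightarrow> (real \<Rightarrow> real) measure) \<Rightarrow> (real \<Rightarrow> real) measure \<Rightarrow> 'i filter \<Rightarrow> bool" where
  "weak_limit_upto s R Q F \<longleftrightarrow>
     (\<forall>f. continuous_map (skorokhod_topology s) euclideanreal f \<and> bounded (f ` cadlag_paths {0..s}) \<longrightarrow>
          ((\<lambda>i. \<integral>\<omega>. f \<omega> \<partial>law_upto s (R i)) \<longlongrightarrow> (\<integral>\<omega>. f \<omega> \<partial>law_upto s Q)) F)"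


section \<open>The spectrally positive stable process\<close>

definition levy_law :: "(real \<Rightarrow> real) measure \<Rightarrow> bool" where
  "levy_law P \<longleftrightarrow>
     prob_space P \<and> sets P = sets (path_space {0..}) \<and>
     (AE \<omega> in P. \<omega> 0 = 0) \<and>
     (\<forall>t :: nat \<Rightarrow> real. 0 \<le> t 0 \<and> mono t \<longrightarrow>
        prob_space.indep_vars P (\<lambda>_. borel) (\<lambda>i \<omega>. \<omega> (t (Suc i)) - \<omega> (t i)) UNIV) \<and>
     (\<forall>s t. 0 \<le> s \<and> s \<le> t \<longrightarrow>
        distr P borel (\<lambda>\<omega>. \<omega> t - \<omega> s) = distr P borel (\<lambda>\<omega>. \<omega> (t - s)))"

text \<open>The normalization \<open>ln E[exp(i u L\<^sub>1)] = \<dots>\<close> is stated in exponential form, since \<open>ln\<close> there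
  is the continuous branch along \<open>u\<close> rather than the principal one; \<open>powr\<close> is principal.\<close>

definition spectrally_positive_stable_law :: "real \<Rightarrow> (real \<Rightarrow> real) measure \<Rightarrow> bool" where
  "spectrally_positive_stable_law \<alpha> P \<longleftrightarrow>
     levy_law P \<and>
     (AE \<omega> in P. \<forall>t>0. Lim (at_left t) \<omega> \<le> \<omega> t) \<and>
     (\<forall>u::real. char (distr P borel (\<lambda>\<omega>. \<omega> 1)) u =
        exp ((\<i> * complex_of_real u) powr complex_of_real \<alpha> *
             exp (- \<i> * complex_of_real (pi * \<alpha> * sgn u))))"

definition started_at :: "real \<Rightarrow> (real \<Rightarrow> real) measure \<Rightarrow> (real \<Rightarrow> real) measure" where
  "started_at x P = distr P (path_space {0..}) (\<lambda>\<omega>. \<lambda>t\<in>{0..}. x + \<omega> t)"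


section \<open>Conditioning on \<open>T\<^sub>0 = r\<close> and the normalized excursion\<close>

definition hitting_time_0 :: "(real \<Rightarrow> real) \<Rightarrow> ereal" where
  "hitting_time_0 \<omega> = (INF t \<in> {t. 0 \<le> t \<and> \<omega> t = 0}. ereal t)"

text \<open>A regular version \<open>\<kappa>\<close> of the conditional law given \<open>T\<^sub>0\<close>. The completion is essential:
  \<^const>\<open>hitting_time_0\<close> is not measurable for the sigma-algebra generated by the coordinates, only
  for its completion under the laws considered here.\<close>

definition cond_kernel_T0 :: "(real \<Rightarrow> real) measure \<Rightarrow> (ereal \<Rightarrow> (real \<Rightarrow> real) measure) \<Rightarrow> bool" where
  "cond_kernel_T0 P \<kappa> \<longleftrightarrow>
     \<kappa> \<in> borel \<rightarrow>\<^sub>M prob_algebra (path_space {0..}) \<and>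
     (\<forall>A \<in> sets (path_space {0..}). \<forall>B \<in> sets borel.
        emeasure (completion P) (A \<inter> {\<omega> \<in> space P. hitting_time_0 \<omega> \<in> B}) =
        (\<integral>\<^sup>+ r \<in> B. emeasure (\<kappa> r) A \<partial>distr (completion P) borel hitting_time_0))"

text \<open>As \<open>T\<^sub>0 = r\<close> is a null event, \<open>\<kappa> r\<close> is meaningful for a single \<open>r\<close> only once a version is
  fixed: the one that, on \<open>\<F>\<^sub>s\<close>, is weakly continuous in \<open>r \<in> (s, \<infinity>)\<close>. This determines \<open>\<kappa> r\<close> on
  \<open>\<F>\<^sub>s\<close> for all \<open>s < r\<close>, because under the laws of interest \<open>T\<^sub>0\<close> has full support in \<open>(0, \<infinity>)\<close>.\<close>

definition cond_law_T0 :: "(real \<Rightarrow> real) measure \<Rightarrow> real \<Rightarrow> (real \<Rightarrow> real) measure \<Rightarrow> bool" where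
  "cond_law_T0 P r R \<longleftrightarrow>
     (\<exists>\<kappa>. cond_kernel_T0 P \<kappa> \<and>
          (\<forall>s t. 0 \<le> s \<and> s < t \<longrightarrow> weak_limit_upto s (\<lambda>u. \<kappa> (ereal u)) (\<kappa> (ereal t)) (at t)) \<and>
          R = \<kappa> (ereal r))"

text \<open>\<open>Q\<close> is a law on the paths over \<open>[0, 1]\<close>. The limits determine it on \<open>\<F>\<^sub>s\<close> for all \<open>s < 1\<close>;
  the endpoint is that of a bridge from 0 to 0.\<close>

definition normalized_excursion_law ::
    "(real \<Rightarrow> real) measure \<Rightarrow> (real \<Rightarrow> real) measure \<Rightarrow> bool" where
  "normalized_excursion_law P Q \<longleftrightarrow>
     prob_space Q \<and> sets Q = sets (path_space {0..1}) \<and>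
     (AE \<omega> in Q. \<omega> 1 = 0) \<and>
     (\<exists>R. (\<forall>x>0. cond_law_T0 (started_at x P) 1 (R x)) \<and>
          (\<forall>s. 0 \<le> s \<and> s < 1 \<longrightarrow> weak_limit_upto s R Q (at_right 0)))"

definition path_area :: "(real \<Rightarrow> real) \<Rightarrow> real" where
  "path_area \<omega> = (LINT t:{0..1}|lborel. \<omega> t)"


section \<open>The M-Wright function\<close>

definition M_Wright :: "real \<Rightarrow> real \<Rightarrow> real" where
  "M_Wright \<alpha> x = 1 / pi * (\<Sum>n. (- 1) ^ n / fact n * Gamma ((1 + real n) / (1 + \<alpha>)) *
     sin (pi * ((1 + real n) / (1 + \<alpha>))) * (1 + \<alpha>) powr ((real n - \<alpha>) / (1 + \<alpha>)) * x ^ n)"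

end

theory Submission
 imports Defs "HOL-Real_Asymp.Real_Asymp" "HOL-Complex_Analysis.Complex_Analysis"
begin

text \<open>
  Let \<open>X\<close> be the process started at \<open>x > 0\<close> and \<open>\<tau>\<close> its first passage below zero, which is almost surely
  its hitting time of zero. Up to a factor, the M-Wright function is the imaginary part of
  \<open>\<integral> e\<^sup>i\<^sup>\<theta> exp (- z\<^sup>\<alpha>\<^sup>+\<^sup>1 / (\<alpha> + 1) - x z) dr\<close> along the ray \<open>z = r e\<^sup>i\<^sup>\<theta>\<close>, \<open>\<theta> = \<pi> / (1 + \<alpha>)\<close>. The
  exponentials \<open>exp (- \<integral> \<zeta> dX - \<integral> \<zeta>\<^sup>\<alpha> dt)\<close> have constant expectation, and for affine \<open>\<zeta>\<close> integration by
  parts turns \<open>\<integral> \<zeta> dX\<close> into the area. Stopping at \<open>\<tau>\<close> and integrating along the ray gives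
  \<open>E exp (- c \<tau> - A\<^sub>\<tau>) = \<Phi> (x + c) / \<Phi> c\<close>, whose derivative at \<open>x = 0\<close> is \<open>\<Phi>' c / \<Phi> c\<close>.

  On the other side one disintegrates over \<open>\<tau>\<close>. By scaling, the conditional law given \<open>\<tau> = t\<close> from \<open>x\<close> is
  that given \<open>\<tau> = 1\<close> from \<open>x t\<^sup>-\<^sup>1\<^sup>/\<^sup>\<alpha>\<close>, and it tends to the excursion as \<open>x\<close> decreases to zero, while the law
  of \<open>\<tau>\<close> divided by \<open>x\<close> tends to the measure \<open>t\<^sup>-\<^sup>1\<^sup>-\<^sup>1\<^sup>/\<^sup>\<alpha> dt / (\<alpha> \<Gamma> (1 - 1 / \<alpha>))\<close>. Weak convergence is available
  on \<open>[0, s t]\<close> with \<open>s < 1\<close> only, so the area of the last piece is bounded uniformly in \<open>x\<close>. A single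
  conditional law is pinned down by continuity because \<open>\<tau>\<close> has full support.
\<close>

section \<open>The M-Wright function\<close>

text \<open>The angle of the ray makes \<open>z powr (\<alpha> + 1)\<close> negative while
  \<open>Re z\<close> stays positive: the kernel decays, and \<open>exp (- z X)\<close> still has a
  finite mean. The affine \<zeta> at time t is z + T - t, so a path stopped at time s leaves an
  integral over the ray translated by T - s. Imaginary parts do not see this translation, because
  the contours differ by a real segment on which the kernel is real; hence the same \<Phi> appears
  before and after stopping. The limit measure has infinite mass near 0. Everything is therefore
  tested with weights exp (- a t) - exp (- b t), a > 0, whose moments against powers of exp (- t)
  are differences of Laplace transforms of \<tau>; a tends to 0 only at the end. The bound on the
  area of the last piece is linear in x, which is what survives the division by x. Full support of
  \<tau> comes from its additivity in law: a passage from x is one from \<theta> x plus an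
  independent one from (1 - \<theta>) x.\<close>

lemmas Lintegrable_bound = Bochner_Integration.integrable_bound
lemmas Lintegrable_diff = Bochner_Integration.integrable_diff
lemmas LINT_add = Bochner_Integration.integral_add
lemmas LINT_cong = Bochner_Integration.integral_cong
lemmas LINT_diff = Bochner_Integration.integral_diff
lemmas LINT_mono = Bochner_Integration.integral_mono
lemmas LINT_nonneg = Bochner_Integration.integral_nonneg

abbreviation area :: "real \<Rightarrow> (real \<Rightarrow> real) \<Rightarrow> real" where
 "area t f \<equiv> LBINT s:{0..<t}. f s"

section \<open>Integrals over half-lines and contour shifts across a half-strip\<close>

lemma set_integrable_has_integral_nonneg:
 fixes f :: "real \<Rightarrow> real"
 assumes i: "(f has_integral I) A" and [measurable]: "f \<in> borel_measurable borel" "A \<in> sets borel"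
  and pos: "\<And>x. x \<in> A \<Longrightarrow> 0 \<le> f x"
 shows "set_integrable lborel A f"
proof -
 have i': "((\<lambda>x. indicator A x * f x) has_integral I) UNIV"
  using i unfolding indicator_times_eq_if by (simp only: has_integral_restrict_UNIV)
 have "(\<integral>\<^sup>+x. ennreal (indicator A x * f x) \<partial>lborel) = ennreal I"
  using pos by (intro nn_integral_has_integral_lborel[OF _ _ i'])  (auto simp: indicator_def)
 then show ?thesis
  unfolding set_integrable_def using pos by (intro integrableI_nonneg) (auto simp: indicator_def)
qed

lemma has_integral_LBINT:
 fixes f :: "real \<Rightarrow> 'a::euclidean_space"
 assumes "set_integrable lborel S f"
 shows "(f has_integral (LBINT x:S. f x)) S"
 using set_borel_integral_eq_integral[OF assms] by (simp add: integrable_integral)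

text \<open>The weight \<open>exp r\<close> leaves a margin: beyond some point the integrand is
  below \<open>exp (- r)\<close>, and before it continuity on a compact interval suffices. Both
  majorants used for contour integrals are integrated this way.\<close>

lemma set_integrable_atLeast_exp_decay:
 fixes f :: "real \<Rightarrow> 'a::{banach, second_countable_topology}"
 assumes cont: "continuous_on {a..} f" and lim: "((\<lambda>r. norm (f r) * exp r) \<longlongrightarrow> 0) at_top"
 shows "set_integrable lborel {a..} f"
proof -
 have "eventually (\<lambda>r. norm (f r) * exp r < 1) at_top"
  using order_tendstoD(2)[OF lim, of 1] by simp
 then obtain R where R: "\<And>r. r \<ge> R \<Longrightarrow> norm (f r) * exp r < 1"
  by (auto simp: eventually_at_top_linorder)
 define b where "b = max a R"
 have e: "set_integrable lborel {b..} (\<lambda>r. exp (-r))"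
 proof -
  have "((\<lambda>x. exp (- x)) has_integral exp (- b)) {b..}"
   using has_integral_exp_minus_to_infinity[of 1 b] by simp
  then show ?thesis by (intro set_integrable_has_integral_nonneg) auto
 qed
 have cb: "continuous_on {b..} f" "continuous_on {a..b} f"
  using cont by (auto intro: continuous_on_subset simp: b_def)
 have 1: "set_integrable lborel {b..} f"
 proof (rule set_integrable_bound[OF e])
  show "set_borel_measurable lborel {b..} f"
   unfolding set_borel_measurable_def using cb(1)
   using borel_measurable_continuous_on_indicator[of "{b..}" f] by simp
  have "norm (f r) \<le> exp (-r)" if "r \<ge> b" for r
  proof -
   have "norm (f r) * exp r * exp (-r) \<le> 1 * exp (-r)"
    using R[of r] that by (intro mult_right_mono) (auto simp: b_def)
   then show ?thesis by (simp add: mult.assoc flip: exp_add)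
  qed
  then show "AE x in lborel. x \<in> {b..} \<longrightarrow> norm (f x) \<le> norm (exp (- x))" by auto
 qed
 have 2: "set_integrable lborel {a..b} f"
  by (rule borel_integrable_atLeastAtMost'[OF cb(2)])
 have "{a..} = {a..b} \<union> {b..}" by (auto simp: b_def)
 with set_integrable_Un[OF 2 1] show ?thesis by auto
qed

text \<open>Cauchy's theorem for the half-strip spanned by the directions \<open>d\<close> and
  \<open>e\<close>. In the applications \<open>f\<close> is a holomorphic function read at an affine
  point moving in these directions and \<open>g\<close> is its derivative; integrating
  \<open>g\<close> over the strip in the two orders gives the two long edges and the short one.
  Derivatives are assumed in the open strip only, with continuity up to the boundary, since the
  boundary may contain the branch point of a power.\<close>

lemma half_strip_shift:
 fixes f g :: "real \<Rightarrow> real \<Rightarrow> complex" and d e :: complex and B :: "real \<Rightarrow> real"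
 assumes T: "0 \<le> T" and d: "d \<noteq> 0"
  and cf: "continuous_on ({0..} \<times> {0..T}) (\<lambda>(r, s). f r s)"
  and cg: "continuous_on ({0..} \<times> {0..T}) (\<lambda>(r, s). g r s)"
  and dr: "\<And>r s. 0 < r \<Longrightarrow> 0 < s \<Longrightarrow> s < T \<Longrightarrow> ((\<lambda>r. f r s) has_vector_derivative d * g r s) (at r)"
  and ds: "\<And>r s. 0 < r \<Longrightarrow> 0 < s \<Longrightarrow> s < T \<Longrightarrow> ((\<lambda>s. f r s) has_vector_derivative e * g r s) (at s)"
  and B: "set_integrable lborel {0..} B"
  and gB: "\<And>r s. 0 \<le> r \<Longrightarrow> 0 \<le> s \<Longrightarrow> s \<le> T \<Longrightarrow> norm (g r s) \<le> B r"
  and lim: "\<And>s. 0 \<le> s \<Longrightarrow> s \<le> T \<Longrightarrow> ((\<lambda>r. f r s) \<longlongrightarrow> 0) at_top"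
  and int0: "set_integrable lborel {0..} (\<lambda>r. f r 0)"
  and intT: "set_integrable lborel {0..} (\<lambda>r. f r T)"
 shows "d * ((LBINT r:{0..}. f r T) - (LBINT r:{0..}. f r 0)) = - e * (LBINT s:{0..T}. f 0 s)"
proof -
 define h where "h = (\<lambda>(r, s). indicator ({0..} \<times> {0..T}) (r, s) *\<^sub>R g r s)"
 have hm[measurable]: "h \<in> borel_measurable (lborel \<Otimes>\<^sub>M lborel)"
 proof -
  have "closed ({0..} \<times> {0..T} :: (real \<times> real) set)"
   by (intro closed_Times) auto
  then have "(\<lambda>x. indicator ({0..} \<times> {0..T}) x *\<^sub>R (\<lambda>(r, s). g r s) x) \<in> borel_measurable borel"
   by (intro borel_measurable_continuous_on_indicator cg) auto
  then show ?thesis unfolding h_def by (simp add: case_prod_unfold lborel_prod)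
 qed
 have hint: "integrable (lborel \<Otimes>\<^sub>M lborel) h"
 proof (rule Lintegrable_bound[OF _ hm])
  have "integrable (lborel \<Otimes>\<^sub>M lborel) (\<lambda>(r, s). (indicator {0..} r * B r) * (indicator {0..T} s :: real))"
  proof (rule lborel_pair.Fubini_integrable)
   show "(\<lambda>(r, s). (indicator {0..} r * B r) * (indicator {0..T} s :: real)) \<in> borel_measurable (lborel \<Otimes>\<^sub>M lborel)"
    using borel_measurable_integrable[OF B[unfolded set_integrable_def]] by simp
   have "integrable lborel (\<lambda>x. indicator {0..} x *\<^sub>R norm (B x) * T)"
    using set_integrable_norm[OF B] unfolding set_integrable_def by (intro integrable_mult_left) auto
   then show "integrable lborel (\<lambda>x. LINT y|lborel. norm (case (x, y) of (r, s) \<Rightarrow> (indicator {0..} r * B r) * (indicator {0..T} s :: real)))"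
    using T by (simp add: abs_mult mult.assoc)
   show "AE x in lborel. integrable lborel (\<lambda>y. case (x, y) of (r, s) \<Rightarrow> (indicator {0..} r * B r) * (indicator {0..T} s :: real))"
    using T by (auto intro!: AE_I2 integrable_real_indicator)
  qed
  then show "integrable (lborel \<Otimes>\<^sub>M lborel) (\<lambda>(r, s). (indicator {0..} r * B r) * (indicator {0..T} s :: real))" .
  show "AE x in lborel \<Otimes>\<^sub>M lborel. norm (h x) \<le> norm ((\<lambda>(r, s). (indicator {0..} r * B r) * (indicator {0..T} s :: real)) x)"
   unfolding h_def using order_trans[OF gB abs_ge_self] by (auto simp: indicator_def intro!: AE_I2)
 qed
 have fr: "continuous_on {0..T} (\<lambda>s. f r s)" "continuous_on {0..T} (\<lambda>s. g r s)" if "0 \<le> r" for r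
  using continuous_on_compose2[OF cf, of "{0..T}" "Pair r"]
   continuous_on_compose2[OF cg, of "{0..T}" "Pair r"] that
   continuous_on_Pair[OF continuous_on_const continuous_on_id, of "{0..T}" r]
  by auto
 have cp: "continuous_on {0..} (\<lambda>r. (r, s))" for s :: real
  by (rule continuous_on_Pair[OF continuous_on_id continuous_on_const])
 have fs: "continuous_on {0..} (\<lambda>r. f r s)" "continuous_on {0..} (\<lambda>r. g r s)" if "0 \<le> s" "s \<le> T" for s
 proof -
  have "(\<lambda>r. (r, s)) ` {0..} \<subseteq> {0..} \<times> {0..T}" using that by auto
  from continuous_on_compose2[OF cf cp this] continuous_on_compose2[OF cg cp this]
  show "continuous_on {0..} (\<lambda>r. f r s)" "continuous_on {0..} (\<lambda>r. g r s)" by auto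
 qed
 have inner_s: "e * (LBINT s:{0..T}. g r s) = f r T - f r 0" if r: "0 < r" for r
 proof -
  have i: "set_integrable lborel {0..T} (\<lambda>s. g r s)"
   using r fr(2)[of r] by (intro borel_integrable_atLeastAtMost') auto
  have "((\<lambda>s. e * g r s) has_integral (f r T - f r 0)) {0..T}"
   using r T ds fr(1)[of r] by (intro fundamental_theorem_of_calculus_interior) auto
  moreover have "((\<lambda>s. e * g r s) has_integral (e * (LBINT s:{0..T}. g r s))) {0..T}"
   using has_integral_mult_right[OF has_integral_LBINT[OF i]] .
  ultimately show ?thesis by (rule has_integral_unique[rotated])
 qed
 have inner_r: "d * (LBINT r:{0..}. g r s) = - f 0 s" if s: "0 < s" "s < T" for s
 proof -
  have gi: "set_integrable lborel {0..} (\<lambda>r. g r s)"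
  proof (rule set_integrable_bound[OF B])
   show "set_borel_measurable lborel {0..} (\<lambda>r. g r s)"
    unfolding set_borel_measurable_def using fs(2)[of s] s
    using borel_measurable_continuous_on_indicator[of "{0..}" "\<lambda>r. g r s"] by simp
   show "AE x in lborel. x \<in> {0..} \<longrightarrow> norm (g x s) \<le> norm (B x)"
    using s by (auto intro!: order_trans[OF gB])
  qed
  have eq: "d * (LBINT r:{0..R}. g r s) = f R s - f 0 s" if R: "0 \<le> R" for R
  proof -
   have i: "set_integrable lborel {0..R} (\<lambda>r. g r s)"
    using gi by (rule set_integrable_subset) auto
   have "((\<lambda>r. d * g r s) has_integral (f R s - f 0 s)) {0..R}"
    using s R dr continuous_on_subset[OF fs(1)[of s], of "{0..R}"]
    by (intro fundamental_theorem_of_calculus_interior) auto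
   moreover have "((\<lambda>r. d * g r s) has_integral (d * (LBINT r:{0..R}. g r s))) {0..R}"
    using has_integral_mult_right[OF has_integral_LBINT[OF i]] .
   ultimately show ?thesis by (rule has_integral_unique[rotated])
  qed
  have "((\<lambda>R. \<integral>r. indicator {..R} r *\<^sub>R (indicator {0..} r *\<^sub>R g r s) \<partial>lborel) \<longlongrightarrow>
    (\<integral>r. indicator {0..} r *\<^sub>R g r s \<partial>lborel)) at_top"
   using gi unfolding set_integrable_def by (intro tendsto_integral_at_top) auto
  moreover have "(\<integral>r. indicator {..R} r *\<^sub>R (indicator {0..} r *\<^sub>R g r s) \<partial>lborel) = (LBINT r:{0..R}. g r s)" for R
   unfolding set_lebesgue_integral_def by (intro LINT_cong) (auto simp: indicator_def)
  ultimately have "((\<lambda>R. LBINT r:{0..R}. g r s) \<longlongrightarrow> (LBINT r:{0..}. g r s)) at_top"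
   by (simp add: set_lebesgue_integral_def)
  then have "((\<lambda>R. d * (LBINT r:{0..R}. g r s)) \<longlongrightarrow> d * (LBINT r:{0..}. g r s)) at_top"
   by (intro tendsto_intros)
  moreover have "((\<lambda>R. d * (LBINT r:{0..R}. g r s)) \<longlongrightarrow> 0 - f 0 s) at_top"
  proof (rule Lim_transform_eventually)
   show "((\<lambda>R. f R s - f 0 s) \<longlongrightarrow> 0 - f 0 s) at_top"
    using lim s by (intro tendsto_intros) auto
   show "\<forall>\<^sub>F R in at_top. f R s - f 0 s = d * (LBINT r:{0..R}. g r s)"
    using eventually_ge_at_top[of 0] by eventually_elim (simp add: eq)
  qed
  ultimately show ?thesis using tendsto_unique[OF trivial_limit_at_top_linorder] by force
 qed
 have F: "(LINT r|lborel. (LINT s|lborel. h (r, s))) = (LINT s|lborel. (LINT r|lborel. h (r, s)))"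
  using lborel_pair.Fubini_integral[of "\<lambda>r s. h (r, s)"] hint by (simp add: case_prod_eta)
 have L: "e * (LINT r|lborel. (LINT s|lborel. h (r, s))) = (LBINT r:{0..}. f r T) - (LBINT r:{0..}. f r 0)"
 proof -
  have "e * (LINT r|lborel. (LINT s|lborel. h (r, s))) = (LINT r|lborel. e * (LINT s|lborel. h (r, s)))" by simp
  also have "... = (LINT r|lborel. indicator {0..} r *\<^sub>R (f r T - f r 0))"
  proof (rule integral_cong_AE)
   show "(\<lambda>r. e * (LINT s|lborel. h (r, s))) \<in> borel_measurable lborel" by measurable
   show "(\<lambda>r. indicator {0..} r *\<^sub>R (f r T - f r 0)) \<in> borel_measurable lborel"
    using set_integral_diff(1)[OF intT int0] unfolding set_integrable_def by measurable
   have "AE r in lborel. r \<noteq> (0::real)" by (rule AE_lborel_singleton)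
   then show "AE r in lborel. e * (LINT s|lborel. h (r, s)) = indicator {0..} r *\<^sub>R (f r T - f r 0)"
   proof eventually_elim
    case (elim r)
    have "(LINT s|lborel. h (r, s)) = (LINT s|lborel. indicator {0..} r *\<^sub>R indicator {0..T} s *\<^sub>R g r s)"
     unfolding h_def by (intro LINT_cong) (auto simp: indicator_def)
    also have "... = indicator {0..} r *\<^sub>R (LBINT s:{0..T}. g r s)"
     unfolding set_lebesgue_integral_def by (rule integral_scaleR_right)
    finally show ?case using inner_s[of r] elim by (auto simp: indicator_def)
   qed
  qed
  also have "... = (LBINT r:{0..}. f r T) - (LBINT r:{0..}. f r 0)"
   using set_integral_diff(2)[OF intT int0] unfolding set_lebesgue_integral_def by simp
  finally show ?thesis .
 qed
 have R: "d * (LINT s|lborel. (LINT r|lborel. h (r, s))) = - (LBINT s:{0..T}. f 0 s)"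
 proof -
  have "d * (LINT s|lborel. (LINT r|lborel. h (r, s))) = (LINT s|lborel. d * (LINT r|lborel. h (r, s)))" by simp
  also have "... = (LINT s|lborel. - (indicator {0..T} s *\<^sub>R f 0 s))"
  proof (rule integral_cong_AE)
   show "(\<lambda>s. d * (LINT r|lborel. h (r, s))) \<in> borel_measurable lborel" by measurable
   show "(\<lambda>s. - (indicator {0..T} s *\<^sub>R f 0 s)) \<in> borel_measurable lborel"
    using borel_measurable_continuous_on_indicator[OF _ fr(1)[of 0]] by simp
   have "AE s in lborel. s \<noteq> (0::real)" "AE s in lborel. s \<noteq> T" by (rule AE_lborel_singleton)+
   then show "AE s in lborel. d * (LINT r|lborel. h (r, s)) = - (indicator {0..T} s *\<^sub>R f 0 s)"
   proof eventually_elim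
    case (elim s)
    have "(LINT r|lborel. h (r, s)) = (LINT r|lborel. indicator {0..T} s *\<^sub>R indicator {0..} r *\<^sub>R g r s)"
     unfolding h_def by (intro LINT_cong) (auto simp: indicator_def)
    also have "... = indicator {0..T} s *\<^sub>R (LBINT r:{0..}. g r s)"
     unfolding set_lebesgue_integral_def by (rule integral_scaleR_right)
    finally show ?case using inner_r[of s] elim by (auto simp: indicator_def)
   qed
  qed
  also have "... = - (LBINT s:{0..T}. f 0 s)"
   unfolding set_lebesgue_integral_def by simp
  finally show ?thesis .
 qed
 have "d * ((LBINT r:{0..}. f r T) - (LBINT r:{0..}. f r 0)) = e * (d * (LINT s|lborel. (LINT r|lborel. h (r, s))))"
  unfolding L[symmetric] F by simp
 then show ?thesis by (simp add: R)
qed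

text \<open>For \<alpha> = 2 this is the integrand of the Airy function. As a function of x,
  \<open>exp (- x z)\<close> is an eigenfunction of the generator with eigenvalue z^\<alpha>, and
  the z-derivative of the kernel is the kernel times z^\<alpha> - x; so contour integrals solve
  (generator - x) u = 0 up to boundary terms.\<close>

definition airy_kernel :: "real \<Rightarrow> real \<Rightarrow> complex \<Rightarrow> complex" where
 "airy_kernel \<alpha> x z = exp (z powr (of_real \<alpha> + 1) / (of_real \<alpha> + 1) - of_real x * z)"

text \<open>The substitution t = \<open>r powr p / p\<close> leads to Euler's Gamma integral. With p
  = \<alpha> + 1 these are the moments of the kernel along the ray, whence the Gamma factors and the
  powers of 1 + \<alpha> in the Wright series.\<close>

lemma has_integral_rotated_Gamma:
 fixes p :: real and n :: nat
 assumes p: "0 < p"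
 shows "((\<lambda>r. r ^ n * exp (- (r powr p) / p)) has_integral
     (Gamma ((1 + real n) / p) * p powr ((1 + real n) / p - 1))) {0..}"
proof -
 define q where "q = (1 + real n) / p"
 have q: "0 < q" using p by (simp add: q_def)
 define G where "G = (\<lambda>r::real. r powr p / p)"
 have G: "(G has_field_derivative r powr (p - 1)) (at r within {0<..})" if "r \<in> {0<..}" for r
  unfolding G_def using that p by (auto intro!: derivative_eq_intros)
 have inj: "inj_on G {0<..}"
 proof (rule strict_mono_on_imp_inj_on, rule strict_mono_onI)
  fix r s :: real assume "r \<in> {0<..}" "s \<in> {0<..}" "r < s"
  then show "G r < G s" using p by (auto simp: G_def powr_less_mono2 divide_strict_right_mono)
 qed
 have im: "G ` {0<..} = {0<..}"
 proof (intro equalityI subsetI)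
  fix t :: real assume "t \<in> {0<..}"
  then show "t \<in> G ` {0<..}" using p
   by (intro image_eqI[of _ _ "(p * t) powr (1 / p)"]) (auto simp: G_def powr_powr)
 qed (use p in \<open>auto simp: G_def\<close>)
 have *: "((\<lambda>t. t powr (q - 1) / exp t) has_integral Gamma q) {0<..}"
  using Gamma_integral_real[OF q]
  by (subst has_integral_spike_set_eq[of _ "{0..}"]) (auto intro: negligible_subset[of "{0}"])
 then have "(\<lambda>t. t powr (q - 1) / exp t) absolutely_integrable_on {0<..}"
  by (intro nonnegative_absolutely_integrable_1) (auto simp: integrable_on_def)
 with * have "(\<lambda>t. t powr (q - 1) / exp t) absolutely_integrable_on G ` {0<..} \<and>
   integral (G ` {0<..}) (\<lambda>t. t powr (q - 1) / exp t) = Gamma q"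
  unfolding im by auto
 then have H: "(\<lambda>r. \<bar>r powr (p - 1)\<bar> * (G r powr (q - 1) / exp (G r))) absolutely_integrable_on {0<..} \<and>
   integral {0<..} (\<lambda>r. \<bar>r powr (p - 1)\<bar> * (G r powr (q - 1) / exp (G r))) = Gamma q"
  by (subst has_absolute_integral_change_of_variables_1'[OF _ G inj]) auto
 then have "((\<lambda>r. \<bar>r powr (p - 1)\<bar> * (G r powr (q - 1) / exp (G r))) has_integral Gamma q) {0<..}"
  using integrable_integral[OF set_lebesgue_integral_eq_integral(1)] by metis
 then have "((\<lambda>r. \<bar>r powr (p - 1)\<bar> * (G r powr (q - 1) / exp (G r)) * p powr (q - 1)) has_integral Gamma q * p powr (q - 1)) {0<..}"
  by (rule has_integral_mult_left)
 moreover have "\<bar>r powr (p - 1)\<bar> * (G r powr (q - 1) / exp (G r)) * p powr (q - 1) = r ^ n * exp (- (r powr p) / p)"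
  if "r \<in> {0<..}" for r
 proof -
  have "p - 1 + p * (q - 1) = real n" using p by (simp add: q_def field_simps)
  then have "r powr (p - 1) * r powr (p * (q - 1)) = r ^ n"
   using that by (simp flip: powr_add add: powr_realpow)
  then show ?thesis using that p
   by (simp add: G_def powr_divide powr_powr exp_minus field_simps)
 qed
 ultimately have "((\<lambda>r. r ^ n * exp (- (r powr p) / p)) has_integral Gamma q * p powr (q - 1)) {0<..}"
  by (subst has_integral_cong) auto
 then show ?thesis unfolding q_def
  by (subst has_integral_spike_set_eq[of _ "{0<..}"]) (auto intro: negligible_subset[of "{0}"])
qed

section \<open>Growth of the kernel along the ray and its translates\<close>

lemma airy_decay:
 fixes \<alpha> C :: real
 assumes \<alpha>: "1 < \<alpha>"
 shows "((\<lambda>r. exp (C * (1 + r)\<^sup>2 - r powr (\<alpha> + 1) / (\<alpha> + 1)) * exp r) \<longlongrightarrow> 0) at_top"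
 using \<alpha> by real_asymp

locale airy_param =
 fixes \<alpha> :: real
 assumes \<alpha>1: "1 < \<alpha>" and \<alpha>2: "\<alpha> \<le> 2"
begin

text \<open>A quadratic exponent absorbs every lower-order term, because
  \<open>\<alpha> \<le> 2\<close> keeps z^\<alpha> below it, and it is still beaten by the negative
  power of order \<alpha> + 1 > 2. One family of majorants thus serves all translates and all
  tilts.\<close>

definition airy_bound :: "real \<Rightarrow> real \<Rightarrow> real" where
 "airy_bound C r = exp (C * (1 + r)\<^sup>2 - r powr (\<alpha> + 1) / (\<alpha> + 1))"

lemma airy_bound_pos: "0 < airy_bound C r" by (simp add: airy_bound_def)

lemma airy_bound_lim: "((\<lambda>r. airy_bound C r) \<longlongrightarrow> 0) at_top"
proof (rule Lim_null_comparison[OF _ airy_decay[OF \<alpha>1, of C]])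
 show "\<forall>\<^sub>F r in at_top. norm (airy_bound C r) \<le> exp (C * (1 + r)\<^sup>2 - r powr (\<alpha> + 1) / (\<alpha> + 1)) * exp r"
  using eventually_ge_at_top[of 0] by eventually_elim (simp add: airy_bound_def)
qed

lemma set_integrable_airy_bound: "set_integrable lborel {0..} (airy_bound C)"
proof (rule set_integrable_atLeast_exp_decay)
 show "continuous_on {0..} (airy_bound C)"
  unfolding airy_bound_def using \<alpha>1 by (intro continuous_intros continuous_on_powr') auto
 show "((\<lambda>r. norm (airy_bound C r) * exp r) \<longlongrightarrow> 0) at_top"
  using airy_decay[OF \<alpha>1, of C] by (simp add: airy_bound_def)
qed

text \<open>\<open>\<alpha> > 1\<close> puts the angle below pi / 2, so the ray lies in the right
  half-plane, where principal powers are holomorphic and \<open>exp (- x z)\<close> is bounded for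
  \<open>x \<ge> 0\<close>; the power of order \<alpha> + 1 of the direction is -1.\<close>

definition ray :: complex where "ray = cis (pi / (\<alpha> + 1))"

lemma norm_ray [simp]: "norm ray = 1" by (simp add: ray_def)

lemma ray_nz [simp]: "ray \<noteq> 0" using norm_ray norm_zero by (metis zero_neq_one)

lemma Re_ray: "0 < Re ray"
proof -
 have "pi / (\<alpha> + 1) < pi / 2" using \<alpha>1 pi_gt_zero by (simp add: field_simps)
 moreover have "0 < pi / (\<alpha> + 1)" using \<alpha>1 by simp
 ultimately show ?thesis by (auto simp: ray_def intro!: cos_gt_zero)
qed

lemma ray_powr:
 assumes "0 \<le> r" shows "(of_real r * ray) powr (of_real \<alpha> + 1) = - of_real (r powr (\<alpha> + 1))"
proof (cases "r = 0")
 case True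
 then show ?thesis using \<alpha>1 by simp
next
 case False
 then have r: "0 < r" using assms by simp
 have b: "pi / (\<alpha> + 1) \<le> pi" using \<alpha>1 by (auto simp: field_simps)
 have "0 < pi / (\<alpha> + 1)" using \<alpha>1 by simp
 have "ray = exp (\<i> * of_real (pi / (\<alpha> + 1)))" unfolding ray_def by (rule cis_conv_exp)
 then have L: "Ln ray = \<i> * of_real (pi / (\<alpha> + 1))"
  using b \<open>0 < pi / (\<alpha> + 1)\<close> pi_gt_zero by (metis (no_types, lifting) Im_i_times Ln_exp Re_complex_of_real less_trans neg_less_0_iff_less)
 have "ray powr (of_real \<alpha> + 1) = exp ((of_real \<alpha> + 1) * (\<i> * of_real (pi / (\<alpha> + 1))))"
  by (simp only: powr_def ray_nz if_False L)
 also have "(of_real \<alpha> + 1) * (\<i> * of_real (pi / (\<alpha> + 1))) = \<i> * of_real pi"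
 proof -
  have "(of_real \<alpha> + 1 :: complex) \<noteq> 0" using \<alpha>1 by (metis of_real_1 of_real_add of_real_eq_0_iff add_pos_pos less_trans zero_less_one less_irrefl)
  then show ?thesis by simp
 qed
 also have "exp (\<i> * of_real pi) = -1" by (simp add: exp_pi_i')
 finally have R: "ray powr (of_real \<alpha> + 1) = -1" .
 have "(of_real r * ray) powr (of_real \<alpha> + 1) = of_real r powr (of_real \<alpha> + 1) * ray powr (of_real \<alpha> + 1)"
  using r by (intro powr_times_real_left) auto
 moreover have "complex_of_real r powr (of_real \<alpha> + 1) = of_real (r powr (\<alpha> + 1))"
  using powr_of_real[of r "\<alpha> + 1"] r by simp
 ultimately show ?thesis by (simp add: R)
qed

lemma Re_point: assumes "0 \<le> r" "0 \<le> s" shows "0 \<le> Re (of_real r * ray + of_real s)"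
 using assms Re_ray by auto

lemma norm_powr_le:
 fixes z :: complex assumes "norm z \<le> r + T" "0 \<le> r" "0 \<le> T"
 shows "norm (z powr of_real \<alpha>) \<le> (1 + T)\<^sup>2 * (1 + r)\<^sup>2"
proof -
 have "norm (z powr of_real \<alpha>) = norm z powr \<alpha>" by (simp add: norm_powr_real_powr')
 also have "... \<le> (1 + r + T) powr \<alpha>" using assms \<alpha>1 by (intro powr_mono2) auto
 also have "... \<le> (1 + r + T) powr 2" using assms \<alpha>2 by (intro powr_mono) auto
 also have "... = (1 + r + T)\<^sup>2" using assms by (simp add: powr_numeral)
 also have "... \<le> ((1 + T) * (1 + r))\<^sup>2" using assms by (intro power_mono) (auto simp: algebra_simps)
 finally show ?thesis by (simp add: power_mult_distrib)
qed

text \<open>Mean value inequality in the translation parameter: at \<open>s = 0\<close> the real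
  part is exactly \<open>- (r powr (\<alpha> + 1))\<close>, and the derivative in s is (\<alpha> +
  1) z^\<alpha>, of at most quadratic size.\<close>

lemma Re_powr_bound:
 assumes "0 \<le> r" "0 \<le> s" "s \<le> T"
 shows "Re ((of_real r * ray + of_real s) powr (of_real \<alpha> + 1)) / (\<alpha> + 1) \<le>
   T * ((1 + T)\<^sup>2 * (1 + r)\<^sup>2) - r powr (\<alpha> + 1) / (\<alpha> + 1)"
proof (cases "s = 0")
 case True
 then show ?thesis using assms \<alpha>1 by (simp add: ray_powr)
next
 case False
 let ?z = "\<lambda>u::real. of_real r * ray + of_real u :: complex"
 have ne: "?z u \<notin> \<real>\<^sub>\<le>\<^sub>0" if "0 < u" for u
  using that assms Re_ray by (auto simp: complex_nonpos_Reals_iff add_nonneg_pos not_le)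
 have d: "((\<lambda>u. ?z u powr (of_real \<alpha> + 1)) has_vector_derivative (of_real \<alpha> + 1) * ?z u powr of_real \<alpha>) (at u)"
  if "0 < u" for u
 proof -
  have "((\<lambda>z. z powr (of_real \<alpha> + 1)) has_field_derivative (of_real \<alpha> + 1) * ?z u powr ((of_real \<alpha> + 1) - 1)) (at (?z u))"
   using ne[OF that] by (rule has_field_derivative_powr)
  then have "((\<lambda>z. z powr (of_real \<alpha> + 1)) has_field_derivative (of_real \<alpha> + 1) * ?z u powr of_real \<alpha>) (at (?z u))"
   by simp
  moreover have "(?z has_vector_derivative 1) (at u)"
   by (auto intro!: derivative_eq_intros)
  ultimately show ?thesis
   using field_vector_diff_chain_at[of ?z 1 u "\<lambda>z. z powr (of_real \<alpha> + 1)"] by (simp add: o_def)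
 qed
 have cont: "continuous_on {0..s} (\<lambda>u. ?z u powr (of_real \<alpha> + 1))"
  using assms Re_point \<alpha>1 by (intro continuous_intros) auto
have "norm (?z s powr (of_real \<alpha> + 1) - ?z 0 powr (of_real \<alpha> + 1)) \<le>
   (\<alpha> + 1) * ((1 + T)\<^sup>2 * (1 + r)\<^sup>2) * s - (\<alpha> + 1) * ((1 + T)\<^sup>2 * (1 + r)\<^sup>2) * 0"
 proof (rule differentiable_bound_general[where f' = "\<lambda>u. (of_real \<alpha> + 1) * ?z u powr of_real \<alpha>" and \<phi>' = "\<lambda>u. (\<alpha> + 1) * ((1 + T)\<^sup>2 * (1 + r)\<^sup>2)"])
  fix u assume u: "0 < u" "u < s"
  have "norm (?z u) \<le> norm (of_real r * ray) + norm (complex_of_real u)" by (rule norm_triangle_ineq)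
  also have "... \<le> r + T" using u assms by (simp add: norm_mult)
  finally have "norm (?z u powr of_real \<alpha>) \<le> (1 + T)\<^sup>2 * (1 + r)\<^sup>2"
   using assms by (intro norm_powr_le) auto
  moreover have "norm (of_real \<alpha> + 1 :: complex) = \<alpha> + 1"
   using \<alpha>1 by (metis abs_of_pos add_pos_pos less_trans norm_of_real of_real_1 of_real_add zero_less_one)
  ultimately show "norm ((of_real \<alpha> + 1) * ?z u powr of_real \<alpha>) \<le> (\<alpha> + 1) * ((1 + T)\<^sup>2 * (1 + r)\<^sup>2)"
   using \<alpha>1 by (simp add: norm_mult)
 qed (use False assms d cont in \<open>auto intro!: continuous_intros derivative_eq_intros\<close>)
 moreover have "Re (?z s powr (of_real \<alpha> + 1) - ?z 0 powr (of_real \<alpha> + 1)) = Re (?z s powr (of_real \<alpha> + 1)) + r powr (\<alpha> + 1)"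
  using assms by (simp add: ray_powr)
 ultimately have "Re (?z s powr (of_real \<alpha> + 1)) + r powr (\<alpha> + 1) \<le> (\<alpha> + 1) * ((1 + T)\<^sup>2 * (1 + r)\<^sup>2) * s"
  using complex_Re_le_cmod[of "?z s powr (of_real \<alpha> + 1) - ?z 0 powr (of_real \<alpha> + 1)"] by simp
 also have "... \<le> (\<alpha> + 1) * ((1 + T)\<^sup>2 * (1 + r)\<^sup>2) * T"
  using assms \<alpha>1 by (intro mult_left_mono) auto
 finally have "Re (?z s powr (of_real \<alpha> + 1)) \<le> (\<alpha> + 1) * (T * ((1 + T)\<^sup>2 * (1 + r)\<^sup>2)) - r powr (\<alpha> + 1)"
  by (simp add: ac_simps)
 then have "Re (?z s powr (of_real \<alpha> + 1)) / (\<alpha> + 1) \<le> ((\<alpha> + 1) * (T * ((1 + T)\<^sup>2 * (1 + r)\<^sup>2)) - r powr (\<alpha> + 1)) / (\<alpha> + 1)"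
  using \<alpha>1 by (intro divide_right_mono) auto
 then show ?thesis using \<alpha>1 by (simp add: diff_divide_distrib)
qed

text \<open>The exponents collected in \<open>airy_kernel_bound\<close>: T from translating the
  power, \<open>\<bar>x\<bar>\<close> from the tilt, and \<open>1 + \<bar>x\<bar>\<close> from the
  factor z^\<alpha> - x of the derivative, estimated by an exponential. The square of 1 + T comes
  from separating T and r in (1 + r + T)^2.\<close>

definition airy_const :: "real \<Rightarrow> real \<Rightarrow> real" where
 "airy_const x T = (T + 2 * \<bar>x\<bar> + 1) * (1 + T)\<^sup>2"

lemma airy_kernel_bound:
 assumes "0 \<le> r" "0 \<le> s" "s \<le> T"
 shows "norm (airy_kernel \<alpha> x (of_real r * ray + of_real s)) \<le> airy_bound (airy_const x T) r"
  and "norm (airy_kernel \<alpha> x (of_real r * ray + of_real s) * ((of_real r * ray + of_real s) powr of_real \<alpha> - of_real x)) \<le> airy_bound (airy_const x T) r"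
proof -
 define z where "z = of_real r * ray + of_real s"
 define K where "K = (1 + T)\<^sup>2 * (1 + r)\<^sup>2"
 have T: "0 \<le> T" using assms by simp
 have K1: "1 \<le> K" unfolding K_def power_mult_distrib[symmetric]
  using assms T by (intro one_le_power) (simp add: algebra_simps)
 have nz: "norm z \<le> r + T"
  using norm_triangle_ineq[of "of_real r * ray" "of_real s"] assms by (simp add: z_def norm_mult)
 have nK: "norm z \<le> K"
 proof -
  have "r + T \<le> (1 + T) * (1 + r)" using assms T by (simp add: algebra_simps)
  also have "... \<le> ((1 + T) * (1 + r))\<^sup>2" using assms T by (intro self_le_power) (auto simp: algebra_simps)
  finally show ?thesis using nz by (simp add: K_def power_mult_distrib)
 qed
 have "Re (z powr (of_real \<alpha> + 1) / (of_real \<alpha> + 1)) = Re (z powr (of_real \<alpha> + 1)) / (\<alpha> + 1)"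
  by (metis Re_divide_of_real of_real_1 of_real_add)
 also have "... \<le> T * K - r powr (\<alpha> + 1) / (\<alpha> + 1)"
  unfolding K_def z_def by (rule Re_powr_bound[OF assms])
 finally have R: "Re (z powr (of_real \<alpha> + 1) / (of_real \<alpha> + 1)) \<le> T * K - r powr (\<alpha> + 1) / (\<alpha> + 1)" .
 have "- (x * Re z) \<le> \<bar>x\<bar> * norm z"
  using mult_left_mono[OF abs_Re_le_cmod[of z], of "\<bar>x\<bar>"] abs_ge_minus_self[of "x * Re z"] by (simp add: abs_mult)
 also have "... \<le> \<bar>x\<bar> * K" using nK by (intro mult_left_mono) auto
 finally have x: "- (x * Re z) \<le> \<bar>x\<bar> * K" .
 have n1: "norm (airy_kernel \<alpha> x z) \<le> exp ((T + \<bar>x\<bar>) * K - r powr (\<alpha> + 1) / (\<alpha> + 1))"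
  using R x unfolding airy_kernel_def norm_exp_eq_Re by (simp add: algebra_simps)
 have CK: "airy_bound (airy_const x T) r = exp ((T + 2 * \<bar>x\<bar> + 1) * K - r powr (\<alpha> + 1) / (\<alpha> + 1))"
  by (simp add: airy_bound_def airy_const_def K_def mult.assoc)
 have "(T + \<bar>x\<bar>) * K \<le> (T + 2 * \<bar>x\<bar> + 1) * K" using K1 by (intro mult_right_mono) auto
 then show "norm (airy_kernel \<alpha> x (of_real r * ray + of_real s)) \<le> airy_bound (airy_const x T) r"
  using n1 unfolding CK z_def by (elim order_trans) simp
 have "norm (z powr of_real \<alpha> - of_real x) \<le> norm (z powr of_real \<alpha>) + \<bar>x\<bar>"
  by (metis norm_of_real norm_triangle_ineq4)
 also have "... \<le> K + \<bar>x\<bar> * K"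
  using norm_powr_le[OF nz] assms T K1 mult_left_mono[OF K1, of "\<bar>x\<bar>"] by (auto simp: K_def)
 also have "... \<le> exp ((1 + \<bar>x\<bar>) * K)"
  by (rule order_trans[OF _ exp_ge_add_one_self]) (simp add: algebra_simps)
 finally have n2: "norm (z powr of_real \<alpha> - of_real x) \<le> exp ((1 + \<bar>x\<bar>) * K)" .
 have "norm (airy_kernel \<alpha> x z * (z powr of_real \<alpha> - of_real x)) \<le>
   exp ((T + \<bar>x\<bar>) * K - r powr (\<alpha> + 1) / (\<alpha> + 1)) * exp ((1 + \<bar>x\<bar>) * K)"
  unfolding norm_mult using n1 n2 by (intro mult_mono) auto
 also have "... = airy_bound (airy_const x T) r"
  unfolding CK by (simp add: algebra_simps flip: exp_add)
 finally show "norm (airy_kernel \<alpha> x (of_real r * ray + of_real s) * ((of_real r * ray + of_real s) powr of_real \<alpha> - of_real x)) \<le> airy_bound (airy_const x T) r"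
  unfolding z_def .
qed

lemma airy_kernel_has_derivative:
 assumes "0 < Re z"
 shows "(airy_kernel \<alpha> x has_field_derivative (airy_kernel \<alpha> x z * (z powr of_real \<alpha> - of_real x))) (at z)"
proof -
 have nz: "(of_real \<alpha> + 1 :: complex) \<noteq> 0" using \<alpha>1 by (metis of_real_1 of_real_add of_real_eq_0_iff add_pos_pos less_trans zero_less_one less_irrefl)
 have "z \<notin> \<real>\<^sub>\<le>\<^sub>0" using assms by (auto simp: complex_nonpos_Reals_iff)
 from has_field_derivative_powr[OF this, of "of_real \<alpha> + 1"]
 have "((\<lambda>z. z powr (of_real \<alpha> + 1)) has_field_derivative (of_real \<alpha> + 1) * z powr of_real \<alpha>) (at z)" by simp
 then have "((\<lambda>z. z powr (of_real \<alpha> + 1) / (of_real \<alpha> + 1) - of_real x * z) has_field_derivative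
   (of_real \<alpha> + 1) * z powr of_real \<alpha> / (of_real \<alpha> + 1) - of_real x * 1) (at z)"
  by (intro DERIV_diff DERIV_cdivide DERIV_cmult DERIV_ident)
 from DERIV_fun_exp[OF this] show ?thesis
  unfolding airy_kernel_def using nz by simp
qed

lemma continuous_on_airy_kernel:
 "continuous_on {z. 0 \<le> Re z} (airy_kernel \<alpha> x)"
 unfolding airy_kernel_def using \<alpha>1
 by (intro continuous_intros) (auto simp: complex_eq_iff)

lemma set_integrable_airy_kernel:
 assumes s: "0 \<le> s"
 shows "set_integrable lborel {0..} (\<lambda>r. airy_kernel \<alpha> x (of_real r * ray + of_real s))"
proof (rule set_integrable_bound[OF set_integrable_airy_bound[of "airy_const x s"]])
 let ?f = "\<lambda>r. airy_kernel \<alpha> x (of_real r * ray + of_real s)"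
 have "continuous_on {0..} ?f"
  by (rule continuous_on_compose2[OF continuous_on_airy_kernel]) (use s Re_ray in \<open>auto intro!: continuous_intros\<close>)
 then show "set_borel_measurable lborel {0..} ?f"
  unfolding set_borel_measurable_def using borel_measurable_continuous_on_indicator[of "{0..}" ?f] by simp
 show "AE r in lborel. r \<in> {0..} \<longrightarrow> norm (?f r) \<le> norm (airy_bound (airy_const x s) r)"
  using s airy_kernel_bound(1)[of _ s s x] airy_bound_pos by (auto intro!: AE_I2 simp: less_imp_le)
qed

text \<open>The ray and its translate by \<open>T\<close> bound a half-strip whose short edge is the
  real segment from 0 to \<open>T\<close>. There the kernel is real, so the difference of the two
  contour integrals is a real number, invisible to the imaginary part.\<close>

lemma airy_contour_shift:
 assumes T: "0 \<le> T"
 shows "Im (ray * (LBINT r:{0..}. airy_kernel \<alpha> x (of_real r * ray + of_real T))) =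
    Im (ray * (LBINT r:{0..}. airy_kernel \<alpha> x (of_real r * ray)))"
proof -
 let ?z = "\<lambda>r s. of_real r * ray + of_real s :: complex"
 let ?f = "\<lambda>r s. airy_kernel \<alpha> x (?z r s)"
 let ?g = "\<lambda>r s. airy_kernel \<alpha> x (?z r s) * (?z r s powr of_real \<alpha> - of_real x)"
 have Re: "0 < Re (?z r s)" if "0 < r" "0 \<le> s" for r s using that Re_ray by (simp add: add_pos_nonneg)
 have z: "continuous_on ({0..} \<times> {0..T}) (\<lambda>p. ?z (fst p) (snd p))" by (intro continuous_intros)
 have cf: "continuous_on ({0..} \<times> {0..T}) (\<lambda>p. ?f (fst p) (snd p))"
  by (rule continuous_on_compose2[OF continuous_on_airy_kernel z]) (use Re_ray in auto)
 have cg: "continuous_on ({0..} \<times> {0..T}) (\<lambda>p. ?g (fst p) (snd p))"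
  using \<alpha>1 Re_point by (intro continuous_intros cf) auto
 have int: "set_integrable lborel {0..} (\<lambda>r. ?f r s)" if s: "0 \<le> s" "s \<le> T" for s
  using set_integrable_airy_kernel[OF s(1)] .
 have "ray * ((LBINT r:{0..}. ?f r T) - (LBINT r:{0..}. ?f r 0)) = - 1 * (LBINT s:{0..T}. ?f 0 s)"
 proof (rule half_strip_shift[where g = ?g and B = "airy_bound (airy_const x T)"])
  show "((\<lambda>r. ?f r s) has_vector_derivative ray * ?g r s) (at r)" if "0 < r" "0 < s" "s < T" for r s
  proof -
   have "((\<lambda>r. ?z r s) has_vector_derivative ray) (at r)"
    by (auto intro!: derivative_eq_intros)
   from field_vector_diff_chain_at[OF this airy_kernel_has_derivative[OF Re]] that
   show ?thesis by (simp add: o_def)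
  qed
  show "((\<lambda>s. ?f r s) has_vector_derivative 1 * ?g r s) (at s)" if "0 < r" "0 < s" "s < T" for r s
  proof -
   have "((\<lambda>s. ?z r s) has_vector_derivative 1) (at s)"
    by (auto intro!: derivative_eq_intros)
   from field_vector_diff_chain_at[OF this airy_kernel_has_derivative[OF Re]] that
   show ?thesis by (simp add: o_def)
  qed
  show "((\<lambda>r. ?f r s) \<longlongrightarrow> 0) at_top" if "0 \<le> s" "s \<le> T" for s
  proof (rule Lim_null_comparison[OF _ airy_bound_lim[of "airy_const x T"]])
   show "\<forall>\<^sub>F r in at_top. norm (?f r s) \<le> airy_bound (airy_const x T) r"
    using eventually_ge_at_top[of 0] by eventually_elim (rule airy_kernel_bound(1)[OF _ that])
  qed
  show "continuous_on ({0..} \<times> {0..T}) (\<lambda>(r, s). ?f r s)" "continuous_on ({0..} \<times> {0..T}) (\<lambda>(r, s). ?g r s)"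
   unfolding case_prod_unfold by (rule cf, rule cg)
  show "set_integrable lborel {0..} (\<lambda>r. ?f r 0)" "set_integrable lborel {0..} (\<lambda>r. ?f r T)"
   using T int[of 0] int[of T] by simp_all
 qed (use T set_integrable_airy_bound airy_kernel_bound(2) in auto)
 moreover have "Im (LBINT s:{0..T}. ?f 0 s) = 0"
 proof -
  have "?f 0 s = of_real (exp (s powr (\<alpha> + 1) / (\<alpha> + 1) - x * s))" if "0 \<le> s" for s
  proof -
   have "complex_of_real s powr (of_real \<alpha> + 1) = of_real (s powr (\<alpha> + 1))"
    using that powr_of_real[of s "\<alpha> + 1"] by simp
   moreover have "complex_of_real (s powr (\<alpha> + 1)) / (of_real \<alpha> + 1) - of_real x * of_real s = of_real (s powr (\<alpha> + 1) / (\<alpha> + 1) - x * s)"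
    by simp
   ultimately show ?thesis by (simp only: airy_kernel_def add_0 mult_zero_left of_real_0 exp_of_real)
  qed
  then have "(LBINT s:{0..T}. ?f 0 s) = (LBINT s:{0..T}. complex_of_real (exp (s powr (\<alpha> + 1) / (\<alpha> + 1) - x * s)))"
   by (intro set_lebesgue_integral_cong) auto
  also have "... = of_real (LBINT s:{0..T}. exp (s powr (\<alpha> + 1) / (\<alpha> + 1) - x * s))"
   by (rule set_integral_complex_of_real)
  finally show ?thesis by simp
 qed
 ultimately have "Im (ray * ((LBINT r:{0..}. ?f r T) - (LBINT r:{0..}. ?f r 0))) = 0" by simp
 then show ?thesis by (simp add: right_diff_distrib)
qed

lemma airy_kernel_ray:
 assumes "0 \<le> r"
 shows "airy_kernel \<alpha> x (of_real r * ray) =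
  of_real (exp (- (r powr (\<alpha> + 1)) / (\<alpha> + 1))) * exp (- (of_real x * (of_real r * ray)))"
proof -
 have "(of_real \<alpha> + 1 :: complex) = of_real (\<alpha> + 1)" by simp
 then have "(of_real r * ray) powr (of_real \<alpha> + 1) / (of_real \<alpha> + 1) = of_real (- (r powr (\<alpha> + 1)) / (\<alpha> + 1))"
  unfolding ray_powr[OF assms] by (metis of_real_divide of_real_minus)
 then show ?thesis unfolding airy_kernel_def
  by (metis exp_add exp_of_real uminus_add_conv_diff add.commute)
qed

lemma norm_airy_kernel_ray:
 assumes "0 \<le> r" "0 \<le> x"
 shows "norm (airy_kernel \<alpha> x (of_real r * ray)) \<le> airy_bound 0 r"
proof -
 have "norm (exp (- (of_real x * (of_real r * ray)))) \<le> 1"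
  using assms Re_ray by (simp add: norm_exp_eq_Re)
 then show ?thesis
  using mult_left_mono[of "norm (exp (- (of_real x * (of_real r * ray))))" 1 "exp (- (r powr (\<alpha> + 1)) / (\<alpha> + 1))"]
  unfolding airy_kernel_ray[OF assms(1)] norm_mult by (simp add: airy_bound_def)
qed

section \<open>The power series and first properties of \<Phi>\<close>

definition wright_coeff :: "nat \<Rightarrow> real" where
 "wright_coeff n = (- 1) ^ n / fact n * Gamma ((1 + real n) / (1 + \<alpha>)) *
  sin (pi * ((1 + real n) / (1 + \<alpha>))) * (1 + \<alpha>) powr ((real n - \<alpha>) / (1 + \<alpha>))"

text \<open>Expand \<open>exp (- x z)\<close> under the integral. The n-th term carries
  \<open>ray ^ Suc n\<close>, one power being the dz of the contour, and the imaginary part of that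
  is the sine in the series; the remaining real integral is a Gamma integral.\<close>

lemma wright_sums:
 "(\<lambda>n. wright_coeff n * x ^ n) sums Im (ray * (LBINT r:{0..}. airy_kernel \<alpha> x (of_real r * ray)))"
proof -
 define p where "p = \<alpha> + 1"
 have p: "0 < p" using \<alpha>1 by (simp add: p_def)
 define c where "c n = Gamma ((1 + real n) / p) * p powr ((1 + real n) / p - 1)" for n
 have hi: "((\<lambda>r. r ^ n * exp (- (r powr p) / p)) has_integral c n) {0..}" for n
  unfolding c_def by (rule has_integral_rotated_Gamma[OF p])
 have si: "set_integrable lborel {0..} (\<lambda>r. r ^ n * exp (- (r powr p) / p))" for n
  by (rule set_integrable_has_integral_nonneg[OF hi]) auto
 have ci: "(LBINT r:{0..}. r ^ n * exp (- (r powr p) / p)) = c n" for n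
  using has_integral_unique[OF has_integral_LBINT[OF si] hi] .
 define f where "f n r = indicator {0..} r *\<^sub>R (of_real (r ^ n * exp (- (r powr p) / p)) * (((- of_real x * ray) ^ n) / fact n))" for n and r :: real
 have fi: "integrable lborel (f n)" and fI: "(LINT r|lborel. f n r) = of_real (c n) * (((- of_real x * ray) ^ n) / fact n)" for n
 proof -
  have f: "f n = (\<lambda>r. of_real (indicator {0..} r *\<^sub>R (r ^ n * exp (- (r powr p) / p))) * (((- of_real x * ray) ^ n) / fact n))"
   by (auto simp: f_def fun_eq_iff indicator_def)
  have i: "integrable lborel (\<lambda>r. complex_of_real (indicator {0..} r *\<^sub>R (r ^ n * exp (- (r powr p) / p))))"
   using si[of n] unfolding set_integrable_def by (rule integrable_of_real)
  show "integrable lborel (f n)" unfolding f using i by (rule integrable_mult_left)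
  show "(LINT r|lborel. f n r) = of_real (c n) * (((- of_real x * ray) ^ n) / fact n)"
   unfolding f using i ci[of n] by (simp add: set_lebesgue_integral_def integral_mult_left del: of_real_mult)
 qed
 have nf: "norm (f n r) = indicator {0..} r * (exp (- (r powr p) / p) * ((\<bar>x\<bar> * r) ^ n / fact n))" for n r
  by (auto simp: f_def indicator_def norm_mult norm_divide norm_power power_mult_distrib)
 have expsums: "(\<lambda>n. (y ^ n / fact n)) sums exp y" for y :: real
  using exp_converges[of y] by (simp add: divide_inverse mult.commute scaleR_conv_of_real)
 have expsumc: "(\<lambda>n. (y ^ n / fact n)) sums exp y" for y :: complex
  using exp_converges[of y] by (simp add: divide_inverse mult.commute scaleR_conv_of_real)
 have sn: "summable (\<lambda>n. norm (f n r))" for r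
  unfolding nf by (intro summable_mult sums_summable[OF expsums])
 have S: "summable (\<lambda>n. LINT r|lborel. norm (f n r))"
 proof (rule summableI_nonneg_bounded)
  show "0 \<le> (LINT r|lborel. norm (f n r))" for n by simp
  fix N
  have "(\<Sum>n<N. LINT r|lborel. norm (f n r)) = (LINT r|lborel. (\<Sum>n<N. norm (f n r)))"
   using fi by (subst Bochner_Integration.integral_sum) auto
  \<comment> \<open>All partial sums of absolute values stay below the exponential of
    \<open>\<bar>x\<bar> * r\<close>, so one integral bounds them independently of N.\<close>
  also have "... \<le> (LINT r|lborel. indicator {0..} r *\<^sub>R airy_bound \<bar>x\<bar> r)"
  proof (rule integral_mono)
   show "integrable lborel (\<lambda>r. \<Sum>n<N. norm (f n r))" using fi by auto
   show "integrable lborel (\<lambda>r. indicator {0..} r *\<^sub>R airy_bound \<bar>x\<bar> r)"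
    using set_integrable_airy_bound unfolding set_integrable_def .
   fix r :: real
   show "(\<Sum>n<N. norm (f n r)) \<le> indicator {0..} r *\<^sub>R airy_bound \<bar>x\<bar> r"
   proof (cases "0 \<le> r")
    case True
    have "(\<Sum>n<N. (\<bar>x\<bar> * r) ^ n / fact n) \<le> exp (\<bar>x\<bar> * r)"
     using sum_le_suminf[OF sums_summable[OF expsums], of "{..<N}" "\<bar>x\<bar> * r"] sums_unique[OF expsums, of "\<bar>x\<bar> * r"] True by auto
    then have "(\<Sum>n<N. norm (f n r)) \<le> exp (- (r powr p) / p) * exp (\<bar>x\<bar> * r)"
    proof -
     have "(\<Sum>n<N. norm (f n r)) = exp (- (r powr p) / p) * (\<Sum>n<N. (\<bar>x\<bar> * r) ^ n / fact n)"
       using True by (simp add: nf sum_distrib_left)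
     then show ?thesis using \<open>_ \<le> exp (\<bar>x\<bar> * r)\<close> by (simp add: mult_left_mono)
    qed
    also have "... \<le> airy_bound \<bar>x\<bar> r"
    proof -
     have "r \<le> (1 + r)\<^sup>2" using True by (simp add: power2_eq_square algebra_simps add_increasing)
     then have "\<bar>x\<bar> * r \<le> \<bar>x\<bar> * (1 + r)\<^sup>2" by (intro mult_left_mono) auto
     then show ?thesis by (simp add: airy_bound_def p_def flip: exp_add)
    qed
    finally show ?thesis using True by simp
   qed (simp add: nf)
  qed
  finally show "(\<Sum>n<N. LINT r|lborel. norm (f n r)) \<le> (LINT r|lborel. indicator {0..} r *\<^sub>R airy_bound \<bar>x\<bar> r)" .
 qed
 have fs: "(\<Sum>n. f n r) = indicator {0..} r *\<^sub>R airy_kernel \<alpha> x (of_real r * ray)" for r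
 proof (cases "0 \<le> r")
  case True
  have "(\<lambda>n. of_real (exp (- (r powr p) / p)) * ((- (of_real x * (of_real r * ray))) ^ n / fact n)) sums
    (of_real (exp (- (r powr p) / p)) * exp (- (of_real x * (of_real r * ray))))"
   by (intro sums_mult expsumc)
  moreover have "(\<lambda>n. of_real (exp (- (r powr p) / p)) * ((- (of_real x * (of_real r * ray))) ^ n / fact n)) = (\<lambda>n. f n r)"
  proof
   fix n
   have "- (of_real x * (of_real r * ray)) = of_real r * (- of_real x * ray)" by simp
   then have "(- (of_real x * (of_real r * ray))) ^ n = of_real r ^ n * (- of_real x * ray) ^ n"
    by (simp only: power_mult_distrib)
   then show "of_real (exp (- (r powr p) / p)) * ((- (of_real x * (of_real r * ray))) ^ n / fact n) = f n r"
    using True by (simp add: f_def mult_ac)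
  qed
  ultimately show ?thesis using True by (simp add: sums_unique[symmetric] airy_kernel_ray p_def)
 qed (simp add: f_def)
 have "(\<lambda>n. LINT r|lborel. f n r) sums (LINT r|lborel. (\<Sum>n. f n r))"
  by (rule sums_integral[OF fi _ S]) (use sn in auto)
 then have "(\<lambda>n. of_real (c n) * (((- of_real x * ray) ^ n) / fact n)) sums (LBINT r:{0..}. airy_kernel \<alpha> x (of_real r * ray))"
  unfolding fI fs set_lebesgue_integral_def .
 then have "(\<lambda>n. Im (ray * (of_real (c n) * (((- of_real x * ray) ^ n) / fact n)))) sums Im (ray * (LBINT r:{0..}. airy_kernel \<alpha> x (of_real r * ray)))"
  by (intro sums_Im sums_mult)
 moreover have "Im (ray * (of_real (c n) * (((- of_real x * ray) ^ n) / fact n))) = wright_coeff n * x ^ n" for n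
 proof -
  have "(- of_real x * ray) ^ n = of_real ((- x) ^ n) * ray ^ n"
   unfolding power_mult_distrib by simp
  then have "ray * (of_real (c n) * (((- of_real x * ray) ^ n) / fact n)) = of_real (c n * (- x) ^ n / fact n) * ray ^ Suc n"
   by simp
  also have "ray ^ Suc n = cis (real (Suc n) * (pi / (\<alpha> + 1)))"
   unfolding ray_def Complex.DeMoivre ..
  finally have e: "ray * (of_real (c n) * (((- of_real x * ray) ^ n) / fact n)) =
    of_real (c n * (- x) ^ n / fact n) * cis (real (Suc n) * (pi / (\<alpha> + 1)))" .
  have "Im (ray * (of_real (c n) * (((- of_real x * ray) ^ n) / fact n))) = c n * (- x) ^ n / fact n * sin (real (Suc n) * (pi / (\<alpha> + 1)))"
   unfolding e by (simp only: times_complex.sel Im_complex_of_real Re_complex_of_real cis.sel mult_zero_left add_0_right)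
  moreover have "real (Suc n) * (pi / (\<alpha> + 1)) = pi * ((1 + real n) / (1 + \<alpha>))" by (simp add: field_simps)
  moreover have "c n = Gamma ((1 + real n) / (1 + \<alpha>)) * (1 + \<alpha>) powr ((real n - \<alpha>) / (1 + \<alpha>))"
  proof -
   have "(1 + real n) / p - 1 = (real n - \<alpha>) / (1 + \<alpha>)" using \<alpha>1 by (simp add: p_def field_simps)
   then show ?thesis by (simp add: c_def p_def add.commute)
  qed
  moreover have "(- x) ^ n = (- 1) ^ n * x ^ n" by (rule power_minus)
  ultimately show ?thesis by (simp only: wright_coeff_def) (simp add: mult_ac)
 qed
 ultimately show ?thesis by simp
qed

lemma M_Wright_suminf: "M_Wright \<alpha> x = 1 / pi * (\<Sum>n. wright_coeff n * x ^ n)"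
 by (simp add: M_Wright_def wright_coeff_def)

lemma M_Wright_eq:
 "M_Wright \<alpha> x = 1 / pi * Im (ray * (LBINT r:{0..}. airy_kernel \<alpha> x (of_real r * ray)))"
 unfolding M_Wright_suminf using sums_unique[OF wright_sums[of x]] by simp

text \<open>For the stopped process T becomes the remaining time, which depends on the path; all
  these contours represent the same function.\<close>

lemma M_Wright_eq_shift:
 assumes "0 \<le> T"
 shows "M_Wright \<alpha> x = 1 / pi * Im (ray * (LBINT r:{0..}. airy_kernel \<alpha> x (of_real r * ray + of_real T)))"
 unfolding M_Wright_eq airy_contour_shift[OF assms] ..

lemma M_Wright_has_derivative:
 "(M_Wright \<alpha> has_real_derivative (1 / pi * (\<Sum>n. diffs wright_coeff n * x ^ n))) (at x)"
 unfolding M_Wright_suminf[abs_def]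
 by (intro DERIV_cmult termdiffs_strong_converges_everywhere sums_summable[OF wright_sums])

lemma deriv_M_Wright: "(M_Wright \<alpha> has_real_derivative deriv (M_Wright \<alpha>) x) (at x)"
 using M_Wright_has_derivative[of x] DERIV_imp_deriv by metis

text \<open>Lets the lower Laplace parameter tend to 0 in \<Phi>' / \<Phi> at the end of the
  proof.\<close>

lemma isCont_deriv_M_Wright: "isCont (deriv (M_Wright \<alpha>)) x"
proof -
 have e: "deriv (M_Wright \<alpha>) = (\<lambda>x. 1 / pi * (\<Sum>n. diffs wright_coeff n * x ^ n))"
  using M_Wright_has_derivative DERIV_imp_deriv by blast
 have "((\<lambda>x. \<Sum>n. diffs wright_coeff n * x ^ n) has_field_derivative (\<Sum>n. diffs (diffs wright_coeff) n * x ^ n)) (at x)"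
  by (intro termdiffs_strong_converges_everywhere termdiff_converges_all sums_summable[OF wright_sums])
 then show ?thesis unfolding e by (intro continuous_intros) (rule DERIV_isCont)
qed

text \<open>At 0 only the coefficient of order zero is left. Positivity elsewhere is not visible
  from the alternating series; it comes from the probabilistic representation, in
  \<open>M_Wright_pos\<close>.\<close>

lemma M_Wright_0_pos: "0 < M_Wright \<alpha> 0"
proof -
 have "(\<lambda>n. wright_coeff n * 0 ^ n) sums wright_coeff 0"
  using powser_sums_zero[of wright_coeff] .
 then have "M_Wright \<alpha> 0 = 1 / pi * wright_coeff 0"
  unfolding M_Wright_suminf by (simp add: sums_unique[symmetric])
 moreover have "0 < wright_coeff 0"
 proof -
  have "pi * (1 / (1 + \<alpha>)) < pi" "0 < pi * (1 / (1 + \<alpha>))" using \<alpha>1 by (auto simp: field_simps)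
  then show ?thesis unfolding wright_coeff_def using \<alpha>1
   by (auto intro!: mult_pos_pos Gamma_real_pos sin_gt_zero)
 qed
 ultimately show ?thesis by simp
qed

text \<open>On the ray \<open>Re z \<ge> 0\<close>, so \<open>exp (- x z)\<close> has modulus at
  most one for \<open>x \<ge> 0\<close>. The bound is the majorant when the horizon of the stopped
  process goes to infinity.\<close>

lemma norm_M_Wright_bounded: "\<exists>C. \<forall>x\<ge>0. \<bar>M_Wright \<alpha> x\<bar> \<le> C"
proof (intro exI allI impI)
 fix x :: real assume x: "0 \<le> x"
 have "\<bar>M_Wright \<alpha> x\<bar> = 1 / pi * \<bar>Im (ray * (LBINT r:{0..}. airy_kernel \<alpha> x (of_real r * ray)))\<bar>"
  unfolding M_Wright_eq by (simp add: abs_mult)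
 also have "... \<le> 1 / pi * norm (ray * (LBINT r:{0..}. airy_kernel \<alpha> x (of_real r * ray)))"
  by (intro mult_left_mono abs_Im_le_cmod) auto
 also have "... = 1 / pi * norm (LBINT r:{0..}. airy_kernel \<alpha> x (of_real r * ray))" by (simp add: norm_mult)
 also have "... \<le> 1 / pi * (LBINT r:{0..}. airy_bound 0 r)"
 proof (intro mult_left_mono)
  show "norm (LBINT r:{0..}. airy_kernel \<alpha> x (of_real r * ray)) \<le> (LBINT r:{0..}. airy_bound 0 r)"
   unfolding set_lebesgue_integral_def
   using set_integrable_airy_bound[of 0] set_integrable_airy_kernel[of 0 x] norm_airy_kernel_ray[OF _ x]
   by (intro Bochner_Integration.integral_norm_bound_integral) (auto simp: indicator_def set_integrable_def)
 qed auto
 finally show "\<bar>M_Wright \<alpha> x\<bar> \<le> 1 / pi * (LBINT r:{0..}. airy_bound 0 r)" .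
qed

end

section \<open>Exponential moments of the stable law\<close>

lemma exp_decay_gauss: "((\<lambda>r::real. exp (r - r\<^sup>2 / 4) * exp r) \<longlongrightarrow> 0) at_top"
 by real_asymp

lemma set_integrable_gauss: "set_integrable lborel {0..} (\<lambda>r. K * exp (r - r\<^sup>2 / 4 :: real))"
proof -
 have "set_integrable lborel {0..} (\<lambda>r. exp (r - r\<^sup>2 / 4 :: real))"
  by (rule set_integrable_atLeast_exp_decay) (use exp_decay_gauss in \<open>auto intro!: continuous_intros\<close>)
 then show ?thesis by simp
qed

text \<open>\<open>half_strip_shift\<close> moves half-lines only; a shift of the whole real line is
  assembled from its two halves.\<close>

lemma integral_eq_halves:
 fixes f :: "real \<Rightarrow> complex"
 assumes c: "continuous_on UNIV f" and "set_integrable lborel {0..} f" and "set_integrable lborel {0..} (\<lambda>r. f (- r))"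
 shows "integrable lborel f" and "(LINT x|lborel. f x) = (LBINT r:{0..}. f r) + (LBINT r:{0..}. f (- r))"
proof -
 have m[measurable]: "f \<in> borel_measurable borel" using c by (rule borel_measurable_continuous_onI)
 have e: "(\<lambda>r. indicator {0..} r *\<^sub>R f (- r)) = (\<lambda>r. (\<lambda>x. indicator {..0} x *\<^sub>R f x) (0 + (-1) * r))"
  by (auto simp: indicator_def fun_eq_iff)
 have i: "integrable lborel (\<lambda>x. indicator {..0} x *\<^sub>R f x)"
  using assms(3) unfolding set_integrable_def e by (subst (asm) lborel_integrable_real_affine_iff) auto
 have I: "(LBINT r:{0..}. f (- r)) = (LINT x|lborel. indicator {..0} x *\<^sub>R f x)"
  unfolding set_lebesgue_integral_def e
  by (subst lborel_integral_real_affine[of "-1" _ 0]) auto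
 have "AE x in lborel. f x = indicator {0..} x *\<^sub>R f x + indicator {..0} x *\<^sub>R f x"
  using AE_lborel_singleton[of 0] by eventually_elim (auto simp: indicator_def)
 then show "integrable lborel f"
  and "(LINT x|lborel. f x) = (LBINT r:{0..}. f r) + (LBINT r:{0..}. f (- r))"
 proof -
  assume ae: "AE x in lborel. f x = indicator {0..} x *\<^sub>R f x + indicator {..0} x *\<^sub>R f x"
  have s: "integrable lborel (\<lambda>x. indicator {0..} x *\<^sub>R f x + indicator {..0} x *\<^sub>R f x)"
   using assms(2) i unfolding set_integrable_def by auto
  show "integrable lborel f"
   using s by (rule integrable_cong_AE_imp) (use ae in auto)
  have "(LINT x|lborel. f x) = (LINT x|lborel. indicator {0..} x *\<^sub>R f x + indicator {..0} x *\<^sub>R f x)"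
   using ae by (intro integral_cong_AE) auto
  also have "... = (LBINT r:{0..}. f r) + (LBINT r:{0..}. f (- r))"
   unfolding I using assms(2) i by (simp add: set_integrable_def set_lebesgue_integral_def)
  finally show "(LINT x|lborel. f x) = (LBINT r:{0..}. f r) + (LBINT r:{0..}. f (- r))" .
 qed
qed

context airy_param
begin

section \<open>Gaussian smoothing of a characteristic function\<close>

lemma powr_le_square:
 fixes q :: complex assumes "norm q \<le> B" shows "norm (q powr of_real \<alpha>) \<le> (1 + B)\<^sup>2"
proof -
 have "norm (q powr of_real \<alpha>) = norm q powr \<alpha>" by (simp add: norm_powr_real_powr')
 also have "... \<le> (1 + B) powr \<alpha>" using assms \<alpha>1 by (intro powr_mono2) auto
 also have "... \<le> (1 + B) powr 2" using assms norm_ge_zero[of q] \<alpha>2 by (intro powr_mono) (auto simp del: norm_ge_zero)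
 also have "... = (1 + B)\<^sup>2" using assms norm_ge_zero[of q] by (simp add: powr_numeral del: norm_ge_zero)
 finally show ?thesis .
qed

lemma powr_m1_le:
 fixes q :: complex assumes "norm q \<le> B" shows "norm (q powr of_real (\<alpha> - 1)) \<le> 1 + B"
proof -
 have "norm (q powr of_real (\<alpha> - 1)) = norm q powr (\<alpha> - 1)" by (simp add: norm_powr_real_powr')
 also have "... \<le> (1 + B) powr (\<alpha> - 1)" using assms \<alpha>1 by (intro powr_mono2) auto
 also have "... \<le> (1 + B) powr 1" using assms norm_ge_zero[of q] \<alpha>2 by (intro powr_mono) (auto simp del: norm_ge_zero)
 also have "... = 1 + B" using assms norm_ge_zero[of q] by (simp del: norm_ge_zero)
 finally show ?thesis .
qed

lemma square_sum_le: "(c + d)\<^sup>2 \<le> 2 * c\<^sup>2 + 2 * (d::real)\<^sup>2"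
 using sum_squares_bound[of c d] by (simp add: power2_sum)

context
 fixes h a b sg :: real
 assumes h: "0 \<le> h" and a: "0 < a" and sg: "0 < sg" and small: "2 * h * sg\<^sup>2 \<le> 1 / 4"
begin

text \<open>The integrand of a Gaussian average of the characteristic function, continued off the
  real axis. On the real line the second factor is the characteristic function at sg v - b; on the
  line of height a / sg the Gaussian becomes centred and the base of the power becomes z - \<i> sg v
  with z = a + \<i> b.\<close>

definition tilted :: "complex \<Rightarrow> complex" where
 "tilted zt = exp (- (zt - \<i> * of_real (a / sg))\<^sup>2 / 2) * exp (of_real h * (- \<i> * (of_real sg * zt - of_real b)) powr of_real \<alpha>)"

definition tilted' :: "complex \<Rightarrow> complex" where
 "tilted' zt = tilted zt * (- (zt - \<i> * of_real (a / sg)) +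
   of_real h * (of_real \<alpha> * (- \<i> * (of_real sg * zt - of_real b)) powr of_real (\<alpha> - 1) * (- \<i> * of_real sg)))"

lemma tilted_deriv:
 assumes "0 < Im zt" shows "(tilted has_field_derivative tilted' zt) (at zt)"
proof -
 let ?q = "\<lambda>zt. - \<i> * (of_real sg * zt - of_real b)"
 have "?q zt \<notin> \<real>\<^sub>\<le>\<^sub>0" using assms sg by (auto simp: complex_nonpos_Reals_iff not_le)
 from has_field_derivative_powr[OF this, of "of_real \<alpha>"]
 have p: "((\<lambda>z. z powr of_real \<alpha>) has_field_derivative of_real \<alpha> * ?q zt powr of_real (\<alpha> - 1)) (at (?q zt))" by simp
 have q: "(?q has_field_derivative (- \<i> * of_real sg)) (at zt)"
  by (auto intro!: derivative_eq_intros)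
 have 1: "((\<lambda>zt. of_real h * ?q zt powr of_real \<alpha>) has_field_derivative of_real h * (of_real \<alpha> * ?q zt powr of_real (\<alpha> - 1) * (- \<i> * of_real sg))) (at zt)"
  by (intro DERIV_cmult DERIV_chain2[OF p q])
 have 2: "((\<lambda>zt. - (zt - \<i> * of_real (a / sg))\<^sup>2 / 2) has_field_derivative - (zt - \<i> * of_real (a / sg))) (at zt)"
 proof -
  have "((\<lambda>zt. (zt - c)\<^sup>2) has_field_derivative 2 * (zt - c)) (at zt)" for c
   by (auto intro!: derivative_eq_intros)
  from DERIV_cdivide[OF DERIV_minus[OF this], of "\<i> * of_real (a / sg)" 2] show ?thesis
   by (simp add: diff_divide_distrib)
 qed
 show ?thesis
  unfolding tilted_def[abs_def] tilted'_def
  using DERIV_mult[OF DERIV_fun_exp[OF 2] DERIV_fun_exp[OF 1]] by (simp add: algebra_simps)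
qed

lemma tilted_cont: "continuous_on {zt. 0 \<le> Im zt} tilted" "continuous_on {zt. 0 \<le> Im zt} tilted'"
proof -
 show "continuous_on {zt. 0 \<le> Im zt} tilted"
  unfolding tilted_def using \<alpha>1 sg by (intro continuous_intros) auto
 then show "continuous_on {zt. 0 \<le> Im zt} tilted'"
  unfolding tilted'_def using \<alpha>1 sg by (intro continuous_intros) auto
qed

text \<open>The term \<open>sg * (a / sg)\<close> bounds \<open>sg\<close> times the imaginary part
  inside the strip; with it, \<open>tilt_c + sg * \<bar>v\<bar> - 1\<close> bounds the base of the
  power throughout the strip.\<close>

definition tilt_c :: real where "tilt_c = 1 + sg * (a / sg) + \<bar>b\<bar>"

definition tilt_K :: real where
 "tilt_K = exp ((a / sg)\<^sup>2 / 2 + 2 * h * tilt_c\<^sup>2) * (1 + a / sg + 2 * h * sg * (tilt_c + sg))"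

text \<open>The Gaussian contributes - v^2 / 2, and \<open>small\<close> lets the power use up at
  most half of it: h |q|^\<alpha> is at most a constant plus v^2 / 4. The factor
  \<open>exp \<bar>v\<bar>\<close> pays for the linear growth of the logarithmic derivative.\<close>

lemma tilted_bound:
 assumes "0 \<le> s" "s \<le> a / sg"
 shows "norm (tilted (of_real v + \<i> * of_real s)) \<le> tilt_K * exp (\<bar>v\<bar> - v\<^sup>2 / 4)"
  and "norm (tilted' (of_real v + \<i> * of_real s)) \<le> tilt_K * exp (\<bar>v\<bar> - v\<^sup>2 / 4)"
proof -
 define T where "T = a / sg"
 define zt where "zt = of_real v + \<i> * of_real s"
 define q where "q = - \<i> * (of_real sg * zt - of_real b)"
 have T: "0 < T" using a sg by (simp add: T_def)
 have s: "0 \<le> s" "s \<le> T" using assms by (auto simp: T_def)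
 have c1: "1 \<le> tilt_c" using a by (auto simp: tilt_c_def sg)
 have nzt: "norm zt \<le> \<bar>v\<bar> + T"
  unfolding zt_def by (rule order_trans[OF norm_triangle_ineq]) (use s in \<open>auto simp: norm_mult\<close>)
 have "norm q = norm (of_real sg * zt - of_real b)" by (simp add: q_def norm_mult)
 also have "... \<le> sg * norm zt + \<bar>b\<bar>"
  by (rule order_trans[OF norm_triangle_ineq4]) (use sg in \<open>auto simp: norm_mult\<close>)
 also have "... \<le> sg * (\<bar>v\<bar> + T) + \<bar>b\<bar>" using nzt sg by (intro add_right_mono mult_left_mono) auto
 also have "... = tilt_c + sg * \<bar>v\<bar> - 1" by (simp add: tilt_c_def T_def algebra_simps)
 finally have nq: "norm q \<le> tilt_c + sg * \<bar>v\<bar> - 1" .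
 have "norm (q powr of_real \<alpha>) \<le> (tilt_c + sg * \<bar>v\<bar>)\<^sup>2"
  using powr_le_square[OF nq] by simp
 also have "... \<le> 2 * tilt_c\<^sup>2 + 2 * (sg * \<bar>v\<bar>)\<^sup>2" by (rule square_sum_le)
 finally have "h * norm (q powr of_real \<alpha>) \<le> h * (2 * tilt_c\<^sup>2 + 2 * (sg * \<bar>v\<bar>)\<^sup>2)"
  using h by (intro mult_left_mono) auto
 also have "... = 2 * h * tilt_c\<^sup>2 + (2 * h * sg\<^sup>2) * v\<^sup>2" by (simp add: power_mult_distrib algebra_simps)
 also have "... \<le> 2 * h * tilt_c\<^sup>2 + (1 / 4) * v\<^sup>2" using small by (intro add_left_mono mult_right_mono) auto
 finally have hq: "h * norm (q powr of_real \<alpha>) \<le> 2 * h * tilt_c\<^sup>2 + v\<^sup>2 / 4" by simp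
 have "Re (of_real h * q powr of_real \<alpha>) \<le> h * norm (q powr of_real \<alpha>)"
  using complex_Re_le_cmod[of "q powr of_real \<alpha>"] h by (simp add: mult_left_mono)
 with hq have R1: "Re (of_real h * q powr of_real \<alpha>) \<le> 2 * h * tilt_c\<^sup>2 + v\<^sup>2 / 4" by simp
 have "Re (- (zt - \<i> * of_real T)\<^sup>2 / 2) = ((s - T)\<^sup>2 - v\<^sup>2) / 2"
  by (simp add: zt_def power2_eq_square diff_divide_distrib)
 also have "(s - T)\<^sup>2 \<le> T\<^sup>2" using s by (intro power2_le_iff_abs_le[THEN iffD2]) auto
 finally have R2: "Re (- (zt - \<i> * of_real T)\<^sup>2 / 2) \<le> (T\<^sup>2 - v\<^sup>2) / 2" by (simp add: divide_right_mono)
 have nt: "norm (tilted zt) \<le> exp (T\<^sup>2 / 2 + 2 * h * tilt_c\<^sup>2) * exp (- v\<^sup>2 / 4)"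
 proof -
  have "norm (tilted zt) = exp (Re (- (zt - \<i> * of_real T)\<^sup>2 / 2) + Re (of_real h * q powr of_real \<alpha>))"
   unfolding tilted_def q_def[symmetric] T_def[symmetric] norm_mult norm_exp_eq_Re exp_add ..
  also have "... \<le> exp ((T\<^sup>2 - v\<^sup>2) / 2 + (2 * h * tilt_c\<^sup>2 + v\<^sup>2 / 4))"
   using add_mono[OF R2 R1] by (simp only: exp_le_cancel_iff)
  also have "... = exp (T\<^sup>2 / 2 + 2 * h * tilt_c\<^sup>2) * exp (- v\<^sup>2 / 4)" by (simp add: field_simps flip: exp_add)
  finally show ?thesis .
 qed
 define D where "D = 1 + T + 2 * h * sg * (tilt_c + sg)"
 have D: "1 \<le> D" using T h sg c1 by (simp add: D_def)
 have K: "tilt_K = exp (T\<^sup>2 / 2 + 2 * h * tilt_c\<^sup>2) * D" by (simp add: tilt_K_def T_def D_def)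
 have 1: "1 + \<bar>v\<bar> \<le> exp \<bar>v\<bar>" by (rule exp_ge_add_one_self)
 have fin: "X \<le> tilt_K * exp (\<bar>v\<bar> - v\<^sup>2 / 4)" if X: "X \<le> exp (T\<^sup>2 / 2 + 2 * h * tilt_c\<^sup>2) * exp (- v\<^sup>2 / 4) * (D * (1 + \<bar>v\<bar>))" for X
 proof -
  have "X \<le> exp (T\<^sup>2 / 2 + 2 * h * tilt_c\<^sup>2) * exp (- v\<^sup>2 / 4) * (D * exp \<bar>v\<bar>)"
   using D 1 by (intro order_trans[OF X] mult_left_mono) auto
  also have "... = tilt_K * exp (\<bar>v\<bar> - v\<^sup>2 / 4)" 
  proof -
   have "exp (\<bar>v\<bar> - v\<^sup>2 / 4) = exp (- v\<^sup>2 / 4) * exp \<bar>v\<bar>" by (simp flip: exp_add)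
   then show ?thesis by (simp add: K mult_ac)
  qed
  finally show ?thesis .
 qed
 have D1: "1 \<le> D * (1 + \<bar>v\<bar>)" using D by (intro mult_ge1_I[of D "1 + \<bar>v\<bar>", simplified]) auto
 show "norm (tilted (of_real v + \<i> * of_real s)) \<le> tilt_K * exp (\<bar>v\<bar> - v\<^sup>2 / 4)"
  unfolding zt_def[symmetric] using mult_left_mono[OF D1, of "exp (T\<^sup>2 / 2 + 2 * h * tilt_c\<^sup>2) * exp (- v\<^sup>2 / 4)"]
  by (intro fin order_trans[OF nt]) simp
 have f1: "norm (zt - \<i> * of_real T) \<le> \<bar>v\<bar> + T"
 proof -
  have "zt - \<i> * of_real T = of_real v + \<i> * of_real (s - T)" by (simp add: zt_def algebra_simps)
  also have "norm ... \<le> \<bar>v\<bar> + \<bar>s - T\<bar>" by (rule order_trans[OF norm_triangle_ineq]) (simp add: norm_mult del: of_real_diff)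
  finally show ?thesis using s by simp
 qed
 have f2: "norm (of_real h * (of_real \<alpha> * q powr of_real (\<alpha> - 1) * (- \<i> * of_real sg))) \<le> 2 * h * sg * (tilt_c + sg * \<bar>v\<bar>)"
 proof -
  have "norm (q powr of_real (\<alpha> - 1)) \<le> tilt_c + sg * \<bar>v\<bar>" using powr_m1_le[OF nq] by simp
  then have "\<alpha> * norm (q powr of_real (\<alpha> - 1)) \<le> 2 * (tilt_c + sg * \<bar>v\<bar>)" using \<alpha>1 \<alpha>2 by (intro mult_mono) auto
  then have "h * sg * (\<alpha> * norm (q powr of_real (\<alpha> - 1))) \<le> h * sg * (2 * (tilt_c + sg * \<bar>v\<bar>))"
   using h sg by (intro mult_left_mono) auto
  then show ?thesis using h sg \<alpha>1 by (simp add: norm_mult mult_ac del: of_real_diff)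
 qed
 have "norm (- (zt - \<i> * of_real T) + of_real h * (of_real \<alpha> * q powr of_real (\<alpha> - 1) * (- \<i> * of_real sg)))
   \<le> norm (zt - \<i> * of_real T) + norm (of_real h * (of_real \<alpha> * q powr of_real (\<alpha> - 1) * (- \<i> * of_real sg)))"
  by (rule order_trans[OF norm_triangle_ineq]) (simp only: norm_minus_cancel order_refl)
 also have "... \<le> (\<bar>v\<bar> + T) + 2 * h * sg * (tilt_c + sg * \<bar>v\<bar>)" using f1 f2 by linarith
 also have "... \<le> D * (1 + \<bar>v\<bar>)"
 proof -
  have "0 \<le> T * \<bar>v\<bar>" "0 \<le> 2 * h * sg * tilt_c * \<bar>v\<bar>" "0 \<le> 2 * h * sg * sg" using T h sg c1 by auto
  then show ?thesis unfolding D_def by (simp add: algebra_simps)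
 qed
 finally have f: "norm (- (zt - \<i> * of_real T) + of_real h * (of_real \<alpha> * q powr of_real (\<alpha> - 1) * (- \<i> * of_real sg))) \<le> D * (1 + \<bar>v\<bar>)" .
 show "norm (tilted' (of_real v + \<i> * of_real s)) \<le> tilt_K * exp (\<bar>v\<bar> - v\<^sup>2 / 4)"
  unfolding zt_def[symmetric] tilted'_def norm_mult[of "tilted zt"] q_def[symmetric] T_def[symmetric]
  by (intro fin mult_mono nt f) auto
qed

text \<open>Both halves of the line are shifted upward over the same vertical segment above the
  origin. It enters the two shifts with opposite signs, so the boundary terms cancel.\<close>

lemma tilted_shift:
 "integrable lborel (\<lambda>v. tilted (of_real v))"
 "(LINT v|lborel. tilted (of_real v)) = (LINT v|lborel. tilted (of_real v + \<i> * of_real (a / sg)))"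
proof -
 define T where "T = a / sg"
 have T: "0 \<le> T" using a sg by (simp add: T_def)
 have bnd: "norm (tilted (of_real v + \<i> * of_real s)) \<le> tilt_K * exp (\<bar>v\<bar> - v\<^sup>2 / 4)"
  "norm (tilted' (of_real v + \<i> * of_real s)) \<le> tilt_K * exp (\<bar>v\<bar> - v\<^sup>2 / 4)" if "0 \<le> s" "s \<le> T" for v s
  using tilted_bound that unfolding T_def by auto
 have cont: "continuous_on UNIV (\<lambda>v. tilted (of_real v + \<i> * of_real s))" if "0 \<le> s" for s
  by (rule continuous_on_compose2[OF tilted_cont(1)]) (use that in \<open>auto intro!: continuous_intros\<close>)
 \<comment> \<open>\<open>ep\<close> is the direction of the half-line, 1 for the right half and -1
   for the left one.\<close>
 have half: "ep = 1 \<or> ep = -1 \<Longrightarrow> (\<forall>s. 0 \<le> s \<longrightarrow> s \<le> T \<longrightarrow> set_integrable lborel {0..} (\<lambda>r. tilted (of_real (ep * r) + \<i> * of_real s))) \<and>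
  of_real ep * ((LBINT r:{0..}. tilted (of_real (ep * r) + \<i> * of_real T)) - (LBINT r:{0..}. tilted (of_real (ep * r) + \<i> * of_real 0)))
   = - \<i> * (LBINT s:{0..T}. tilted (of_real (ep * 0) + \<i> * of_real s))" for ep :: real
 proof (intro conjI allI impI)
  assume ep: "ep = 1 \<or> ep = -1"
  then have ep1: "\<bar>ep * r\<bar> = \<bar>r\<bar>" "(ep * r)\<^sup>2 = r\<^sup>2" for r by (auto simp: abs_mult)
  have int: "set_integrable lborel {0..} (\<lambda>r. tilted (of_real (ep * r) + \<i> * of_real s))" if s: "0 \<le> s" "s \<le> T" for s
  proof (rule set_integrable_bound[OF set_integrable_gauss[of tilt_K]])
   have "continuous_on {0..} (\<lambda>r. tilted (of_real (ep * r) + \<i> * of_real s))"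
    by (rule continuous_on_compose2[OF cont[OF s(1)], of _ "\<lambda>r. ep * r"]) (auto intro!: continuous_intros)
   then show "set_borel_measurable lborel {0..} (\<lambda>r. tilted (of_real (ep * r) + \<i> * of_real s))"
    unfolding set_borel_measurable_def
    using borel_measurable_continuous_on_indicator[of "{0..}" "(\<lambda>r. tilted (of_real (ep * r) + \<i> * of_real s))"] by simp
   show "AE r in lborel. r \<in> {0..} \<longrightarrow> norm (tilted (of_real (ep * r) + \<i> * of_real s)) \<le> norm (tilt_K * exp (r - r\<^sup>2 / 4))"
   proof (intro AE_I2 impI)
    fix r :: real assume "r \<in> {0..}"
    then have "norm (tilted (of_real (ep * r) + \<i> * of_real s)) \<le> tilt_K * exp (r - r\<^sup>2 / 4)"
     using bnd(1)[OF s, of "ep * r"] ep1[of r] by simp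
    then show "norm (tilted (of_real (ep * r) + \<i> * of_real s)) \<le> norm (tilt_K * exp (r - r\<^sup>2 / 4))"
     unfolding real_norm_def by linarith
   qed
  qed
  then show "set_integrable lborel {0..} (\<lambda>r. tilted (of_real (ep * r) + \<i> * of_real s))" if "0 \<le> s" "s \<le> T" for s using that .
  let ?p = "\<lambda>r s. of_real (ep * r) + \<i> * of_real s :: complex"
  have cp: "continuous_on ({0..} \<times> {0..T}) (\<lambda>x. ?p (fst x) (snd x))" by (intro continuous_intros)
  show "of_real ep * ((LBINT r:{0..}. tilted (?p r T)) - (LBINT r:{0..}. tilted (?p r 0)))
   = - \<i> * (LBINT s:{0..T}. tilted (?p 0 s))"
  proof (rule half_strip_shift[where g = "\<lambda>r s. tilted' (?p r s)" and B = "\<lambda>r. tilt_K * exp (r - r\<^sup>2 / 4)"])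
   show "continuous_on ({0..} \<times> {0..T}) (\<lambda>(r, s). tilted (?p r s))"
    unfolding case_prod_unfold by (rule continuous_on_compose2[OF tilted_cont(1) cp]) auto
   show "continuous_on ({0..} \<times> {0..T}) (\<lambda>(r, s). tilted' (?p r s))"
    unfolding case_prod_unfold by (rule continuous_on_compose2[OF tilted_cont(2) cp]) auto
   show "((\<lambda>r. tilted (?p r s)) has_vector_derivative of_real ep * tilted' (?p r s)) (at r)" if "0 < r" "0 < s" "s < T" for r s
   proof -
    have "((\<lambda>r. ?p r s) has_vector_derivative of_real ep) (at r)"
     unfolding of_real_mult by (auto intro!: derivative_eq_intros)
    from field_vector_diff_chain_at[OF this tilted_deriv] that show ?thesis by (simp add: o_def)
   qed
   show "((\<lambda>s. tilted (?p r s)) has_vector_derivative \<i> * tilted' (?p r s)) (at s)" if "0 < r" "0 < s" "s < T" for r s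
   proof -
    have "((\<lambda>s. ?p r s) has_vector_derivative \<i>) (at s)"
     by (auto intro!: derivative_eq_intros)
    from field_vector_diff_chain_at[OF this tilted_deriv] that show ?thesis by (simp add: o_def)
   qed
   show "((\<lambda>r. tilted (?p r s)) \<longlongrightarrow> 0) at_top" if s: "0 \<le> s" "s \<le> T" for s
   proof (rule Lim_null_comparison)
    show "\<forall>\<^sub>F r in at_top. norm (tilted (?p r s)) \<le> tilt_K * exp (r - r\<^sup>2 / 4)"
     using eventually_ge_at_top[of 0]
    proof eventually_elim
     case (elim r)
     then show ?case using bnd(1)[OF s, of "ep * r"] ep1[of r] by simp
    qed
    have "((\<lambda>r::real. exp (r - r\<^sup>2 / 4)) \<longlongrightarrow> 0) at_top" by real_asymp
    then show "((\<lambda>r. tilt_K * exp (r - r\<^sup>2 / 4)) \<longlongrightarrow> 0) at_top" by (rule tendsto_mult_right_zero)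
   qed
   show "norm (tilted' (?p r s)) \<le> tilt_K * exp (r - r\<^sup>2 / 4)" if "0 \<le> r" "0 \<le> s" "s \<le> T" for r s
    using bnd(2)[OF that(2,3), of "ep * r"] ep1[of r] that(1) by simp
   show "set_integrable lborel {0..} (\<lambda>r. tilted (?p r 0))" "set_integrable lborel {0..} (\<lambda>r. tilted (?p r T))"
    using int[of 0] int[of T] T by auto
   show "0 \<le> T" by (rule T)
   show "complex_of_real ep \<noteq> 0" using ep by auto
   show "set_integrable lborel {0..} (\<lambda>r. tilt_K * exp (r - r\<^sup>2 / 4))" by (rule set_integrable_gauss)
  qed
 qed
 have H: "integrable lborel (\<lambda>v. tilted (of_real v + \<i> * of_real s))"
  "(LINT v|lborel. tilted (of_real v + \<i> * of_real s)) = (LBINT r:{0..}. tilted (of_real (1 * r) + \<i> * of_real s)) + (LBINT r:{0..}. tilted (of_real (-1 * r) + \<i> * of_real s))"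
  if s: "0 \<le> s" "s \<le> T" for s
 proof -
  have i: "set_integrable lborel {0..} (\<lambda>r. tilted (of_real (1 * r) + \<i> * of_real s))"
   "set_integrable lborel {0..} (\<lambda>r. tilted (of_real (- 1 * r) + \<i> * of_real s))"
   using conjunct1[OF half[of 1]] conjunct1[OF half[of "-1"]] s by (blast, blast)
  then show "integrable lborel (\<lambda>v. tilted (of_real v + \<i> * of_real s))"
   "(LINT v|lborel. tilted (of_real v + \<i> * of_real s)) = (LBINT r:{0..}. tilted (of_real (1 * r) + \<i> * of_real s)) + (LBINT r:{0..}. tilted (of_real (-1 * r) + \<i> * of_real s))"
   using integral_eq_halves[OF cont[OF s(1)]] by (simp_all only: mult_1 mult_minus1)
 qed
 show "integrable lborel (\<lambda>v. tilted (of_real v))" using H(1)[of 0] T by simp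
 show "(LINT v|lborel. tilted (of_real v)) = (LINT v|lborel. tilted (of_real v + \<i> * of_real (a / sg)))"
 proof -
  define I where "I ep s = (LBINT r:{0..}. tilted (of_real (ep * r) + \<i> * of_real s))" for ep s :: real
  define W where "W = (LBINT s:{0..T}. tilted (\<i> * of_real s))"
  have e1: "I 1 T - I 1 0 = - \<i> * W"
   using conjunct2[OF half[of 1]] unfolding I_def[symmetric] W_def by simp
  have "- (I (-1) T - I (-1) 0) = - \<i> * W"
   using conjunct2[OF half[of "-1"]] unfolding I_def[symmetric] W_def by simp
  then have e2: "I (-1) T - I (-1) 0 = \<i> * W" by (metis minus_minus mult_minus_left)
  have "(I 1 T - I 1 0) + (I (-1) T - I (-1) 0) = 0" unfolding e1 e2 by simp
  then have e3: "I 1 0 + I (-1) 0 = I 1 T + I (-1) T" by (metis add_diff_add right_minus_eq)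
  have e4: "(LINT v|lborel. tilted (of_real v + \<i> * of_real s)) = I 1 s + I (-1) s" if "0 \<le> s" "s \<le> T" for s
   using H(2)[OF that] unfolding I_def .
  have "(LINT v|lborel. tilted (of_real v + \<i> * of_real 0)) = (LINT v|lborel. tilted (of_real v + \<i> * of_real T))"
   unfolding e4[OF order_refl T] e4[OF T order_refl] by (rule e3)
  then show ?thesis unfolding T_def by simp
 qed
qed

text \<open>A Gaussian is a Fourier transform of a Gaussian, so the regularised exponential is an
  average over w of the oscillating exponentials behind \<open>char M\<close>; giving the Gaussian
  in w an imaginary centre produces the real tilt exp (- a x). Fubini brings in the characteristic
  function, and the contour shift recentres the Gaussian.\<close>

lemma gaussian_regularised_moment:
 assumes M: "real_distribution M" and ch: "\<And>u. char M u = exp (of_real h * (- \<i> * of_real u) powr of_real \<alpha>)"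
 shows "(LINT x|M. exp (- (Complex a b * of_real x) - of_real (sg\<^sup>2 * x\<^sup>2 / 2))) =
  (LINT w|lborel. of_real (std_normal_density w) * exp (of_real h * (Complex a b - \<i> * of_real (sg * w)) powr of_real \<alpha>))"
proof -
 interpret M: real_distribution M by fact
 interpret P: pair_sigma_finite M lborel ..
 define T where "T = a / sg"
 define k :: "real \<Rightarrow> real \<Rightarrow> complex" where
  "k x w = of_real (1 / sqrt (2 * pi)) * (iexp (x * (sg * w - b)) * exp (- (of_real w - \<i> * of_real T)\<^sup>2 / 2))" for x w
 have e: "exp (- (of_real w - \<i> * of_real T)\<^sup>2 / 2) = of_real (exp (T\<^sup>2 / 2)) * (of_real (exp (- w\<^sup>2 / 2)) * iexp (T * w))" for w
 proof -
  have "- (of_real w - \<i> * of_real T)\<^sup>2 / 2 = complex_of_real (T\<^sup>2 / 2) + (complex_of_real (- w\<^sup>2 / 2) + \<i> * complex_of_real (T * w))"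
   by (simp add: complex_eq_iff power2_eq_square diff_divide_distrib)
  then show ?thesis by (simp only: exp_add exp_of_real)
 qed
 have k: "k x w = of_real (exp (T\<^sup>2 / 2)) * (iexp (- (x * b)) * (std_normal_density w *\<^sub>R iexp ((x * sg + T) * w)))" for x w
 proof -
  have i: "iexp (x * (sg * w - b)) * iexp (T * w) = iexp (- (x * b)) * iexp ((x * sg + T) * w)"
   unfolding exp_add[symmetric] by (simp add: algebra_simps)
  have "k x w = of_real (exp (T\<^sup>2 / 2)) * (of_real (std_normal_density w) * (iexp (x * (sg * w - b)) * iexp (T * w)))"
   unfolding k_def e std_normal_density_def of_real_mult by (simp only: mult_ac)
  also have "... = of_real (exp (T\<^sup>2 / 2)) * (iexp (- (x * b)) * (std_normal_density w *\<^sub>R iexp ((x * sg + T) * w)))"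
   unfolding i scaleR_conv_of_real by (simp only: mult_ac)
  finally show ?thesis .
 qed
 have nk: "norm (k x w) = exp (T\<^sup>2 / 2) * std_normal_density w" for x w
  unfolding k by (simp add: norm_mult)
 have km[measurable]: "(\<lambda>(x, w). k x w) \<in> borel_measurable (M \<Otimes>\<^sub>M lborel)"
  unfolding k by measurable
 have ik: "integrable (M \<Otimes>\<^sub>M lborel) (\<lambda>(x, w). k x w)"
 proof (rule P.Fubini_integrable[OF km])
  show "integrable M (\<lambda>x. LINT w|lborel. norm (case (x, w) of (x, w) \<Rightarrow> k x w))" by (simp add: nk)
  have "integrable lborel (\<lambda>w. k x w)" for x
  proof (rule Lintegrable_bound)
   show "integrable lborel (\<lambda>w. exp (T\<^sup>2 / 2) * std_normal_density w)" by simp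
   show "(\<lambda>w. k x w) \<in> borel_measurable lborel" unfolding k by measurable
   show "AE w in lborel. norm (k x w) \<le> norm (exp (T\<^sup>2 / 2) * std_normal_density w)"
    unfolding nk by (intro AE_I2) simp
  qed
  then show "AE x in M. integrable lborel (\<lambda>w. case (x, w) of (x, w) \<Rightarrow> k x w)" by simp
 qed
 have L: "(LINT w|lborel. k x w) = exp (- (Complex a b * of_real x) - of_real (sg\<^sup>2 * x\<^sup>2 / 2))" for x
 proof -
  have "(LINT w|lborel. std_normal_density w *\<^sub>R iexp ((x * sg + T) * w)) = char std_normal_distribution (x * sg + T)"
   unfolding char_def by (subst integral_density) auto
  then have "(LINT w|lborel. k x w) = of_real (exp (T\<^sup>2 / 2)) * (iexp (- (x * b)) * of_real (exp (- (x * sg + T)\<^sup>2 / 2)))"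
   unfolding k by (simp only: integral_mult_right_zero char_std_normal_distribution)
  also have "... = exp (of_real (T\<^sup>2 / 2) + (\<i> * of_real (- (x * b)) + of_real (- (x * sg + T)\<^sup>2 / 2)))"
   by (simp only: exp_add exp_of_real)
  also have "of_real (T\<^sup>2 / 2) + (\<i> * of_real (- (x * b)) + of_real (- (x * sg + T)\<^sup>2 / 2)) = - (Complex a b * of_real x) - complex_of_real (sg\<^sup>2 * x\<^sup>2 / 2)"
  proof -
   have "T * sg = a" using sg by (simp add: T_def)
   then have "T\<^sup>2 / 2 - (x * sg + T)\<^sup>2 / 2 = - (a * x) - sg\<^sup>2 * x\<^sup>2 / 2"
    by (simp add: power2_sum power_mult_distrib diff_divide_distrib add_divide_distrib algebra_simps)
   then show ?thesis by (simp add: complex_eq_iff)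
  qed
  finally show ?thesis .
 qed
 have R: "(LINT x|M. k x w) = of_real (1 / sqrt (2 * pi)) * tilted (of_real w)" for w
 proof -
  have e': "k x w = of_real (1 / sqrt (2 * pi)) * (iexp ((sg * w - b) * x) * exp (- (of_real w - \<i> * of_real T)\<^sup>2 / 2))" for x
   unfolding k_def by (simp only: mult.commute[of x "sg * w - b"])
  have "(LINT x|M. k x w) = of_real (1 / sqrt (2 * pi)) * (char M (sg * w - b) * exp (- (of_real w - \<i> * of_real T)\<^sup>2 / 2))"
   unfolding e' char_def by (subst integral_mult_right_zero, subst integral_mult_left_zero, rule refl)
  moreover have "char M (sg * w - b) * exp (- (of_real w - \<i> * of_real T)\<^sup>2 / 2) = tilted (of_real w)"
   unfolding ch tilted_def T_def by (simp only: of_real_diff of_real_mult mult.commute)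
  ultimately show ?thesis by (simp only:)
 qed
 have "(LINT x|M. LINT w|lborel. k x w) = (LINT w|lborel. LINT x|M. k x w)"
  by (rule P.Fubini_integral[OF ik, symmetric])
 then have "(LINT x|M. exp (- (Complex a b * of_real x) - of_real (sg\<^sup>2 * x\<^sup>2 / 2))) = of_real (1 / sqrt (2 * pi)) * (LINT w|lborel. tilted (of_real w))"
  unfolding L R by (simp only: integral_mult_right_zero)
 also have "... = of_real (1 / sqrt (2 * pi)) * (LINT w|lborel. tilted (of_real w + \<i> * of_real (a / sg)))"
  by (simp only: tilted_shift(2))
 also have "... = (LINT w|lborel. of_real (1 / sqrt (2 * pi)) * tilted (of_real w + \<i> * of_real (a / sg)))" by simp
 also have "... = (LINT w|lborel. of_real (std_normal_density w) * exp (of_real h * (Complex a b - \<i> * of_real (sg * w)) powr of_real \<alpha>))"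
 proof (rule LINT_cong[OF refl])
  fix w :: real
  have "- \<i> * (of_real sg * (of_real w + \<i> * of_real (a / sg)) - of_real b) = Complex a b - \<i> * of_real (sg * w)"
   using sg by (simp add: complex_eq_iff)
  moreover have "of_real w + \<i> * of_real (a / sg) - \<i> * of_real (a / sg) = complex_of_real w" by simp
  moreover have "exp (- (complex_of_real w)\<^sup>2 / 2) = of_real (exp (- w\<^sup>2 / 2))"
   using exp_of_real[of "- w\<^sup>2 / 2", where 'a = complex] by simp
  ultimately show "of_real (1 / sqrt (2 * pi)) * tilted (of_real w + \<i> * of_real (a / sg)) =
    of_real (std_normal_density w) * exp (of_real h * (Complex a b - \<i> * of_real (sg * w)) powr of_real \<alpha>)"
   unfolding tilted_def std_normal_density_def by simp
 qed
 finally show ?thesis .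
qed

end

text \<open>With the factor 2 sqrt 2, the left side is h / (4 (1 + h)^2 (1 + n)^2), which is at most
  1 / 4 for every n.\<close>

lemma width_small:
 assumes "0 \<le> h"
 shows "2 * h * (1 / (2 * sqrt 2 * (1 + h) * (1 + real n)))\<^sup>2 \<le> 1 / 4"
proof -
 define D where "D = (1 + h)\<^sup>2 * (1 + real n)\<^sup>2"
 have e: "(1 / (2 * sqrt 2 * (1 + h) * (1 + real n)))\<^sup>2 = 1 / (8 * D)"
  by (simp add: D_def power_divide power_mult_distrib)
 have "h * 1 \<le> D" unfolding D_def using assms
  by (intro mult_mono one_le_power) (auto simp: power2_eq_square algebra_simps)
 moreover have "0 < D" unfolding D_def using assms by simp
 ultimately have "h / D \<le> 1" by simp
 then show ?thesis unfolding e by simp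
qed

lemma width_tendsto: "(\<lambda>n. 1 / (2 * sqrt 2 * (1 + h) * (1 + real n))) \<longlonglongrightarrow> 0"
 using tendsto_mult_right_zero[OF LIMSEQ_inverse_real_of_nat, of "1 / (2 * sqrt 2 * (1 + h))"]
 by (simp add: field_simps)

text \<open>Dominated convergence as the width of the smoothing tends to 0. The smallness of the
  widths caps the growth of the exponential at exp (w^2 / 4) up to a constant, uniformly in n,
  against the density exp (- w^2 / 2).\<close>

lemma gaussian_average_limit:
 assumes h: "0 \<le> h" and z: "0 < Re z"
 shows "(\<lambda>n. LINT w|lborel. of_real (std_normal_density w) * exp (of_real h * (z - \<i> * of_real (1 / (2 * sqrt 2 * (1 + h) * (1 + real n)) * w)) powr of_real \<alpha>))
  \<longlonglongrightarrow> exp (of_real h * z powr of_real \<alpha>)"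
proof -
 define sg where "sg n = 1 / (2 * sqrt 2 * (1 + h) * (1 + real n))" for n
 have sg: "0 < sg n" for n using h by (simp add: sg_def)
 have sg0: "sg \<longlonglongrightarrow> 0" unfolding sg_def by (rule width_tendsto)
 have small: "2 * h * (sg n)\<^sup>2 \<le> 1 / 4" for n
  unfolding sg_def by (rule width_small[OF h])
 define g where "g = (\<lambda>w::real. exp (2 * h * (1 + norm z)\<^sup>2) * exp (- w\<^sup>2 / 4))"
 have "integrable lborel (\<lambda>w. normal_density 0 (sqrt 2) w)" by simp
 then have "integrable lborel (\<lambda>w. exp (2 * h * (1 + norm z)\<^sup>2) * (sqrt (2 * pi * 2) * normal_density 0 (sqrt 2) w))"
  by (intro integrable_mult_right)
 then have gi: "integrable lborel g" by (simp add: g_def normal_density_def)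
 have "(\<lambda>n. LINT w|lborel. of_real (std_normal_density w) * exp (of_real h * (z - \<i> * of_real (sg n * w)) powr of_real \<alpha>))
   \<longlonglongrightarrow> (LINT w|lborel. of_real (std_normal_density w) * exp (of_real h * z powr of_real \<alpha>))"
 proof (rule integral_dominated_convergence[OF _ _ gi])
  show "(\<lambda>w. of_real (std_normal_density w) * exp (of_real h * z powr of_real \<alpha>)) \<in> borel_measurable lborel" by measurable
  show "(\<lambda>w. of_real (std_normal_density w) * exp (of_real h * (z - \<i> * of_real (sg n * w)) powr of_real \<alpha>)) \<in> borel_measurable lborel" for n
  proof -
   have "continuous_on UNIV (\<lambda>w. exp (of_real h * (z - \<i> * of_real (sg n * w)) powr of_real \<alpha>))"
    using z by (intro continuous_intros) (auto simp: complex_eq_iff)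
   then have [measurable]: "(\<lambda>w. exp (of_real h * (z - \<i> * of_real (sg n * w)) powr of_real \<alpha>)) \<in> borel_measurable borel"
    by (rule borel_measurable_continuous_onI)
   show ?thesis by measurable
  qed
  show "AE w in lborel. (\<lambda>n. of_real (std_normal_density w) * exp (of_real h * (z - \<i> * of_real (sg n * w)) powr of_real \<alpha>))
    \<longlonglongrightarrow> of_real (std_normal_density w) * exp (of_real h * z powr of_real \<alpha>)"
  proof (intro AE_I2)
   fix w :: real
   have "(\<lambda>n. z - \<i> * of_real (sg n * w)) \<longlonglongrightarrow> z - \<i> * of_real (0 * w)" using sg0 by (intro tendsto_intros)
   then have "(\<lambda>n. z - \<i> * of_real (sg n * w)) \<longlonglongrightarrow> z" by simp
   then show "(\<lambda>n. of_real (std_normal_density w) * exp (of_real h * (z - \<i> * of_real (sg n * w)) powr of_real \<alpha>))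
    \<longlonglongrightarrow> of_real (std_normal_density w) * exp (of_real h * z powr of_real \<alpha>)"
    using z by (intro tendsto_intros tendsto_powr_complex) (auto simp: complex_nonpos_Reals_iff)
  qed
  show "AE w in lborel. norm (of_real (std_normal_density w) * exp (of_real h * (z - \<i> * of_real (sg n * w)) powr of_real \<alpha>)) \<le> g w" for n
  proof (intro AE_I2)
   fix w :: real
   let ?q = "z - \<i> * of_real (sg n * w)"
   have "norm ?q \<le> norm z + sg n * \<bar>w\<bar>"
    by (rule order_trans[OF norm_triangle_ineq4]) (use sg[of n] in \<open>simp add: norm_mult abs_mult\<close>)
   from powr_le_square[OF this] have "norm (?q powr of_real \<alpha>) \<le> ((1 + norm z) + sg n * \<bar>w\<bar>)\<^sup>2" by (simp add: add.assoc)
   also have "... \<le> 2 * (1 + norm z)\<^sup>2 + 2 * (sg n * \<bar>w\<bar>)\<^sup>2" by (rule square_sum_le)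
   finally have "h * norm (?q powr of_real \<alpha>) \<le> h * (2 * (1 + norm z)\<^sup>2 + 2 * (sg n * \<bar>w\<bar>)\<^sup>2)"
    using h by (intro mult_left_mono) auto
   also have "... = 2 * h * (1 + norm z)\<^sup>2 + (2 * h * (sg n)\<^sup>2) * w\<^sup>2" by (simp add: power_mult_distrib algebra_simps)
   also have "... \<le> 2 * h * (1 + norm z)\<^sup>2 + (1 / 4) * w\<^sup>2" using small[of n] by (intro add_left_mono mult_right_mono) auto
   finally have hq: "h * norm (?q powr of_real \<alpha>) \<le> 2 * h * (1 + norm z)\<^sup>2 + w\<^sup>2 / 4" by simp
   have "Re (of_real h * ?q powr of_real \<alpha>) \<le> h * norm (?q powr of_real \<alpha>)"
    using complex_Re_le_cmod[of "?q powr of_real \<alpha>"] h by (simp add: mult_left_mono)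
   from order_trans[OF this hq] have "norm (exp (of_real h * ?q powr of_real \<alpha>)) \<le> exp (2 * h * (1 + norm z)\<^sup>2 + w\<^sup>2 / 4)"
    unfolding norm_exp_eq_Re exp_le_cancel_iff .
   moreover have "std_normal_density w \<le> exp (- w\<^sup>2 / 2)"
   proof -
    have "1 / sqrt (2 * pi) \<le> 1" using pi_ge_two by simp
    from mult_right_mono[OF this, of "exp (- w\<^sup>2 / 2)"] show ?thesis
     unfolding std_normal_density_def by simp
   qed
   ultimately have "norm (of_real (std_normal_density w) * exp (of_real h * ?q powr of_real \<alpha>)) \<le> exp (- w\<^sup>2 / 2) * exp (2 * h * (1 + norm z)\<^sup>2 + w\<^sup>2 / 4)"
    unfolding norm_mult by (intro mult_mono) auto
   also have "... = g w"
   proof -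
    have "- w\<^sup>2 / 2 + (2 * h * (1 + norm z)\<^sup>2 + w\<^sup>2 / 4) = 2 * h * (1 + norm z)\<^sup>2 + - w\<^sup>2 / 4" by simp
    then show ?thesis unfolding g_def exp_add[symmetric] by simp
   qed
   finally show "norm (of_real (std_normal_density w) * exp (of_real h * ?q powr of_real \<alpha>)) \<le> g w" .
  qed
 qed
 moreover have "(LINT w|lborel. of_real (std_normal_density w) * exp (of_real h * z powr of_real \<alpha>)) = exp (of_real h * z powr of_real \<alpha>)"
 proof -
  have "(LINT w|lborel. complex_of_real (std_normal_density w)) = of_real (LINT w|lborel. std_normal_density w)"
   by (rule integral_complex_of_real)
  then show ?thesis by simp
 qed
 ultimately show ?thesis by (simp add: sg_def)
qed

text \<open>A characteristic function does not by itself provide integrability of exp (- z X). It is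
  produced by Fatou's lemma, applied to the Gaussian-regularised moments at the real point
  \<open>Re z\<close>, whose limit is known. The function exp (- Re z X) then dominates the
  regularised integrands at z itself.\<close>

theorem stable_exponential_moment:
 assumes M: "real_distribution M" and h: "0 \<le> h"
  and ch: "\<And>u. char M u = exp (of_real h * (- \<i> * of_real u) powr of_real \<alpha>)" and z: "0 < Re z"
 shows "integrable M (\<lambda>x. exp (- (z * of_real x)))"
  and "(LINT x|M. exp (- (z * of_real x))) = exp (of_real h * z powr of_real \<alpha>)"
proof -
 interpret M: real_distribution M by fact
 define sg where "sg n = 1 / (2 * sqrt 2 * (1 + h) * (1 + real n))" for n
 have sg: "0 < sg n" for n using h by (simp add: sg_def)
 have sg0: "sg \<longlonglongrightarrow> 0" unfolding sg_def by (rule width_tendsto)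
 have small: "2 * h * (sg n)\<^sup>2 \<le> 1 / 4" for n
  unfolding sg_def by (rule width_small[OF h])
 have reg: "(\<lambda>n. LINT x|M. exp (- (w * of_real x) - of_real ((sg n)\<^sup>2 * x\<^sup>2 / 2))) \<longlonglongrightarrow> exp (of_real h * w powr of_real \<alpha>)"
  if w: "0 < Re w" for w
 proof -
  have e: "(LINT x|M. exp (- (w * of_real x) - of_real ((sg n)\<^sup>2 * x\<^sup>2 / 2))) =
   (LINT v|lborel. of_real (std_normal_density v) * exp (of_real h * (w - \<i> * of_real (sg n * v)) powr of_real \<alpha>))" for n
   using gaussian_regularised_moment[OF h w sg small M ch, where b = "Im w"] unfolding complex_surj .
  show ?thesis unfolding e unfolding sg_def by (rule gaussian_average_limit[OF h w])
 qed
 define a where "a = Re z"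
 have a: "0 < a" using z by (simp add: a_def)
 define f where "f n x = exp (- a * x - (sg n)\<^sup>2 * x\<^sup>2 / 2)" for n x
 have fm[measurable]: "f n \<in> borel_measurable borel" for n unfolding f_def by measurable
 have flim: "(\<lambda>n. f n x) \<longlonglongrightarrow> exp (- a * x)" for x
 proof -
  have "(\<lambda>n. exp (- a * x - (sg n)\<^sup>2 * x\<^sup>2 / 2)) \<longlonglongrightarrow> exp (- a * x - 0\<^sup>2 * x\<^sup>2 / 2)" using sg0 by (intro tendsto_intros) auto
  then show ?thesis by (simp add: f_def)
 qed
 \<comment> \<open>Completing the square bounds each regularised integrand by a constant, so it is
   integrable before anything is known about the tails of M.\<close>
 have fbd: "f n x \<le> exp (a\<^sup>2 / (2 * (sg n)\<^sup>2))" for n x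
 proof -
  have "0 \<le> (sg n * x + a / sg n)\<^sup>2" by simp
  then have "0 \<le> (sg n)\<^sup>2 * x\<^sup>2 + 2 * (a * x) + a\<^sup>2 / (sg n)\<^sup>2" using sg[of n]
   by (simp add: power2_sum power_mult_distrib power_divide mult.commute[of x a])
  then have "- a * x - (sg n)\<^sup>2 * x\<^sup>2 / 2 \<le> (a\<^sup>2 / (sg n)\<^sup>2) / 2" by (simp add: field_simps)
  then show ?thesis unfolding f_def by simp
 qed
 have fi: "integrable M (f n)" for n
  by (rule M.integrable_const_bound[of _ "exp (a\<^sup>2 / (2 * (sg n)\<^sup>2))"]) (use fbd in \<open>auto simp: f_def\<close>)
 have cf: "complex_of_real (f n x) = exp (- (of_real a * of_real x) - of_real ((sg n)\<^sup>2 * x\<^sup>2 / 2))" for n x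
  unfolding f_def exp_of_real[symmetric] by simp
 have "(\<lambda>n. complex_of_real (LINT x|M. f n x)) \<longlonglongrightarrow> exp (of_real h * of_real a powr of_real \<alpha>)"
  using reg[of "of_real a"] a unfolding cf[symmetric] by simp
 moreover have "exp (of_real h * of_real a powr of_real \<alpha>) = complex_of_real (exp (h * a powr \<alpha>))"
 proof -
  have "of_real h * of_real a powr of_real \<alpha> = complex_of_real (h * a powr \<alpha>)" using a by (simp add: powr_of_real)
  then show ?thesis by (simp only: exp_of_real)
 qed
 ultimately have fl: "(\<lambda>n. LINT x|M. f n x) \<longlonglongrightarrow> exp (h * a powr \<alpha>)"
  by (simp only: tendsto_of_real_iff)
 have "(\<integral>\<^sup>+x. ennreal (exp (- a * x)) \<partial>M) = (\<integral>\<^sup>+x. liminf (\<lambda>n. ennreal (f n x)) \<partial>M)"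
  using flim by (intro nn_integral_cong lim_imp_Liminf[symmetric] tendsto_ennrealI) auto
 also have "... \<le> liminf (\<lambda>n. \<integral>\<^sup>+x. ennreal (f n x) \<partial>M)" by (rule nn_integral_liminf) simp
 also have "... = liminf (\<lambda>n. ennreal (LINT x|M. f n x))"
  by (subst nn_integral_eq_integral[OF fi]) (auto simp: f_def)
 also have "... = ennreal (exp (h * a powr \<alpha>))"
  using fl by (intro lim_imp_Liminf tendsto_ennrealI) auto
 finally have "(\<integral>\<^sup>+x. ennreal (exp (- a * x)) \<partial>M) < \<infinity>" by (simp add: order_le_less_trans ennreal_less_top)
 then have ia: "integrable M (\<lambda>x. exp (- a * x))" by (intro integrableI_nonneg) auto
 show "integrable M (\<lambda>x. exp (- (z * of_real x)))"
  by (rule Lintegrable_bound[OF ia]) (auto simp: norm_exp_eq_Re a_def)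
 have "(\<lambda>n. LINT x|M. exp (- (z * of_real x) - of_real ((sg n)\<^sup>2 * x\<^sup>2 / 2))) \<longlonglongrightarrow> (LINT x|M. exp (- (z * of_real x)))"
 proof (rule integral_dominated_convergence[OF _ _ ia])
  show "AE x in M. (\<lambda>n. exp (- (z * of_real x) - of_real ((sg n)\<^sup>2 * x\<^sup>2 / 2))) \<longlonglongrightarrow> exp (- (z * of_real x))"
  proof (intro AE_I2)
   fix x :: real
   have "(\<lambda>n. exp (- (z * of_real x) - of_real ((sg n)\<^sup>2 * x\<^sup>2 / 2))) \<longlonglongrightarrow> exp (- (z * of_real x) - of_real (0\<^sup>2 * x\<^sup>2 / 2))"
    using sg0 by (intro tendsto_intros) auto
   then show "(\<lambda>n. exp (- (z * of_real x) - of_real ((sg n)\<^sup>2 * x\<^sup>2 / 2))) \<longlonglongrightarrow> exp (- (z * of_real x))" by simp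
  qed
  show "AE x in M. norm (exp (- (z * of_real x) - of_real ((sg n)\<^sup>2 * x\<^sup>2 / 2))) \<le> exp (- a * x)" for n
   by (auto simp: norm_exp_eq_Re a_def simp del: of_real_mult of_real_power of_real_divide)
  show "(\<lambda>x. exp (- (z * of_real x))) \<in> borel_measurable M"
   "(\<lambda>x. exp (- (z * of_real x) - of_real ((sg n)\<^sup>2 * x\<^sup>2 / 2))) \<in> borel_measurable M" for n
   by measurable
 qed
 from LIMSEQ_unique[OF this reg[OF z]]
 show "(LINT x|M. exp (- (z * of_real x))) = exp (of_real h * z powr of_real \<alpha>)" .
qed

end

section \<open>Optional stopping on a grid\<close>

text \<open>Bounded second moments give uniform integrability. Values are retracted radially onto
  the disc of radius K, at a cost of at most C / K in every expectation, uniformly in n; the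
  truncated functions converge by dominated convergence.\<close>

lemma tendsto_expectation_square_bounded:
 fixes f :: "nat \<Rightarrow> 'a \<Rightarrow> complex"
 assumes M: "prob_space M" and [measurable]: "\<And>n. f n \<in> borel_measurable M" "g \<in> borel_measurable M"
  and lim: "AE x in M. (\<lambda>n. f n x) \<longlonglongrightarrow> g x"
  and sq: "\<And>n. (\<integral>\<^sup>+x. ennreal ((norm (f n x))\<^sup>2) \<partial>M) \<le> ennreal C" and C: "0 \<le> C"
 shows "integrable M g" and "(\<lambda>n. LINT x|M. f n x) \<longlonglongrightarrow> (LINT x|M. g x)"
proof -
 interpret prob_space M by fact
 have sqg: "(\<integral>\<^sup>+x. ennreal ((norm (g x))\<^sup>2) \<partial>M) \<le> ennreal C"
 proof -
  have "(\<integral>\<^sup>+x. ennreal ((norm (g x))\<^sup>2) \<partial>M) = (\<integral>\<^sup>+x. liminf (\<lambda>n. ennreal ((norm (f n x))\<^sup>2)) \<partial>M)"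
  proof (rule nn_integral_cong_AE)
   show "AE x in M. ennreal ((norm (g x))\<^sup>2) = liminf (\<lambda>n. ennreal ((norm (f n x))\<^sup>2))"
    using lim by eventually_elim (intro lim_imp_Liminf[symmetric] tendsto_ennrealI tendsto_intros, auto)
  qed
  also have "... \<le> liminf (\<lambda>n. \<integral>\<^sup>+x. ennreal ((norm (f n x))\<^sup>2) \<partial>M)" by (rule nn_integral_liminf) simp
  also have "... \<le> liminf (\<lambda>n. ennreal C)" using sq by (intro Liminf_mono) auto
  also have "... = ennreal C" by (simp add: lim_imp_Liminf)
  finally show ?thesis .
 qed
 have L2: "integrable M h \<and> (\<forall>K>0. norm ((LINT x|M. h x) - (LINT x|M. (K / max K (norm (h x))) *\<^sub>R h x)) \<le> C / K)"
  if [measurable]: "h \<in> borel_measurable M" and s: "(\<integral>\<^sup>+x. ennreal ((norm (h x))\<^sup>2) \<partial>M) \<le> ennreal C" for h :: "'a \<Rightarrow> complex"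
 proof (intro conjI allI impI)
  have i2: "integrable M (\<lambda>x. (norm (h x))\<^sup>2)"
   using s by (intro integrableI_nonneg) (auto intro: order_le_less_trans)
  have C2: "(LINT x|M. (norm (h x))\<^sup>2) \<le> C"
   using s C by (subst (asm) nn_integral_eq_integral[OF i2]) auto
  show i: "integrable M h"
  proof (rule Lintegrable_bound)
   show "integrable M (\<lambda>x. 1 + (norm (h x))\<^sup>2)" using i2 by simp
   have "t \<le> 1 + t\<^sup>2" for t :: real using zero_le_power2[of "t - 1 / 2"] by (simp add: power2_eq_square algebra_simps)
   then show "AE x in M. norm (h x) \<le> norm (1 + (norm (h x))\<^sup>2)" by (auto intro!: AE_I2 order_trans[OF _ abs_ge_self])
  qed simp
  fix K :: real assume K: "0 < K"
  let ?t = "\<lambda>x. (K / max K (norm (h x))) *\<^sub>R h x"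
  have nt: "norm (?t x) \<le> norm (h x)" for x
   using K by (simp add: max_def field_simps mult_right_mono)
  have it: "integrable M ?t" by (rule Lintegrable_bound[OF i]) (use nt in auto)
  have d: "norm (h x - ?t x) \<le> (norm (h x))\<^sup>2 / K" for x
  proof (cases "norm (h x) \<le> K")
   case True then show ?thesis using K by (simp add: max_def)
  next
   case False
   then have "h x - ?t x = (1 - K / norm (h x)) *\<^sub>R h x" by (simp add: max_def scaleR_diff_left)
   then have "norm (h x - ?t x) = \<bar>1 - K / norm (h x)\<bar> * norm (h x)" by simp
   also have "... \<le> 1 * norm (h x)"
   proof (intro mult_right_mono)
    have "0 < K / norm (h x)" "K / norm (h x) \<le> 1" using False K by (auto simp: divide_le_eq_1 intro!: divide_pos_pos)
    then show "\<bar>1 - K / norm (h x)\<bar> \<le> 1" by linarith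
   qed simp
   also have "... \<le> (norm (h x))\<^sup>2 / K"
    using False K mult_right_mono[of K "norm (h x)" "norm (h x)"] by (simp add: pos_le_divide_eq power2_eq_square mult.commute)
   finally show ?thesis .
  qed
  have "norm ((LINT x|M. h x) - (LINT x|M. ?t x)) = norm (LINT x|M. h x - ?t x)"
   by (simp only: LINT_diff[OF i it])
  also have "... \<le> (LINT x|M. norm (h x - ?t x))" by (rule integral_norm_bound)
  also have "... \<le> (LINT x|M. (norm (h x))\<^sup>2 / K)"
   using i it i2 d by (intro integral_mono) auto
  also have "... \<le> C / K" using C2 K by (simp add: divide_right_mono)
  finally show "norm ((LINT x|M. h x) - (LINT x|M. ?t x)) \<le> C / K" .
 qed
 show "integrable M g" using L2[OF _ sqg] by simp
 let ?ph = "\<lambda>K z. (K / max K (norm z)) *\<^sub>R (z :: complex)"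
 show "(\<lambda>n. LINT x|M. f n x) \<longlonglongrightarrow> (LINT x|M. g x)"
 proof (rule LIMSEQ_I)
  fix e :: real assume e: "0 < e"
  \<comment> \<open>Chosen so that C / K is below e / 3; the added 1 keeps K positive when C is
    0.\<close>
  define K where "K = 3 * (C + 1) / e"
  have K: "0 < K" using e C by (simp add: K_def)
  have CK: "C / K < e / 3" using e C by (simp add: K_def field_simps)
  have nph: "norm (?ph K z) \<le> K" for z using K by (simp add: max_def field_simps)
  have "(\<lambda>n. LINT x|M. ?ph K (f n x)) \<longlonglongrightarrow> (LINT x|M. ?ph K (g x))"
  proof (rule integral_dominated_convergence[where w = "\<lambda>_. K"])
   show "AE x in M. (\<lambda>n. ?ph K (f n x)) \<longlonglongrightarrow> ?ph K (g x)"
    using lim by eventually_elim (intro tendsto_intros, use K in auto)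
   show "AE x in M. norm (?ph K (f n x)) \<le> K" for n using nph by auto
  qed auto
  from LIMSEQ_D[OF this, of "e / 3"] e obtain N where
   N: "\<And>n. n \<ge> N \<Longrightarrow> norm ((LINT x|M. ?ph K (f n x)) - (LINT x|M. ?ph K (g x))) < e / 3" by auto
  show "\<exists>N. \<forall>n\<ge>N. norm ((LINT x|M. f n x) - (LINT x|M. g x)) < e"
  proof (intro exI allI impI)
   fix n assume n: "n \<ge> N"
   let ?a = "LINT x|M. f n x" and ?b = "LINT x|M. ?ph K (f n x)" and ?c = "LINT x|M. ?ph K (g x)" and ?d = "LINT x|M. g x"
   have 1: "norm (?a - ?b) \<le> C / K" using L2[OF _ sq[of n]] K by simp
   have 2: "norm (?d - ?c) \<le> C / K" using L2[OF _ sqg] K by simp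
   have "norm (?a - ?d) = norm (((?a - ?b) + (?b - ?c)) - (?d - ?c))" by (rule arg_cong[where f = norm]) (rule sym, simp only: add_diff_eq diff_add_eq diff_diff_eq2 diff_add_cancel add_diff_cancel_right')
   also have "... \<le> norm ((?a - ?b) + (?b - ?c)) + norm (?d - ?c)" by (rule norm_triangle_ineq4)
   also have "... \<le> norm (?a - ?b) + norm (?b - ?c) + norm (?d - ?c)" by (intro add_right_mono norm_triangle_ineq)
   finally have "norm (?a - ?d) \<le> norm (?a - ?b) + norm (?b - ?c) + norm (?d - ?c)" .
   then show "norm (?a - ?d) < e" using 1 2 CK N[OF n] by linarith
  qed
 qed
qed

text \<open>The factor of step \<open>j\<close> is switched off once the walk has visited the negative half-line, so
 the product is a stopped product martingale.\<close>

definition alive :: "real \<Rightarrow> nat \<Rightarrow> (nat \<Rightarrow> real) \<Rightarrow> bool" where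
 "alive x j v \<longleftrightarrow> (\<forall>i\<le>j. 0 \<le> x + sum v {..<i})"

definition stopped_prod :: "real \<Rightarrow> (nat \<Rightarrow> real \<Rightarrow> complex) \<Rightarrow> nat \<Rightarrow> (nat \<Rightarrow> real) \<Rightarrow> complex" where
 "stopped_prod x g k v = (\<Prod>j<k. if alive x j v then g j (v j) else 1)"

lemma alive_cong: "(\<And>i. i < j \<Longrightarrow> v i = w i) \<Longrightarrow> alive x j v = alive x j w"
 by (auto simp: alive_def intro!: arg_cong[where f = "\<lambda>s. 0 \<le> x + s"] sum.cong)

lemma stopped_prod_cong: "(\<And>i. i < k \<Longrightarrow> v i = w i) \<Longrightarrow> stopped_prod x g k v = stopped_prod x g k w"
 unfolding stopped_prod_def by (intro prod.cong) (use alive_cong[of _ v w] in \<open>auto\<close>)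

lemma measurable_alive [measurable]:
 assumes "j \<le> k" shows "Measurable.pred (Pi\<^sub>M {..<k} (\<lambda>_. borel)) (alive x j)"
proof -
 have [measurable]: "(\<lambda>v. v l) \<in> borel_measurable (Pi\<^sub>M {..<k} (\<lambda>_. borel :: real measure))" if "l < k" for l
  using that by (intro measurable_component_singleton) auto
 have [measurable]: "(\<lambda>v. sum v {..<i}) \<in> borel_measurable (Pi\<^sub>M {..<k} (\<lambda>_. borel :: real measure))" if "i \<le> j" for i
  using that assms by (intro borel_measurable_sum) auto
 have "{v \<in> space (Pi\<^sub>M {..<k} (\<lambda>_. borel)). alive x j v} =
  (\<Inter>i\<in>{..j}. {v \<in> space (Pi\<^sub>M {..<k} (\<lambda>_. borel)). 0 \<le> x + sum v {..<i}})" by (auto simp: alive_def)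
 also have "... \<in> sets (Pi\<^sub>M {..<k} (\<lambda>_. borel))" by (intro sets.finite_INT) auto
 finally show ?thesis by (simp add: pred_def)
qed

lemma measurable_stopped_prod:
 assumes [measurable]: "\<And>j. g j \<in> borel_measurable borel"
 shows "stopped_prod x g k \<in> borel_measurable (Pi\<^sub>M {..<k} (\<lambda>_. borel))"
proof -
 have [measurable]: "(\<lambda>v. v l) \<in> borel_measurable (Pi\<^sub>M {..<k} (\<lambda>_. borel :: real measure))" if "l < k" for l
  using that by (intro measurable_component_singleton) auto
 show ?thesis unfolding stopped_prod_def[abs_def]
  by (intro borel_measurable_prod measurable_If) auto
qed

context prob_space
begin

text \<open>Whether step k is switched on depends on the first k increments only. The product
  therefore changes by U times (g k - 1), with U independent of the k-th increment and the other
  factor of mean zero.\<close>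

lemma expectation_stopped_prod:
 fixes xia :: "nat \<Rightarrow> 'a \<Rightarrow> real"
 assumes ind: "indep_vars (\<lambda>_. borel) xia UNIV" and gm[measurable]: "\<And>j. g j \<in> borel_measurable borel"
  and gi: "\<And>j. integrable M (\<lambda>w. g j (xia j w))" and g1: "\<And>j. (LINT w|M. g j (xia j w)) = 1"
 shows "integrable M (\<lambda>w. stopped_prod x g k (\<lambda>i. xia i w)) \<and> (LINT w|M. stopped_prod x g k (\<lambda>i. xia i w)) = 1"
proof (induction k)
 case 0
 then show ?case by (simp add: stopped_prod_def prob_space)
next
 case (Suc k)
 have xiam[measurable]: "xia i \<in> borel_measurable M" for i
  using ind by (auto simp: indep_vars_def)
 let ?R = "\<lambda>w. restrict (\<lambda>i. xia i w) {..<k}"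
 let ?S = "\<lambda>w. stopped_prod x g k (\<lambda>i. xia i w)"
 let ?A = "\<lambda>w. alive x k (\<lambda>i. xia i w)"
 have Rm[measurable]: "?R \<in> measurable M (Pi\<^sub>M {..<k} (\<lambda>_. borel))" by (intro measurable_restrict) simp
 have S: "?S w = stopped_prod x g k (?R w)" for w by (rule stopped_prod_cong) simp
 have A: "?A w = alive x k (?R w)" for w by (rule alive_cong) simp
 define U where "U v = (if alive x k v then stopped_prod x g k v else 0)" for v
 have Um[measurable]: "U \<in> borel_measurable (Pi\<^sub>M {..<k} (\<lambda>_. borel))"
  unfolding U_def[abs_def] using measurable_stopped_prod[OF gm] by (intro measurable_If) auto
 have "indep_var (Pi\<^sub>M {..<k} (\<lambda>_. borel)) ?R (Pi\<^sub>M {k} (\<lambda>_. borel)) (\<lambda>w. restrict (\<lambda>i. xia i w) {k})"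
  by (rule indep_var_restrict[OF ind]) auto
 then have "indep_var borel (U \<circ> ?R) borel ((\<lambda>v. g k (v k) - 1) \<circ> (\<lambda>w. restrict (\<lambda>i. xia i w) {k}))"
  by (rule indep_var_compose) (use Um in auto)
 then have iv: "indep_var borel (\<lambda>w. U (?R w)) borel (\<lambda>w. g k (xia k w) - 1)"
  by (simp add: o_def)
 have iU: "integrable M (\<lambda>w. U (?R w))"
 proof (rule Lintegrable_bound[OF conjunct1[OF Suc]])
  show "(\<lambda>w. U (?R w)) \<in> borel_measurable M" by (rule measurable_compose[OF Rm Um])
  show "AE w in M. norm (U (?R w)) \<le> norm (?S w)" unfolding U_def S by auto
 qed
 have ig: "integrable M (\<lambda>w. g k (xia k w) - 1)" using gi by auto
 have step: "stopped_prod x g (Suc k) (\<lambda>i. xia i w) = ?S w + U (?R w) * (g k (xia k w) - 1)" for w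
 proof -
  have "stopped_prod x g (Suc k) (\<lambda>i. xia i w) = ?S w * (if ?A w then g k (xia k w) else 1)"
   by (simp add: stopped_prod_def)
  then show ?thesis by (auto simp: U_def S A algebra_simps)
 qed
 have "(LINT w|M. U (?R w) * (g k (xia k w) - 1)) = (LINT w|M. U (?R w)) * (LINT w|M. g k (xia k w) - 1)"
  by (rule indep_var_lebesgue_integral[OF iv iU ig])
 also have "(LINT w|M. g k (xia k w) - 1) = 0" using gi g1 by (simp add: prob_space)
 finally have z: "(LINT w|M. U (?R w) * (g k (xia k w) - 1)) = 0" unfolding mult_zero_right .
 note i2 = indep_var_integrable[OF iv iU ig]
 show ?case
 proof
  show "integrable M (\<lambda>w. stopped_prod x g (Suc k) (\<lambda>i. xia i w))"
   unfolding step by (rule Bochner_Integration.integrable_add[OF conjunct1[OF Suc] i2])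
  show "(LINT w|M. stopped_prod x g (Suc k) (\<lambda>i. xia i w)) = 1"
   unfolding step LINT_add[OF conjunct1[OF Suc] i2] z conjunct2[OF Suc] by simp
 qed
qed

text \<open>Dividing the square of |g j| by its own mean gives nonnegative factors of mean one, to
  which the first-moment statement applies again. What is lost is the product of these means over
  the steps taken, at most exp D per step.\<close>

lemma second_moment_stopped_prod:
 fixes xia :: "nat \<Rightarrow> 'a \<Rightarrow> real"
 assumes ind: "indep_vars (\<lambda>_. borel) xia UNIV" and gm[measurable]: "\<And>j. g j \<in> borel_measurable borel"
  and gi: "\<And>j. integrable M (\<lambda>w. (norm (g j (xia j w)))\<^sup>2)"
  and gp: "\<And>j. 0 < (LINT w|M. (norm (g j (xia j w)))\<^sup>2)"
  and gb: "\<And>j. j < k \<Longrightarrow> (LINT w|M. (norm (g j (xia j w)))\<^sup>2) \<le> exp D" and D: "0 \<le> D"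
 shows "(\<integral>\<^sup>+w. ennreal ((norm (stopped_prod x g k (\<lambda>i. xia i w)))\<^sup>2) \<partial>M) \<le> ennreal (exp (real k * D))"
proof -
 have xiam[measurable]: "xia i \<in> borel_measurable M" for i
  using ind by (auto simp: indep_vars_def)
 define m where "m j = (LINT w|M. (norm (g j (xia j w)))\<^sup>2)" for j
 define g' where "g' j y = complex_of_real ((norm (g j y))\<^sup>2 / m j)" for j y
 have g'm: "g' j \<in> borel_measurable borel" for j unfolding g'_def[abs_def] by measurable
 have g'i: "integrable M (\<lambda>w. g' j (xia j w))" for j
  unfolding g'_def using gi[of j] by (intro integrable_of_real) simp
 have g'1: "(LINT w|M. g' j (xia j w)) = 1" for j
  unfolding g'_def using gp[of j] by (simp add: m_def del: of_real_divide of_real_power)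
 note E = expectation_stopped_prod[OF ind g'm g'i g'1, of x k]
 have le: "(norm (stopped_prod x g k v))\<^sup>2 \<le> exp (real k * D) * norm (stopped_prod x g' k v)" for v
 proof -
  have "(norm (stopped_prod x g k v))\<^sup>2 = (\<Prod>j<k. if alive x j v then (norm (g j (v j)))\<^sup>2 else 1)"
  proof -
   have "(norm (stopped_prod x g k v))\<^sup>2 = (\<Prod>j<k. (norm (if alive x j v then g j (v j) else 1))\<^sup>2)"
    unfolding stopped_prod_def by (simp only: prod_norm[symmetric] prod_power_distrib)
   also have "... = (\<Prod>j<k. if alive x j v then (norm (g j (v j)))\<^sup>2 else 1)" by (intro prod.cong) auto
   finally show ?thesis .
  qed
  also have "... \<le> (\<Prod>j<k. exp D * (if alive x j v then (norm (g j (v j)))\<^sup>2 / m j else 1))"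
  proof (intro prod_mono conjI)
   fix j assume j: "j \<in> {..<k}"
   have "(norm (g j (v j)))\<^sup>2 = m j * ((norm (g j (v j)))\<^sup>2 / m j)" using gp[of j] by (simp add: m_def)
   also have "... \<le> exp D * ((norm (g j (v j)))\<^sup>2 / m j)"
    using gb[of j] gp[of j] j by (intro mult_right_mono) (auto simp: m_def less_imp_le)
   finally show "(if alive x j v then (norm (g j (v j)))\<^sup>2 else 1) \<le> exp D * (if alive x j v then (norm (g j (v j)))\<^sup>2 / m j else 1)"
    using D by auto
  qed auto
  also have "... = exp (real k * D) * (\<Prod>j<k. if alive x j v then (norm (g j (v j)))\<^sup>2 / m j else 1)"
   by (simp add: prod.distrib exp_of_nat_mult)
  also have "(\<Prod>j<k. if alive x j v then (norm (g j (v j)))\<^sup>2 / m j else 1) = norm (stopped_prod x g' k v)"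
   unfolding stopped_prod_def prod_norm[symmetric]
  proof (intro prod.cong refl)
   fix j
   have "0 \<le> (norm (g j (v j)))\<^sup>2 / m j" using gp[of j] by (simp add: m_def less_imp_le)
   then show "(if alive x j v then (norm (g j (v j)))\<^sup>2 / m j else 1) = norm (if alive x j v then g' j (v j) else 1)"
    unfolding g'_def by (auto simp only: norm_of_real abs_of_nonneg norm_one split: if_splits)
  qed
  finally show ?thesis .
 qed
 have pos: "stopped_prod x g' k v = of_real (norm (stopped_prod x g' k v))" for v
 proof -
  have "stopped_prod x g' k v = of_real (\<Prod>j<k. if alive x j v then (norm (g j (v j)))\<^sup>2 / m j else 1)"
   unfolding stopped_prod_def g'_def of_real_prod by (intro prod.cong) auto
  moreover have "0 \<le> (\<Prod>j<k. if alive x j v then (norm (g j (v j)))\<^sup>2 / m j else 1)"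
   using gp by (intro prod_nonneg) (auto simp: m_def less_imp_le)
  ultimately show ?thesis by (simp only: norm_of_real abs_of_nonneg)
 qed
 have "complex_of_real (LINT w|M. norm (stopped_prod x g' k (\<lambda>i. xia i w))) = 1"
  using conjunct2[OF E] unfolding integral_complex_of_real[symmetric] pos[symmetric] .
 then have n1: "(LINT w|M. norm (stopped_prod x g' k (\<lambda>i. xia i w))) = 1" by (simp only: of_real_eq_1_iff)
 have "(\<integral>\<^sup>+w. ennreal ((norm (stopped_prod x g k (\<lambda>i. xia i w)))\<^sup>2) \<partial>M)
   \<le> (\<integral>\<^sup>+w. ennreal (exp (real k * D) * norm (stopped_prod x g' k (\<lambda>i. xia i w))) \<partial>M)"
  using le by (intro nn_integral_mono ennreal_leI)
 also have "... = ennreal (LINT w|M. exp (real k * D) * norm (stopped_prod x g' k (\<lambda>i. xia i w)))"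
  using conjunct1[OF E] by (intro nn_integral_eq_integral) auto
 also have "... = ennreal (exp (real k * D))" using n1 by simp
 finally show ?thesis .
qed

end

section \<open>Cadlag paths\<close>

lemma cadlag_right_tendsto:
 assumes "cadlag_on {0..} w" "0 \<le> t"
 shows "(w \<longlongrightarrow> w t) (at_right t)"
proof -
 have "{0..} \<inter> {t<..} = {t<..}" using assms(2) by auto
 moreover have "(w \<longlongrightarrow> w t) (at t within ({0..} \<inter> {t<..}))"
  using assms by (auto simp: cadlag_on_def)
 ultimately show ?thesis by (simp only:)
qed

lemma cadlag_right_sequence:
 assumes c: "cadlag_on {0..} w" and t: "0 \<le> t" and s: "s \<longlonglongrightarrow> t" and ge: "\<And>n. t \<le> s n"
 shows "(\<lambda>n. w (s n)) \<longlonglongrightarrow> w t"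
proof -
 have "(w \<longlongrightarrow> w t) (at t within {t..})"
 proof -
  have "{t<..} = {t..} - {t}" by auto
  with cadlag_right_tendsto[OF c t] have "(w \<longlongrightarrow> w t) (at t within ({t..} - {t}))" by simp
  then show ?thesis by (simp add: at_within_def)
 qed
 then have "continuous (at t within {t..}) w" by (simp add: continuous_within)
 then show ?thesis using s ge unfolding continuous_within_sequentially by (auto simp: o_def)
qed

lemma cadlag_bounded_on:
 assumes "cadlag_on {0..} w"
 shows "\<exists>C. \<forall>t\<in>{0..T}. \<bar>w t\<bar> \<le> C"
proof (rule cadlag_on_bounded)
 show "cadlag_on {0..T} w"
  unfolding cadlag_on_def
 proof (intro ballI conjI)
  fix t assume t: "t \<in> {0..T}"
  then obtain l where "(w \<longlongrightarrow> w t) (at t within ({0..} \<inter> {t<..}))" "(w \<longlongrightarrow> l) (at t within ({0..} \<inter> {..<t}))"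
   using assms unfolding cadlag_on_def by (metis atLeastAtMost_iff atLeast_iff)
  then show "(w \<longlongrightarrow> w t) (at t within ({0..T} \<inter> {t<..}))" "\<exists>l. (w \<longlongrightarrow> l) (at t within ({0..T} \<inter> {..<t}))"
   by (auto elim!: tendsto_within_subset intro!: exI[of _ l])
 qed
qed

text \<open>The first grid point strictly to the right of s. Discretising from the right is what
  right-continuity of the paths supports, both for Riemann sums and for measurability.\<close>

definition grid_up :: "real \<Rightarrow> real \<Rightarrow> real" where
 "grid_up h s = h * (of_int \<lfloor>s / h\<rfloor> + 1)"

lemma grid_up_bounds: assumes "0 < h" shows "s < grid_up h s" "grid_up h s \<le> s + h"
proof -
 have 1: "s / h < of_int \<lfloor>s / h\<rfloor> + 1" and 2: "of_int \<lfloor>s / h\<rfloor> \<le> s / h" by linarith+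
 have e: "h * (s / h) = s" using assms by simp
 show "s < grid_up h s"
  using mult_strict_left_mono[OF 1 assms] unfolding e grid_up_def .
 show "grid_up h s \<le> s + h"
  using mult_left_mono[OF 2 less_imp_le[OF assms]] unfolding e grid_up_def by (simp only: distrib_left mult_1_right add_le_cancel_right)
qed

lemma grid_up_nonneg: assumes "0 < h" "0 \<le> s" shows "0 \<le> grid_up h s"
 using grid_up_bounds(1)[OF assms(1), of s] assms(2) by linarith

lemma grid_up_eq:
 assumes "0 < h" "real j * h \<le> s" "s < real (Suc j) * h"
 shows "grid_up h s = real (Suc j) * h"
proof -
 have "real j \<le> s / h" "s / h < real j + 1" using assms by (auto simp: field_simps)
 then have "\<lfloor>s / h\<rfloor> = int j" by (simp add: floor_unique)
 then show ?thesis by (simp add: grid_up_def mult.commute add.commute)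
qed

text \<open>True for arbitrary \<open>f\<close>, since the composition factors through an
  integer.\<close>

lemma measurable_grid_up:
 fixes f :: "real \<Rightarrow> 'b::topological_space"
 shows "(\<lambda>s. f (grid_up h s)) \<in> borel_measurable borel"
proof -
 have "(\<lambda>k. f (h * (of_int k + 1))) \<in> measurable (count_space UNIV) borel" by simp
 moreover have "(\<lambda>s. \<lfloor>s / h\<rfloor>) \<in> measurable borel (count_space UNIV)" by measurable
 ultimately show ?thesis unfolding grid_up_def by (rule measurable_compose[rotated])
qed

lemma integral_grid_up:
 fixes f :: "real \<Rightarrow> 'b::{banach, second_countable_topology}"
 assumes h: "0 < h"
 shows "set_integrable lborel {0..<real k * h} (\<lambda>s. f (grid_up h s)) \<and>
  (LBINT s:{0..<real k * h}. f (grid_up h s)) = (\<Sum>j<k. h *\<^sub>R f (real (Suc j) * h))"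
proof (induction k)
 case 0
 then show ?case by (simp add: set_integrable_def set_lebesgue_integral_def)
next
 case (Suc k)
 let ?A = "{real k * h..<real (Suc k) * h}"
 have U: "{0..<real (Suc k) * h} = {0..<real k * h} \<union> ?A" using h by (auto simp: field_simps) (smt (verit) mult_nonneg_nonneg of_nat_0_le_iff)
 have c: "indicator ?A s *\<^sub>R f (grid_up h s) = indicator ?A s *\<^sub>R f (real (Suc k) * h)" for s
  using grid_up_eq[OF h, of k s] by (auto simp: indicator_def)
 have i: "set_integrable lborel ?A (\<lambda>s. f (grid_up h s))"
  unfolding set_integrable_def c by (intro integrable_scaleR_left integrable_real_indicator) (use h in auto)
 have "(LBINT s:?A. f (grid_up h s)) = (LINT s|lborel. indicator ?A s *\<^sub>R f (real (Suc k) * h))"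
  unfolding set_lebesgue_integral_def c ..
 also have "... = measure lborel ?A *\<^sub>R f (real (Suc k) * h)"
  by (subst integral_scaleR_left) (use h in \<open>auto intro!: integrable_real_indicator\<close>)
 also have "measure lborel ?A = h" using h by (simp add: algebra_simps)
 finally have v: "(LBINT s:?A. f (grid_up h s)) = h *\<^sub>R f (real (Suc k) * h)" .
 have d: "{0..<real k * h} \<inter> ?A = {}" by auto
 show ?case unfolding U
  using set_integrable_Un[OF conjunct1[OF Suc] i] set_integral_Un[OF d conjunct1[OF Suc] i] Suc v by simp
qed

text \<open>The sums are integrals of the function read at the next grid point, and these step
  functions converge pointwise by right-continuity. The upper end moves with n; its indicators
  converge except at the single point \<open>sg\<close>. The bound up to T provides the majorant,
  and integrability of \<open>f\<close> comes out as well.\<close>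

lemma riemann_sum_tendsto:
 fixes f :: "real \<Rightarrow> 'b::{banach, second_countable_topology}"
 assumes h: "\<And>n. 0 < h n" "h \<longlonglongrightarrow> 0"
  and sg: "(\<lambda>n. real (k n) * h n) \<longlonglongrightarrow> sg" and kT: "\<And>n. real (k n) * h n \<le> T"
  and rc: "\<And>s t. 0 \<le> t \<Longrightarrow> s \<longlonglongrightarrow> t \<Longrightarrow> (\<And>n. t \<le> s n) \<Longrightarrow> (\<lambda>n. f (s n)) \<longlonglongrightarrow> f t"
  and bd: "\<And>t. 0 \<le> t \<Longrightarrow> t \<le> T \<Longrightarrow> norm (f t) \<le> C"
 shows "set_integrable lborel {0..<sg} f" "(\<lambda>n. \<Sum>j<k n. h n *\<^sub>R f (real (Suc j) * h n)) \<longlonglongrightarrow> (LBINT s:{0..<sg}. f s)"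
proof -
 let ?F = "\<lambda>n s. indicator {0..<real (k n) * h n} s *\<^sub>R f (grid_up (h n) s)"
 have sgT: "sg \<le> T" using kT by (intro LIMSEQ_le_const2[OF sg]) auto
 have gu: "(\<lambda>n. grid_up (h n) s) \<longlonglongrightarrow> s" for s
 proof (rule tendsto_sandwich)
  show "\<forall>\<^sub>F n in sequentially. s \<le> grid_up (h n) s" "\<forall>\<^sub>F n in sequentially. grid_up (h n) s \<le> s + h n"
   using grid_up_bounds[OF h(1)] by (auto intro!: always_eventually less_imp_le)
  show "(\<lambda>_. s) \<longlonglongrightarrow> s" by simp
  show "(\<lambda>n. s + h n) \<longlonglongrightarrow> s" using tendsto_add[OF tendsto_const h(2), of s] by simp
 qed
 have lim: "(\<lambda>n. indicator {0..} s *\<^sub>R f (grid_up (h n) s)) \<longlonglongrightarrow> indicator {0..} s *\<^sub>R f s" for s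
 proof (cases "0 \<le> s")
  case True
  then show ?thesis using rc[OF True gu] grid_up_bounds(1)[OF h(1)] by (auto simp: less_imp_le)
 qed simp
 have fm[measurable]: "(\<lambda>s. indicator {0..} s *\<^sub>R f s) \<in> borel_measurable borel"
  by (rule borel_measurable_LIMSEQ_metric[OF _ lim]) (intro borel_measurable_scaleR measurable_grid_up, auto)
 have e: "indicator {0..<sg} s *\<^sub>R f s = indicator {..<sg} s *\<^sub>R (indicator {0..} s *\<^sub>R f s)" for s :: real
  by (auto simp: indicator_def)
 have m1: "(\<lambda>s. indicator {0..<sg} s *\<^sub>R f s) \<in> borel_measurable lborel" unfolding e by measurable
 have m2: "?F n \<in> borel_measurable lborel" for n
  using measurable_grid_up[of f "h n"] by (intro borel_measurable_scaleR) auto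
 have l: "AE s in lborel. (\<lambda>n. ?F n s) \<longlonglongrightarrow> indicator {0..<sg} s *\<^sub>R f s"
  using AE_lborel_singleton[of sg]
 proof eventually_elim
  case (elim s)
  show ?case
  proof (cases "s < sg")
   case True
   have "\<forall>\<^sub>F n in sequentially. indicator {0..} s *\<^sub>R f (grid_up (h n) s) = ?F n s"
    using order_tendstoD(1)[OF sg True] by eventually_elim (auto simp: indicator_def)
   from Lim_transform_eventually[OF lim this] show ?thesis using True by (simp add: e)
  next
   case False
   then have "sg < s" using elim by simp
   have "\<forall>\<^sub>F n in sequentially. 0 = ?F n s"
    using order_tendstoD(2)[OF sg \<open>sg < s\<close>] by eventually_elim (auto simp: indicator_def)
   from Lim_transform_eventually[OF tendsto_const this] show ?thesis using False by simp
  qed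
 qed
 have i: "integrable lborel (\<lambda>s. indicator {0..T} s *\<^sub>R C)"
  by (intro integrable_scaleR_left integrable_real_indicator) (auto simp: emeasure_lborel_Icc_eq)
 have bn: "AE s in lborel. norm (?F n s) \<le> indicator {0..T} s *\<^sub>R C" for n
 proof (intro AE_I2)
  fix s :: real
  show "norm (?F n s) \<le> indicator {0..T} s *\<^sub>R C"
  proof (cases "s \<in> {0..<real (k n) * h n}")
   case True
   have "0 < k n" using True by (cases "k n") auto
   have "\<lfloor>s / h n\<rfloor> < int (k n)" using True h(1)[of n] by (simp add: floor_less_iff pos_divide_less_eq)
   then have "of_int \<lfloor>s / h n\<rfloor> + 1 \<le> real (k n)" by linarith
   then have "grid_up (h n) s \<le> real (k n) * h n" unfolding grid_up_def using h(1)[of n] by (simp add: mult.commute mult_left_mono)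
   then have "norm (f (grid_up (h n) s)) \<le> C" using kT[of n] grid_up_nonneg[OF h(1)[of n], of s] True by (intro bd) auto
   then show ?thesis using True kT[of n] by auto
  next
   case False
   have "0 \<le> C" if "0 \<le> s" "s \<le> T" using order_trans[OF norm_ge_zero bd[OF that]] .
   then show ?thesis using False by (auto simp: indicator_def)
  qed
 qed
 note D = integral_dominated_convergence[OF m1 m2 i l bn]
 show "set_integrable lborel {0..<sg} f"
  unfolding set_integrable_def by (rule integrable_dominated_convergence[OF m1 m2 i l bn])
 show "(\<lambda>n. \<Sum>j<k n. h n *\<^sub>R f (real (Suc j) * h n)) \<longlonglongrightarrow> (LBINT s:{0..<sg}. f s)"
 proof -
  have e: "(LINT s|lborel. ?F n s) = (\<Sum>j<k n. h n *\<^sub>R f (real (Suc j) * h n))" for n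
   using conjunct2[OF integral_grid_up[OF h(1)[of n], of "k n" f]] unfolding set_lebesgue_integral_def .
  show ?thesis using D unfolding e set_lebesgue_integral_def .
 qed
qed

text \<open>The condition \<open>w t < 0\<close> is open, so right-continuity lets rational times
  decide it and the passage time is measurable for the coordinates themselves. A path without
  passage gets infinity, whence the type \<open>ereal\<close>.\<close>

definition passage :: "(real \<Rightarrow> real) \<Rightarrow> ereal" where
 "passage w = (INF t\<in>{t. 0 \<le> t \<and> w t < 0}. ereal t)"

text \<open>The minimum with the finite horizon is taken in \<open>ereal\<close>, so the conversion
  to a real number never meets infinity.\<close>

definition first_neg :: "real \<Rightarrow> (real \<Rightarrow> real) \<Rightarrow> real" where
 "first_neg T w = real_of_ereal (min (ereal T) (passage w))"

lemma passage_nonneg: "0 \<le> passage w"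
 unfolding passage_def by (intro INF_greatest) auto

lemma ereal_first_neg: "0 \<le> T \<Longrightarrow> ereal (first_neg T w) = min (ereal T) (passage w)"
 using passage_nonneg[of w] unfolding first_neg_def
 by (cases "passage w") (auto simp: min_def)

lemma first_neg_bounds: assumes "0 \<le> T" shows "0 \<le> first_neg T w" "first_neg T w \<le> T"
 using ereal_first_neg[OF assms, of w] passage_nonneg[of w] assms
 by (metis ereal_less_eq(3) min.bounded_iff ereal_less_eq(5), metis ereal_less_eq(3) min.cobounded1)

lemma passage_le: "0 \<le> t \<Longrightarrow> w t < 0 \<Longrightarrow> passage w \<le> ereal t"
 unfolding passage_def by (intro INF_lower) auto

lemma nonneg_before_passage: "0 \<le> t \<Longrightarrow> ereal t < passage w \<Longrightarrow> 0 \<le> w t"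
 using passage_le[of t w] by (meson leD linorder_not_less)

lemma passage_less_iff: "passage w < a \<longleftrightarrow> (\<exists>t\<ge>0. w t < 0 \<and> ereal t < a)"
 unfolding passage_def INF_less_iff by auto

text \<open>The alternative \<open>j = K\<close> makes the search always succeed; the value K means
  that no earlier grid point carries a negative value.\<close>

definition grid_hit :: "real \<Rightarrow> nat \<Rightarrow> (real \<Rightarrow> real) \<Rightarrow> nat" where
 "grid_hit h K w = (LEAST j. j = K \<or> w (real j * h) < 0)"

lemma grid_hit_le: "grid_hit h K w \<le> K"
 unfolding grid_hit_def by (rule Least_le) simp

lemma grid_hit_cases: "grid_hit h K w = K \<or> w (real (grid_hit h K w) * h) < 0"
 unfolding grid_hit_def by (rule LeastI[where k = K]) simp

lemma grid_hit_less: "j < grid_hit h K w \<Longrightarrow> 0 \<le> w (real j * h)"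
 unfolding grid_hit_def using not_less_Least by fastforce

lemma grid_hit_lower: "j < K \<Longrightarrow> w (real j * h) < 0 \<Longrightarrow> grid_hit h K w \<le> j"
 unfolding grid_hit_def by (rule Least_le) simp

lemma grid_hit_ge:
 assumes "0 < h" "real K * h = T"
 shows "first_neg T w \<le> real (grid_hit h K w) * h"
proof -
 have T: "0 \<le> T" using assms by (metis less_imp_le mult_nonneg_nonneg of_nat_0_le_iff)
 show ?thesis
 proof (cases "grid_hit h K w = K")
  case True
  then show ?thesis using first_neg_bounds(2)[OF T] assms by simp
 next
  case False
  then have "w (real (grid_hit h K w) * h) < 0" using grid_hit_cases by blast
  then have "passage w \<le> ereal (real (grid_hit h K w) * h)" using assms by (intro passage_le) auto
  then have "ereal (first_neg T w) \<le> ereal (real (grid_hit h K w) * h)"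
   unfolding ereal_first_neg[OF T] by (simp add: min.coboundedI2)
  then show ?thesis by simp
 qed
qed

text \<open>The grid can only see the passage late, but not much too late: shortly after the passage
  time there is a negative value, by right-continuity a whole interval of them, and a fine grid has
  a point in it.\<close>

lemma grid_hit_tendsto:
 assumes c: "cadlag_on {0..} w" and h: "\<And>n. 0 < h n" "h \<longlonglongrightarrow> 0" and K: "\<And>n. real (K n) * h n = T"
 shows "(\<lambda>n. real (grid_hit (h n) (K n) w) * h n) \<longlonglongrightarrow> first_neg T w"
proof -
 have T: "0 \<le> T" using h(1)[of 0] K[of 0] by (metis less_imp_le mult_nonneg_nonneg of_nat_0_le_iff)
 let ?g = "\<lambda>n. real (grid_hit (h n) (K n) w) * h n"
 have ge: "first_neg T w \<le> ?g n" for n by (rule grid_hit_ge[OF h(1) K])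
 have le: "?g n \<le> T" for n
  using mult_right_mono[of "real (grid_hit (h n) (K n) w)" "real (K n)" "h n"] grid_hit_le[of "h n" "K n" w] h(1)[of n] K[of n] by auto
 show ?thesis
 proof (cases "first_neg T w = T")
  case True
  then have "?g n = T" for n using ge[of n] le[of n] by simp
  then show ?thesis using True by simp
 next
  case False
  then have lt: "first_neg T w < T" using first_neg_bounds(2)[OF T, of w] by simp
  then have p: "passage w = ereal (first_neg T w)" using ereal_first_neg[OF T, of w] by (auto simp: min_def split: if_splits)
  show ?thesis
  proof (rule order_tendstoI)
   fix a assume "a < first_neg T w"
   then show "\<forall>\<^sub>F n in sequentially. a < ?g n" using ge by (auto intro!: always_eventually intro: less_le_trans)
  next
   fix a assume "first_neg T w < a"
   then have "passage w < ereal (min a T)" using lt p by simp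
   then obtain t where t: "0 \<le> t" "w t < 0" "t < a" "t < T" unfolding passage_less_iff by auto
   have "\<forall>\<^sub>F s in at_right t. w s < 0" using order_tendstoD(2)[OF cadlag_right_tendsto[OF c t(1)] t(2)] .
   then obtain b where b: "t < b" "\<And>s. t < s \<Longrightarrow> s < b \<Longrightarrow> w s < 0"
    unfolding eventually_at_right_field by blast
   \<comment> \<open>A mesh below this length puts a grid point into the interval of negative
     values, before \<open>a\<close> and before the horizon T.\<close>
   define dl where "dl = min (b - t) (min (a - t) (T - t))"
   have dl: "0 < dl" using b t by (simp add: dl_def)
   show "\<forall>\<^sub>F n in sequentially. ?g n < a"
    using order_tendstoD(2)[OF h(2) dl]
   proof eventually_elim
    case (elim n)
    define j where "j = nat (\<lfloor>t / h n\<rfloor> + 1)"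
    have fl: "0 \<le> \<lfloor>t / h n\<rfloor>" using t h(1)[of n] by simp
    have j: "real j * h n = grid_up (h n) t" using fl by (simp add: j_def grid_up_def mult.commute)
    have jb: "t < real j * h n" "real j * h n \<le> t + h n" unfolding j by (rule grid_up_bounds[OF h(1)])+
    have jd: "real j * h n < b" "real j * h n < a" "real j * h n < T" using jb elim by (auto simp: dl_def)
    have "real j * h n < real (K n) * h n" using jd K by simp
    then have "j < K n" using h(1)[of n] by simp
    then have "grid_hit (h n) (K n) w \<le> j" using b(2) jb jd by (intro grid_hit_lower) auto
    then have "?g n \<le> real j * h n" using h(1)[of n] by (intro mult_right_mono) auto
    then show ?case using jd by simp
   qed
  qed
 qed
qed

section \<open>Joint measurability in time and path\<close>

lemma measurable_coord:
 assumes "sets M = sets (path_space I)"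
 shows "(\<lambda>w. w t) \<in> borel_measurable M"
proof (cases "t \<in> I")
 case True
 have "(\<lambda>w. w t) \<in> borel_measurable (path_space I)"
  unfolding path_space_def using True by (intro measurable_restrict_space1 measurable_component_singleton)
 then show ?thesis using measurable_cong_sets[OF assms refl] by blast
next
 case False
 have "w t = undefined" if "w \<in> space M" for w
  using that False sets_eq_imp_space_eq[OF assms] by (auto simp: cadlag_paths_def extensional_def)
 then show ?thesis using measurable_cong[of M "\<lambda>w. w t" "\<lambda>_. undefined" borel] by simp
qed

lemma grid_up_tendsto: "(\<lambda>n. grid_up (1 / real (Suc n)) s) \<longlonglongrightarrow> s"
proof (rule tendsto_sandwich)
 show "\<forall>\<^sub>F n in sequentially. s \<le> grid_up (1 / real (Suc n)) s" "\<forall>\<^sub>F n in sequentially. grid_up (1 / real (Suc n)) s \<le> s + 1 / real (Suc n)"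
  using grid_up_bounds[of "1 / real (Suc n)" s for n] by (auto intro!: always_eventually less_imp_le simp del: of_nat_Suc)
 show "(\<lambda>_. s) \<longlonglongrightarrow> s" by simp
 show "(\<lambda>n. s + 1 / real (Suc n)) \<longlonglongrightarrow> s"
  using tendsto_add[OF tendsto_const LIMSEQ_inverse_real_of_nat, of s] by (simp add: inverse_eq_divide)
qed

text \<open>A limit of step processes that read the path at the next grid point. Negative times are
  harmless because a path is the constant \<open>undefined\<close> there.\<close>

lemma measurable_coord_joint:
 assumes s: "sets M = sets (path_space {0..})"
 shows "(\<lambda>(t, w). w t) \<in> borel_measurable (borel \<Otimes>\<^sub>M M)"
proof (rule borel_measurable_LIMSEQ_metric[where f = "\<lambda>n (t, w). w (grid_up (1 / real (Suc n)) t)"])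
 let ?h = "\<lambda>n. 1 / real (Suc n)"
 fix n
 have 1: "(\<lambda>p. (snd p) (?h n * (of_int k + 1))) \<in> borel_measurable (borel \<Otimes>\<^sub>M M)" for k :: int
  by (rule measurable_compose[OF measurable_snd measurable_coord[OF s]])
 have 2: "(\<lambda>p. \<lfloor>fst p / ?h n\<rfloor>) \<in> measurable (borel \<Otimes>\<^sub>M M) (count_space UNIV)" by measurable
 show "(\<lambda>(t, w). w (grid_up (?h n) t)) \<in> borel_measurable (borel \<Otimes>\<^sub>M M)"
  using measurable_compose_countable[OF 1 2] unfolding grid_up_def case_prod_unfold .
next
 let ?h = "\<lambda>n. 1 / real (Suc n)"
 fix p :: "real \<times> (real \<Rightarrow> real)" assume "p \<in> space (borel \<Otimes>\<^sub>M M)"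
 then obtain t w where p: "p = (t, w)" and "w \<in> space M" by (auto simp: space_pair_measure)
 then have c: "cadlag_on {0..} w" and e: "\<And>t. t < 0 \<Longrightarrow> w t = undefined"
  using sets_eq_imp_space_eq[OF s] by (auto simp: cadlag_paths_def extensional_def)
 have "(\<lambda>n. w (grid_up (?h n) t)) \<longlonglongrightarrow> w t"
 proof (cases "0 \<le> t")
  case True
  show ?thesis using grid_up_bounds(1)[of "?h n" t for n]
   by (intro cadlag_right_sequence[OF c True grid_up_tendsto]) (auto simp: less_imp_le simp del: of_nat_Suc)
 next
  case False
  then have "\<forall>\<^sub>F n in sequentially. w t = w (grid_up (?h n) t)"
   using order_tendstoD(2)[OF grid_up_tendsto[of t], of 0] by (auto elim!: eventually_mono simp: e)
  from Lim_transform_eventually[OF tendsto_const this] show ?thesis .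
 qed
 then show "(\<lambda>n. (\<lambda>(t, w). w (grid_up (?h n) t)) p) \<longlonglongrightarrow> (\<lambda>(t, w). w t) p" by (simp add: p)
qed

lemma measurable_coord_at:
 assumes s: "sets M = sets (path_space {0..})" and [measurable]: "f \<in> borel_measurable M"
 shows "(\<lambda>w. w (f w)) \<in> borel_measurable M"
proof -
 have "(\<lambda>w. (f w, w)) \<in> measurable M (borel \<Otimes>\<^sub>M M)" by measurable
 from measurable_compose[OF this measurable_coord_joint[OF s]] show ?thesis by simp
qed

lemma measurable_area_joint:
 assumes s: "sets M = sets (path_space {0..})"
 shows "(\<lambda>(t, w). LBINT s:{0..<t}. w s) \<in> borel_measurable (borel \<Otimes>\<^sub>M M)"
proof -
 have 1: "(\<lambda>p. (snd (fst p)) (snd p)) \<in> borel_measurable ((borel \<Otimes>\<^sub>M M) \<Otimes>\<^sub>M lborel)"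
 proof -
  have "(\<lambda>p. (snd p, snd (fst p))) \<in> measurable ((borel \<Otimes>\<^sub>M M) \<Otimes>\<^sub>M lborel) (borel \<Otimes>\<^sub>M M)" by measurable
  from measurable_compose[OF this measurable_coord_joint[OF s]] show ?thesis by (simp add: case_prod_unfold)
 qed
 have m1: "(\<lambda>p. snd p :: real) \<in> borel_measurable ((borel \<Otimes>\<^sub>M M) \<Otimes>\<^sub>M lborel)"
  and m2: "(\<lambda>p. fst (fst p) :: real) \<in> borel_measurable ((borel \<Otimes>\<^sub>M M) \<Otimes>\<^sub>M lborel)" by measurable
 have 2: "{p \<in> space ((borel \<Otimes>\<^sub>M M) \<Otimes>\<^sub>M lborel). 0 \<le> (snd p :: real) \<and> snd p < (fst (fst p) :: real)} \<in> sets ((borel \<Otimes>\<^sub>M M) \<Otimes>\<^sub>M lborel)"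
  using m1 m2 by (intro sets.sets_Collect_conj borel_measurable_le borel_measurable_less) auto
 have 3: "(\<lambda>p. if 0 \<le> (snd p :: real) \<and> snd p < (fst (fst p) :: real) then (snd (fst p)) (snd p) else (0::real)) \<in> borel_measurable ((borel \<Otimes>\<^sub>M M) \<Otimes>\<^sub>M lborel)"
  by (rule measurable_If[OF 1 _ 2]) simp
 have e: "(if 0 \<le> s \<and> s < t then w s else 0) = indicator {0..<t} s *\<^sub>R w s" for s t :: real and w :: "real \<Rightarrow> real"
  by (simp add: indicator_def)
 have "(\<lambda>(q, s). indicator {0..<fst q} s *\<^sub>R (snd q) s :: real) \<in> borel_measurable ((borel \<Otimes>\<^sub>M M) \<Otimes>\<^sub>M lborel)"
  using 3 unfolding case_prod_unfold e .
 from lborel.borel_measurable_lebesgue_integral[OF this]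
 show ?thesis unfolding set_lebesgue_integral_def case_prod_unfold .
qed

lemma measurable_area_at:
 assumes s: "sets M = sets (path_space {0..})" and [measurable]: "f \<in> borel_measurable M"
 shows "(\<lambda>w. LBINT s:{0..<f w}. w s) \<in> borel_measurable M"
proof -
 have "(\<lambda>w. (f w, w)) \<in> measurable M (borel \<Otimes>\<^sub>M M)" by measurable
 from measurable_compose[OF this measurable_area_joint[OF s]] show ?thesis by simp
qed

lemma measurable_passage:
 assumes s: "sets M = sets (path_space {0..})"
 shows "passage \<in> borel_measurable M"
proof (rule borel_measurableI_less)
 fix a :: ereal
 have [measurable]: "(\<lambda>v. v t) \<in> borel_measurable M" for t by (rule measurable_coord[OF s])
 have "{v \<in> space M. passage v < a} = (\<Union>q\<in>{q\<in>\<rat>. 0 \<le> q \<and> ereal q < a}. {v \<in> space M. v q < 0})"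
 proof (intro equalityI subsetI)
  fix v assume w: "v \<in> {v \<in> space M. passage v < a}"
  then have c: "cadlag_on {0..} v" using sets_eq_imp_space_eq[OF s] by (auto simp: cadlag_paths_def)
  from w obtain t where t: "0 \<le> t" "v t < 0" "ereal t < a" by (auto simp: passage_less_iff)
  have "\<forall>\<^sub>F s in at_right t. v s < 0" by (rule order_tendstoD(2)[OF cadlag_right_tendsto[OF c t(1)] t(2)])
  then obtain b where b: "t < b" "\<And>s. t < s \<Longrightarrow> s < b \<Longrightarrow> v s < 0" unfolding eventually_at_right_field by blast
  obtain c where c: "t < c" "ereal c \<le> a"
  proof (cases a)
   case (real r) then show ?thesis using t that[of r] by auto
  next
   case PInf then show ?thesis using that[of "t + 1"] by auto
  next
   case MInf then show ?thesis using t by auto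
  qed
  obtain q where "q \<in> \<rat>" "t < q" "q < min b c" using Rats_dense_in_real[of t "min b c"] b c by auto
  moreover have "ereal q < a" using \<open>q < min b c\<close> c by (simp add: less_le_trans[of "ereal q" "ereal c"])
  ultimately show "v \<in> (\<Union>q\<in>{q\<in>\<rat>. 0 \<le> q \<and> ereal q < a}. {v \<in> space M. v q < 0})" using w t b by auto
 next
  fix v assume "v \<in> (\<Union>q\<in>{q\<in>\<rat>. 0 \<le> q \<and> ereal q < a}. {v \<in> space M. v q < 0})"
  then show "v \<in> {v \<in> space M. passage v < a}" by (auto simp: passage_less_iff)
 qed
 also have "... \<in> sets M"
  by (intro sets.countable_UN') (auto intro: countable_subset[OF _ countable_rat])
 finally show "{v \<in> space M. passage v < a} \<in> sets M" .
qed

lemma measurable_first_neg: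
 assumes s: "sets M = sets (path_space {0..})"
 shows "first_neg T \<in> borel_measurable M"
proof -
 have [measurable]: "passage \<in> borel_measurable M" by (rule measurable_passage[OF s])
 show ?thesis unfolding first_neg_def[abs_def] by measurable
qed

text \<open>At the passage time the value is at most 0 by right-continuity and the left limit is at
  least 0. A strictly negative value would be a downward jump. This is where the one-sidedness of
  the jumps enters.\<close>

lemma passage_zero:
 assumes c: "cadlag_on {0..} w" and nj: "\<forall>t>0. Lim (at_left t) w \<le> w t" and w0: "0 < w 0"
  and p: "passage w = ereal p"
 shows "0 < p" "w p = 0"
proof -
 have p0: "0 \<le> p" using passage_nonneg[of w] p by simp
 have wp: "w p \<le> 0"
 proof (rule ccontr)
  assume "\<not> w p \<le> 0"
  then have "0 < w p" by simp
  have "\<forall>\<^sub>F s in at_right p. 0 < w s" by (rule order_tendstoD(1)[OF cadlag_right_tendsto[OF c p0] \<open>0 < w p\<close>])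
  then obtain b where b: "p < b" "\<And>s. p < s \<Longrightarrow> s < b \<Longrightarrow> 0 < w s" unfolding eventually_at_right_field by blast
  have "passage w < ereal b" using p b by simp
  then obtain t where t: "0 \<le> t" "w t < 0" "t < b" by (auto simp: passage_less_iff)
  have "p \<le> t" using passage_le[of t w] t p by simp
  then show False using b t \<open>0 < w p\<close> by (cases "t = p") force+
 qed
 show pp: "0 < p" using p0 wp w0 by (cases "p = 0") auto
 obtain l where "(w \<longlongrightarrow> l) (at p within ({0..} \<inter> {..<p}))" using c p0 unfolding cadlag_on_def by auto
 moreover have "at p within ({0..} \<inter> {..<p}) = at_left p"
  by (rule at_within_nhd[of _ "{0<..}"]) (use pp in auto)
 ultimately have l: "(w \<longlongrightarrow> l) (at_left p)" by simp
 have "0 \<le> l"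
 proof (rule tendsto_lowerbound[OF l])
  have "\<forall>\<^sub>F s in at_left p. 0 < s \<and> s < p" using eventually_at_left_real[OF pp] by (auto elim: eventually_mono)
  then show "\<forall>\<^sub>F s in at_left p. 0 \<le> w s"
   by eventually_elim (rule nonneg_before_passage, auto simp: p)
 qed (simp add: trivial_limit_at_left_real)
 moreover have "Lim (at_left p) w = l" by (rule tendsto_Lim[OF _ l]) simp
 ultimately show "w p = 0" using nj pp wp by force
qed

text \<open>The working form of the process: an arbitrary starting point, and the characteristic
  functions of all increments instead of that at time one, so that translated and rescaled laws are
  again instances. \<open>stable_start_law\<close> derives it from the given law.\<close>

locale stable_start = airy_param \<alpha> + prob_space M for \<alpha> :: real and M :: "(real \<Rightarrow> real) measure" +
 fixes x :: real
 assumes sets_M: "sets M = sets (path_space {0..})"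
  and start: "AE w in M. w 0 = x"
  and indep: "\<And>t :: nat \<Rightarrow> real. 0 \<le> t 0 \<Longrightarrow> mono t \<Longrightarrow> indep_vars (\<lambda>_. borel) (\<lambda>i w. w (t (Suc i)) - w (t i)) UNIV"
  and no_neg_jumps: "AE w in M. \<forall>t>0. Lim (at_left t) w \<le> w t"
  and char_incr: "\<And>s t u. 0 \<le> s \<Longrightarrow> s \<le> t \<Longrightarrow>
   char (distr M borel (\<lambda>w. w t - w s)) u = exp (of_real (t - s) * (- \<i> * of_real u) powr of_real \<alpha>)"
begin

lemma coord_measurable [measurable]: "(\<lambda>w. w t) \<in> borel_measurable M"
 by (rule measurable_coord[OF sets_M])

lemma space_M: "space M = cadlag_paths {0..}"
 using sets_eq_imp_space_eq[OF sets_M] by simp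

lemma cadlag: "w \<in> space M \<Longrightarrow> cadlag_on {0..} w"
 by (simp add: space_M cadlag_paths_def)

section \<open>Stopped exponential martingales\<close>

lemma increment_moment:
 assumes "0 \<le> s" "s \<le> t" "0 < Re z"
 shows "integrable M (\<lambda>w. exp (- (z * of_real (w t - w s))))"
  and "(LINT w|M. exp (- (z * of_real (w t - w s)))) = exp (of_real (t - s) * z powr of_real \<alpha>)"
proof -
 have m[measurable]: "(\<lambda>w. w t - w s) \<in> borel_measurable M" by measurable
 have d: "real_distribution (distr M borel (\<lambda>w. w t - w s))" by (rule real_distribution_distr) measurable
 have ts: "0 \<le> t - s" using assms by simp
 note H = stable_exponential_moment[OF d ts char_incr[OF assms(1,2)] assms(3)]
 have b: "(\<lambda>y. exp (- (z * of_real y))) \<in> borel_measurable borel" by measurable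
 show "integrable M (\<lambda>w. exp (- (z * of_real (w t - w s))))"
  using H(1) unfolding integrable_distr_eq[OF m b] .
 show "(LINT w|M. exp (- (z * of_real (w t - w s)))) = exp (of_real (t - s) * z powr of_real \<alpha>)"
  using H(2) unfolding integral_distr[OF m b] .
qed

lemma increment_moment_real:
 assumes "0 \<le> s" "s \<le> t" "0 < a"
 shows "integrable M (\<lambda>w. exp (- (a * (w t - w s))))"
  and "(LINT w|M. exp (- (a * (w t - w s)))) = exp ((t - s) * a powr \<alpha>)"
proof -
 have e: "exp (- (complex_of_real a * of_real (w t - w s))) = of_real (exp (- (a * (w t - w s))))" for w
  unfolding of_real_mult[symmetric] of_real_minus[symmetric] exp_of_real ..
 have p: "exp (of_real (t - s) * complex_of_real a powr of_real \<alpha>) = of_real (exp ((t - s) * a powr \<alpha>))"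
  using assms by (simp add: powr_of_real exp_of_real del: of_real_mult of_real_diff flip: of_real_mult)
 note H = increment_moment[OF assms(1,2), of "of_real a", unfolded e p]
 show "integrable M (\<lambda>w. exp (- (a * (w t - w s))))" using H(1) assms by (simp add: complex_of_real_integrable_eq)
 show "(LINT w|M. exp (- (a * (w t - w s)))) = exp ((t - s) * a powr \<alpha>)"
  using H(2) assms by (simp only: integral_complex_of_real of_real_eq_iff Re_complex_of_real)
qed

lemma grid_indep:
 assumes "0 < h"
 shows "indep_vars (\<lambda>_. borel) (\<lambda>i w. w (real (Suc i) * h) - w (real i * h)) UNIV"
 by (rule indep[of "\<lambda>i. real i * h"]) (use assms in \<open>auto simp: mono_def intro: mult_right_mono\<close>)

lemma alive_grid:
 assumes "w 0 = x" "j < K"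
 shows "alive x j (\<lambda>i. w (real (Suc i) * h) - w (real i * h)) \<longleftrightarrow> j < grid_hit h K w"
proof -
 have e: "x + (\<Sum>i<k. w (real (Suc i) * h) - w (real i * h)) = w (real k * h)" for k
  using sum_lessThan_telescope[of "\<lambda>i. w (real i * h)" k] assms(1) by simp
 show ?thesis
 proof
  assume "alive x j (\<lambda>i. w (real (Suc i) * h) - w (real i * h))"
  then have *: "\<And>i. i \<le> j \<Longrightarrow> 0 \<le> w (real i * h)" unfolding alive_def e by auto
  show "j < grid_hit h K w"
  proof (rule ccontr)
   assume "\<not> j < grid_hit h K w"
   then have "grid_hit h K w \<le> j" by simp
   with grid_hit_cases[of h K w] *[of "grid_hit h K w"] assms(2) show False by auto
  qed
 next
  assume "j < grid_hit h K w"
  then show "alive x j (\<lambda>i. w (real (Suc i) * h) - w (real i * h))"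
   unfolding alive_def e using grid_hit_less[of _ h K w] by (meson le_less_trans)
 qed
qed

text \<open>On the grid of mesh u / 2^n up to m u the stopped product has mean one. Each of its m
  2^n factors contributes at most exp (h D) to the second moment, so that moment is at most exp (m u
  D) for every n, and expectations pass to the almost sure limit Y. Both u and m u are grid points
  at every level.\<close>

lemma optional_stopping:
 fixes zt :: "real \<Rightarrow> complex" and u :: real and m :: nat
 defines "h \<equiv> \<lambda>n. u / 2 ^ n" and "K \<equiv> \<lambda>n. m * 2 ^ n"
 assumes u: "0 < u" and m: "0 < m"
  and zt: "\<And>t. 0 \<le> t \<Longrightarrow> 0 < Re (zt t) \<and> norm (zt t) \<le> R"
  and Ym[measurable]: "Y \<in> borel_measurable M"
  and lim: "AE w in M. (\<lambda>n. exp (- (\<Sum>j<grid_hit (h n) (K n) w.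
    zt (real j * h n) * of_real (w (real (Suc j) * h n) - w (real j * h n)) + of_real (h n) * zt (real j * h n) powr of_real \<alpha>))) \<longlonglongrightarrow> Y w"
 shows "integrable M Y" "(LINT w|M. Y w) = 1"
proof -
 have h: "0 < h n" for n using u by (simp add: h_def)
 have hK: "real (K n) * h n = real m * u" for n by (simp add: h_def K_def)
 define xia where "xia n i w = w (real (Suc i) * h n) - w (real i * h n)" for n i and w :: "real \<Rightarrow> real"
 define g where "g n j y = exp (- (zt (real j * h n) * of_real y)) * exp (- (of_real (h n) * zt (real j * h n) powr of_real \<alpha>))" for n j y
 have gm[measurable]: "g n j \<in> borel_measurable borel" for n j unfolding g_def[abs_def] by measurable
 define f where "f n w = stopped_prod x (g n) (K n) (\<lambda>i. xia n i w)" for n w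
 have ind: "indep_vars (\<lambda>_. borel) (xia n) UNIV" for n
  unfolding xia_def[abs_def] by (rule grid_indep[OF h])
 have xiam: "xia n i \<in> borel_measurable M" for n i using ind by (auto simp: indep_vars_def)
 have t: "0 \<le> real j * h n" "real j * h n \<le> real (Suc j) * h n" "real (Suc j) * h n - real j * h n = h n" for j n
  using h[of n] by (auto simp: algebra_simps)
 have zp: "0 < Re (zt (real j * h n))" "norm (zt (real j * h n)) \<le> R" for j n using zt[OF t(1)] by auto
 have R: "0 \<le> R" using zp(2)[of 0 0] norm_ge_zero order_trans by blast
 have gi: "integrable M (\<lambda>w. g n j (xia n j w))" for n j
  unfolding g_def xia_def by (intro integrable_mult_left increment_moment(1)[OF t(1,2) zp(1)])
 have g1: "(LINT w|M. g n j (xia n j w)) = 1" for n j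
  unfolding g_def xia_def integral_mult_left_zero increment_moment(2)[OF t(1,2) zp(1)] t(3)
  by (simp only: exp_add[symmetric] add.right_inverse exp_zero)
 have g2: "(norm (g n j y))\<^sup>2 = exp (- (2 * Re (zt (real j * h n)) * y)) * exp (- (2 * h n * Re (zt (real j * h n) powr of_real \<alpha>)))" for n j y
  unfolding g_def norm_mult norm_exp_eq_Re power_mult_distrib exp_double[symmetric] by (simp add: mult.assoc)
 have zp2: "0 < 2 * Re (zt (real j * h n))" for j n using zp(1)[of j n] by simp
 have gi2: "integrable M (\<lambda>w. (norm (g n j (xia n j w)))\<^sup>2)" for n j
  unfolding g2 xia_def by (intro integrable_mult_left increment_moment_real(1)[OF t(1,2) zp2])
 have gv2: "(LINT w|M. (norm (g n j (xia n j w)))\<^sup>2) = exp (h n * ((2 * Re (zt (real j * h n))) powr \<alpha> - 2 * Re (zt (real j * h n) powr of_real \<alpha>)))" for n j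
  unfolding g2 xia_def integral_mult_left_zero increment_moment_real(2)[OF t(1,2) zp2] t(3)
  unfolding exp_add[symmetric] by (simp add: algebra_simps)
 \<comment> \<open>\<open>D\<close> bounds the logarithmic second moment per unit time, (2 Re
   \<zeta>)^\<alpha> - 2 Re (\<zeta>^\<alpha>), through the bound R on the modulus of
   \<zeta>.\<close>
 define D where "D = (2 * R) powr \<alpha> + 2 * R powr \<alpha>"
 have D: "0 \<le> D" by (simp add: D_def)
 have gb: "(LINT w|M. (norm (g n j (xia n j w)))\<^sup>2) \<le> exp (h n * D)" for n j
 proof -
  let ?z = "zt (real j * h n)"
  have "Re ?z \<le> R" using complex_Re_le_cmod[of ?z] zp(2)[of j n] by linarith
  then have "(2 * Re ?z) powr \<alpha> \<le> (2 * R) powr \<alpha>" using zp2[of j n] \<alpha>1 by (intro powr_mono2) auto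
  moreover have "- Re (?z powr of_real \<alpha>) \<le> R powr \<alpha>"
  proof -
   have "- Re (?z powr of_real \<alpha>) \<le> norm (?z powr of_real \<alpha>)" using abs_Re_le_cmod[of "?z powr of_real \<alpha>"] by linarith
   also have "... = norm ?z powr \<alpha>" by (simp add: norm_powr_real_powr')
   also have "... \<le> R powr \<alpha>" using zp(2)[of j n] \<alpha>1 by (intro powr_mono2) auto
   finally show ?thesis .
  qed
  ultimately have "(2 * Re ?z) powr \<alpha> - 2 * Re (?z powr of_real \<alpha>) \<le> D" by (simp add: D_def)
  then show ?thesis unfolding gv2 using h[of n] by simp
 qed
 have E1: "(LINT w|M. f n w) = 1" for n
  unfolding f_def using expectation_stopped_prod[OF ind gm gi g1] by blast
 have fm: "f n \<in> borel_measurable M" for n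
  unfolding f_def using expectation_stopped_prod[OF ind gm gi g1] by (intro borel_measurable_integrable) blast
 have E2: "(\<integral>\<^sup>+w. ennreal ((norm (f n w))\<^sup>2) \<partial>M) \<le> ennreal (exp (real m * u * D))" for n
 proof -
  have "(\<integral>\<^sup>+w. ennreal ((norm (f n w))\<^sup>2) \<partial>M) \<le> ennreal (exp (real (K n) * (h n * D)))"
   unfolding f_def using D h[of n] by (intro second_moment_stopped_prod[OF ind gm gi2 _ gb]) (auto simp: gv2)
  then show ?thesis using hK[of n] by (simp add: mult.assoc[symmetric])
 qed
 have fl: "AE w in M. (\<lambda>n. f n w) \<longlonglongrightarrow> Y w"
  using lim start
 proof eventually_elim
  case (elim w)
  have "f n w = exp (- (\<Sum>j<grid_hit (h n) (K n) w.
    zt (real j * h n) * of_real (w (real (Suc j) * h n) - w (real j * h n)) + of_real (h n) * zt (real j * h n) powr of_real \<alpha>))" for n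
  proof -
   have "f n w = (\<Prod>j<K n. if j < grid_hit (h n) (K n) w then g n j (xia n j w) else 1)"
    unfolding f_def stopped_prod_def xia_def using alive_grid[of w _ "K n" "h n"] elim(2) by (intro prod.cong) (auto simp del: of_nat_Suc)
   also have "... = (\<Prod>j\<in>{j\<in>{..<K n}. j < grid_hit (h n) (K n) w}. g n j (xia n j w))"
    by (rule prod.inter_filter[symmetric]) simp
   also have "{j\<in>{..<K n}. j < grid_hit (h n) (K n) w} = {..<grid_hit (h n) (K n) w}"
    using grid_hit_le[of "h n" "K n" w] by auto
   also have "(\<Prod>j<grid_hit (h n) (K n) w. g n j (xia n j w)) = exp (\<Sum>j<grid_hit (h n) (K n) w. - (zt (real j * h n) * of_real (w (real (Suc j) * h n) - w (real j * h n)) + of_real (h n) * zt (real j * h n) powr of_real \<alpha>))"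
    unfolding exp_sum[OF finite_lessThan] g_def xia_def exp_add[symmetric] by (intro prod.cong) auto
   finally show ?thesis by (simp only: sum_negf)
  qed
  then show ?case using elim(1) by (simp only:)
 qed
 show "integrable M Y" by (rule tendsto_expectation_square_bounded(1)[OF prob_space_axioms fm Ym fl E2]) simp
 have "(\<lambda>n. LINT w|M. f n w) \<longlonglongrightarrow> (LINT w|M. Y w)"
  by (rule tendsto_expectation_square_bounded(2)[OF prob_space_axioms fm Ym fl E2]) simp
 then show "(LINT w|M. Y w) = 1" unfolding E1 by (simp add: LIMSEQ_const_iff)
qed

lemma grid_limits:
 fixes w :: "real \<Rightarrow> real"
 assumes c: "cadlag_on {0..} w" and u: "0 < u" and m: "0 < m"
 defines "h \<equiv> \<lambda>n. u / 2 ^ n" and "K \<equiv> \<lambda>n. m * 2 ^ n"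
 shows "\<And>n. 0 < h n" "h \<longlonglongrightarrow> 0" "\<And>n. real (K n) * h n = real m * u"
  "(\<lambda>n. real (grid_hit (h n) (K n) w) * h n) \<longlonglongrightarrow> first_neg (real m * u) w"
  "(\<lambda>n. w (real (grid_hit (h n) (K n) w) * h n)) \<longlonglongrightarrow> w (first_neg (real m * u) w)"
  "\<And>n. first_neg (real m * u) w \<le> real (grid_hit (h n) (K n) w) * h n"
  "\<And>n. real (grid_hit (h n) (K n) w) * h n \<le> real m * u"
proof -
 show h: "0 < h n" for n using u by (simp add: h_def)
 have "(\<lambda>n. u * (1 / 2) ^ n) \<longlonglongrightarrow> u * 0" by (intro tendsto_intros LIMSEQ_power_zero) simp
 then show h0: "h \<longlonglongrightarrow> 0" by (simp add: h_def power_divide)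
 show hK: "real (K n) * h n = real m * u" for n by (simp add: h_def K_def)
 show t: "(\<lambda>n. real (grid_hit (h n) (K n) w) * h n) \<longlonglongrightarrow> first_neg (real m * u) w"
  by (rule grid_hit_tendsto[OF c h h0 hK])
 show ge: "first_neg (real m * u) w \<le> real (grid_hit (h n) (K n) w) * h n" for n
  by (rule grid_hit_ge[OF h hK])
 show "(\<lambda>n. w (real (grid_hit (h n) (K n) w) * h n)) \<longlonglongrightarrow> w (first_neg (real m * u) w)"
  by (rule cadlag_right_sequence[OF c first_neg_bounds(1) t ge]) (use u in simp)
 show "real (grid_hit (h n) (K n) w) * h n \<le> real m * u" for n
  using mult_right_mono[of "real (grid_hit (h n) (K n) w)" "real (K n)" "h n"] grid_hit_le[of "h n" "K n" w] h[of n] hK[of n] by auto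
qed

lemma first_neg_measurable [measurable]: "first_neg T \<in> borel_measurable M"
 by (rule measurable_first_neg[OF sets_M])

lemma passage_measurable [measurable]: "passage \<in> borel_measurable M"
 by (rule measurable_passage[OF sets_M])

lemma coord_at_measurable: "f \<in> borel_measurable M \<Longrightarrow> (\<lambda>w. w (f w)) \<in> borel_measurable M"
 by (rule measurable_coord_at[OF sets_M])

lemma area_at_measurable: "f \<in> borel_measurable M \<Longrightarrow> (\<lambda>w. LBINT s:{0..<f w}. w s) \<in> borel_measurable M"
 by (rule measurable_area_at[OF sets_M])

lemma step_telescope:
 fixes f :: "nat \<Rightarrow> 'b::comm_ring_1"
 shows "(\<Sum>j<k. (if j < l then a else b) * (f (Suc j) - f j)) = a * (f (min k l) - f 0) + b * (f k - f (min k l))"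
proof (induction k)
 case (Suc k)
 show ?case
 proof (cases "k < l")
  case True
  then show ?thesis using Suc by (simp add: min_def algebra_simps)
 next
  case False
  then show ?thesis using Suc by (cases "k = l") (simp_all add: min_def algebra_simps)
 qed
qed simp

text \<open>Here \<zeta> is a up to the fixed time u and b afterwards. Equal values give the
  ordinary stopped exponential; different ones serve the comparison in
  \<open>tail_exponential_bound\<close>.\<close>

lemma stopped_exponential_step:
 fixes a b u :: real and m :: nat
 assumes a: "0 < a" and b: "0 < b" and u: "0 < u" and m: "0 < m"
 defines "sg \<equiv> first_neg (real m * u)"
 shows "integrable M (\<lambda>w. exp (a * x - a * w (min (sg w) u) - b * (w (sg w) - w (min (sg w) u))
   - a powr \<alpha> * min (sg w) u - b powr \<alpha> * (sg w - min (sg w) u)))" (is "integrable M ?Y")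
  and "(LINT w|M. exp (a * x - a * w (min (sg w) u) - b * (w (sg w) - w (min (sg w) u))
   - a powr \<alpha> * min (sg w) u - b powr \<alpha> * (sg w - min (sg w) u))) = 1"
proof -
 define zt where "zt t = complex_of_real (if t < u then a else b)" for t
 have [measurable]: "sg \<in> borel_measurable M" unfolding sg_def by measurable
 have [measurable]: "(\<lambda>w. w (sg w)) \<in> borel_measurable M" "(\<lambda>w. w (min (sg w) u)) \<in> borel_measurable M"
  by (intro coord_at_measurable; measurable)+
 have zt: "0 < Re (zt t) \<and> norm (zt t) \<le> max a b" for t using a b by (auto simp: zt_def)
 have Ym: "(\<lambda>w. complex_of_real (?Y w)) \<in> borel_measurable M" by measurable
 have lim: "AE w in M. (\<lambda>n. exp (- (\<Sum>j<grid_hit (u / 2 ^ n) (m * 2 ^ n) w.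
    zt (real j * (u / 2 ^ n)) * of_real (w (real (Suc j) * (u / 2 ^ n)) - w (real j * (u / 2 ^ n)))
    + of_real (u / 2 ^ n) * zt (real j * (u / 2 ^ n)) powr of_real \<alpha>))) \<longlonglongrightarrow> complex_of_real (?Y w)"
  using start AE_space
 proof eventually_elim
  case (elim w)
  have c: "cadlag_on {0..} w" using elim(2) by (rule cadlag)
  define h where "h n = u / 2 ^ n" for n :: nat
  define k where "k n = grid_hit (h n) (m * 2 ^ n) w" for n
  note G = grid_limits[OF c u m, folded h_def, folded k_def, folded sg_def]
  have hu: "2 ^ n * h n = u" for n by (simp add: h_def)
  have jl: "real j * h n < u \<longleftrightarrow> j < 2 ^ n" for j n
  proof -
   have "real j * h n < u \<longleftrightarrow> real j * h n < 2 ^ n * h n" by (simp only: hu)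
   also have "... \<longleftrightarrow> real j < 2 ^ n" using G(1)[of n] by simp
   finally show ?thesis by simp
  qed
  have mn: "real (min (k n) (2 ^ n)) * h n = min (real (k n) * h n) u" for n
  proof -
   have "min (real (k n) * h n) u = min (real (k n) * h n) (2 ^ n * h n)" by (simp only: hu)
   also have "... = min (real (k n)) (2 ^ n) * h n" using G(1)[of n] by (simp add: min_mult_distrib_right)
   also have "min (real (k n)) (2 ^ n) = real (min (k n) (2 ^ n))" by (simp add: min_def)
   finally show ?thesis by simp
  qed
  let ?e = "\<lambda>n. - (a * (w (min (real (k n) * h n) u) - x) + b * (w (real (k n) * h n) - w (min (real (k n) * h n) u))
    + a powr \<alpha> * min (real (k n) * h n) u + b powr \<alpha> * (real (k n) * h n - min (real (k n) * h n) u))"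
  have eq: "- (\<Sum>j<k n. zt (real j * h n) * of_real (w (real (Suc j) * h n) - w (real j * h n))
    + of_real (h n) * zt (real j * h n) powr of_real \<alpha>) = complex_of_real (?e n)" for n
  proof -
   have "(\<Sum>j<k n. zt (real j * h n) * of_real (w (real (Suc j) * h n) - w (real j * h n)) + of_real (h n) * zt (real j * h n) powr of_real \<alpha>)
    = complex_of_real (\<Sum>j<k n. (if j < 2 ^ n then a else b) * (w (real (Suc j) * h n) - w (real j * h n)) + (if j < 2 ^ n then a powr \<alpha> else b powr \<alpha>) * (real (Suc j) * h n - real j * h n))"
    unfolding of_real_sum
   proof (intro sum.cong refl)
    fix j
    have "real (Suc j) * h n - real j * h n = h n" by (simp add: algebra_simps)
    then show "zt (real j * h n) * of_real (w (real (Suc j) * h n) - w (real j * h n)) + of_real (h n) * zt (real j * h n) powr of_real \<alpha>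
     = complex_of_real ((if j < 2 ^ n then a else b) * (w (real (Suc j) * h n) - w (real j * h n)) + (if j < 2 ^ n then a powr \<alpha> else b powr \<alpha>) * (real (Suc j) * h n - real j * h n))"
     unfolding zt_def jl using a b by (simp add: powr_of_real)
   qed
   also have "(\<Sum>j<k n. (if j < 2 ^ n then a else b) * (w (real (Suc j) * h n) - w (real j * h n)) + (if j < 2 ^ n then a powr \<alpha> else b powr \<alpha>) * (real (Suc j) * h n - real j * h n))
    = - ?e n"
    unfolding sum.distrib step_telescope[where f = "\<lambda>j. w (real j * h n)"] step_telescope[where f = "\<lambda>j. real j * h n"] mn
    using elim(1) by simp
   finally show ?thesis by simp
  qed
  have mt: "(\<lambda>n. min (real (k n) * h n) u) \<longlonglongrightarrow> min (sg w) u" by (intro tendsto_min G(4) tendsto_const)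
  have wt: "(\<lambda>n. w (min (real (k n) * h n) u)) \<longlonglongrightarrow> w (min (sg w) u)"
   using G(6) first_neg_bounds(1)[of "real m * u" w] u unfolding sg_def
   by (intro cadlag_right_sequence[OF c _ mt[unfolded sg_def]]) (auto intro: min.coboundedI1)
  have "(\<lambda>n. exp (complex_of_real (?e n))) \<longlonglongrightarrow> exp (complex_of_real (- (a * (w (min (sg w) u) - x) + b * (w (sg w) - w (min (sg w) u))
    + a powr \<alpha> * min (sg w) u + b powr \<alpha> * (sg w - min (sg w) u))))"
   by (intro tendsto_intros mt wt G(4,5))
  then show ?case unfolding h_def[symmetric] k_def[symmetric] eq by (simp add: exp_of_real[symmetric] algebra_simps)
 qed
 note O = optional_stopping[OF u m zt Ym lim]
 show "integrable M ?Y" using O(1) by (rule complex_of_real_integrable_eq[THEN iffD1])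
 show "(LINT w|M. ?Y w) = 1" using O(2) unfolding integral_complex_of_real of_real_eq_1_iff .
qed

end

section \<open>The passage time and the stopped area\<close>

text \<open>Summation by parts: when the weights decrease by d at each step, the remaining sum is a
  Riemann sum for the area.\<close>

lemma linear_telescope:
 fixes f :: "nat \<Rightarrow> complex"
 shows "(\<Sum>j<k. (c - of_nat j * d) * (f (Suc j) - f j)) = (c - of_nat k * d) * f k - c * f 0 + (\<Sum>j<k. d * f (Suc j))"
 by (induction k) (simp_all add: algebra_simps)

lemma LBINT_atLeastLessThan:
 fixes f :: "real \<Rightarrow> 'b::{banach, second_countable_topology}"
 assumes [measurable]: "f \<in> borel_measurable borel"
 shows "(LBINT s:{a..<b}. f s) = (LBINT s:{a..b}. f s)"
 unfolding set_lebesgue_integral_def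
proof (rule integral_cong_AE)
 show "AE s in lborel. indicator {a..<b} s *\<^sub>R f s = indicator {a..b} s *\<^sub>R f s"
  using AE_lborel_singleton[of b] by eventually_elim (auto simp: indicator_def)
qed measurable

lemma (in airy_param) measurable_M_Wright: "M_Wright \<alpha> \<in> borel_measurable borel"
proof (rule borel_measurable_continuous_onI)
 show "continuous_on UNIV (M_Wright \<alpha>)"
  by (intro continuous_at_imp_continuous_on ballI DERIV_isCont[OF M_Wright_has_derivative])
qed

context stable_start
begin

declare coord_measurable [measurable del]

text \<open>With \<zeta> = w + T - t, integration by parts turns the integral against dX into
  boundary terms plus the area, and the compensator \<zeta>^\<alpha> integrates to a difference of
  values of z^(\<alpha> + 1) / (\<alpha> + 1). The exponential martingale is thus the kernel at a
  moving point times exp (- area), up to its initial value.\<close>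

lemma stopped_airy:
 fixes w :: complex and T :: real
 assumes w: "0 < Re w" and T: "0 < T"
 defines "sg \<equiv> first_neg T"
 shows "integrable M (\<lambda>v. airy_kernel \<alpha> (v (sg v)) (w + of_real (T - sg v)) * of_real (exp (- (area (sg v) v))))"
  and "(LINT v|M. airy_kernel \<alpha> (v (sg v)) (w + of_real (T - sg v)) * of_real (exp (- (area (sg v) v)))) = airy_kernel \<alpha> x (w + of_real T)"
proof -
 \<comment> \<open>Beyond the horizon \<zeta> is frozen at w, which keeps it bounded with positive
   real part for all times; the stopped process never gets there.\<close>
 define zt where "zt t = w + complex_of_real (max 0 (T - t))" for t
 define ph where "ph t = zt t powr of_real \<alpha>" for t
 have \<alpha>0: "(of_real \<alpha> + 1 :: complex) \<noteq> 0" using \<alpha>1 by (simp add: complex_eq_iff)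
 define H where "H z = z powr (of_real \<alpha> + 1) / (of_real \<alpha> + 1)" for z :: complex
 define A where "A v = (area (sg v) v)" for v
 define Y where "Y v = exp (- ((w + of_real (T - sg v)) * of_real (v (sg v)) - (w + of_real T) * of_real x + of_real (A v)
  + (H (w + of_real T) - H (w + of_real (T - sg v)))))" for v
 have [measurable]: "sg \<in> borel_measurable M" unfolding sg_def by measurable
 have X: "(\<lambda>v. v (sg v)) \<in> borel_measurable M"
  by (intro coord_at_measurable; measurable)
 have [measurable]: "A \<in> borel_measurable M" unfolding A_def[abs_def] by (intro area_at_measurable; measurable)
 have Hc: "continuous_on {z. 0 < Re z} H"
  unfolding H_def using \<alpha>0 \<alpha>1 by (intro continuous_intros) (auto simp: complex_eq_iff)
 have sgb: "0 \<le> sg v" "sg v \<le> T" for v using first_neg_bounds[of T v] T unfolding sg_def by auto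
 have Hm: "(\<lambda>v. H (w + of_real (T - sg v))) \<in> borel_measurable M"
 proof -
  have "(\<lambda>t. H (w + of_real (max 0 (T - t)))) \<in> borel_measurable borel"
   by (intro borel_measurable_continuous_onI continuous_on_compose2[OF Hc] continuous_intros) (use w in auto)
  from measurable_compose[OF \<open>sg \<in> borel_measurable M\<close> this] show ?thesis
   using sgb by (simp add: max_absorb2)
 qed
 have Ym: "Y \<in> borel_measurable M"
 proof -
  define V where "V v = v (sg v)" for v :: "real \<Rightarrow> real"
  have [measurable]: "V \<in> borel_measurable M" unfolding V_def[abs_def] by (rule X)
  define G where "G v = H (w + of_real (T - sg v))" for v
  have [measurable]: "G \<in> borel_measurable M" unfolding G_def[abs_def] by (rule Hm)
  show ?thesis unfolding Y_def[abs_def] V_def[symmetric] G_def[symmetric] by measurable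
 qed
 have zt: "0 < Re (zt t) \<and> norm (zt t) \<le> norm w + T" if "0 \<le> t" for t
 proof
  show "0 < Re (zt t)" using w by (simp add: zt_def add_pos_nonneg)
  show "norm (zt t) \<le> norm w + T" unfolding zt_def
   by (rule order_trans[OF norm_triangle_ineq]) (use that T in auto)
 qed
 have ztc: "continuous_on UNIV zt" unfolding zt_def by (intro continuous_intros)
 have phc: "continuous_on UNIV ph" unfolding ph_def
  by (rule continuous_on_powr_complex[OF _ _ ztc continuous_on_const]) (use w \<alpha>1 in \<open>auto simp: zt_def add_pos_nonneg less_imp_le\<close>)
 have phI: "(LBINT s:{0..<t}. ph s) = H (w + of_real T) - H (w + of_real (T - t))" if t: "0 \<le> t" "t \<le> T" for t
 proof -
  have d: "((\<lambda>s. - H (w + of_real (T - s))) has_vector_derivative ph s) (at s within {0..t})" if s: "s \<in> {0..t}" for s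
  proof -
   have z: "w + of_real (T - s) \<notin> \<real>\<^sub>\<le>\<^sub>0" using w s t by (auto simp: complex_nonpos_Reals_iff not_le add_pos_nonneg)
   have "(H has_field_derivative (w + of_real (T - s)) powr of_real \<alpha>) (at (w + of_real (T - s)))"
    using DERIV_cdivide[OF has_field_derivative_powr[OF z, of "of_real \<alpha> + 1"], of "of_real \<alpha> + 1"] \<alpha>0
    unfolding H_def by simp
   moreover have "((\<lambda>s. w + of_real (T - s)) has_vector_derivative - 1) (at s)"
    unfolding of_real_diff by (auto intro!: derivative_eq_intros)
   ultimately have "((H \<circ> (\<lambda>s. w + of_real (T - s))) has_vector_derivative - 1 * (w + of_real (T - s)) powr of_real \<alpha>) (at s)"
    by (rule field_vector_diff_chain_at[rotated])
   from has_vector_derivative_at_within[OF has_vector_derivative_minus[OF this]] show ?thesis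
    using s t by (simp add: o_def ph_def zt_def max_absorb2)
  qed
  have "((\<lambda>s. ph s) has_integral (- H (w + of_real (T - t)) - (- H (w + of_real (T - 0))))) {0..t}"
   by (rule fundamental_theorem_of_calculus[OF t(1) d])
  moreover have i: "set_integrable lborel {0..t} ph"
   by (rule borel_integrable_atLeastAtMost'[OF continuous_on_subset[OF phc]]) simp
  ultimately have "(LBINT s:{0..t}. ph s) = - H (w + of_real (T - t)) - (- H (w + of_real (T - 0)))"
   using has_integral_unique[OF has_integral_LBINT[OF i]] by blast
  moreover have "(LBINT s:{0..<t}. ph s) = (LBINT s:{0..t}. ph s)"
   using phc by (intro LBINT_atLeastLessThan borel_measurable_continuous_onI)
  ultimately show ?thesis by simp
 qed
 have lim: "AE v in M. (\<lambda>n. exp (- (\<Sum>j<grid_hit (T / 2 ^ n) (1 * 2 ^ n) v.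
    zt (real j * (T / 2 ^ n)) * of_real (v (real (Suc j) * (T / 2 ^ n)) - v (real j * (T / 2 ^ n)))
    + of_real (T / 2 ^ n) * zt (real j * (T / 2 ^ n)) powr of_real \<alpha>))) \<longlonglongrightarrow> Y v"
  using start AE_space
 proof eventually_elim
  case (elim v)
  have c: "cadlag_on {0..} v" using elim(2) by (rule cadlag)
  define h where "h n = T / 2 ^ n" for n :: nat
  define k where "k n = grid_hit (h n) (1 * 2 ^ n) v" for n
  have "real 1 * T = T" by simp
  note G = grid_limits[OF c T zero_less_one, folded h_def, folded k_def, unfolded this, folded sg_def]
  let ?t = "\<lambda>n j. real j * h n"
  obtain C where C: "\<And>t. 0 \<le> t \<Longrightarrow> t \<le> T \<Longrightarrow> \<bar>v t\<bar> \<le> C" using cadlag_bounded_on[OF c, of T] by (metis atLeastAtMost_iff)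
  have RA: "(\<lambda>n. \<Sum>j<k n. h n *\<^sub>R v (?t n (Suc j))) \<longlonglongrightarrow> A v"
   unfolding A_def
  proof (rule riemann_sum_tendsto(2)[where f = v and T = T and C = C, OF G(1,2,4,7)])
   show "(\<lambda>n. v (s n)) \<longlonglongrightarrow> v t" if "0 \<le> t" "s \<longlonglongrightarrow> t" "\<And>n. t \<le> s n" for s t
    using c that by (rule cadlag_right_sequence)
  qed (use C in auto)
  have phb: "norm (ph t) \<le> (1 + (norm w + T))\<^sup>2" if "0 \<le> t" for t
   unfolding ph_def using zt[OF that] by (intro powr_le_square) auto
  have Rph: "(\<lambda>n. \<Sum>j<k n. h n *\<^sub>R ph (?t n (Suc j))) \<longlonglongrightarrow> (LBINT s:{0..<sg v}. ph s)"
  proof (rule riemann_sum_tendsto(2)[where f = ph and T = T, OF G(1,2,4,7)])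
   show "(\<lambda>n. ph (s n)) \<longlonglongrightarrow> ph t" if "s \<longlonglongrightarrow> t" for s t
    using continuous_on_tendsto_compose[OF phc that] by simp
  qed (use phb in auto)
  have pht: "(\<lambda>n. ph (?t n (k n))) \<longlonglongrightarrow> ph (sg v)"
   using continuous_on_tendsto_compose[OF phc G(4)] by simp
  let ?e = "\<lambda>n. (w + of_real (T - ?t n (k n))) * of_real (v (?t n (k n))) - (w + of_real T) * of_real x
   + of_real (\<Sum>j<k n. h n *\<^sub>R v (?t n (Suc j))) + ((\<Sum>j<k n. h n *\<^sub>R ph (?t n (Suc j))) + of_real (h n) * (ph 0 - ph (?t n (k n))))"
  have eq: "(\<Sum>j<k n. zt (?t n j) * of_real (v (?t n (Suc j)) - v (?t n j)) + of_real (h n) * zt (?t n j) powr of_real \<alpha>) = ?e n" for n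
  proof -
   have "zt (?t n j) = (w + of_real T) - of_nat j * of_real (h n)" if "j < k n" for j
   proof -
    have "?t n j \<le> ?t n (k n)" using that G(1)[of n] by (intro mult_right_mono) auto
    then have "?t n j \<le> T" using G(7)[of n] by simp
    then show ?thesis by (simp add: zt_def max_absorb2)
   qed
   then have "(\<Sum>j<k n. zt (?t n j) * of_real (v (?t n (Suc j)) - v (?t n j)))
    = (\<Sum>j<k n. ((w + of_real T) - of_nat j * of_real (h n)) * (of_real (v (?t n (Suc j))) - of_real (v (?t n j))))"
    by (intro sum.cong refl) (simp only: lessThan_iff of_real_diff)
   also have "... = ((w + of_real T) - of_nat (k n) * of_real (h n)) * of_real (v (?t n (k n))) - (w + of_real T) * of_real (v (?t n 0)) + (\<Sum>j<k n. of_real (h n) * of_real (v (?t n (Suc j))))"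
    by (rule linear_telescope[where f = "\<lambda>j. of_real (v (?t n j))"])
   also have "... = (w + of_real (T - ?t n (k n))) * of_real (v (?t n (k n))) - (w + of_real T) * of_real x + of_real (\<Sum>j<k n. h n *\<^sub>R v (?t n (Suc j)))"
    using elim(1) by (simp del: of_nat_Suc add: add_diff_eq)
   finally have 1: "(\<Sum>j<k n. zt (?t n j) * of_real (v (?t n (Suc j)) - v (?t n j))) = ..." .
   \<comment> \<open>The compensator is read at left grid points, the Riemann sums at right ones.
     The discrepancy telescopes to one mesh length times a bounded difference.\<close>
   have "(\<Sum>j<k n. of_real (h n) * ph (?t n j)) = (\<Sum>j<k n. of_real (h n) * ph (?t n (Suc j))) - of_real (h n) * (\<Sum>j<k n. ph (?t n (Suc j)) - ph (?t n j))"
    by (simp only: sum_subtractf sum_distrib_left right_diff_distrib) simp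
   also have "(\<Sum>j<k n. ph (?t n (Suc j)) - ph (?t n j)) = ph (?t n (k n)) - ph (?t n 0)"
    by (rule sum_lessThan_telescope[where f = "\<lambda>j. ph (?t n j)"])
   finally have 2: "(\<Sum>j<k n. of_real (h n) * ph (?t n j)) = (\<Sum>j<k n. h n *\<^sub>R ph (?t n (Suc j))) + of_real (h n) * (ph 0 - ph (?t n (k n)))"
    by (simp add: scaleR_conv_of_real algebra_simps del: of_nat_Suc)
   show ?thesis unfolding sum.distrib ph_def[symmetric] 1 2 by (simp only: add.assoc)
  qed
  have "(\<lambda>n. exp (- ?e n)) \<longlonglongrightarrow> exp (- ((w + of_real (T - sg v)) * of_real (v (sg v)) - (w + of_real T) * of_real x
   + of_real (A v) + ((LBINT s:{0..<sg v}. ph s) + of_real 0 * (ph 0 - ph (sg v)))))"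
   by (intro tendsto_intros RA Rph pht G(2,4,5))
  then show ?case unfolding h_def[symmetric] k_def[symmetric] eq Y_def phI[OF sgb] by simp
 qed
 note O = optional_stopping[OF T zero_less_one zt Ym lim]
 define c where "c = airy_kernel \<alpha> x (w + of_real T)"
 have e: "airy_kernel \<alpha> (v (sg v)) (w + of_real (T - sg v)) * of_real (exp (- (area (sg v) v))) = c * Y v" for v
  unfolding airy_kernel_def c_def Y_def A_def[symmetric] H_def exp_of_real[symmetric] exp_add[symmetric]
  by (rule arg_cong[where f = exp]) (simp add: algebra_simps)
 show "integrable M (\<lambda>v. airy_kernel \<alpha> (v (sg v)) (w + of_real (T - sg v)) * of_real (exp (- (area (sg v) v))))"
  unfolding e using O(1) by (rule integrable_mult_right)
 show "(LINT v|M. airy_kernel \<alpha> (v (sg v)) (w + of_real (T - sg v)) * of_real (exp (- (area (sg v) v)))) = airy_kernel \<alpha> x (w + of_real T)"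
  unfolding e integral_mult_right_zero using O(2) by (simp add: c_def)
qed

end

text \<open>On paths without passage the conversion yields 0; by \<open>AE_passage_finite\<close>
  this is a null event for a positive starting point.\<close>

definition tau :: "(real \<Rightarrow> real) \<Rightarrow> real" where
 "tau w = real_of_ereal (passage w)"

lemma tau_nonneg: "0 \<le> tau w"
 unfolding tau_def using passage_nonneg[of w] by (rule real_of_ereal_pos)

lemma first_neg_eq_tau:
 assumes "passage w = ereal p" "p \<le> T" shows "first_neg T w = tau w" "tau w = p"
 using assms by (auto simp: first_neg_def tau_def min_def)

locale positive_start = stable_start +
 assumes x_pos: "0 < x"
begin

section \<open>The Laplace transform of the passage time\<close>

lemma tau_measurable [measurable]: "tau \<in> borel_measurable M"
 unfolding tau_def[abs_def] by measurable

lemma AE_passage_zero: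
 "AE w in M. cadlag_on {0..} w \<and> (\<forall>p. passage w = ereal p \<longrightarrow> 0 < p \<and> w p = 0)"
 using start no_neg_jumps AE_space
proof eventually_elim
 case (elim w)
 have "cadlag_on {0..} w" using elim(3) by (rule cadlag)
 moreover have "0 < w 0" using elim(1) x_pos by simp
 ultimately show ?case using passage_zero elim(2) by blast
qed

lemma first_neg_nonneg:
 assumes z: "\<forall>p. passage w = ereal p \<longrightarrow> 0 < p \<and> w p = 0" and T: "0 \<le> T"
 shows "0 \<le> w (first_neg T w)"
proof (cases "passage w \<le> ereal T")
 case True
 then obtain p where p: "passage w = ereal p" "p \<le> T" using passage_nonneg[of w] by (cases "passage w") auto
 then show ?thesis using z first_neg_eq_tau[OF p] by simp
next
 case False
 then have "ereal T \<le> passage w" by simp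
 then have "first_neg T w = T" unfolding first_neg_def by (simp add: min_absorb1)
 then show ?thesis using False T by (simp add: nonneg_before_passage)
qed

lemma nonneg_before_first_neg:
 assumes "0 \<le> s" "s < first_neg T w" "0 \<le> T" shows "0 \<le> w s"
proof (rule nonneg_before_passage[OF assms(1)])
 have "ereal s < ereal (first_neg T w)" using assms by simp
 then show "ereal s < passage w" unfolding ereal_first_neg[OF assms(3)] by simp
qed

lemma area_nonneg:
 assumes "0 \<le> T" "t \<le> first_neg T w" shows "0 \<le> (area t w)"
 unfolding set_lebesgue_integral_def
 by (intro LINT_nonneg) (use assms nonneg_before_first_neg[of _ T w] in \<open>auto simp: indicator_def\<close>)

lemma stopped_exponential:
 assumes w: "0 < w" and m: "0 < m"
 shows "(LINT v|M. exp (w * x - w * v (first_neg (real m) v) - w powr \<alpha> * first_neg (real m) v)) = 1"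
proof -
 have e: "w * x - w * v (min s 1) - w * (v s - v (min s 1)) - w powr \<alpha> * min s 1 - w powr \<alpha> * (s - min s 1)
   = w * x - w * v s - w powr \<alpha> * s" for v :: "real \<Rightarrow> real" and s :: real by (simp add: algebra_simps)
 show ?thesis using stopped_exponential_step(2)[OF w w zero_less_one m] by (simp only: mult_1_right e)
qed

text \<open>Finiteness of the passage time is still open here. When the horizon m grows in the
  stopped exponential, a path that never passes contributes at most exp (w x - w^\<alpha> m), hence
  nothing in the limit; on the other paths the final value is 0. Nonnegativity up to the passage
  gives the majorant exp (w x).\<close>

lemma laplace_passage_partial:
 assumes w: "0 < w"
 shows "(LINT v|M. (if passage v = \<infinity> then 0 else exp (- (w powr \<alpha>) * tau v))) = exp (- w * x)"
proof -
 let ?f = "\<lambda>m v. exp (w * x - w * v (first_neg (real (Suc m)) v) - w powr \<alpha> * first_neg (real (Suc m)) v)"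
 let ?g = "\<lambda>v. exp (w * x) * (if passage v = \<infinity> then 0 else exp (- (w powr \<alpha>) * tau v))"
 have wa: "0 < w powr \<alpha>" using w by simp
 have fm: "?f m \<in> borel_measurable M" for m
 proof -
  define V where "V v = v (first_neg (real (Suc m)) v)" for v :: "real \<Rightarrow> real"
  have [measurable]: "V \<in> borel_measurable M"
   unfolding V_def[abs_def] by (rule coord_at_measurable[OF first_neg_measurable])
  show ?thesis unfolding V_def[symmetric] by measurable
 qed
 have gm: "?g \<in> borel_measurable M" by measurable
 have cm: "integrable M (\<lambda>_. exp (w * x))" by simp
 have "(\<lambda>m. LINT v|M. ?f m v) \<longlonglongrightarrow> (LINT v|M. ?g v)"
 proof (rule integral_dominated_convergence[OF gm fm cm])
  show "AE v in M. (\<lambda>m. ?f m v) \<longlonglongrightarrow> ?g v"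
   using AE_passage_zero
  proof eventually_elim
   case (elim v)
   show ?case
   proof (cases "passage v = \<infinity>")
    case True
    have fn: "first_neg (real (Suc m)) v = real (Suc m)" for m using True by (simp add: first_neg_def min_def)
    have "(\<lambda>m. ?f m v) \<longlonglongrightarrow> 0"
    proof (rule Lim_null_comparison)
     show "\<forall>\<^sub>F m in sequentially. norm (?f m v) \<le> exp (w * x) * exp (- (w powr \<alpha>)) ^ Suc m"
     proof (intro always_eventually allI)
      fix m
      have "0 \<le> w * v (first_neg (real (Suc m)) v)"
       using first_neg_nonneg[of v "real (Suc m)"] elim w by (intro mult_nonneg_nonneg) auto
      then have "?f m v \<le> exp (w * x + real (Suc m) * - (w powr \<alpha>))" unfolding exp_le_cancel_iff fn by (simp add: mult.commute)
      then show "norm (?f m v) \<le> exp (w * x) * exp (- (w powr \<alpha>)) ^ Suc m"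
       unfolding exp_add exp_of_nat_mult by simp
     qed
     have "(\<lambda>m. exp (- (w powr \<alpha>)) ^ m) \<longlonglongrightarrow> 0" using wa by (intro LIMSEQ_power_zero) simp
     then show "(\<lambda>m. exp (w * x) * exp (- (w powr \<alpha>)) ^ Suc m) \<longlonglongrightarrow> 0"
      by (intro tendsto_mult_right_zero) (rule LIMSEQ_Suc)
    qed
    then show ?thesis using True by simp
   next
    case False
    then obtain p where p: "passage v = ereal p" using passage_nonneg[of v] by (cases "passage v") auto
    have "\<forall>\<^sub>F m in sequentially. ?g v = ?f m v"
    proof (rule eventually_sequentiallyI[of "nat \<lceil>p\<rceil>"])
     fix m assume "nat \<lceil>p\<rceil> \<le> m"
     then have "p \<le> real (Suc m)" by linarith
     from first_neg_eq_tau[OF p this] have "first_neg (real (Suc m)) v = p" "tau v = p" by auto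
     then show "?g v = ?f m v" using elim p by (simp add: exp_diff exp_minus field_simps)
    qed
    from Lim_transform_eventually[OF tendsto_const this] show ?thesis .
   qed
  qed
  show "AE v in M. norm (?f m v) \<le> exp (w * x)" for m
   using AE_passage_zero
  proof eventually_elim
   case (elim v)
   have "0 \<le> w * v (first_neg (real (Suc m)) v)" "0 \<le> w powr \<alpha> * first_neg (real (Suc m)) v"
    using first_neg_nonneg[of v "real (Suc m)"] first_neg_bounds(1)[of "real (Suc m)" v] elim w by (auto intro!: mult_nonneg_nonneg)
   then show ?case by simp
  qed
 qed
 moreover have "(LINT v|M. ?f m v) = 1" for m using stopped_exponential[OF w, of "Suc m"] by simp
 ultimately have "(LINT v|M. ?g v) = 1" by (simp add: LIMSEQ_const_iff)
 then have "exp (w * x) * (LINT v|M. (if passage v = \<infinity> then 0 else exp (- (w powr \<alpha>) * tau v))) = 1" by simp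
 then show ?thesis by (simp add: exp_minus field_simps)
qed

text \<open>Let w tend to 0 in \<open>laplace_passage_partial\<close>: the right side tends to 1,
  and the left side is at most the probability of a finite passage.\<close>

lemma AE_passage_finite: "AE v in M. passage v = ereal (tau v) \<and> 0 < tau v \<and> v (tau v) = 0 \<and> cadlag_on {0..} v"
proof -
 let ?B = "{v \<in> space M. passage v \<noteq> \<infinity>}"
 have B: "?B \<in> sets M" by measurable
 have le: "exp (- w * x) \<le> prob ?B" if "0 < w" for w
 proof -
  have "exp (- w * x) \<le> (LINT v|M. indicator ?B v)"
   unfolding laplace_passage_partial[OF that, symmetric]
  proof (rule integral_mono)
   show "integrable M (\<lambda>v. if passage v = \<infinity> then 0 else exp (- (w powr \<alpha>) * tau v))"
    by (rule integrable_const_bound[where B = 1]) (use tau_nonneg in \<open>auto intro!: AE_I2\<close>)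
   show "integrable M (indicator ?B :: _ \<Rightarrow> real)" using B by (intro integrable_real_indicator) (auto simp: emeasure_eq_measure)
  qed (use tau_nonneg in \<open>auto simp: indicator_def\<close>)
  then show ?thesis using B by simp
 qed
 have "1 \<le> prob ?B"
 proof (rule tendsto_upperbound)
  have "(\<lambda>n. exp (- inverse (real (Suc n)) * x)) \<longlonglongrightarrow> exp (- 0 * x)"
   by (intro tendsto_intros LIMSEQ_inverse_real_of_nat)
  then show "(\<lambda>n. exp (- inverse (real (Suc n)) * x)) \<longlonglongrightarrow> 1" by simp
  show "\<forall>\<^sub>F n in sequentially. exp (- inverse (real (Suc n)) * x) \<le> prob ?B" using le by (intro always_eventually allI) simp
 qed simp
 then have "prob ?B = 1" using prob_le_1[of ?B] by simp
 then have "AE v in M. v \<in> ?B" by (subst AE_in_set_eq_1[OF B])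
 then show ?thesis using AE_passage_zero
 proof eventually_elim
  case (elim v)
  then obtain p where p: "passage v = ereal p" using passage_nonneg[of v] by (cases "passage v") auto
  then show ?case using elim by (simp add: tau_def)
 qed
qed

lemma laplace_tau:
 assumes q: "0 < q"
 shows "(LINT v|M. exp (- q * tau v)) = exp (- (q powr (1 / \<alpha>)) * x)"
proof -
 define w where "w = q powr (1 / \<alpha>)"
 have w: "0 < w" "w powr \<alpha> = q" using q \<alpha>1 by (auto simp: w_def powr_powr)
 have "(LINT v|M. exp (- q * tau v)) = (LINT v|M. (if passage v = \<infinity> then 0 else exp (- (w powr \<alpha>) * tau v)))"
  using AE_passage_finite by (intro integral_cong_AE) (auto simp: w)
 then show ?thesis using laplace_passage_partial[OF w(1)] by (simp add: w_def)
qed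

section \<open>Integrating the stopped kernel along the ray\<close>

lemma continuous_airy_joint:
 "continuous_on UNIV (\<lambda>p :: real \<times> real \<times> real. airy_kernel \<alpha> (fst p) (of_real (max 0 (fst (snd p))) * ray + of_real (max 0 (snd (snd p)))))"
proof -
 define Z where "Z p = of_real (max 0 (fst (snd p))) * ray + of_real (max 0 (snd (snd p)))" for p :: "real \<times> real \<times> real"
 have Z: "continuous_on UNIV Z" unfolding Z_def[abs_def] by (intro continuous_intros)
 have "0 \<le> Re (Z p)" for p using Re_ray by (simp add: Z_def)
 then have P: "continuous_on UNIV (\<lambda>p. Z p powr (of_real \<alpha> + 1))"
  using \<alpha>1 by (intro continuous_on_powr_complex Z continuous_on_const) auto
 have nz: "(of_real \<alpha> + 1 :: complex) \<noteq> 0" using \<alpha>1 by (simp add: complex_eq_iff)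
 have f: "continuous_on UNIV (\<lambda>p :: real \<times> real \<times> real. complex_of_real (fst p))" by (intro continuous_intros)
 show ?thesis
  unfolding airy_kernel_def Z_def[symmetric]
  by (rule continuous_on_exp[OF continuous_on_diff[OF continuous_on_divide[OF P continuous_on_const] continuous_on_mult[OF f Z]]]) (simp add: nz)
qed

text \<open>Killing at rate c becomes a translation by c in the space variable, because time enters
  the kernel through z.\<close>

lemma airy_kernel_tilt: "airy_kernel \<alpha> y z * exp (- (of_real c * z)) = airy_kernel \<alpha> (y + c) z"
 unfolding airy_kernel_def exp_add[symmetric] by (rule arg_cong[where f = exp]) (simp add: algebra_simps)

text \<open>\<open>stopped_airy\<close> is integrated over base points w on the ray. Inside the
  expectation the ray is translated by the remaining time, on the right side by T, and
  \<open>M_Wright_eq_shift\<close> removes both. The factor exp (- c z) of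
  \<open>airy_kernel_tilt\<close>, taken at the two translated points, differs by exactly exp (- c
  sg).\<close>

lemma stopped_M_Wright:
 assumes T: "0 < T" and c: "0 \<le> c"
 shows "(LINT v|M. M_Wright \<alpha> (v (first_neg T v) + c) * exp (- c * first_neg T v - (area (first_neg T v) v))) = M_Wright \<alpha> (x + c)"
proof -
 define sg where "sg = first_neg T"
 define A where "A v = exp (- c * sg v - (area (sg v) v))" for v
 have sgm[measurable]: "sg \<in> borel_measurable M" unfolding sg_def by measurable
 have X: "(\<lambda>v. v (sg v)) \<in> borel_measurable M" by (intro coord_at_measurable; measurable)
 have [measurable]: "(\<lambda>v. LBINT s:{0..<sg v}. v s) \<in> borel_measurable M" by (intro area_at_measurable; measurable)
 have Am[measurable]: "A \<in> borel_measurable M" unfolding A_def[abs_def] by measurable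
 have sgb: "0 \<le> sg v" "sg v \<le> T" for v using first_neg_bounds[of T v] T unfolding sg_def by auto
 interpret P: pair_sigma_finite M lborel ..
 define k where "k v r = indicator {0..} r *\<^sub>R (airy_kernel \<alpha> (v (sg v) + c) (of_real (max 0 r) * ray + of_real (max 0 (T - sg v))) * of_real (A v))" for v and r :: real
 have km: "(\<lambda>(v, r). k v r) \<in> borel_measurable (M \<Otimes>\<^sub>M lborel)"
 proof -
  have 1: "(\<lambda>p :: real \<times> real \<times> real. airy_kernel \<alpha> (fst p) (of_real (max 0 (fst (snd p))) * ray + of_real (max 0 (snd (snd p))))) \<in> borel_measurable (borel \<Otimes>\<^sub>M (borel \<Otimes>\<^sub>M borel))"
   unfolding borel_prod by (rule borel_measurable_continuous_onI[OF continuous_airy_joint])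
  have 2: "(\<lambda>p. (fst p (sg (fst p)) + c, snd p, T - sg (fst p))) \<in> measurable (M \<Otimes>\<^sub>M lborel) (borel \<Otimes>\<^sub>M (borel \<Otimes>\<^sub>M borel))"
   using measurable_compose[OF measurable_fst X] by measurable
  have 3: "(\<lambda>p. A (fst p)) \<in> borel_measurable (M \<Otimes>\<^sub>M lborel)" by measurable
  show ?thesis unfolding k_def case_prod_unfold
   using measurable_compose[OF 2 1] 3 by (auto intro!: borel_measurable_scaleR borel_measurable_times)
 qed
 have AEn: "AE v in M. 0 \<le> v (sg v)"
  using AE_passage_zero by eventually_elim (use first_neg_nonneg T in \<open>auto simp: sg_def\<close>)
 have A1: "0 \<le> A v" "A v \<le> 1" for v
  using area_nonneg[of T "sg v" v] T mult_nonneg_nonneg[OF c sgb(1)[of v]] unfolding A_def by (auto simp: sg_def)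
 \<comment> \<open>The stopped value is nonnegative, so the tilt by it can only decrease the modulus
   and a single majorant in r serves almost every path.\<close>
 have bnd: "norm (airy_kernel \<alpha> y (of_real r * ray + of_real s)) \<le> airy_bound (airy_const 0 T) r" if "0 \<le> r" "0 \<le> s" "s \<le> T" "0 \<le> y" for r s y
 proof -
  have "airy_kernel \<alpha> y (of_real r * ray + of_real s) = airy_kernel \<alpha> 0 (of_real r * ray + of_real s) * exp (- (of_real y * (of_real r * ray + of_real s)))"
   unfolding airy_kernel_tilt by simp
  moreover have "norm (exp (- (of_real y * (of_real r * ray + of_real s)))) \<le> 1"
   using that Re_point[of r s] by (simp add: norm_exp_eq_Re del: plus_complex.sel)
  ultimately have "norm (airy_kernel \<alpha> y (of_real r * ray + of_real s)) \<le> norm (airy_kernel \<alpha> 0 (of_real r * ray + of_real s)) * 1"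
   by (simp only: norm_mult mult_left_mono norm_ge_zero)
  also have "... \<le> airy_bound (airy_const 0 T) r" using airy_kernel_bound(1)[OF that(1-3), of 0] by simp
  finally show ?thesis .
 qed
 define B where "B r = indicator {0..} r *\<^sub>R airy_bound (airy_const 0 T) r" for r
 have Bi: "integrable lborel B" using set_integrable_airy_bound unfolding B_def[abs_def] set_integrable_def .
 have kB: "norm (k v r) \<le> B r" if "0 \<le> v (sg v)" for v r
 proof (cases "0 \<le> r")
  case True
  have "norm (k v r) = norm (airy_kernel \<alpha> (v (sg v) + c) (of_real r * ray + of_real (T - sg v))) * A v"
   using True sgb[of v] A1[of v] by (simp add: k_def norm_mult max_absorb2)
  also have "... \<le> airy_bound (airy_const 0 T) r * 1"
   using True sgb[of v] that c A1[of v] by (intro mult_mono bnd) (auto intro: less_imp_le airy_bound_pos)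
  finally show ?thesis using True by (simp add: B_def)
 qed (simp add: k_def B_def)
 have ik: "integrable (M \<Otimes>\<^sub>M lborel) (\<lambda>(v, r). k v r)"
 proof (rule P.Fubini_integrable[OF km])
  have i: "AE v in M. integrable lborel (\<lambda>r. k v r)"
   using AEn
  proof eventually_elim
   case (elim v)
   have km1: "(\<lambda>r. airy_kernel \<alpha> (v (sg v) + c) (of_real (max 0 r) * ray + of_real (max 0 (T - sg v)))) \<in> borel_measurable borel"
   proof (rule borel_measurable_continuous_onI)
    have "continuous_on UNIV (\<lambda>r :: real. (v (sg v) + c, r, T - sg v))" by (intro continuous_intros)
    from continuous_on_compose2[OF continuous_airy_joint this]
    show "continuous_on UNIV (\<lambda>r. airy_kernel \<alpha> (v (sg v) + c) (of_real (max 0 r) * ray + of_real (max 0 (T - sg v))))"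
     by (simp only: fst_conv snd_conv subset_UNIV)
   qed
   show ?case
    by (rule Lintegrable_bound[OF Bi])
     (use km1 kB[of v, OF elim] in \<open>auto simp: k_def intro!: AE_I2 order_trans[OF _ abs_ge_self]\<close>)
  qed
  then show "AE v in M. integrable lborel (\<lambda>r. case (v, r) of (v, r) \<Rightarrow> k v r)" by simp
  have nm: "(\<lambda>v. LINT r|lborel. norm (k v r)) \<in> borel_measurable M"
   using km by (intro lborel.borel_measurable_lebesgue_integral) (simp add: case_prod_unfold)
  show "integrable M (\<lambda>v. LINT r|lborel. norm (case (v, r) of (v, r) \<Rightarrow> k v r))"
  proof (rule integrable_const_bound[where B = "LINT r|lborel. B r"])
   show "AE v in M. norm (LINT r|lborel. norm (case (v, r) of (v, r) \<Rightarrow> k v r)) \<le> (LINT r|lborel. B r)"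
    using AEn i
   proof eventually_elim
    case (elim v)
    have "(LINT r|lborel. norm (k v r)) \<le> (LINT r|lborel. B r)"
     using elim Bi kB[of v, OF elim(1)] by (intro integral_mono) auto
    then show ?case by simp
   qed
  qed (use nm in simp)
 qed
 have F: "(LINT v|M. (LINT r|lborel. k v r)) = (LINT r|lborel. (LINT v|M. k v r))"
  by (rule P.Fubini_integral[OF ik, symmetric])
 have R: "(LINT r|lborel. (LINT v|M. k v r)) = (LBINT r:{0..}. airy_kernel \<alpha> (x + c) (of_real r * ray + of_real T))"
  unfolding set_lebesgue_integral_def
 proof (rule integral_cong_AE)
  show "(\<lambda>r. LINT v|M. k v r) \<in> borel_measurable lborel"
  proof -
   have "(\<lambda>(r, v). k v r) \<in> borel_measurable (lborel \<Otimes>\<^sub>M M)"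
    using measurable_compose[OF measurable_pair_swap' km] by (simp add: case_prod_unfold)
   then show ?thesis by (rule borel_measurable_lebesgue_integral)
  qed
  show "(\<lambda>r. indicator {0..} r *\<^sub>R airy_kernel \<alpha> (x + c) (of_real r * ray + of_real T)) \<in> borel_measurable lborel"
   using set_integrable_airy_kernel[of T "x + c"] T unfolding set_integrable_def by auto
  \<comment> \<open>At r = 0 the base point leaves the open half-plane that
    \<open>stopped_airy\<close> asks for.\<close>
  have "AE r in lborel. r \<noteq> (0::real)" by (rule AE_lborel_singleton)
  then show "AE r in lborel. (LINT v|M. k v r) = indicator {0..} r *\<^sub>R airy_kernel \<alpha> (x + c) (of_real r * ray + of_real T)"
  proof eventually_elim
   case (elim r)
   show ?case
   proof (cases "0 \<le> r")
    case True
    then have r: "0 < r" using elim by simp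
    have w: "0 < Re (of_real r * ray)" using r Re_ray by simp
    have e: "k v r = (airy_kernel \<alpha> (v (sg v)) (of_real r * ray + of_real (T - sg v)) * of_real (exp (- (area (sg v) v))))
      * exp (- (of_real c * (of_real r * ray + of_real T)))" for v
    proof -
     have "exp (- (of_real c * (of_real r * ray + of_real (T - sg v)))) * complex_of_real (A v) =
       complex_of_real (exp (- (area (sg v) v))) * exp (- (of_real c * (of_real r * ray + of_real T)))"
      unfolding A_def exp_of_real[symmetric] exp_add[symmetric]
      by (rule arg_cong[where f = exp]) (simp add: algebra_simps)
     then show ?thesis using True sgb[of v]
      by (simp only: k_def airy_kernel_tilt[symmetric] max_absorb2 diff_ge_0_iff_ge indicator_simps atLeast_iff scaleR_one mult.assoc)
    qed
    have "(LINT v|M. k v r) = airy_kernel \<alpha> x (of_real r * ray + of_real T) * exp (- (of_real c * (of_real r * ray + of_real T)))"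
     unfolding e integral_mult_left_zero sg_def stopped_airy(2)[OF w T] ..
    then show ?thesis using True by (simp only: airy_kernel_tilt indicator_simps atLeast_iff scaleR_one)
   qed (simp add: k_def)
  qed
 qed
 have Li: "integrable M (\<lambda>v. LINT r|lborel. k v r)" using P.integrable_fst[OF ik] .
 have L: "AE v in M. 1 / pi * Im (ray * (LINT r|lborel. k v r)) = M_Wright \<alpha> (v (sg v) + c) * A v"
 proof (intro AE_I2)
  fix v
  have "(LINT r|lborel. k v r) = (LINT r|lborel. (indicator {0..} r *\<^sub>R airy_kernel \<alpha> (v (sg v) + c) (of_real r * ray + of_real (T - sg v))) * of_real (A v))"
   using sgb[of v] by (intro LINT_cong) (auto simp: k_def indicator_def max_absorb2)
  also have "... = (LBINT r:{0..}. airy_kernel \<alpha> (v (sg v) + c) (of_real r * ray + of_real (T - sg v))) * of_real (A v)"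
   unfolding set_lebesgue_integral_def by (rule integral_mult_left_zero)
  finally have K: "(LINT r|lborel. k v r) = (LBINT r:{0..}. airy_kernel \<alpha> (v (sg v) + c) (of_real r * ray + of_real (T - sg v))) * of_real (A v)" .
  have Im: "1 / pi * Im (ray * (z * of_real a)) = (1 / pi * Im (ray * z)) * a" for z a by (simp add: algebra_simps)
  have "0 \<le> T - sg v" using sgb[of v] by simp
  from M_Wright_eq_shift[OF this, of "v (sg v) + c"]
  show "1 / pi * Im (ray * (LINT r|lborel. k v r)) = M_Wright \<alpha> (v (sg v) + c) * A v"
   unfolding K Im by (rule arg_cong[where f = "\<lambda>t. t * A v", OF sym])
 qed
 have Wm: "(\<lambda>v. M_Wright \<alpha> (v (sg v) + c)) \<in> borel_measurable M"
 proof -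
  show ?thesis by (rule measurable_compose[OF _ measurable_M_Wright]) (intro borel_measurable_add X borel_measurable_const)
 qed
 have "(LINT v|M. M_Wright \<alpha> (v (sg v) + c) * A v) = (LINT v|M. 1 / pi * Im (ray * (LINT r|lborel. k v r)))"
  using L borel_measurable_integrable[OF Li] Wm by (intro integral_cong_AE) auto
 also have "... = 1 / pi * Im (ray * (LINT v|M. (LINT r|lborel. k v r)))"
 proof -
  have i: "integrable M (\<lambda>v. ray * (LINT r|lborel. k v r))" using Li by (rule integrable_mult_right)
  show ?thesis unfolding integral_mult_right_zero integral_Im[OF i] ..
 qed
 also have "... = M_Wright \<alpha> (x + c)"
  unfolding F R by (rule M_Wright_eq_shift[symmetric]) (use T in simp)
 finally show ?thesis unfolding A_def sg_def .
qed

end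

section \<open>The Feynman-Kac formula and the area of the last piece\<close>

context positive_start
begin

text \<open>Let the horizon grow in \<open>stopped_M_Wright\<close>: on almost every path the
  stopped value is eventually 0, so that \<Phi> is read at c, and boundedness of \<Phi> on the
  half-line dominates.\<close>

lemma feynman_kac:
 assumes c: "0 \<le> c"
 shows "M_Wright \<alpha> (x + c) = M_Wright \<alpha> c * (LINT v|M. exp (- c * tau v - area (tau v) v))"
proof -
 obtain C where C: "\<And>y. 0 \<le> y \<Longrightarrow> \<bar>M_Wright \<alpha> y\<bar> \<le> C" using norm_M_Wright_bounded by auto
 define sg where "sg m = first_neg (real (Suc m))" for m
 define V where "V m v = v (sg m v)" for m and v :: "real \<Rightarrow> real"
 define B where "B m v = area (sg m v) v" for m v
 define B' where "B' v = area (tau v) v" for v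
 have [measurable]: "sg m \<in> borel_measurable M" for m unfolding sg_def by measurable
 have [measurable]: "V m \<in> borel_measurable M" for m unfolding V_def[abs_def] by (rule coord_at_measurable) measurable
 have [measurable]: "B m \<in> borel_measurable M" for m unfolding B_def[abs_def] by (rule area_at_measurable) measurable
 have [measurable]: "B' \<in> borel_measurable M" unfolding B'_def[abs_def] by (rule area_at_measurable) measurable
 note measurable_M_Wright[measurable]
 have "(\<lambda>m. LINT v|M. M_Wright \<alpha> (V m v + c) * exp (- c * sg m v - B m v)) \<longlonglongrightarrow> (LINT v|M. M_Wright \<alpha> c * exp (- c * tau v - B' v))"
 proof (rule integral_dominated_convergence[where w = "\<lambda>_. C"])
  show "AE v in M. (\<lambda>m. M_Wright \<alpha> (V m v + c) * exp (- c * sg m v - B m v)) \<longlonglongrightarrow> M_Wright \<alpha> c * exp (- c * tau v - B' v)"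
   using AE_passage_finite
  proof eventually_elim
   case (elim v)
   then have p: "passage v = ereal (tau v)" by simp
   have "\<forall>\<^sub>F m in sequentially. M_Wright \<alpha> c * exp (- c * tau v - B' v) = M_Wright \<alpha> (V m v + c) * exp (- c * sg m v - B m v)"
   proof (rule eventually_sequentiallyI[of "nat \<lceil>tau v\<rceil>"])
    fix m assume "nat \<lceil>tau v\<rceil> \<le> m"
    then have "tau v \<le> real (Suc m)" by linarith
    from first_neg_eq_tau(1)[OF p this] have "sg m v = tau v" by (simp add: sg_def)
    then show "M_Wright \<alpha> c * exp (- c * tau v - B' v) = M_Wright \<alpha> (V m v + c) * exp (- c * sg m v - B m v)"
     using elim by (simp add: V_def B_def B'_def)
   qed
   from Lim_transform_eventually[OF tendsto_const this] show ?case .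
  qed
  show "AE v in M. norm (M_Wright \<alpha> (V m v + c) * exp (- c * sg m v - B m v)) \<le> C" for m
   using AE_passage_zero
  proof eventually_elim
   case (elim v)
   have "0 \<le> V m v" unfolding V_def sg_def by (rule first_neg_nonneg[of v "real (Suc m)"]) (use elim in auto)
   then have 1: "\<bar>M_Wright \<alpha> (V m v + c)\<bar> \<le> C" using c by (intro C) auto
   have "0 \<le> B m v" unfolding B_def sg_def by (rule area_nonneg[of "real (Suc m)"]) auto
   moreover have "0 \<le> sg m v" unfolding sg_def by (rule first_neg_bounds) simp
   ultimately have 2: "exp (- c * sg m v - B m v) \<le> 1" using mult_nonneg_nonneg[OF c, of "sg m v"] by simp
   show ?case unfolding norm_mult using mult_mono[OF 1 2] by (simp add: order_trans[OF abs_ge_zero 1])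
  qed
  show "(\<lambda>v. M_Wright \<alpha> (V m v + c) * exp (- c * sg m v - B m v)) \<in> borel_measurable M" for m by measurable
  show "(\<lambda>v. M_Wright \<alpha> c * exp (- c * tau v - B' v)) \<in> borel_measurable M" by measurable
 qed simp
 moreover have "(LINT v|M. M_Wright \<alpha> (V m v + c) * exp (- c * sg m v - B m v)) = M_Wright \<alpha> (x + c)" for m
  unfolding V_def B_def sg_def by (rule stopped_M_Wright) (use c in auto)
 ultimately have "M_Wright \<alpha> (x + c) = (LINT v|M. M_Wright \<alpha> c * exp (- c * tau v - B' v))"
  by (simp add: LIMSEQ_const_iff)
 then show ?thesis by (simp add: B'_def)
qed

text \<open>Two exponential martingales with exponent w / 2 up to time u are compared: one switches
  to w afterwards, the other keeps w / 2. In the limit the first has mean at most one and the second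
  mean exactly one, and they agree on paths that have passed by u. On the remaining event the first
  therefore has no larger mean than the second, which there is at most a constant; the same constant
  cancels on the left. The switch leaves exp (w / 2 X) at time u as a surplus.\<close>

lemma tail_exponential_bound:
 assumes u: "0 < u" and w: "0 < w"
 shows "(\<integral>\<^sup>+v. indicator {u<..} (tau v) * ennreal (exp (w / 2 * v u - w powr \<alpha> * (tau v - u))) \<partial>M) \<le> ennreal (prob {v \<in> space M. u < tau v})"
proof -
 define a where "a = w / 2"
 have a: "0 < a" "w - a = a" using w by (auto simp: a_def)
 define V where "V v = v u" for v :: "real \<Rightarrow> real"
 have [measurable]: "V \<in> borel_measurable M" unfolding V_def[abs_def] by (rule coord_measurable)
 define g where "g v = indicator {u<..} (tau v) * exp (a * x + a * V v - a powr \<alpha> * u - w powr \<alpha> * (tau v - u))" for v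
 define g0 where "g0 v = indicator {..u} (tau v) * exp (a * x - a powr \<alpha> * tau v)" for v
 define g1 where "g1 v = indicator {u<..} (tau v) * exp (a * x - a powr \<alpha> * tau v)" for v
 have [measurable]: "g \<in> borel_measurable M" "g0 \<in> borel_measurable M" "g1 \<in> borel_measurable M"
  unfolding g_def[abs_def] g0_def[abs_def] g1_def[abs_def] by measurable
 have pos: "0 \<le> g v" "0 \<le> g0 v" "0 \<le> g1 v" for v by (auto simp: g_def g0_def g1_def)
 define Y where "Y m v = exp (a * x - a * v (min (first_neg (real (Suc m) * u) v) u) - w * (v (first_neg (real (Suc m) * u) v) - v (min (first_neg (real (Suc m) * u) v) u))
   - a powr \<alpha> * min (first_neg (real (Suc m) * u) v) u - w powr \<alpha> * (first_neg (real (Suc m) * u) v - min (first_neg (real (Suc m) * u) v) u))" for m v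
 have Yi: "integrable M (Y m)" "(LINT v|M. Y m v) = 1" for m
  unfolding Y_def[abs_def] by (rule stopped_exponential_step[OF a(1) w u], simp)+
 have Yl: "AE v in M. ennreal (g v + g0 v) = liminf (\<lambda>m. ennreal (Y m v) * indicator {..real (Suc m) * u} (tau v))"
  using AE_passage_finite
 proof eventually_elim
  case (elim v)
  then have p: "passage v = ereal (tau v)" by simp
  have "\<forall>\<^sub>F m in sequentially. ennreal (g v + g0 v) = ennreal (Y m v) * indicator {..real (Suc m) * u} (tau v)"
  proof (rule eventually_sequentiallyI[of "nat \<lceil>tau v / u\<rceil>"])
   fix m assume "nat \<lceil>tau v / u\<rceil> \<le> m"
   then have "tau v / u \<le> real (Suc m)" by linarith
   then have le: "tau v \<le> real (Suc m) * u" using u by (simp add: pos_divide_le_eq)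
   from first_neg_eq_tau(1)[OF p this] have s: "first_neg (real (Suc m) * u) v = tau v" .
   have w0: "v (tau v) = 0" using elim by simp
   have "Y m v = g v + g0 v"
   proof (cases "tau v \<le> u")
    case True
    then show ?thesis unfolding Y_def s by (simp add: min_absorb1 w0 g_def g0_def)
   next
    case False
    then have "a * x - a * v u - w * (0 - v u) = a * x + (w - a) * V v" by (simp add: V_def algebra_simps)
    then show ?thesis unfolding Y_def s using False by (simp only: min_absorb2 w0 g_def g0_def a(2)) (simp add: min_absorb2 w0)
   qed
   then show "ennreal (g v + g0 v) = ennreal (Y m v) * indicator {..real (Suc m) * u} (tau v)"
    using le by simp
  qed
  from Lim_transform_eventually[OF tendsto_const this] show ?case by (rule lim_imp_Liminf[OF sequentially_bot, symmetric])
 qed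
 have "(\<integral>\<^sup>+v. ennreal (g v + g0 v) \<partial>M) = (\<integral>\<^sup>+v. liminf (\<lambda>m. ennreal (Y m v) * indicator {..real (Suc m) * u} (tau v)) \<partial>M)"
  by (rule nn_integral_cong_AE[OF Yl])
 also have "... \<le> liminf (\<lambda>m. \<integral>\<^sup>+v. ennreal (Y m v) * indicator {..real (Suc m) * u} (tau v) \<partial>M)"
  using borel_measurable_integrable[OF Yi(1)] by (intro nn_integral_liminf) auto
 also have "... \<le> liminf (\<lambda>m. 1)"
 proof (intro Liminf_mono always_eventually allI)
  fix m
  have "(\<integral>\<^sup>+v. ennreal (Y m v) * indicator {..real (Suc m) * u} (tau v) \<partial>M) \<le> (\<integral>\<^sup>+v. ennreal (Y m v) \<partial>M)"
   by (intro nn_integral_mono) (auto simp: indicator_def)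
  also have "... = ennreal (LINT v|M. Y m v)"
   by (rule nn_integral_eq_integral[OF Yi(1)]) (simp add: Y_def)
  also have "... = 1" unfolding Yi(2) by simp
  finally show "(\<integral>\<^sup>+v. ennreal (Y m v) * indicator {..real (Suc m) * u} (tau v) \<partial>M) \<le> 1" .
 qed
 also have "... = 1" by (simp add: lim_imp_Liminf)
 finally have G: "(\<integral>\<^sup>+v. ennreal (g v + g0 v) \<partial>M) \<le> 1" .
 have gi: "integrable M (\<lambda>v. g v + g0 v)"
  using G pos by (intro integrableI_nonneg) (auto intro: order_le_less_trans)
 have G': "(LINT v|M. g v + g0 v) \<le> 1"
  using G pos by (subst (asm) nn_integral_eq_integral[OF gi]) auto
 have aq: "0 < a powr \<alpha>" using a by simp
 have i0: "integrable M g0" "integrable M g1"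
  by (rule integrable_const_bound[where B = "exp (a * x)"]; use tau_nonneg in \<open>auto simp: g0_def g1_def indicator_def intro!: AE_I2\<close>)+
 have ig: "integrable M g" using Lintegrable_diff[OF gi i0(1)] by simp
 have s1: "(LINT v|M. g0 v + g1 v) = 1"
 proof -
  have "g0 v + g1 v = exp (a * x) * exp (- (a powr \<alpha>) * tau v)" for v
   by (auto simp: g0_def g1_def indicator_def exp_diff exp_minus field_simps)
  then have "(LINT v|M. g0 v + g1 v) = exp (a * x) * exp (- ((a powr \<alpha>) powr (1 / \<alpha>)) * x)"
   using laplace_tau[OF aq] by simp
  also have "(a powr \<alpha>) powr (1 / \<alpha>) = a" using a \<alpha>1 by (simp add: powr_powr)
  finally show ?thesis by (simp flip: exp_add)
 qed
 have S[measurable]: "{v \<in> space M. u < tau v} \<in> sets M" by measurable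
 have "(LINT v|M. g v) \<le> (LINT v|M. g1 v)"
  using G' s1 LINT_add[OF ig i0(1)] LINT_add[OF i0] by simp
 also have "... \<le> (LINT v|M. exp (a * x - a powr \<alpha> * u) * indicator {v \<in> space M. u < tau v} v)"
 proof (rule integral_mono[OF i0(2)])
  show "integrable M (\<lambda>v. exp (a * x - a powr \<alpha> * u) * indicator {v \<in> space M. u < tau v} v)"
   using S by (intro integrable_mult_right integrable_real_indicator) (auto simp: emeasure_eq_measure)
  show "g1 v \<le> exp (a * x - a powr \<alpha> * u) * indicator {v \<in> space M. u < tau v} v" if "v \<in> space M" for v
  proof (cases "u < tau v")
   case True
   then have "a powr \<alpha> * u \<le> a powr \<alpha> * tau v" using aq by (intro mult_left_mono) auto
   then show ?thesis using True that by (simp add: g1_def)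
  qed (simp add: g1_def)
 qed
 also have "... = exp (a * x - a powr \<alpha> * u) * prob {v \<in> space M. u < tau v}" by simp
 finally have L: "(LINT v|M. g v) \<le> exp (a * x - a powr \<alpha> * u) * prob {v \<in> space M. u < tau v}" .
 have "(\<integral>\<^sup>+v. indicator {u<..} (tau v) * ennreal (exp (w / 2 * v u - w powr \<alpha> * (tau v - u))) \<partial>M)
  = (\<integral>\<^sup>+v. ennreal (exp (- (a * x - a powr \<alpha> * u)) * g v) \<partial>M)"
  by (intro nn_integral_cong) (auto simp: g_def indicator_def V_def a_def simp flip: exp_add)
 also have "... = ennreal (exp (- (a * x - a powr \<alpha> * u)) * (LINT v|M. g v))"
  using ig pos by (subst nn_integral_eq_integral) auto
 also have "... \<le> ennreal (exp (- (a * x - a powr \<alpha> * u)) * (exp (a * x - a powr \<alpha> * u) * prob {v \<in> space M. u < tau v}))"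
  using L by (intro ennreal_leI mult_left_mono) auto
 also have "exp (- (a * x - a powr \<alpha> * u)) * (exp (a * x - a powr \<alpha> * u) * prob {v \<in> space M. u < tau v}) = prob {v \<in> space M. u < tau v}"
  by (simp add: mult.assoc[symmetric] flip: exp_add)
 finally show ?thesis .
qed

text \<open>Markov's inequality for 1 - exp (- \<tau> / u), which is at least 1 / 2 when \<tau> > u.
  Linearity in x is the point: the estimate is later divided by x.\<close>

lemma prob_tau_greater:
 assumes u: "0 < u" shows "prob {w \<in> space M. u < tau w} \<le> 2 * x * u powr (- 1 / \<alpha>)"
proof -
 have e: "exp (- 1) \<le> (1/2 :: real)"
 proof -
  have "(2::real) \<le> exp 1" using exp_ge_add_one_self[of "1::real"] by simp
  then have "1 / exp 1 \<le> (1 / 2 :: real)" by (intro divide_left_mono) auto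
  then show ?thesis by (simp add: exp_minus inverse_eq_divide)
 qed
 have i: "integrable M (\<lambda>w. exp (- (1 / u) * tau w))"
  by (rule integrable_const_bound[where B = 1]) (use u tau_nonneg in \<open>auto intro!: AE_I2\<close>)
 have S: "{w \<in> space M. u < tau w} \<in> sets M" by measurable
 have "prob {w \<in> space M. u < tau w} = (LINT w|M. indicator {w \<in> space M. u < tau w} w)" using S by simp
 also have "... \<le> (LINT w|M. 2 * (1 - exp (- (1 / u) * tau w)))"
 proof (rule integral_mono)
  show "integrable M (indicator {w \<in> space M. u < tau w} :: _ \<Rightarrow> real)" using S by (intro integrable_real_indicator) (auto simp: emeasure_eq_measure)
  show "integrable M (\<lambda>w. 2 * (1 - exp (- (1 / u) * tau w)))" using i by auto
  fix w
  show "indicator {w \<in> space M. u < tau w} w \<le> 2 * (1 - exp (- (1 / u) * tau w))"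
  proof (cases "u < tau w")
   case True
   then have "1 \<le> tau w / u" using u by simp
   then have "exp (- (1 / u) * tau w) \<le> exp (- 1)" by simp
   from order_trans[OF this e] show ?thesis using \<open>1 \<le> tau w / u\<close> by (auto simp: indicator_def)
  next
   case False
   have "0 \<le> tau w / u" using u tau_nonneg[of w] by simp
   then show ?thesis using False by (auto simp: indicator_def)
  qed
 qed
 also have "... = 2 * (1 - (LINT w|M. exp (- (1 / u) * tau w)))" using i by (simp add: prob_space)
 also have "... = 2 * (1 - exp (- ((1 / u) powr (1 / \<alpha>)) * x))" using laplace_tau[of "1 / u"] u by simp
 also have "... \<le> 2 * ((1 / u) powr (1 / \<alpha>) * x)" using exp_ge_add_one_self[of "- ((1 / u) powr (1 / \<alpha>)) * x"] by simp
 also have "... = 2 * x * u powr (- 1 / \<alpha>)" using u by (simp add: powr_divide powr_minus_divide)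
 finally show ?thesis .
qed

text \<open>By Fubini this is an integral over times u with s \<tau> \<le> u < \<tau>, which forces
  \<tau> - u \<le> (1 / s - 1) u. Over so short a time a discount at rate w^\<alpha> = 1 / ((1 / s -
  1) u) costs at most a factor e, and the value of X at u is at most (2 / w) exp (w X / 2), so
  \<open>tail_exponential_bound\<close> applies. The result is linear in x and vanishes as s tends
  to 1.\<close>

lemma last_area_bound:
 assumes kp: "0 < kp" and s: "0 < s" "s < 1"
 shows "(\<integral>\<^sup>+v. ennreal (exp (- kp * tau v) * (area (tau v) v - area (s * tau v) v)) \<partial>M) \<le> ennreal (4 * exp 1 * x * (1 / s - 1) powr (1 / \<alpha>) / kp)"
proof -
 interpret P: pair_sigma_finite M lborel ..
 define ep where "ep = 1 / s - 1"
 have ep: "0 < ep" using s by (simp add: ep_def)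
 define k where "k v u = (if s * tau v \<le> u \<and> u < tau v then exp (- kp * tau v) * v u else 0)" for v and u :: real
 have km: "(\<lambda>(v, u). k v u) \<in> borel_measurable (M \<Otimes>\<^sub>M lborel)"
 proof -
  have 1: "(\<lambda>p. (fst p) (snd p)) \<in> borel_measurable (M \<Otimes>\<^sub>M lborel)"
  proof -
   have "(\<lambda>p. (snd p, fst p)) \<in> measurable (M \<Otimes>\<^sub>M lborel) (borel \<Otimes>\<^sub>M M)" by measurable
   from measurable_compose[OF this measurable_coord_joint[OF sets_M]] show ?thesis by (simp add: case_prod_unfold)
  qed
  have m1: "(\<lambda>p. tau (fst p)) \<in> borel_measurable (M \<Otimes>\<^sub>M lborel)" by measurable
  have m2: "(\<lambda>p. snd p :: real) \<in> borel_measurable (M \<Otimes>\<^sub>M lborel)" by measurable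
  have 2: "{p \<in> space (M \<Otimes>\<^sub>M lborel). s * tau (fst p) \<le> snd p \<and> snd p < tau (fst p)} \<in> sets (M \<Otimes>\<^sub>M lborel)"
   using m1 m2 by (intro sets.sets_Collect_conj borel_measurable_le borel_measurable_less borel_measurable_times) auto
  have 3: "(\<lambda>p. exp (- kp * tau (fst p)) * (fst p) (snd p)) \<in> borel_measurable (M \<Otimes>\<^sub>M lborel)"
   using m1 by (intro borel_measurable_times 1 borel_measurable_exp) auto
  show ?thesis unfolding k_def case_prod_unfold by (rule measurable_If[OF 3 _ 2]) simp
 qed
 have eq: "AE v in M. ennreal (exp (- kp * tau v) * (area (tau v) v - area (s * tau v) v)) = (\<integral>\<^sup>+u. ennreal (k v u) \<partial>lborel)"
  using AE_passage_finite
 proof eventually_elim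
  case (elim v)
  then have c: "cadlag_on {0..} v" and p: "passage v = ereal (tau v)" and t: "0 < tau v" by auto
  obtain C where C: "\<And>r. 0 \<le> r \<Longrightarrow> r \<le> tau v \<Longrightarrow> \<bar>v r\<bar> \<le> C" using cadlag_bounded_on[OF c, of "tau v"] by (metis atLeastAtMost_iff)
  have g: "\<And>n. 0 < tau v / 2 ^ n" "(\<lambda>n. tau v / 2 ^ n) \<longlonglongrightarrow> 0" "\<And>n. real (2 ^ n) * (tau v / 2 ^ n) \<le> tau v"
   using grid_limits(1,2)[OF c t zero_less_one] t by auto
  have g2: "(\<lambda>n. real (2 ^ n) * (tau v / 2 ^ n)) \<longlonglongrightarrow> tau v" by simp
  have i1: "set_integrable lborel {0..<tau v} v"
   by (rule riemann_sum_tendsto(1)[where f = v and T = "tau v" and C = C, OF g(1,2) g2 g(3)])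
    (use cadlag_right_sequence[OF c] C in auto)
  have st: "s * tau v \<le> tau v" "0 \<le> s * tau v" using s t by auto
  have i2: "set_integrable lborel {0..<s * tau v} v" "set_integrable lborel {s * tau v..<tau v} v"
   by (rule set_integrable_subset[OF i1]; use st in auto)+
  have U: "{0..<tau v} = {0..<s * tau v} \<union> {s * tau v..<tau v}" using st by auto
  have "area (tau v) v = area (s * tau v) v + (LBINT u:{s * tau v..<tau v}. v u)"
   unfolding U by (rule set_integral_Un[OF _ i2]) auto
  then have "exp (- kp * tau v) * (area (tau v) v - area (s * tau v) v) = (LINT u|lborel. exp (- kp * tau v) * (indicator {s * tau v..<tau v} u *\<^sub>R v u))"
   by (simp add: set_lebesgue_integral_def)
  also have "... = (LINT u|lborel. k v u)" by (intro LINT_cong) (auto simp: k_def indicator_def)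
  finally have 1: "exp (- kp * tau v) * (area (tau v) v - area (s * tau v) v) = (LINT u|lborel. k v u)" .
  have kk: "k v u = exp (- kp * tau v) * (indicator {s * tau v..<tau v} u *\<^sub>R v u)" for u by (auto simp: k_def indicator_def)
  have ki: "integrable lborel (k v)" unfolding kk[abs_def] using i2(2) unfolding set_integrable_def by (rule integrable_mult_right)
  have k0: "0 \<le> k v u" for u
   using st nonneg_before_passage[of u v] by (auto simp: k_def p intro!: mult_nonneg_nonneg)
  show ?case unfolding 1 using ki k0 by (intro nn_integral_eq_integral[symmetric]) auto
 qed
 have inner: "(\<integral>\<^sup>+v. ennreal (k v u) \<partial>M) \<le> ennreal (4 * exp 1 * x * ep powr (1 / \<alpha>)) * ennreal (exp (- kp * u))" if u: "0 < u" for u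
 proof -
  define q where "q = 1 / (ep * u)"
  define w where "w = q powr (1 / \<alpha>)"
  have q: "0 < q" using ep u by (simp add: q_def)
  have w: "0 < w" "w powr \<alpha> = q" using q \<alpha>1 by (auto simp: w_def powr_powr)
  define D where "D = exp (- kp * u) * exp 1 * (2 / w)"
  have D: "0 \<le> D" using w by (simp add: D_def)
  have le: "ennreal (k v u) \<le> ennreal D * (indicator {u<..} (tau v) * ennreal (exp (w / 2 * v u - w powr \<alpha> * (tau v - u))))" for v
  proof (cases "s * tau v \<le> u \<and> u < tau v")
   case True
   have "tau v \<le> u / s" using True s by (simp add: pos_le_divide_eq mult.commute)
   then have "tau v - u \<le> ep * u" by (simp add: ep_def left_diff_distrib)
   then have "q * (tau v - u) \<le> q * (ep * u)" using q by (intro mult_left_mono) auto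
   also have "q * (ep * u) = 1" using ep u by (simp add: q_def)
   finally have 1: "1 \<le> exp (1 - q * (tau v - u))" by simp
   have 2: "v u \<le> 2 / w * exp (w / 2 * v u)"
   proof -
    have "w / 2 * v u \<le> exp (w / 2 * v u)" using exp_ge_add_one_self[of "w / 2 * v u"] by linarith
    then have "2 / w * (w / 2 * v u) \<le> 2 / w * exp (w / 2 * v u)" using w by (intro mult_left_mono) auto
    then show ?thesis using w by simp
   qed
   have 3: "exp (- kp * tau v) \<le> exp (- kp * u)" using True kp by simp
   have "k v u \<le> exp (- kp * tau v) * (2 / w * exp (w / 2 * v u))"
    using True mult_left_mono[OF 2, of "exp (- kp * tau v)"] by (simp add: k_def)
   also have "... \<le> exp (- kp * u) * (2 / w * exp (w / 2 * v u)) * 1"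
    using 3 w by (simp only: mult_1_right) (intro mult_right_mono, auto)
   also have "... \<le> exp (- kp * u) * (2 / w * exp (w / 2 * v u)) * exp (1 - q * (tau v - u))"
    using 1 w by (intro mult_left_mono) auto
   also have "... = D * exp (w / 2 * v u - w powr \<alpha> * (tau v - u))"
    unfolding D_def w(2) by (simp add: exp_diff)
   finally show ?thesis using True D by (simp add: ennreal_mult[symmetric] ennreal_leI)
  qed (auto simp: k_def)
  have "(\<integral>\<^sup>+v. ennreal (k v u) \<partial>M) \<le> (\<integral>\<^sup>+v. ennreal D * (indicator {u<..} (tau v) * ennreal (exp (w / 2 * v u - w powr \<alpha> * (tau v - u)))) \<partial>M)"
   by (rule nn_integral_mono[OF le])
  also have "... = ennreal D * (\<integral>\<^sup>+v. indicator {u<..} (tau v) * ennreal (exp (w / 2 * v u - w powr \<alpha> * (tau v - u))) \<partial>M)"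
  proof (rule nn_integral_cmult)
   define V where "V v = v u" for v :: "real \<Rightarrow> real"
   have [measurable]: "V \<in> borel_measurable M" unfolding V_def[abs_def] by (rule coord_measurable)
   have "(\<lambda>v. indicator {u<..} (tau v) * ennreal (exp (w / 2 * V v - w powr \<alpha> * (tau v - u)))) \<in> borel_measurable M"
    by measurable
   then show "(\<lambda>v. indicator {u<..} (tau v) * ennreal (exp (w / 2 * v u - w powr \<alpha> * (tau v - u)))) \<in> borel_measurable M"
    unfolding V_def .
  qed
  also have "... \<le> ennreal D * ennreal (prob {v \<in> space M. u < tau v})"
   by (intro mult_left_mono tail_exponential_bound[OF u w(1)]) auto
  also have "... \<le> ennreal D * ennreal (2 * x * u powr (- 1 / \<alpha>))"
   by (intro mult_left_mono ennreal_leI prob_tau_greater[OF u]) auto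
  also have "... = ennreal (D * (2 * x * u powr (- 1 / \<alpha>)))" using D x_pos by (simp add: ennreal_mult)
  also have "D * (2 * x * u powr (- 1 / \<alpha>)) = (4 * exp 1 * x * ep powr (1 / \<alpha>)) * exp (- kp * u)"
  proof -
   \<comment> \<open>1 / w grows like u^(1/\<alpha>), which compensates exactly the decay in
     \<open>prob_tau_greater\<close>; only exp (- kp u) is left to be integrated.\<close>
   have "1 / w = (ep * u) powr (1 / \<alpha>)" using ep u by (simp add: w_def q_def powr_divide)
   also have "... = ep powr (1 / \<alpha>) * u powr (1 / \<alpha>)" using ep u by (simp add: powr_mult)
   finally have W: "1 / w * u powr (- 1 / \<alpha>) = ep powr (1 / \<alpha>)" using u by (simp add: powr_minus field_simps)
   have "D * (2 * x * u powr (- 1 / \<alpha>)) = 4 * exp 1 * x * (1 / w * u powr (- 1 / \<alpha>)) * exp (- kp * u)" by (simp add: D_def)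
   then show ?thesis unfolding W .
  qed
  finally show ?thesis using x_pos by (simp add: ennreal_mult)
 qed
 have "(\<integral>\<^sup>+v. ennreal (exp (- kp * tau v) * (area (tau v) v - area (s * tau v) v)) \<partial>M) = (\<integral>\<^sup>+v. \<integral>\<^sup>+u. ennreal (k v u) \<partial>lborel \<partial>M)"
  by (rule nn_integral_cong_AE[OF eq])
 also have "... = (\<integral>\<^sup>+u. \<integral>\<^sup>+v. ennreal (k v u) \<partial>M \<partial>lborel)"
  using km by (intro P.Fubini'[symmetric]) (simp add: case_prod_unfold)
 also have "... \<le> (\<integral>\<^sup>+u. ennreal (4 * exp 1 * x * ep powr (1 / \<alpha>)) * (ennreal (exp (- kp * u)) * indicator {0..} u) \<partial>lborel)"
 proof (rule nn_integral_mono_AE)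
  have "AE u in lborel. u \<noteq> (0::real)" by (rule AE_lborel_singleton)
  then show "AE u in lborel. (\<integral>\<^sup>+v. ennreal (k v u) \<partial>M) \<le> ennreal (4 * exp 1 * x * ep powr (1 / \<alpha>)) * (ennreal (exp (- kp * u)) * indicator {0..} u)"
  proof eventually_elim
   case (elim u)
   show ?case
   proof (cases "0 \<le> u")
    case True
    then show ?thesis using inner[of u] elim by simp
   next
    case False
    have "k v u = 0" for v
    proof -
     have "0 \<le> s * tau v" using s tau_nonneg[of v] by simp
     then show ?thesis using False by (auto simp: k_def)
    qed
    then show ?thesis by simp
   qed
  qed
 qed
 also have "... = ennreal (4 * exp 1 * x * ep powr (1 / \<alpha>)) * (\<integral>\<^sup>+u. ennreal (exp (- kp * u)) * indicator {0..} u \<partial>lborel)"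
  by (rule nn_integral_cmult) measurable
 also have "(\<integral>\<^sup>+u. ennreal (exp (- kp * u)) * indicator {0..} u \<partial>lborel) = ennreal (1 / kp)"
 proof -
  have "((\<lambda>u. exp (- kp * u)) has_integral (exp (- kp * 0) / kp)) {0..}"
   using has_integral_exp_minus_to_infinity[OF kp, of 0] by simp
  from nn_integral_has_integral_lebesgue'[OF _ this] show ?thesis by simp
 qed
 also have "ennreal (4 * exp 1 * x * ep powr (1 / \<alpha>)) * ennreal (1 / kp) = ennreal (4 * exp 1 * x * ep powr (1 / \<alpha>) / kp)"
  using kp x_pos by (simp add: ennreal_mult[symmetric])
 finally show ?thesis unfolding ep_def .
qed

end

section \<open>Uniqueness and scaling of the process\<close>

text \<open>One map for the three transformations in use: translation to a starting point, a small
  downward shift, and stable scaling. The restriction keeps the image extensional on the time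
  set.\<close>

definition affine_path :: "real \<Rightarrow> real \<Rightarrow> real \<Rightarrow> (real \<Rightarrow> real) \<Rightarrow> real \<Rightarrow> real" where
 "affine_path y c b w = (\<lambda>t\<in>{0..}. y + c * w (b * t))"

lemma cadlag_on_atLeast_iff:
 "cadlag_on {0..} w \<longleftrightarrow> (\<forall>t\<ge>0. (w \<longlongrightarrow> w t) (at_right t)) \<and> (\<forall>t>0. \<exists>l. (w \<longlongrightarrow> l) (at_left t))"
proof -
 have r: "{0..} \<inter> {t<..} = {t<..}" if "0 \<le> t" for t :: real using that by auto
 have l: "at t within ({0..} \<inter> {..<t}) = at_left t" if "0 < t" for t :: real
  by (rule at_within_nhd[of _ "{0<..}"]) (use that in auto)
 have z: "{0..} \<inter> {..<0} = ({} :: real set)" by auto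
 show ?thesis
 proof
  assume "cadlag_on {0..} w"
  then show "(\<forall>t\<ge>0. (w \<longlongrightarrow> w t) (at_right t)) \<and> (\<forall>t>0. \<exists>l. (w \<longlongrightarrow> l) (at_left t))"
   unfolding cadlag_on_def using r l by (metis atLeast_iff less_imp_le)
 next
  assume H: "(\<forall>t\<ge>0. (w \<longlongrightarrow> w t) (at_right t)) \<and> (\<forall>t>0. \<exists>l. (w \<longlongrightarrow> l) (at_left t))"
  show "cadlag_on {0..} w"
   unfolding cadlag_on_def
  proof (intro ballI conjI)
   fix t :: real assume t: "t \<in> {0..}"
   then show "(w \<longlongrightarrow> w t) (at t within ({0..} \<inter> {t<..}))" using H r[of t] by simp
   show "\<exists>l. (w \<longlongrightarrow> l) (at t within ({0..} \<inter> {..<t}))"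
   proof (cases "t = 0")
    case True
    then show ?thesis by (simp add: z)
   next
    case False
    then have "0 < t" using t by simp
    then show ?thesis using H l[of t] by simp
   qed
  qed
 qed
qed

lemma filterlim_scale_right: assumes "0 < (b::real)" shows "filterlim (\<lambda>s. b * s) (at_right (b * t)) (at_right t)"
 unfolding filterlim_at
proof
 show "\<forall>\<^sub>F s in at_right t. b * s \<in> {b * t<..} \<and> b * s \<noteq> b * t"
  using assms by (auto simp: eventually_at_filter)
 show "((\<lambda>s. b * s) \<longlongrightarrow> b * t) (at_right t)" by (intro tendsto_intros)
qed

lemma filterlim_scale_left: assumes "0 < (b::real)" shows "filterlim (\<lambda>s. b * s) (at_left (b * t)) (at_left t)"
 unfolding filterlim_at
proof
 show "\<forall>\<^sub>F s in at_left t. b * s \<in> {..<b * t} \<and> b * s \<noteq> b * t"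
  using assms by (auto simp: eventually_at_filter)
 show "((\<lambda>s. b * s) \<longlongrightarrow> b * t) (at_left t)" by (intro tendsto_intros)
qed

lemma affine_path_limits:
 assumes b: "0 < b"
 shows "0 \<le> t \<Longrightarrow> (w \<longlongrightarrow> l) (at_right (b * t)) \<Longrightarrow> (affine_path y c b w \<longlongrightarrow> y + c * l) (at_right t)"
  and "0 < t \<Longrightarrow> (w \<longlongrightarrow> l) (at_left (b * t)) \<Longrightarrow> (affine_path y c b w \<longlongrightarrow> y + c * l) (at_left t)"
proof -
 assume t: "0 \<le> t" and l: "(w \<longlongrightarrow> l) (at_right (b * t))"
 have "((\<lambda>s. y + c * w (b * s)) \<longlongrightarrow> y + c * l) (at_right t)"
  by (intro tendsto_intros filterlim_compose[OF l filterlim_scale_right[OF b]])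
 moreover have "\<forall>\<^sub>F s in at_right t. y + c * w (b * s) = affine_path y c b w s"
  using eventually_at_right_less[of t] by eventually_elim (use t in \<open>simp add: affine_path_def\<close>)
 ultimately show "(affine_path y c b w \<longlongrightarrow> y + c * l) (at_right t)" by (rule Lim_transform_eventually)
next
 assume t: "0 < t" and l: "(w \<longlongrightarrow> l) (at_left (b * t))"
 have "((\<lambda>s. y + c * w (b * s)) \<longlongrightarrow> y + c * l) (at_left t)"
  by (intro tendsto_intros filterlim_compose[OF l filterlim_scale_left[OF b]])
 moreover have "\<forall>\<^sub>F s in at_left t. y + c * w (b * s) = affine_path y c b w s"
  using eventually_at_left_real[OF t] by eventually_elim (simp add: affine_path_def)
 ultimately show "(affine_path y c b w \<longlongrightarrow> y + c * l) (at_left t)" by (rule Lim_transform_eventually)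
qed

lemma cadlag_affine_path:
 assumes "cadlag_on {0..} w" "0 < b" shows "affine_path y c b w \<in> cadlag_paths {0..}"
proof -
 have "cadlag_on {0..} (affine_path y c b w)"
  unfolding cadlag_on_atLeast_iff
 proof (intro conjI allI impI)
  fix t :: real assume t: "0 \<le> t"
  have "(w \<longlongrightarrow> w (b * t)) (at_right (b * t))" using assms t by (simp add: cadlag_on_atLeast_iff)
  from affine_path_limits(1)[OF assms(2) t this] show "(affine_path y c b w \<longlongrightarrow> affine_path y c b w t) (at_right t)"
   using t by (simp add: affine_path_def)
 next
  fix t :: real assume t: "0 < t"
  then have "0 < b * t" using assms(2) by simp
  then obtain l where "(w \<longlongrightarrow> l) (at_left (b * t))" using assms(1) unfolding cadlag_on_atLeast_iff by blast
  from affine_path_limits(2)[OF assms(2) t this] show "\<exists>l. (affine_path y c b w \<longlongrightarrow> l) (at_left t)" by blast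
 qed
 then show ?thesis by (simp add: cadlag_paths_def affine_path_def)
qed

lemma measurable_into_path_space:
 assumes "\<And>w. w \<in> space M \<Longrightarrow> F w \<in> cadlag_paths I" "\<And>t. t \<in> I \<Longrightarrow> (\<lambda>w. F w t) \<in> borel_measurable M"
 shows "F \<in> measurable M (path_space I)"
 unfolding path_space_def
proof (rule measurable_restrict_space2)
 show "F \<in> space M \<rightarrow> cadlag_paths I" using assms(1) by auto
 show "F \<in> measurable M (Pi\<^sub>M I (\<lambda>_. borel))"
 proof (rule measurable_PiM_single')
  show "(\<lambda>w. F w t) \<in> borel_measurable M" if "t \<in> I" for t by (rule assms(2)[OF that])
  show "F \<in> space M \<rightarrow> (\<Pi>\<^sub>E i\<in>I. space borel)" using assms(1) by (auto simp: cadlag_paths_def PiE_def)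
 qed
qed

lemma measurable_affine_path:
 assumes "sets M = sets (path_space {0..})" "0 < b"
 shows "affine_path y c b \<in> measurable M (path_space {0..})"
proof (rule measurable_into_path_space)
 fix w assume "w \<in> space M"
 then have "cadlag_on {0..} w" using sets_eq_imp_space_eq[OF assms(1)] by (simp add: cadlag_paths_def)
 then show "affine_path y c b w \<in> cadlag_paths {0..}" by (rule cadlag_affine_path[OF _ assms(2)])
next
 fix t :: real assume t: "t \<in> {0..}"
 have "(\<lambda>w. y + c * w (b * t)) \<in> borel_measurable M"
  by (intro borel_measurable_add borel_measurable_times borel_measurable_const measurable_coord[OF assms(1)])
 then show "(\<lambda>w. affine_path y c b w t) \<in> borel_measurable M" using t by (simp add: affine_path_def)
qed

lemma Lim_affine_path:
 assumes c: "cadlag_on {0..} w" and b: "0 < b" and cc: "0 \<le> c" and nj: "\<forall>t>0. Lim (at_left t) w \<le> w t" and t: "0 < t"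
 shows "Lim (at_left t) (affine_path y c b w) \<le> affine_path y c b w t"
proof -
 have bt: "0 < b * t" using b t by simp
 then obtain l where l: "(w \<longlongrightarrow> l) (at_left (b * t))" using c unfolding cadlag_on_atLeast_iff by blast
 have "l \<le> w (b * t)" using nj bt tendsto_Lim[OF _ l] by force
 then have "y + c * l \<le> y + c * w (b * t)" using cc by (simp add: mult_left_mono)
 moreover have "Lim (at_left t) (affine_path y c b w) = y + c * l"
  by (rule tendsto_Lim[OF _ affine_path_limits(2)[OF b t l]]) simp
 ultimately show ?thesis using t by (simp add: affine_path_def)
qed

context stable_start
begin

text \<open>The time change by b and the space change by c cancel in the characteristic exponent
  exactly when \<open>b * c powr \<alpha> = 1\<close>.\<close>

lemma stable_start_affine:
 assumes b: "0 < b" and c: "0 < c" and bc: "b * c powr \<alpha> = 1"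
 shows "stable_start \<alpha> (distr M (path_space {0..}) (affine_path y c b)) (y + c * x)"
proof -
 let ?F = "affine_path y c b"
 let ?N = "distr M (path_space {0..}) ?F"
 have F: "?F \<in> measurable M (path_space {0..})" by (rule measurable_affine_path[OF sets_M b])
 interpret N: prob_space ?N by (rule prob_space_distr[OF F])
 have Ft: "?F v t = y + c * v (b * t)" if "0 \<le> t" for v t using that by (simp add: affine_path_def)
 have cm: "(\<lambda>v. v t) \<in> borel_measurable (path_space {0..})" for t by (rule measurable_coord) simp
 show ?thesis
 proof (unfold_locales)
  show "sets ?N = sets (path_space {0..})" by simp
  show "AE v in ?N. v 0 = y + c * x"
  proof (subst AE_distr_iff[OF F])
   show "{v \<in> space (path_space {0..}). v 0 = y + c * x} \<in> sets (path_space {0..})"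
    using cm[of 0] by measurable
   show "AE v in M. ?F v 0 = y + c * x" using start by eventually_elim (simp add: Ft)
  qed
  show "AE v in ?N. \<forall>t>0. Lim (at_left t) v \<le> v t"
  proof -
   \<comment> \<open>The absence of downward jumps is given only up to some null set, so such a
     measurable set is chosen and pulled back through the inverse affine map.\<close>
   obtain B where B: "B \<in> sets M" "emeasure M B = 0" "{v \<in> space M. \<not> (\<forall>t>0. Lim (at_left t) v \<le> v t)} \<subseteq> B"
    using no_neg_jumps by (auto elim!: AE_E)
   let ?G = "affine_path (- y / c) (1 / c) (1 / b)"
   have G: "?G \<in> measurable (path_space {0..}) M"
    using measurable_affine_path[of "path_space {0..}" "1 / b" "- y / c" "1 / c"] b measurable_cong_sets[OF refl sets_M] by auto
   have GF: "?G (?F v) = v" if "v \<in> space M" for v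
   proof
    fix t
    have "v \<in> extensional {0..}" using that by (simp add: space_M cadlag_paths_def)
    then show "?G (?F v) t = v t" using b c by (auto simp: affine_path_def extensional_def field_simps)
   qed
   have FG: "?F (?G v) = v" if "v \<in> cadlag_paths {0..}" for v
   proof
    fix t
    have "v \<in> extensional {0..}" using that by (simp add: cadlag_paths_def)
    then show "?F (?G v) t = v t" using b c by (auto simp: affine_path_def extensional_def field_simps)
   qed
   show ?thesis
   proof (rule AE_I[where N = "?G -` B \<inter> space (path_space {0..})"])
    show S: "?G -` B \<inter> space (path_space {0..}) \<in> sets ?N" using measurable_sets[OF G B(1)] by simp
    have "?F -` (?G -` B \<inter> space (path_space {0..})) \<inter> space M \<subseteq> B" using GF by auto
    then have "emeasure M (?F -` (?G -` B \<inter> space (path_space {0..})) \<inter> space M) \<le> emeasure M B" using B(1) by (intro emeasure_mono)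
    then show "emeasure ?N (?G -` B \<inter> space (path_space {0..})) = 0"
     using B(2) S by (subst emeasure_distr[OF F]) auto
    show "{v \<in> space ?N. \<not> (\<forall>t>0. Lim (at_left t) v \<le> v t)} \<subseteq> ?G -` B \<inter> space (path_space {0..})"
    proof
     fix v assume "v \<in> {v \<in> space ?N. \<not> (\<forall>t>0. Lim (at_left t) v \<le> v t)}"
     then have w: "v \<in> cadlag_paths {0..}" and n: "\<not> (\<forall>t>0. Lim (at_left t) v \<le> v t)" by auto
     have Gw: "?G v \<in> space M" using measurable_space[OF G, of v] w by simp
     have "\<not> (\<forall>t>0. Lim (at_left t) (?G v) \<le> ?G v t)"
     proof
      assume A: "\<forall>t>0. Lim (at_left t) (?G v) \<le> ?G v t"
      have "Lim (at_left t) (?F (?G v)) \<le> ?F (?G v) t" if "0 < t" for t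
       by (rule Lim_affine_path[OF cadlag[OF Gw] b less_imp_le[OF c] A that])
      then show False using n unfolding FG[OF w] by blast
     qed
     then show "v \<in> ?G -` B \<inter> space (path_space {0..})" using B(3) Gw w by auto
    qed
   qed
  qed
  show "N.indep_vars (\<lambda>_. borel) (\<lambda>i v. v (t (Suc i)) - v (t i)) UNIV" if t: "0 \<le> t 0" "mono t" for t :: "nat \<Rightarrow> real"
  proof -
   have t0: "0 \<le> t i" for i using t monoD[OF t(2), of 0 i] by simp
   have "indep_vars (\<lambda>_. borel) (\<lambda>i v. v (b * t (Suc i)) - v (b * t i)) UNIV"
    using indep[of "\<lambda>i. b * t i"] t b by (auto simp: mono_def)
   then have "indep_vars (\<lambda>_. borel) (\<lambda>i. (\<lambda>d. c * d) \<circ> (\<lambda>v. v (b * t (Suc i)) - v (b * t i))) UNIV"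
    by (rule indep_vars_compose) simp
   moreover have "((\<lambda>d. c * d) \<circ> (\<lambda>v. v (b * t (Suc i)) - v (b * t i))) = (\<lambda>v. ?F v (t (Suc i)) - ?F v (t i))" for i
    using t0 by (auto simp: fun_eq_iff Ft algebra_simps)
   ultimately have "indep_vars (\<lambda>_. borel) (\<lambda>i v. ?F v (t (Suc i)) - ?F v (t i)) UNIV" by simp
   note iF = this
   have rv: "(\<lambda>v. v (t (Suc i)) - v (t i)) \<in> borel_measurable (path_space {0..})" for i
    by (intro borel_measurable_diff cm)
   show ?thesis
   \<comment> \<open>Independence is transported as the statement that the joint law is the product
     of the marginals, since joint laws push forward.\<close>
   proof (subst N.indep_vars_iff_distr_eq_PiM)
    show "(UNIV::nat set) \<noteq> {}" by simp
    show "(\<lambda>v. v (t (Suc i)) - v (t i)) \<in> measurable ?N borel" for i using rv by simp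
    have m: "(\<lambda>v. \<lambda>i\<in>UNIV. v (t (Suc i)) - v (t i)) \<in> measurable (path_space {0..}) (Pi\<^sub>M UNIV (\<lambda>_. borel))"
     by (rule measurable_restrict[OF rv])
    have rF: "random_variable borel (\<lambda>v. ?F v (t (Suc i)) - ?F v (t i))" for i
     using measurable_compose[OF F rv] .
    have "distr ?N (Pi\<^sub>M UNIV (\<lambda>_. borel)) (\<lambda>v. \<lambda>i\<in>UNIV. v (t (Suc i)) - v (t i)) = distr M (Pi\<^sub>M UNIV (\<lambda>_. borel)) (\<lambda>v. \<lambda>i\<in>UNIV. ?F v (t (Suc i)) - ?F v (t i))"
     by (subst distr_distr[OF m F]) (simp add: o_def)
    also have "... = Pi\<^sub>M UNIV (\<lambda>i. distr M borel (\<lambda>v. ?F v (t (Suc i)) - ?F v (t i)))"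
     using iF indep_vars_iff_distr_eq_PiM[of "UNIV :: nat set" "\<lambda>i v. ?F v (t (Suc i)) - ?F v (t i)" "\<lambda>_. borel", OF _ rF] by blast
    also have "... = Pi\<^sub>M UNIV (\<lambda>i. distr ?N borel (\<lambda>v. v (t (Suc i)) - v (t i)))"
     by (subst distr_distr[OF rv F]) (simp add: o_def)
    finally show "distr ?N (Pi\<^sub>M UNIV (\<lambda>_. borel)) (\<lambda>v. \<lambda>i\<in>UNIV. v (t (Suc i)) - v (t i)) = Pi\<^sub>M UNIV (\<lambda>i. distr ?N borel (\<lambda>v. v (t (Suc i)) - v (t i)))" .
   qed
  qed
  show "char (distr ?N borel (\<lambda>v. v t - v s)) u = exp (of_real (t - s) * (- \<i> * of_real u) powr of_real \<alpha>)" if st: "0 \<le> s" "s \<le> t" for s t u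
  proof -
   have rv: "(\<lambda>v. v t - v s) \<in> borel_measurable (path_space {0..})" by (intro borel_measurable_diff cm)
   have rM: "(\<lambda>v. v (b * t) - v (b * s)) \<in> borel_measurable M" by (intro borel_measurable_diff coord_measurable)
   have "distr ?N borel (\<lambda>v. v t - v s) = distr M borel (\<lambda>v. c * (v (b * t) - v (b * s)))"
    using st by (subst distr_distr[OF rv F]) (simp add: o_def Ft algebra_simps)
   then have "char (distr ?N borel (\<lambda>v. v t - v s)) u = char (distr M borel (\<lambda>v. v (b * t) - v (b * s))) (u * c)"
    unfolding char_def using rM by (simp add: integral_distr mult.assoc)
   also have "... = exp (of_real (b * t - b * s) * (- \<i> * of_real (u * c)) powr of_real \<alpha>)"
    using st b by (intro char_incr) auto
   also have "of_real (b * t - b * s) * (- \<i> * complex_of_real (u * c)) powr of_real \<alpha> = of_real (t - s) * (- \<i> * of_real u) powr of_real \<alpha>"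
   proof -
    have "- \<i> * complex_of_real (u * c) = of_real c * (- \<i> * of_real u)" by simp
    moreover have "(of_real c * (- \<i> * complex_of_real u)) powr of_real \<alpha> = of_real c powr of_real \<alpha> * (- \<i> * of_real u) powr of_real \<alpha>"
     using c by (intro powr_times_real_left) auto
    moreover have "complex_of_real c powr of_real \<alpha> = of_real (c powr \<alpha>)" using c by (simp add: powr_of_real)
    moreover have "b * t - b * s = b * (t - s)" by (simp add: right_diff_distrib)
    moreover have "complex_of_real (b * (t - s)) * (of_real (c powr \<alpha>) * z) = of_real (b * c powr \<alpha>) * (of_real (t - s) * z)" for z by simp
    ultimately show ?thesis by (simp only: bc of_real_1 mult_1)
   qed
   finally show ?thesis .
  qed
 qed
qed

end

text \<open>Characteristic functions determine each increment, independence the joint law of the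
  increments, and the starting point then all finite-dimensional distributions. The use is to
  identify a rescaled law with the law from the rescaled starting point.\<close>

lemma stable_start_unique:
 assumes "stable_start \<alpha> M x" "stable_start \<alpha> N x" shows "M = N"
proof -
 interpret M: stable_start \<alpha> M x by fact
 interpret N: stable_start \<alpha> N x by fact
 let ?Q = "Pi\<^sub>M {0..} (\<lambda>_. borel) :: (real \<Rightarrow> real) measure"
 have idm: "(\<lambda>w. w) \<in> measurable (path_space {0..}) ?Q" unfolding path_space_def by (rule measurable_restrict_space1) simp
 have iM: "(\<lambda>w. w) \<in> measurable M ?Q" and iN: "(\<lambda>w. w) \<in> measurable N ?Q"
  using idm measurable_cong_sets[OF M.sets_M refl] measurable_cong_sets[OF N.sets_M refl] by auto
 have "distr M ?Q (\<lambda>w. w) = distr N ?Q (\<lambda>w. w)"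
 proof (rule measure_eqI_PiM_infinite)
  show "finite_measure (distr M ?Q (\<lambda>w. w))" using M.prob_space_distr[OF iM] by (simp add: prob_space.finite_measure)
  fix A J assume J: "finite J" "J \<subseteq> {0::real..}" "\<And>i. i \<in> J \<Longrightarrow> A i \<in> sets (borel :: real measure)"
  \<comment> \<open>Time 0 is added so that every coordinate is x plus a sum of increments. The
    sequence \<open>t\<close> repeats the last time forever, because independence is assumed for
    infinite monotone sequences.\<close>
  define l where "l = sorted_list_of_set (insert 0 J)"
  define t where "t i = l ! min i (length l - 1)" for i
  have fl: "finite (insert 0 J)" using J by simp
  have sl: "set l = insert 0 J" "sorted l" unfolding l_def using fl by (simp_all only: set_sorted_list_of_set sorted_sorted_list_of_set)
  have ln: "0 < length l" using sl(1) by (cases l) auto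
  have mi: "min i (length l - 1) < length l" for i by (rule le_less_trans[OF min.cobounded2]) (use ln in simp)
  have mt: "mono t"
  proof (rule monoI)
   fix i j :: nat assume "i \<le> j"
   then have "min i (length l - 1) \<le> min j (length l - 1)" by (rule min.mono) simp
   then show "t i \<le> t j" unfolding t_def by (rule sorted_nth_mono[OF sl(2) _ mi])
  qed
  have tin: "t i \<in> insert 0 J" for i unfolding t_def sl(1)[symmetric] by (rule nth_mem[OF mi])
  have tl: "t i = l ! i" if "i < length l" for i
  proof -
   have "min i (length l - 1) = i" using that by linarith
   then show ?thesis by (simp only: t_def)
  qed
  have t0: "t 0 = 0"
  proof -
   have "0 \<in> set l" unfolding sl(1) by simp
   then obtain i where "i < length l" "l ! i = 0" unfolding in_set_conv_nth by blast
   then have "t i = 0" using tl by simp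
   then have "t 0 \<le> 0" using monoD[OF mt, of 0 i] by simp
   moreover have "0 \<le> t 0" using tin[of 0] J(2) by auto
   ultimately show ?thesis by simp
  qed
  have "\<exists>k. t k = j" if "j \<in> J" for j
  proof -
   have "j \<in> set l" unfolding sl(1) using that by simp
   then obtain i where "i < length l" "l ! i = j" unfolding in_set_conv_nth by blast
   then show ?thesis using tl by blast
  qed
  then obtain k where k: "\<And>j. j \<in> J \<Longrightarrow> t (k j) = j" by metis
  define d where "d i w = w (t (Suc i)) - w (t i)" for i and w :: "real \<Rightarrow> real"
  define D where "D w = (\<lambda>i\<in>UNIV. d i w)" for w :: "real \<Rightarrow> real"
  let ?R = "Pi\<^sub>M UNIV (\<lambda>_. borel) :: (nat \<Rightarrow> real) measure"
  define E where "E = {v \<in> space ?R. \<forall>j\<in>J. x + sum v {..<k j} \<in> A j}"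
  have E: "E \<in> sets ?R"
  proof -
   have "{v \<in> space ?R. x + sum v {..<k j} \<in> A j} \<in> sets ?R" if "j \<in> J" for j
   proof -
    have "(\<lambda>v. x + sum v {..<k j}) \<in> borel_measurable ?R" by measurable
    from measurable_sets[OF this J(3)[OF that]] show ?thesis by (simp add: vimage_def Int_def conj_commute)
   qed
   then show ?thesis unfolding E_def using J(1) by (intro sets.sets_Collect_finite_All) auto
  qed
  have main: "emeasure (distr L ?Q (\<lambda>w. w)) (prod_emb {0..} (\<lambda>_. borel) J (Pi\<^sub>E J A)) = emeasure (Pi\<^sub>M UNIV (\<lambda>i. distr L borel (d i))) E"
   if L: "stable_start \<alpha> L x" for L
  proof -
   interpret L: stable_start \<alpha> L x by fact
   have dm: "d i \<in> borel_measurable L" for i unfolding d_def[abs_def] by (intro borel_measurable_diff L.coord_measurable)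
   have Dm: "D \<in> measurable L ?R" unfolding D_def[abs_def] by (rule measurable_restrict[OF dm])
   have iv: "L.indep_vars (\<lambda>_. borel) d UNIV" unfolding d_def[abs_def] by (rule L.indep[OF _ mt]) (simp add: t0)
   have DL: "distr L ?R D = Pi\<^sub>M UNIV (\<lambda>i. distr L borel (d i))"
    using L.indep_vars_iff_distr_eq_PiM[of "UNIV :: nat set" d "\<lambda>_. borel", OF _ dm] iv unfolding D_def[abs_def] by blast
   have iL: "(\<lambda>w. w) \<in> measurable L ?Q" using idm measurable_cong_sets[OF L.sets_M refl] by auto
   have S: "prod_emb {0..} (\<lambda>_. borel) J (Pi\<^sub>E J A) \<in> sets ?Q" using J by (intro sets_PiM_I) auto
   have "emeasure (distr L ?Q (\<lambda>w. w)) (prod_emb {0..} (\<lambda>_. borel) J (Pi\<^sub>E J A)) = emeasure L (prod_emb {0..} (\<lambda>_. borel) J (Pi\<^sub>E J A) \<inter> space L)"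
    using S by (subst emeasure_distr[OF iL]) auto
   also have "... = emeasure L (D -` E \<inter> space L)"
   proof (rule emeasure_eq_AE)
    show "AE w in L. w \<in> prod_emb {0..} (\<lambda>_. borel) J (Pi\<^sub>E J A) \<inter> space L \<longleftrightarrow> w \<in> D -` E \<inter> space L"
     using L.start AE_space
    proof eventually_elim
     case (elim w)
     have e: "x + sum (D w) {..<n} = w (t n)" for n
      using sum_lessThan_telescope[of "\<lambda>i. w (t i)" n] elim(1) by (simp add: D_def d_def t0)
     have "w \<in> extensional {0..}" using elim(2) by (simp add: L.space_M cadlag_paths_def)
     then have "w \<in> prod_emb {0..} (\<lambda>_. borel) J (Pi\<^sub>E J A) \<longleftrightarrow> (\<forall>j\<in>J. w j \<in> A j)"
      by (auto simp: prod_emb_def PiE_def Pi_def)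
     moreover have "D w \<in> E \<longleftrightarrow> (\<forall>j\<in>J. w j \<in> A j)"
      using k by (auto simp: E_def e space_PiM)
     ultimately show ?case by auto
    qed
    show "prod_emb {0..} (\<lambda>_. borel) J (Pi\<^sub>E J A) \<inter> space L \<in> sets L" using measurable_sets[OF iL S] by simp
    show "D -` E \<inter> space L \<in> sets L" by (rule measurable_sets[OF Dm E])
   qed
   also have "... = emeasure (distr L ?R D) E" by (rule emeasure_distr[OF Dm E, symmetric])
   finally show ?thesis unfolding DL .
  qed
  have "distr M borel (d i) = distr N borel (d i)" for i
  proof (rule Levy_uniqueness)
   have dM: "d i \<in> borel_measurable M" "d i \<in> borel_measurable N" unfolding d_def[abs_def] by (intro borel_measurable_diff M.coord_measurable N.coord_measurable)+
   show "real_distribution (distr M borel (d i))" using dM by (intro M.real_distribution_distr)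
   show "real_distribution (distr N borel (d i))" using dM by (intro N.real_distribution_distr)
   have ti: "0 \<le> t i" "t i \<le> t (Suc i)" using tin[of i] J(2) monoD[OF mt, of i "Suc i"] by auto
   show "char (distr M borel (d i)) = char (distr N borel (d i))"
    unfolding d_def[abs_def] using M.char_incr[OF ti] N.char_incr[OF ti] by auto
  qed
  then show "emeasure (distr M ?Q (\<lambda>w. w)) (prod_emb {0..} (\<lambda>_. borel) J (Pi\<^sub>E J A)) = emeasure (distr N ?Q (\<lambda>w. w)) (prod_emb {0..} (\<lambda>_. borel) J (Pi\<^sub>E J A))"
   using main[OF assms(1)] main[OF assms(2)] by simp
 qed simp_all
 note eq = this
 show ?thesis
 proof (rule measure_eqI)
  show "sets M = sets N" using M.sets_M N.sets_M by simp
  fix S assume "S \<in> sets M"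
  then have "S \<in> sets (path_space {0..})" using M.sets_M by simp
  then obtain B where B: "B \<in> sets ?Q" "S = B \<inter> cadlag_paths {0..}"
   unfolding path_space_def by (auto simp: sets_restrict_space)
  have "emeasure M S = emeasure (distr M ?Q (\<lambda>w. w)) B" using B by (subst emeasure_distr[OF iM]) (auto simp: M.space_M)
  also have "... = emeasure N S" unfolding eq using B by (subst emeasure_distr[OF iN]) (auto simp: N.space_M)
  finally show "emeasure M S = emeasure N S" .
 qed
qed

section \<open>Hitting zero and passing below zero\<close>

context positive_start
begin

text \<open>A path might touch zero before it goes below. Shift it down by a small amount: where the
  path touches zero the shifted one is negative, so the shifted passage is no later than the hitting
  time. As the shift tends to 0, the Laplace transform of the shifted passage tends to that of
  \<open>tau\<close>, so the gap is almost surely zero.\<close>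

lemma AE_hitting_time: "AE w in M. hitting_time_0 w = passage w \<and> hitting_time_0 w = ereal (tau w) \<and> 0 < tau w \<and> w (tau w) = 0 \<and> cadlag_on {0..} w"
proof -
 define dl where "dl n = x / (real n + 2)" for n
 have dl: "0 < dl n" "dl n < x" for n
 proof -
  show "0 < dl n" using x_pos by (simp add: dl_def)
  have "x / (real n + 2) < x / 1" by (rule divide_strict_left_mono) (use x_pos in auto)
  then show "dl n < x" by (simp add: dl_def)
 qed
 define F where "F n = affine_path (- dl n) 1 1" for n
 have Fm: "F n \<in> measurable M (path_space {0..})" for n unfolding F_def by (rule measurable_affine_path[OF sets_M]) simp
 define N where "N n = distr M (path_space {0..}) (F n)" for n
 have Ns: "stable_start \<alpha> (N n) (x - dl n)" for n
  using stable_start_affine[of 1 1 "- dl n"] unfolding N_def F_def by simp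
 have Np: "positive_start \<alpha> (N n) (x - dl n)" for n
  using Ns[of n] dl(2)[of n] by (simp add: positive_start_def positive_start_axioms_def)
 have tm: "tau \<in> borel_measurable (path_space {0..})"
  unfolding tau_def[abs_def] using measurable_passage[of "path_space {0..}"] by measurable
 have tFm[measurable]: "(\<lambda>w. tau (F n w)) \<in> borel_measurable M" for n by (rule measurable_compose[OF Fm tm])
 have EN: "(LINT w|M. exp (- tau (F n w))) = exp (- (x - dl n))" for n
 proof -
  interpret N: positive_start \<alpha> "N n" "x - dl n" by (rule Np)
  have "(LINT w|N n. exp (- 1 * tau w)) = exp (- (1 powr (1 / \<alpha>)) * (x - dl n))" by (rule N.laplace_tau) simp
  then have "(LINT w|N n. exp (- tau w)) = exp (- (x - dl n))" by simp
  moreover have "(\<lambda>w. exp (- tau w)) \<in> borel_measurable (path_space {0..})" using tm by measurable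
  ultimately show ?thesis unfolding N_def using Fm[of n] by (simp add: integral_distr)
 qed
 have AN: "AE w in M. passage (F n w) = ereal (tau (F n w))" for n
 proof -
  interpret N: positive_start \<alpha> "N n" "x - dl n" by (rule Np)
  have "AE w in distr M (path_space {0..}) (F n). passage w = ereal (tau w)"
   using N.AE_passage_finite unfolding N_def by eventually_elim simp
  moreover have "{w \<in> space (path_space {0..}). passage w = ereal (tau w)} \<in> sets (path_space {0..})"
   using tm measurable_passage[of "path_space {0..}"] by measurable
  ultimately show ?thesis by (subst (asm) AE_distr_iff[OF Fm])
 qed
 have ord: "passage (F n w) \<le> hitting_time_0 w" for n w
  unfolding hitting_time_0_def
 proof (rule INF_greatest)
  fix t assume t: "t \<in> {t. 0 \<le> t \<and> w t = 0}"
  then have "F n w t < 0" using dl(1)[of n] by (simp add: F_def affine_path_def)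
  then show "passage (F n w) \<le> ereal t" using t by (intro passage_le) auto
 qed
 \<comment> \<open>The smallest gap over all shifts. A hitting time strictly before
   \<open>tau\<close> would keep it positive, while its mean is at most that of every single
   gap.\<close>
 define W where "W w = (INF n. ennreal (exp (- tau (F n w)) - exp (- tau w)))" for w
 have Wm: "W \<in> borel_measurable M" unfolding W_def[abs_def] by measurable
 have hit_le: "AE w in M. hitting_time_0 w \<le> ereal (tau w)"
  using AE_passage_finite
 proof eventually_elim
  case (elim w)
  then show ?case unfolding hitting_time_0_def by (intro INF_lower) auto
 qed
 have le: "(\<integral>\<^sup>+w. W w \<partial>M) \<le> ennreal (exp (- (x - dl n)) - exp (- x))" for n
 proof -
  have i: "integrable M (\<lambda>w. exp (- tau (F n w)))" "integrable M (\<lambda>w. exp (- tau w))"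
   by (rule integrable_const_bound[where B = 1]; use tau_nonneg in \<open>auto intro!: AE_I2\<close>)+
  have "(\<integral>\<^sup>+w. W w \<partial>M) \<le> (\<integral>\<^sup>+w. ennreal (exp (- tau (F n w)) - exp (- tau w)) \<partial>M)"
   unfolding W_def by (intro nn_integral_mono INF_lower) auto
  also have "... = ennreal (LINT w|M. exp (- tau (F n w)) - exp (- tau w))"
  proof (rule nn_integral_eq_integral)
   show "AE w in M. 0 \<le> exp (- tau (F n w)) - exp (- tau w)"
    using hit_le AN[of n]
   proof eventually_elim
    case (elim w)
    have "passage (F n w) \<le> ereal (tau w)" by (rule order_trans[OF ord elim(1)])
    then have "ereal (tau (F n w)) \<le> ereal (tau w)" unfolding elim(2) .
    then show ?case by simp
   qed
  qed (use i in auto)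
  also have "(LINT w|M. exp (- tau (F n w)) - exp (- tau w)) = exp (- (x - dl n)) - exp (- x)"
   using i laplace_tau[of 1] by (simp add: EN)
  finally show ?thesis .
 qed
 have "(\<integral>\<^sup>+w. W w \<partial>M) \<le> 0"
 proof (rule tendsto_lowerbound)
  have "dl \<longlonglongrightarrow> 0" unfolding dl_def by real_asymp
  then have "(\<lambda>n. ennreal (exp (- (x - dl n)) - exp (- x))) \<longlonglongrightarrow> ennreal (exp (- (x - 0)) - exp (- x))"
   by (intro tendsto_intros tendsto_ennrealI)
  then show "(\<lambda>n. ennreal (exp (- (x - dl n)) - exp (- x))) \<longlonglongrightarrow> 0" by simp
  show "\<forall>\<^sub>F n in sequentially. (\<integral>\<^sup>+w. W w \<partial>M) \<le> ennreal (exp (- (x - dl n)) - exp (- x))" using le by simp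
 qed simp
 then have "(\<integral>\<^sup>+w. W w \<partial>M) = 0" by simp
 then have W0: "AE w in M. W w = 0" using nn_integral_0_iff_AE[OF Wm] by simp
 have AN': "AE w in M. \<forall>n. passage (F n w) = ereal (tau (F n w))" using AN by (simp add: AE_all_countable)
 show ?thesis using W0 AN' hit_le AE_passage_finite
 proof eventually_elim
  case (elim w)
  have "0 \<le> hitting_time_0 w" unfolding hitting_time_0_def by (intro INF_greatest) auto
  then obtain r where r: "hitting_time_0 w = ereal r" "r \<le> tau w" using elim(3) by (cases "hitting_time_0 w") auto
  have "r = tau w"
  proof (rule ccontr)
   assume "r \<noteq> tau w"
   then have "r < tau w" using r by simp
   then have p: "0 < exp (- r) - exp (- tau w)" by simp
   have "ennreal (exp (- r) - exp (- tau w)) \<le> W w"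
    unfolding W_def
   proof (rule INF_greatest)
    fix n
    have "ereal (tau (F n w)) \<le> ereal r" using ord[of n w] elim(2) r by simp
    then show "ennreal (exp (- r) - exp (- tau w)) \<le> ennreal (exp (- tau (F n w)) - exp (- tau w))" by (intro ennreal_leI) simp
   qed
   then show False using elim(1) p by simp
  qed
  then show ?case using r elim by simp
 qed
qed

lemma hitting_time_measurable: "hitting_time_0 \<in> borel_measurable (completion M)"
proof -
 have 1: "(\<lambda>w. ereal (tau w)) \<in> borel_measurable (completion M)"
  by (rule measurable_completion) measurable
 have 2: "AE w in completion M. ereal (tau w) = hitting_time_0 w"
 proof (rule AE_completion)
  show "AE w in M. ereal (tau w) = hitting_time_0 w" using AE_hitting_time
  proof eventually_elim
   case (elim w)
   then have "hitting_time_0 w = ereal (tau w)" by blast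
   then show ?case by (rule sym)
  qed
 qed
 show ?thesis
 proof (rule measurableI)
  fix B :: "ereal set" assume B: "B \<in> sets borel"
  show "hitting_time_0 -` B \<inter> space (completion M) \<in> sets (completion M)"
  proof (rule completion.in_sets_AE)
   show "(\<lambda>w. ereal (tau w)) -` B \<inter> space (completion M) \<in> sets (completion M)" by (rule measurable_sets[OF 1 B])
   show "AE w in completion M. w \<in> (\<lambda>w. ereal (tau w)) -` B \<inter> space (completion M) \<longleftrightarrow> w \<in> hitting_time_0 -` B \<inter> space (completion M)"
    using 2 by eventually_elim simp
  qed simp
 qed simp
qed

end

section \<open>Convergence of moments\<close>

lemma integrable_mult_continuous:
 fixes G :: "real \<Rightarrow> real"
 assumes W: "integrable N W" and Z: "Z \<in> borel_measurable N" "\<And>w. 0 \<le> Z w \<and> Z w \<le> 1"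
  and G: "continuous_on UNIV G"
 shows "integrable N (\<lambda>w. W w * G (Z w))"
proof -
 have "compact (G ` {0..1})" by (intro compact_continuous_image continuous_on_subset[OF G]) auto
 then obtain C where "\<forall>y\<in>G ` {0..1}. norm y \<le> C"
  using compact_imp_bounded[of "G ` {0..1}"] unfolding bounded_iff by blast
 then have C: "\<bar>G u\<bar> \<le> C" if "u \<in> {0..1}" for u using that by auto
 have Gm: "(\<lambda>w. G (Z w)) \<in> borel_measurable N"
  by (rule measurable_compose[OF Z(1) borel_measurable_continuous_onI[OF G]])
 show ?thesis
 proof (rule Lintegrable_bound)
  show "integrable N (\<lambda>w. C * W w)" by (intro integrable_mult_right W)
  show "(\<lambda>w. W w * G (Z w)) \<in> borel_measurable N" by (intro borel_measurable_times borel_measurable_integrable[OF W] Gm)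
  show "AE w in N. norm (W w * G (Z w)) \<le> norm (C * W w)"
  proof (rule AE_I2)
   fix w
   have "\<bar>G (Z w)\<bar> \<le> \<bar>C\<bar>" using C[of "Z w"] Z(2)[of w] by force
   then have "\<bar>W w\<bar> * \<bar>G (Z w)\<bar> \<le> \<bar>W w\<bar> * \<bar>C\<bar>" by (rule mult_left_mono) simp
   then show "norm (W w * G (Z w)) \<le> norm (C * W w)" by (simp only: real_norm_def abs_mult mult.commute)
  qed
 qed
qed

lemma moments_approx:
 fixes G :: "real \<Rightarrow> real"
 assumes W: "integrable N W" "\<And>w. 0 \<le> W w" and Z: "Z \<in> borel_measurable N" "\<And>w. 0 \<le> Z w \<and> Z w \<le> 1"
  and G: "continuous_on UNIV G" and a: "\<And>u. u \<in> {0..1} \<Longrightarrow> \<bar>G u - (\<Sum>k\<le>n. a k * u ^ k)\<bar> \<le> e"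
 shows "\<bar>(LINT w|N. W w * G (Z w)) - (\<Sum>k\<le>n. a k * (LINT w|N. W w * Z w ^ k))\<bar> \<le> e * (LINT w|N. W w)"
proof -
 have iG: "integrable N (\<lambda>w. W w * G (Z w))" by (rule integrable_mult_continuous[OF W(1) Z G])
 have ik: "integrable N (\<lambda>w. W w * Z w ^ k)" for k
  by (rule integrable_mult_continuous[OF W(1) Z, of "\<lambda>u. u ^ k"]) (intro continuous_intros)
 have iS: "integrable N (\<lambda>w. \<Sum>k\<le>n. a k * (W w * Z w ^ k))" by (intro Bochner_Integration.integrable_sum integrable_mult_right ik)
 have s: "(\<Sum>k\<le>n. a k * (LINT w|N. W w * Z w ^ k)) = (LINT w|N. (\<Sum>k\<le>n. a k * (W w * Z w ^ k)))"
  by (subst Bochner_Integration.integral_sum) (auto intro!: integrable_mult_right ik)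
 have "\<bar>(LINT w|N. W w * G (Z w)) - (LINT w|N. (\<Sum>k\<le>n. a k * (W w * Z w ^ k)))\<bar> = \<bar>(LINT w|N. W w * G (Z w) - (\<Sum>k\<le>n. a k * (W w * Z w ^ k)))\<bar>"
  by (subst LINT_diff[OF iG iS]) (rule refl)
 also have "... \<le> (LINT w|N. \<bar>W w * G (Z w) - (\<Sum>k\<le>n. a k * (W w * Z w ^ k))\<bar>)" by (rule integral_abs_bound)
 also have "... \<le> (LINT w|N. e * W w)"
 proof (rule LINT_mono)
  show "integrable N (\<lambda>w. \<bar>W w * G (Z w) - (\<Sum>k\<le>n. a k * (W w * Z w ^ k))\<bar>)"
   by (intro integrable_abs Lintegrable_diff iG iS)
  show "integrable N (\<lambda>w. e * W w)" by (intro integrable_mult_right W(1))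
  fix w
  have "W w * G (Z w) - (\<Sum>k\<le>n. a k * (W w * Z w ^ k)) = W w * (G (Z w) - (\<Sum>k\<le>n. a k * Z w ^ k))"
   by (simp add: right_diff_distrib sum_distrib_left mult.left_commute)
  then have "\<bar>W w * G (Z w) - (\<Sum>k\<le>n. a k * (W w * Z w ^ k))\<bar> = W w * \<bar>G (Z w) - (\<Sum>k\<le>n. a k * Z w ^ k)\<bar>"
   using W(2)[of w] by (simp only: abs_mult abs_of_nonneg)
  also have "... \<le> W w * e" by (rule mult_left_mono[OF a W(2)]) (use Z(2)[of w] in simp)
  finally show "\<bar>W w * G (Z w) - (\<Sum>k\<le>n. a k * (W w * Z w ^ k))\<bar> \<le> e * W w" by (simp only: mult.commute)
 qed
 finally show ?thesis unfolding s by simp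
qed

text \<open>Weierstrass on [0, 1]: a continuous function is uniformly close to a polynomial, and
  polynomials are covered by the assumed moments. With Z = exp (- \<tau>) the moments are Laplace
  transforms at shifted arguments. The weights allow Lebesgue measure as the limit space.\<close>

lemma moments_tendsto:
 fixes G :: "real \<Rightarrow> real" and N :: "'i \<Rightarrow> 'a measure" and N0 :: "'b measure"
 assumes W: "\<And>i. integrable (N i) (W i)" "\<And>i w. 0 \<le> W i w"
  and Z: "\<And>i. Z i \<in> borel_measurable (N i)" "\<And>i w. 0 \<le> Z i w \<and> Z i w \<le> 1"
  and W0: "integrable N0 W0" "\<And>w. 0 \<le> W0 w" and Z0: "Z0 \<in> borel_measurable N0" "\<And>w. 0 \<le> Z0 w \<and> Z0 w \<le> 1"
  and mom: "\<And>k. ((\<lambda>i. LINT w|N i. W i w * Z i w ^ k) \<longlongrightarrow> (LINT w|N0. W0 w * Z0 w ^ k)) F"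
  and G: "continuous_on UNIV G"
 shows "((\<lambda>i. LINT w|N i. W i w * G (Z i w)) \<longlongrightarrow> (LINT w|N0. W0 w * G (Z0 w))) F"
proof (rule tendstoI)
 fix e :: real assume e: "0 < e"
 \<comment> \<open>The total weights are eventually below B, so d B = e / 4 bounds the polynomial
   approximation error on both sides.\<close>
 define B where "B = (LINT w|N0. W0 w) + 1"
 have B: "1 \<le> B" unfolding B_def using W0(2) by (simp add: LINT_nonneg)
 define d where "d = e / (4 * B)"
 have d: "0 < d" "d * B = e / 4" using e B by (auto simp: d_def)
 obtain g where "real_polynomial_function g" and g: "\<And>u. u \<in> {0..1} \<Longrightarrow> \<bar>G u - g u\<bar> < d"
  by (rule Stone_Weierstrass_real_polynomial_function[of "{0..1}" G d]) (use d continuous_on_subset[OF G] in auto)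
 then obtain a n where gs: "g = (\<lambda>u. \<Sum>k\<le>n. a k * u ^ k)" unfolding real_polynomial_function_iff_sum by blast
 have a: "\<bar>G u - (\<Sum>k\<le>n. a k * u ^ k)\<bar> \<le> d" if "u \<in> {0..1}" for u using g[OF that] unfolding gs by simp
 have A0: "\<bar>(LINT w|N0. W0 w * G (Z0 w)) - (\<Sum>k\<le>n. a k * (LINT w|N0. W0 w * Z0 w ^ k))\<bar> \<le> d * (LINT w|N0. W0 w)"
  by (rule moments_approx[OF W0 Z0 G a])
 have Ai: "\<bar>(LINT w|N i. W i w * G (Z i w)) - (\<Sum>k\<le>n. a k * (LINT w|N i. W i w * Z i w ^ k))\<bar> \<le> d * (LINT w|N i. W i w)" for i
  by (rule moments_approx[OF W Z G a])
 have "((\<lambda>i. \<Sum>k\<le>n. a k * (LINT w|N i. W i w * Z i w ^ k)) \<longlongrightarrow> (\<Sum>k\<le>n. a k * (LINT w|N0. W0 w * Z0 w ^ k))) F"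
  by (intro tendsto_sum tendsto_mult tendsto_const mom)
 from tendstoD[OF this, of "e / 4"] have ev1: "\<forall>\<^sub>F i in F. dist (\<Sum>k\<le>n. a k * (LINT w|N i. W i w * Z i w ^ k)) (\<Sum>k\<le>n. a k * (LINT w|N0. W0 w * Z0 w ^ k)) < e / 4" using e by simp
 have "((\<lambda>i. LINT w|N i. W i w) \<longlongrightarrow> (LINT w|N0. W0 w)) F" using mom[of 0] by simp
 from order_tendstoD(2)[OF this, of B] have ev2: "\<forall>\<^sub>F i in F. (LINT w|N i. W i w) < B" by (simp add: B_def)
 show "\<forall>\<^sub>F i in F. dist (LINT w|N i. W i w * G (Z i w)) (LINT w|N0. W0 w * G (Z0 w)) < e"
  using ev1 ev2
 proof eventually_elim
  case (elim i)
  have "d * (LINT w|N i. W i w) \<le> e / 4" unfolding d(2)[symmetric] by (rule mult_left_mono) (use elim(2) d in auto)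
  moreover have "d * (LINT w|N0. W0 w) \<le> e / 4" unfolding d(2)[symmetric] by (rule mult_left_mono) (use d in \<open>auto simp: B_def\<close>)
  ultimately show ?case using Ai[of i] A0 elim(1) e unfolding dist_real_def by linarith
 qed
qed

section \<open>Skorokhod continuity of the area\<close>

text \<open>Points of oscillation at least e cannot accumulate: one-sided limits make the path
  nearly constant on either side of every point. A set without limit points is countable.\<close>

lemma countable_discontinuities:
 assumes c: "cadlag_on {0..s} w"
 shows "countable {t \<in> {0<..<s}. \<not> isCont w t}"
proof -
 define J where "J e = {t \<in> {0<..<s}. \<forall>dl>0. \<exists>u v. \<bar>u - t\<bar> < dl \<and> \<bar>v - t\<bar> < dl \<and> e \<le> \<bar>w u - w v\<bar>}" for e :: real
 have lim: "countable (J e)" if e: "0 < e" for e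
 proof (rule no_limpt_imp_countable)
  fix t
  show "\<not> t islimpt J e"
  proof (cases "t \<in> {0..s}")
   case False
   have "J e \<subseteq> {0..s}" by (auto simp: J_def)
   then show ?thesis using False closed_limpt[of "{0..s}"] islimpt_subset by blast
  next
   case True
   obtain l where r: "(w \<longlongrightarrow> w t) (at t within ({0..s} \<inter> {t<..}))" and l: "(w \<longlongrightarrow> l) (at t within ({0..s} \<inter> {..<t}))"
    using c True unfolding cadlag_on_def by blast
   have e2: "0 < e / 2" using e by simp
   obtain d1 where d1: "0 < d1" "\<And>u. u \<in> {0..s} \<Longrightarrow> t < u \<Longrightarrow> \<bar>u - t\<bar> < d1 \<Longrightarrow> \<bar>w u - w t\<bar> < e / 2"
    using tendstoD[OF r e2] unfolding eventually_at dist_real_def by auto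
   obtain d2 where d2: "0 < d2" "\<And>u. u \<in> {0..s} \<Longrightarrow> u < t \<Longrightarrow> \<bar>u - t\<bar> < d2 \<Longrightarrow> \<bar>w u - l\<bar> < e / 2"
    using tendstoD[OF l e2] unfolding eventually_at dist_real_def by auto
   define d where "d = min d1 d2"
   have d: "0 < d" "d \<le> d1" "d \<le> d2" using d1 d2 by (auto simp: d_def)
   have no: "t' \<notin> J e" if t': "\<bar>t' - t\<bar> < d" "t' \<noteq> t" for t'
   proof
    assume "t' \<in> J e"
    then have ts: "0 < t'" "t' < s" and H: "\<And>dl. 0 < dl \<Longrightarrow> \<exists>u v. \<bar>u - t'\<bar> < dl \<and> \<bar>v - t'\<bar> < dl \<and> e \<le> \<bar>w u - w v\<bar>"
     by (auto simp: J_def)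
    define dl where "dl = min (min t' (s - t')) (min (\<bar>t' - t\<bar>) (d - \<bar>t' - t\<bar>))"
    have dl: "0 < dl" "dl \<le> t'" "dl \<le> s - t'" "dl \<le> \<bar>t' - t\<bar>" "dl \<le> d - \<bar>t' - t\<bar>" using ts t' by (auto simp: dl_def)
    obtain u v where uv: "\<bar>u - t'\<bar> < dl" "\<bar>v - t'\<bar> < dl" "e \<le> \<bar>w u - w v\<bar>" using H[OF dl(1)] by blast
    have in_s: "u \<in> {0..s}" "v \<in> {0..s}" using uv dl by auto
    have near: "\<bar>u - t\<bar> < d" "\<bar>v - t\<bar> < d" using uv dl by linarith+
    show False
    proof (cases "t < t'")
     case True
     then have "t < u" "t < v" using uv dl by linarith+
     then have "\<bar>w u - w t\<bar> < e / 2" "\<bar>w v - w t\<bar> < e / 2" using d1(2) in_s near d by auto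
     then show False using uv(3) by linarith
    next
     case False
     then have "u < t" "v < t" using uv dl t' by linarith+
     then have "\<bar>w u - l\<bar> < e / 2" "\<bar>w v - l\<bar> < e / 2" using d2(2) in_s near d by auto
     then show False using uv(3) by linarith
    qed
   qed
   show ?thesis
   proof
    assume "t islimpt J e"
    then obtain t' where "t' \<in> J e" "t' \<noteq> t" "dist t' t < d" using d(1) unfolding islimpt_approachable by blast
    then show False using no by (simp add: dist_real_def)
   qed
  qed
 qed
 have "{t \<in> {0<..<s}. \<not> isCont w t} \<subseteq> (\<Union>n. J (1 / real (Suc n)))"
 proof
  fix t assume t: "t \<in> {t \<in> {0<..<s}. \<not> isCont w t}"
  then have nc: "\<not> isCont w t" by blast
  obtain e where e0: "0 < e" and ne: "\<not> (\<exists>d>0. \<forall>u. \<bar>u - t\<bar> < d \<longrightarrow> \<bar>w u - w t\<bar> < e)"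
   using nc unfolding continuous_at_eps_delta dist_real_def by blast
  have e: "0 < e" "\<And>d. 0 < d \<Longrightarrow> \<exists>u. \<bar>u - t\<bar> < d \<and> e \<le> \<bar>w u - w t\<bar>"
   using ne e0 by (meson not_less)+
  obtain n where n: "1 / real (Suc n) < e" using reals_Archimedean[OF e(1)] by (auto simp: inverse_eq_divide)
  have "t \<in> J (1 / real (Suc n))"
   unfolding J_def mem_Collect_eq
  proof (intro conjI allI impI)
   show "t \<in> {0<..<s}" using t by blast
   fix d :: real assume d: "0 < d"
   obtain u where "\<bar>u - t\<bar> < d" "e \<le> \<bar>w u - w t\<bar>" using e(2)[OF d] by blast
   then show "\<exists>u v. \<bar>u - t\<bar> < d \<and> \<bar>v - t\<bar> < d \<and> 1 / real (Suc n) \<le> \<bar>w u - w v\<bar>"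
    using n d by (intro exI[of _ u] exI[of _ t]) auto
  qed
  then show "t \<in> (\<Union>n. J (1 / real (Suc n)))" by blast
 qed
 moreover have "countable (\<Union>n. J (1 / real (Suc n)))" by (intro countable_UN lim) auto
 ultimately show ?thesis by (rule countable_subset)
qed

lemma AE_isCont_cadlag:
 assumes "cadlag_on {0..s} w"
 shows "AE t in lborel. t \<in> {0<..<s} \<longrightarrow> isCont w t"
proof -
 have "AE t in lborel. t \<notin> {t \<in> {0<..<s}. \<not> isCont w t}"
  by (rule AE_not_in) (rule countable_imp_null_set_lborel[OF countable_discontinuities[OF assms]])
 then show ?thesis by eventually_elim auto
qed

lemma borel_measurable_cadlag:
 assumes "cadlag_on {0..s} w"
 shows "(\<lambda>t. indicator {0..s} t *\<^sub>R w t :: real) \<in> borel_measurable borel"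
proof (rule borel_measurable_continuous_countable_exceptions)
 let ?X = "{0, s} \<union> {t \<in> {0<..<s}. \<not> isCont w t}"
 show "countable ?X" using countable_discontinuities[OF assms] by simp
 show "continuous_on (- ?X) (\<lambda>t. indicator {0..s} t *\<^sub>R w t)"
 proof (intro continuous_at_imp_continuous_on ballI)
  fix t assume t: "t \<in> - ?X"
  consider "t < 0 \<or> s < t" | "t \<in> {0<..<s}" "isCont w t" using t by force
  then show "isCont (\<lambda>t. indicator {0..s} t *\<^sub>R w t) t"
  proof cases
   case 1
   have e: "\<forall>\<^sub>F u in nhds t. indicator {0..s} u *\<^sub>R w u = 0"
    using 1 by (intro eventually_nhds_in_open[of "- {0..s}" t, THEN eventually_mono]) auto
   show ?thesis unfolding isCont_cong[OF e] by simp
  next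
   case 2
   have e: "\<forall>\<^sub>F u in nhds t. indicator {0..s} u *\<^sub>R w u = w u"
    using 2 by (intro eventually_nhds_in_open[of "{0<..<s}" t, THEN eventually_mono]) auto
   show ?thesis unfolding isCont_cong[OF e] using 2 by simp
  qed
 qed
qed

text \<open>At a continuity point of the limit path the time change disappears in the limit, and all
  but countably many times are of this kind. The paths are uniformly bounded, so dominated
  convergence applies.\<close>

lemma skorokhod_close_tendsto_area:
 assumes x: "x \<in> cadlag_paths {0..s}" and y: "\<And>n. y n \<in> cadlag_paths {0..s}"
  and e: "\<And>n. e n \<in> skorokhod_close s (y n) x" "e \<longlonglongrightarrow> 0"
 shows "(\<lambda>n. LBINT t:{0..s}. y n t) \<longlonglongrightarrow> (LBINT t:{0..s}. x t)"
proof -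
 have cx: "cadlag_on {0..s} x" and cy: "\<And>n. cadlag_on {0..s} (y n)" using x y by (auto simp: cadlag_paths_def)
 obtain C where C: "\<And>t. t \<in> {0..s} \<Longrightarrow> \<bar>x t\<bar> \<le> C" using cadlag_on_bounded[OF cx] by blast
 obtain K where K: "\<And>n. \<bar>e n\<bar> \<le> K" using convergent_imp_Bseq[OF convergentI[OF e(2)]] by (auto simp: Bseq_def)
 have "\<forall>n. \<exists>\<mu>. time_change s \<mu> \<and> (\<forall>t\<in>{0..s}. \<bar>\<mu> t - t\<bar> \<le> e n \<and> \<bar>y n t - x (\<mu> t)\<bar> \<le> e n)"
  using e(1) unfolding skorokhod_close_def by blast
 then obtain \<mu> where \<mu>: "\<And>n. time_change s (\<mu> n)"
  "\<And>n t. t \<in> {0..s} \<Longrightarrow> \<bar>\<mu> n t - t\<bar> \<le> e n" "\<And>n t. t \<in> {0..s} \<Longrightarrow> \<bar>y n t - x (\<mu> n t)\<bar> \<le> e n" by metis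
 have \<mu>s: "\<mu> n t \<in> {0..s}" if "t \<in> {0..s}" for n t using \<mu>(1)[of n] that by (auto simp: time_change_def dest: bij_betwE)
 show ?thesis
  unfolding set_lebesgue_integral_def
 proof (rule integral_dominated_convergence[where w = "\<lambda>t. (C + K) * indicator {0..s} t"])
  show "(\<lambda>t. indicator {0..s} t *\<^sub>R x t) \<in> borel_measurable lborel" using borel_measurable_cadlag[OF cx] by simp
  show "(\<lambda>t. indicator {0..s} t *\<^sub>R y n t) \<in> borel_measurable lborel" for n using borel_measurable_cadlag[OF cy] by simp
  show "integrable lborel (\<lambda>t. (C + K) * indicator {0..s} t :: real)" by (intro integrable_mult_right integrable_real_indicator) (auto simp: emeasure_lborel_Icc_eq)
  show "AE t in lborel. norm (indicator {0..s} t *\<^sub>R y n t) \<le> (C + K) * indicator {0..s} t" for n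
  proof (rule AE_I2)
   fix t
   have "\<bar>y n t\<bar> \<le> C + K" if "t \<in> {0..s}" using \<mu>(3)[OF that, of n] C[OF \<mu>s[OF that, of n]] K[of n] by linarith
   then show "norm (indicator {0..s} t *\<^sub>R y n t) \<le> (C + K) * indicator {0..s} t" by (auto simp: indicator_def)
  qed
  show "AE t in lborel. (\<lambda>n. indicator {0..s} t *\<^sub>R y n t) \<longlonglongrightarrow> indicator {0..s} t *\<^sub>R x t"
   using AE_isCont_cadlag[OF cx] AE_lborel_singleton[of 0] AE_lborel_singleton[of s]
  proof eventually_elim
   case (elim t)
   show ?case
   proof (cases "t \<in> {0..s}")
    case True
    then have ct: "isCont x t" using elim by auto
    have "(\<lambda>n. \<mu> n t - t) \<longlonglongrightarrow> 0" by (rule Lim_null_comparison[OF _ e(2)]) (use \<mu>(2)[OF True] in auto)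
    then have "(\<lambda>n. \<mu> n t) \<longlonglongrightarrow> t" by (simp add: LIM_zero_iff)
    then have a: "(\<lambda>n. x (\<mu> n t)) \<longlonglongrightarrow> x t" by (rule isCont_tendsto_compose[OF ct])
    have "(\<lambda>n. y n t - x (\<mu> n t)) \<longlonglongrightarrow> 0" by (rule Lim_null_comparison[OF _ e(2)]) (use \<mu>(3)[OF True] in auto)
    from tendsto_add[OF this a] have "(\<lambda>n. y n t) \<longlonglongrightarrow> x t" by simp
    then show ?thesis by (intro tendsto_scaleR tendsto_const)
   qed simp
  qed
 qed
qed

text \<open>Makes bounded continuous functions of the area admissible as test functions in
  \<open>weak_limit_upto\<close>.\<close>

lemma continuous_map_area:
 fixes f :: "real \<Rightarrow> real"
 assumes f: "continuous_on UNIV f"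
 shows "continuous_map (skorokhod_topology s) euclideanreal (\<lambda>w. f (LBINT t:{0..s}. w t))"
proof -
 interpret Metric_space "cadlag_paths {0..s}" "skorokhod_dist s" by (rule Metric_space_skorokhod)
 show ?thesis
  unfolding skorokhod_topology_def continuous_map_from_metric
 proof (intro conjI ballI allI impI)
  show "(\<lambda>w. f (LBINT t:{0..s}. w t)) \<in> cadlag_paths {0..s} \<rightarrow> topspace euclideanreal" by simp
  fix x U assume x: "x \<in> cadlag_paths {0..s}" and U: "openin euclideanreal U \<and> f (LBINT t:{0..s}. x t) \<in> U"
  show "\<exists>r>0. \<forall>y. y \<in> cadlag_paths {0..s} \<and> skorokhod_dist s x y < r \<longrightarrow> f (LBINT t:{0..s}. y t) \<in> U"
  proof (rule ccontr)
   assume "\<not> ?thesis"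
   then have "\<forall>n. \<exists>y. y \<in> cadlag_paths {0..s} \<and> skorokhod_dist s x y < 1 / real (Suc n) \<and> f (LBINT t:{0..s}. y t) \<notin> U"
    by (metis of_nat_0_less_iff zero_less_Suc zero_less_divide_1_iff)
   then obtain y where y: "\<And>n. y n \<in> cadlag_paths {0..s}" "\<And>n. skorokhod_dist s x (y n) < 1 / real (Suc n)" "\<And>n. f (LBINT t:{0..s}. y n t) \<notin> U"
    by metis
   have "\<exists>e\<in>skorokhod_close s x (y n). e < 1 / real (Suc n)" for n
   proof -
    have "Inf (skorokhod_close s x (y n)) < 1 / real (Suc n)" using y(1,2)[of n] x by (simp only: skorokhod_dist_def if_True simp_thms)
    from cInf_lessD[OF skorokhod_close_nonempty[OF x y(1)] this] show ?thesis by blast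
   qed
   then obtain e where e: "\<And>n. e n \<in> skorokhod_close s x (y n)" "\<And>n. e n < 1 / real (Suc n)" by metis
   have e0: "0 < e n" for n using e(1)[of n] by (simp add: skorokhod_close_def)
   have "e \<longlonglongrightarrow> 0"
   proof (rule Lim_null_comparison)
    show "\<forall>\<^sub>F n in sequentially. norm (e n) \<le> 1 / real (Suc n)" using e(2) e0 by (intro always_eventually allI) (simp only: real_norm_def abs_of_pos less_imp_le)
    show "(\<lambda>n. 1 / real (Suc n)) \<longlonglongrightarrow> 0" by (rule lim_1_over_real_power[of 1, simplified, THEN LIMSEQ_Suc])
   qed
   then have "(\<lambda>n. LBINT t:{0..s}. y n t) \<longlonglongrightarrow> (LBINT t:{0..s}. x t)"
    using e(1) skorokhod_close_sym by (intro skorokhod_close_tendsto_area[OF x y(1), of e]) blast+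
   then have "(\<lambda>n. f (LBINT t:{0..s}. y n t)) \<longlonglongrightarrow> f (LBINT t:{0..s}. x t)"
    using f by (intro isCont_tendsto_compose[of _ f]) (auto simp: continuous_on_eq_continuous_at)
   then have "\<forall>\<^sub>F n in sequentially. f (LBINT t:{0..s}. y n t) \<in> U"
    by (rule topological_tendstoD[OF _ iffD2[OF open_openin conjunct1[OF U]] conjunct2[OF U]])
   then show False using y(3) by simp
  qed
 qed
qed

lemma measurable_area:
 assumes s: "0 < s"
 shows "(\<lambda>w. LBINT t:{0..s}. w t) \<in> borel_measurable (path_space {0..s})"
proof (rule borel_measurable_LIMSEQ_real)
 let ?h = "\<lambda>n. s / real (Suc n)"
 fix w assume "w \<in> space (path_space {0..s})"
 then have c: "cadlag_on {0..s} w" by (simp add: cadlag_paths_def)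
 obtain C where C: "\<And>t. t \<in> {0..s} \<Longrightarrow> \<bar>w t\<bar> \<le> C" using cadlag_on_bounded[OF c] by blast
 have "(\<lambda>n. \<Sum>j<Suc n. ?h n *\<^sub>R w (min (real (Suc j) * ?h n) s)) \<longlonglongrightarrow> (LBINT t:{0..<s}. w (min t s))"
 proof (rule riemann_sum_tendsto(2)[where f = "\<lambda>t. w (min t s)" and h = ?h and k = Suc and T = s and C = C])
  show "0 < ?h n" for n using s by simp
  show "?h \<longlonglongrightarrow> 0" by (rule LIMSEQ_Suc[OF lim_const_over_n])
  have k: "real (Suc n) * ?h n = s" for n by simp
  show "(\<lambda>n. real (Suc n) * ?h n) \<longlonglongrightarrow> s" unfolding k by simp
  show "real (Suc n) * ?h n \<le> s" for n unfolding k by simp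
  show "norm (w (min t s)) \<le> C" if "0 \<le> t" "t \<le> s" for t using C[of "min t s"] that by simp
  fix b :: "nat \<Rightarrow> real" and t :: real assume t: "0 \<le> t" and b: "b \<longlonglongrightarrow> t" "\<And>n. t \<le> b n"
  have bt: "(\<lambda>n. min (b n) s) \<longlonglongrightarrow> min t s" by (intro tendsto_min b tendsto_const)
  show "(\<lambda>n. w (min (b n) s)) \<longlonglongrightarrow> w (min t s)"
  proof (rule tendstoI)
   fix e :: real assume e: "0 < e"
   have "(w \<longlongrightarrow> w (min t s)) (at (min t s) within ({0..s} \<inter> {min t s<..}))" using c t s unfolding cadlag_on_def by auto
   from tendstoD[OF this e] obtain d where d: "0 < d" "\<And>u. u \<in> {0..s} \<Longrightarrow> min t s < u \<Longrightarrow> dist u (min t s) < d \<Longrightarrow> dist (w u) (w (min t s)) < e"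
    unfolding eventually_at by auto
   show "\<forall>\<^sub>F n in sequentially. dist (w (min (b n) s)) (w (min t s)) < e"
    using tendstoD[OF bt d(1)]
   proof eventually_elim
    case (elim n)
    have le: "min t s \<le> min (b n) s" using b(2)[of n] by simp
    have i: "min (b n) s \<in> {0..s}" using b(2)[of n] t s by auto
    show ?case
    proof (cases "min (b n) s = min t s")
     case True
     then show ?thesis using e by simp
    next
     case False
     then show ?thesis using le by (intro d(2)[OF i _ elim]) linarith
    qed
   qed
  qed
 qed
 also have "(LBINT t:{0..<s}. w (min t s)) = (LBINT t:{0..s}. w t)"
 proof -
  have "(LBINT t:{0..<s}. w (min t s)) = (area s w)" by (intro set_lebesgue_integral_cong) auto
  also have "... = (LBINT t:{0..<s}. indicator {0..s} t *\<^sub>R w t)" by (intro set_lebesgue_integral_cong) auto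
  also have "... = (LBINT t:{0..s}. indicator {0..s} t *\<^sub>R w t)" by (rule LBINT_atLeastLessThan[OF borel_measurable_cadlag[OF c]])
  also have "... = (LBINT t:{0..s}. w t)" by (intro set_lebesgue_integral_cong) auto
  finally show ?thesis .
 qed
 finally show "(\<lambda>n. \<Sum>j<Suc n. ?h n *\<^sub>R w (min (real (Suc j) * ?h n) s)) \<longlonglongrightarrow> (LBINT t:{0..s}. w t)" .
next
 fix n :: nat
 show "(\<lambda>w. \<Sum>j<Suc n. (s / real (Suc n)) *\<^sub>R w (min (real (Suc j) * (s / real (Suc n))) s)) \<in> borel_measurable (path_space {0..s})"
  by (intro borel_measurable_sum borel_measurable_scaleR borel_measurable_const measurable_coord[OF refl])
qed

lemma exp_diff_le: assumes "0 \<le> u" "u \<le> v" shows "exp (- u) - exp (- v) \<le> v - (u::real)"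
proof -
 have "exp (- u) - exp (- v) = exp (- u) * (1 - exp (- (v - u)))" by (simp add: right_diff_distrib exp_add[symmetric])
 also have "... \<le> 1 * (v - u)"
 proof (rule mult_mono)
  show "1 - exp (- (v - u)) \<le> v - u" using exp_ge_add_one_self[of "- (v - u)"] by linarith
 qed (use assms in auto)
 finally show ?thesis by simp
qed

section \<open>The law of the passage time\<close>

text \<open>(exp (- a r) - exp (- b r)) / r is the integral of exp (- q r) over q between a and b.
  After exchanging the integrals, the one over r is Gamma (1 - 1 / \<alpha>) q^(1/\<alpha> - 1), and
  its antiderivative in q brings the factor \<alpha>. This is the origin of the constant in the
  theorem.\<close>

lemma levy_measure_integral:
 fixes a b \<alpha> :: real
 assumes a: "0 < a" "a < b" and \<alpha>: "1 < \<alpha>"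
 shows "has_bochner_integral lborel (\<lambda>r. indicator {0<..} r * ((exp (- a * r) - exp (- b * r)) * r powr (- (1 + 1 / \<alpha>))))
  (\<alpha> * Gamma (1 - 1 / \<alpha>) * (b powr (1 / \<alpha>) - a powr (1 / \<alpha>)))"
proof (rule has_bochner_integral_nn_integral)
 define gma where "gma = 1 - 1 / \<alpha>"
 have gma: "0 < gma" using \<alpha> by (simp add: gma_def)
 have G0: "0 < Gamma gma" using gma by (rule Gamma_real_pos)
 define h where "h q r = indicator {0<..} r * (r powr (gma - 1) * exp (- q * r))" for q r :: real
 have h0: "0 \<le> h q r" for q r by (simp add: h_def)
 have hm: "(\<lambda>(r, q). ennreal (indicator {a..b} q * h q r)) \<in> borel_measurable (lborel \<Otimes>\<^sub>M lborel)"
  unfolding h_def by measurable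
 show "(\<lambda>r. indicator {0<..} r * ((exp (- a * r) - exp (- b * r)) * r powr (- (1 + 1 / \<alpha>)))) \<in> borel_measurable lborel" by measurable
 show "AE r in lborel. 0 \<le> indicator {0<..} r * ((exp (- a * r) - exp (- b * r)) * r powr (- (1 + 1 / \<alpha>)))"
  using a by (intro AE_I2) (auto simp: indicator_def intro!: mult_nonneg_nonneg)
 show "0 \<le> \<alpha> * Gamma (1 - 1 / \<alpha>) * (b powr (1 / \<alpha>) - a powr (1 / \<alpha>))"
  using a \<alpha> G0 unfolding gma_def by (intro mult_nonneg_nonneg) (auto intro!: powr_mono2)
 have inner_q: "(\<integral>\<^sup>+q. ennreal (indicator {a..b} q * h q r) \<partial>lborel) = ennreal (indicator {0<..} r * ((exp (- a * r) - exp (- b * r)) * r powr (- (1 + 1 / \<alpha>))))" for r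
 proof (cases "0 < r")
  case True
  have "(\<integral>\<^sup>+q. ennreal (r powr (gma - 1) * exp (- q * r)) * indicator {a..b} q \<partial>lborel)
    = ennreal (- (r powr (gma - 1) * exp (- b * r) / r) - - (r powr (gma - 1) * exp (- a * r) / r))"
  proof (rule nn_integral_FTC_Icc[where F = "\<lambda>q. - (r powr (gma - 1) * exp (- q * r) / r)"])
   show "((\<lambda>q. - (r powr (gma - 1) * exp (- q * r) / r)) has_real_derivative r powr (gma - 1) * exp (- q * r)) (at q)" for q
    using True by (auto intro!: derivative_eq_intros)
  qed (use a in auto)
  moreover have "r powr (gma - 1) / r = r powr (- (1 + 1 / \<alpha>))"
  proof -
   have "r powr (gma - 1) / r powr 1 = r powr (gma - 1 - 1)" by (rule powr_diff[symmetric])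
   moreover have "gma - 1 - 1 = - (1 + 1 / \<alpha>)" by (simp add: gma_def)
   ultimately show ?thesis using True by simp
  qed
  moreover have "- (r powr (gma - 1) * exp (- b * r) / r) - - (r powr (gma - 1) * exp (- a * r) / r) = (exp (- a * r) - exp (- b * r)) * (r powr (gma - 1) / r)"
   by (simp add: divide_inverse algebra_simps)
  ultimately have *: "(\<integral>\<^sup>+q. ennreal (r powr (gma - 1) * exp (- q * r)) * indicator {a..b} q \<partial>lborel) = ennreal ((exp (- a * r) - exp (- b * r)) * r powr (- (1 + 1 / \<alpha>)))"
   by (simp only:)
  have "(\<integral>\<^sup>+q. ennreal (indicator {a..b} q * h q r) \<partial>lborel) = (\<integral>\<^sup>+q. ennreal (r powr (gma - 1) * exp (- q * r)) * indicator {a..b} q \<partial>lborel)"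
   using True by (intro nn_integral_cong) (simp add: h_def indicator_def)
  then show ?thesis unfolding * using True by simp
 qed (simp add: h_def)
 have inner_r: "(\<integral>\<^sup>+r. ennreal (h q r) \<partial>lborel) = ennreal (Gamma gma * q powr (- gma))" if q: "0 < q" for q
 proof -
  have "ennreal (Gamma gma) = (\<integral>\<^sup>+t. ennreal (indicator {0..} t * t powr (gma - 1) / exp t) \<partial>lborel)"
   by (rule Gamma_conv_nn_integral_real[OF gma])
  also have "... = ennreal \<bar>q\<bar> * (\<integral>\<^sup>+r. ennreal (indicator {0..} (0 + q * r) * (0 + q * r) powr (gma - 1) / exp (0 + q * r)) \<partial>lborel)"
  proof (rule nn_integral_real_affine)
   show "(\<lambda>t. ennreal (indicator {0..} t * t powr (gma - 1) / exp t)) \<in> borel_measurable borel" by measurable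
   show "q \<noteq> 0" using q by simp
  qed
  also have "(\<integral>\<^sup>+r. ennreal (indicator {0..} (0 + q * r) * (0 + q * r) powr (gma - 1) / exp (0 + q * r)) \<partial>lborel) = (\<integral>\<^sup>+r. ennreal (q powr (gma - 1)) * ennreal (h q r) \<partial>lborel)"
  proof (rule nn_integral_cong)
   fix r :: real
   have "indicator {0..} (0 + q * r) * (0 + q * r) powr (gma - 1) / exp (0 + q * r) = q powr (gma - 1) * h q r"
    using q by (cases "0 < r"; cases "r = 0") (auto simp: h_def powr_mult exp_minus indicator_def zero_le_mult_iff divide_inverse)
   then show "ennreal (indicator {0..} (0 + q * r) * (0 + q * r) powr (gma - 1) / exp (0 + q * r)) = ennreal (q powr (gma - 1)) * ennreal (h q r)"
    by (simp add: ennreal_mult'[symmetric])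
  qed
  also have "... = ennreal (q powr (gma - 1)) * (\<integral>\<^sup>+r. ennreal (h q r) \<partial>lborel)"
   by (rule nn_integral_cmult) (unfold h_def, measurable)
  finally have "ennreal (Gamma gma) = ennreal q * ennreal (q powr (gma - 1)) * (\<integral>\<^sup>+r. ennreal (h q r) \<partial>lborel)" using q by (simp add: mult.assoc)
  also have "ennreal q * ennreal (q powr (gma - 1)) = ennreal (q powr gma)" using q by (simp add: ennreal_mult'[symmetric] powr_diff)
  finally have "ennreal (q powr (- gma)) * ennreal (Gamma gma) = (ennreal (q powr (- gma)) * ennreal (q powr gma)) * (\<integral>\<^sup>+r. ennreal (h q r) \<partial>lborel)"
   by (simp add: mult.assoc)
  also have "ennreal (q powr (- gma)) * ennreal (q powr gma) = 1" using q by (simp add: ennreal_mult'[symmetric] powr_add[symmetric])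
  finally have "(\<integral>\<^sup>+r. ennreal (h q r) \<partial>lborel) = ennreal (q powr (- gma)) * ennreal (Gamma gma)" by simp
  also have "... = ennreal (Gamma gma * q powr (- gma))" using G0 by (subst ennreal_mult'') (auto simp: mult.commute)
  finally show ?thesis .
 qed
 have D: "((\<lambda>q. Gamma gma * (\<alpha> * q powr (1 / \<alpha>))) has_real_derivative Gamma gma * q powr (- gma)) (at q)" if "a \<le> q" for q :: real
 proof -
  have q: "0 < q" using that a by linarith
  have "((\<lambda>q. q powr (1 / \<alpha>)) has_real_derivative (1 / \<alpha>) * q powr (1 / \<alpha> - 1)) (at q)" by (rule has_real_derivative_powr[OF q])
  then have "((\<lambda>q. Gamma gma * (\<alpha> * q powr (1 / \<alpha>))) has_real_derivative Gamma gma * (\<alpha> * ((1 / \<alpha>) * q powr (1 / \<alpha> - 1)))) (at q)" by (intro DERIV_cmult)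
  moreover have "Gamma gma * (\<alpha> * ((1 / \<alpha>) * q powr (1 / \<alpha> - 1))) = Gamma gma * q powr (- gma)" using \<alpha> by (simp add: gma_def)
  ultimately show ?thesis by (simp only:)
 qed
 have "(\<integral>\<^sup>+r. ennreal (indicator {0<..} r * ((exp (- a * r) - exp (- b * r)) * r powr (- (1 + 1 / \<alpha>)))) \<partial>lborel) = (\<integral>\<^sup>+r. \<integral>\<^sup>+q. ennreal (indicator {a..b} q * h q r) \<partial>lborel \<partial>lborel)"
  by (simp only: inner_q)
 also have "... = (\<integral>\<^sup>+q. \<integral>\<^sup>+r. ennreal (indicator {a..b} q * h q r) \<partial>lborel \<partial>lborel)"
  by (rule lborel_pair.Fubini'[symmetric]) (rule hm)
 also have "... = (\<integral>\<^sup>+q. ennreal (Gamma gma * q powr (- gma)) * indicator {a..b} q \<partial>lborel)"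
  using a inner_r by (intro nn_integral_cong) (auto simp: indicator_def)
 also have "... = ennreal (Gamma gma * (\<alpha> * b powr (1 / \<alpha>)) - Gamma gma * (\<alpha> * a powr (1 / \<alpha>)))"
  by (rule nn_integral_FTC_Icc[OF _ D]) (use a G0 in auto)
 also have "Gamma gma * (\<alpha> * b powr (1 / \<alpha>)) - Gamma gma * (\<alpha> * a powr (1 / \<alpha>)) = \<alpha> * Gamma (1 - 1 / \<alpha>) * (b powr (1 / \<alpha>) - a powr (1 / \<alpha>))"
  unfolding gma_def by (simp only: right_diff_distrib mult.assoc mult.commute mult.left_commute)
 finally show "(\<integral>\<^sup>+r. ennreal (indicator {0<..} r * ((exp (- a * r) - exp (- b * r)) * r powr (- (1 + 1 / \<alpha>)))) \<partial>lborel)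
  = ennreal (\<alpha> * Gamma (1 - 1 / \<alpha>) * (b powr (1 / \<alpha>) - a powr (1 / \<alpha>)))" .
qed

section \<open>The support of the passage time and disintegration over it\<close>

context positive_start
begin

text \<open>In law a passage from x is the sum of independent passages from \<theta> x and (1 -
  \<theta>) x, and by scaling these are \<theta>^\<alpha> and (1 - \<theta>)^\<alpha> times passages
  from x. The argument is purely analytic: the Laplace transforms multiply correctly at all
  integers, and \<open>moments_tendsto\<close> with constant sequences extends this to continuous
  functions.\<close>

lemma tau_split:
 fixes G :: "real \<Rightarrow> real"
 assumes G: "continuous_on UNIV G" and \<theta>: "0 < \<theta>" "\<theta> < 1"
 shows "(LINT z|(M \<Otimes>\<^sub>M M). G (exp (- (\<theta> powr \<alpha> * tau (fst z) + (1 - \<theta>) powr \<alpha> * tau (snd z))))) = (LINT v|M. G (exp (- tau v)))"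
proof -
 interpret P: pair_prob_space M M ..
 define Z where "Z z = exp (- (\<theta> powr \<alpha> * tau (fst z) + (1 - \<theta>) powr \<alpha> * tau (snd z)))" for z
 have Zm: "Z \<in> borel_measurable (M \<Otimes>\<^sub>M M)" unfolding Z_def[abs_def] by measurable
 have Z01: "0 \<le> Z z \<and> Z z \<le> 1" for z
 proof -
  have "0 \<le> \<theta> powr \<alpha> * tau (fst z) + (1 - \<theta>) powr \<alpha> * tau (snd z)"
   by (intro add_nonneg_nonneg mult_nonneg_nonneg tau_nonneg powr_ge_zero)
  then show ?thesis unfolding Z_def by (simp only: exp_ge_zero exp_le_one_iff neg_le_0_iff_le simp_thms)
 qed
 have mom: "(LINT z|(M \<Otimes>\<^sub>M M). 1 * Z z ^ k) = (LINT v|M. 1 * exp (- tau v) ^ k)" for k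
 proof (cases "k = 0")
  case True
  then show ?thesis using P.prob_space prob_space by simp
 next
  case False
  then have k: "0 < real k" by simp
  have rt: "(real k * c powr \<alpha>) powr (1 / \<alpha>) = real k powr (1 / \<alpha>) * c" if "0 < c" for c
   using that k \<alpha>1 by (simp add: powr_mult powr_powr)
  have e: "Z (v, w) ^ k = exp (- (real k * \<theta> powr \<alpha>) * tau v) * exp (- (real k * (1 - \<theta>) powr \<alpha>) * tau w)" for v w
   unfolding Z_def exp_of_nat_mult[symmetric] exp_add[symmetric] by (simp add: algebra_simps)
  have "(LINT z|(M \<Otimes>\<^sub>M M). Z z ^ k) = (LINT v|M. LINT w|M. Z (v, w) ^ k)"
  proof (rule P.integral_fst'[symmetric])
   show "integrable (M \<Otimes>\<^sub>M M) (\<lambda>z. Z z ^ k)"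
    by (rule P.integrable_const_bound[where B = 1]) (use Z01 Zm in \<open>auto intro!: AE_I2 power_le_one\<close>)
  qed
  also have "... = (LINT v|M. exp (- (real k * \<theta> powr \<alpha>) * tau v) * (LINT w|M. exp (- (real k * (1 - \<theta>) powr \<alpha>) * tau w)))"
   unfolding e by (subst integral_mult_right_zero) (rule refl)
  also have "... = (LINT v|M. exp (- (real k * \<theta> powr \<alpha>) * tau v)) * (LINT w|M. exp (- (real k * (1 - \<theta>) powr \<alpha>) * tau w))"
   by (rule integral_mult_left_zero)
  also have "... = exp (- (real k powr (1 / \<alpha>) * \<theta>) * x) * exp (- (real k powr (1 / \<alpha>) * (1 - \<theta>)) * x)"
   using laplace_tau[of "real k * \<theta> powr \<alpha>"] laplace_tau[of "real k * (1 - \<theta>) powr \<alpha>"] k \<theta> by (simp only: rt zero_less_mult_iff powr_gt_zero) simp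
  also have "... = exp (- (real k powr (1 / \<alpha>)) * x)" unfolding exp_add[symmetric] by (simp add: algebra_simps)
  also have "... = (LINT v|M. exp (- real k * tau v))" by (rule laplace_tau[OF k, symmetric])
  also have "... = (LINT v|M. exp (- tau v) ^ k)" unfolding exp_of_nat_mult[symmetric] by simp
  finally show ?thesis by simp
 qed
 have one: "integrable (M \<Otimes>\<^sub>M M) (\<lambda>_. 1 :: real)" "integrable M (\<lambda>_. 1 :: real)"
  using P.integrable_const integrable_const by auto
 have Z0: "(\<lambda>v. exp (- tau v)) \<in> borel_measurable M" "\<And>v. 0 \<le> exp (- tau v) \<and> exp (- tau v) \<le> 1"
  using tau_nonneg by auto
 have cm: "((\<lambda>i::nat. LINT z|(M \<Otimes>\<^sub>M M). 1 * Z z ^ k) \<longlongrightarrow> (LINT v|M. 1 * exp (- tau v) ^ k)) sequentially" for k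
  unfolding mom by (rule tendsto_const)
 have "((\<lambda>i::nat. LINT z|(M \<Otimes>\<^sub>M M). 1 * G (Z z)) \<longlongrightarrow> (LINT v|M. 1 * G (exp (- tau v)))) sequentially"
  by (rule moments_tendsto[where N = "\<lambda>_. M \<Otimes>\<^sub>M M" and W = "\<lambda>_ _. 1" and Z = "\<lambda>_. Z", OF one(1) zero_le_one Zm Z01 one(2) zero_le_one Z0 cm G])
 from LIMSEQ_unique[OF tendsto_const this] show ?thesis unfolding Z_def by (simp only: mult_1)
qed

definition in_support :: "real \<Rightarrow> bool" where
 "in_support p \<longleftrightarrow> (\<forall>dl>0. 0 < prob {w \<in> space M. \<bar>tau w - p\<bar> < dl})"

text \<open>Two independent copies near p place the combination of \<open>tau_split\<close> near the
  scaled point with positive probability. Distances are measured after applying exp (- r), where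
  continuous test functions are available.\<close>

lemma in_support_scale:
 assumes p: "in_support p" "0 < p" and \<theta>: "0 < \<theta>" "\<theta> < 1"
 shows "in_support ((\<theta> powr \<alpha> + (1 - \<theta>) powr \<alpha>) * p)"
 unfolding in_support_def
proof (intro allI impI)
 fix dl :: real assume dl: "0 < dl"
 interpret P: pair_prob_space M M ..
 define A B where "A = \<theta> powr \<alpha>" and "B = (1 - \<theta>) powr \<alpha>"
 have AB: "0 < A" "A \<le> 1" "0 < B" "B \<le> 1" using \<theta> \<alpha>1 by (auto simp: A_def B_def powr_le1)
 define q where "q = (A + B) * p"
 have q: "0 < q" using AB p by (simp add: q_def)
 \<comment> \<open>Small enough that a distance below d between values of exp (- r) means a distance
   below dl between the values of r.\<close>
 define d where "d = min (exp (- q) - exp (- q - dl)) (exp (- q + dl) - exp (- q))"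
 have d: "0 < d" using dl by (simp add: d_def)
 have dd: "\<bar>r - q\<bar> < dl" if "\<bar>exp (- r) - exp (- q)\<bar> < d" for r
 proof -
  have "exp (- r) < exp (- q + dl)" "exp (- q - dl) < exp (- r)" using that unfolding d_def by linarith+
  then have "- r < - q + dl" "- q - dl < - r" by (simp_all only: exp_less_cancel_iff)
  then show ?thesis by linarith
 qed
 have lip: "\<bar>exp (- r) - exp (- q)\<bar> \<le> \<bar>r - q\<bar>" if "0 \<le> r" for r :: real
 proof -
  show ?thesis using exp_diff_le[of r q] exp_diff_le[of q r] that q by (cases "r \<le> q") auto
 qed
 define G where "G u = max 0 (d - \<bar>u - exp (- q)\<bar>)" for u
 have Gc: "continuous_on UNIV G" unfolding G_def by (intro continuous_intros)
 have Gm[measurable]: "G \<in> borel_measurable borel" by (rule borel_measurable_continuous_onI[OF Gc])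
 define E where "E = {w \<in> space M. \<bar>tau w - p\<bar> < d / 4}"
 have E: "E \<in> sets M" unfolding E_def by measurable
 have "0 < d / 4" using d by simp
 from p(1)[unfolded in_support_def, rule_format, OF this] have pE: "0 < prob E" unfolding E_def .
 have Gb: "0 \<le> G u \<and> G u \<le> d" for u using d by (auto simp: G_def)
 have iG: "integrable (M \<Otimes>\<^sub>M M) (\<lambda>z. G (exp (- (A * tau (fst z) + B * tau (snd z)))))"
  by (rule P.integrable_const_bound[where B = d]) (use Gb in \<open>auto intro!: AE_I2\<close>)
 have "0 < (d / 2) * (prob E * prob E)" using d pE by simp
 also have "prob E * prob E = measure (M \<Otimes>\<^sub>M M) (E \<times> E)"
  unfolding measure_def emeasure_pair_measure_Times[OF E E] by (simp add: enn2real_mult)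
 also have "(d / 2) * measure (M \<Otimes>\<^sub>M M) (E \<times> E) = (LINT z|(M \<Otimes>\<^sub>M M). (d / 2) * indicator (E \<times> E) z)" using E by simp
 also have "... \<le> (LINT z|(M \<Otimes>\<^sub>M M). G (exp (- (A * tau (fst z) + B * tau (snd z)))))"
 proof (rule LINT_mono[OF _ iG])
  show "integrable (M \<Otimes>\<^sub>M M) (\<lambda>z. (d / 2) * indicator (E \<times> E) z)" using E by (intro integrable_mult_right integrable_real_indicator) (simp_all add: emeasure_pair_measure_Times emeasure_eq_measure ennreal_mult''[symmetric])
  fix z
  show "(d / 2) * indicator (E \<times> E) z \<le> G (exp (- (A * tau (fst z) + B * tau (snd z))))"
  proof (cases "z \<in> E \<times> E")
   case True
   then have t: "\<bar>tau (fst z) - p\<bar> < d / 4" "\<bar>tau (snd z) - p\<bar> < d / 4" unfolding E_def mem_Times_iff by blast+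
   have "A * \<bar>tau (fst z) - p\<bar> \<le> 1 * (d / 4)" "B * \<bar>tau (snd z) - p\<bar> \<le> 1 * (d / 4)" using t AB by (intro mult_mono; simp)+
   then have b: "\<bar>A * (tau (fst z) - p)\<bar> \<le> d / 4" "\<bar>B * (tau (snd z) - p)\<bar> \<le> d / 4" using AB by (simp_all add: abs_mult)
   have "A * tau (fst z) + B * tau (snd z) - q = A * (tau (fst z) - p) + B * (tau (snd z) - p)" by (simp add: q_def algebra_simps)
   then have "\<bar>A * tau (fst z) + B * tau (snd z) - q\<bar> \<le> d / 2" using b by linarith
   moreover have "0 \<le> A * tau (fst z) + B * tau (snd z)" using AB tau_nonneg by (simp add: add_nonneg_nonneg)
   ultimately have "\<bar>exp (- (A * tau (fst z) + B * tau (snd z))) - exp (- q)\<bar> \<le> d / 2" using lip by (meson order_trans)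
   then have "d / 2 \<le> G (exp (- (A * tau (fst z) + B * tau (snd z))))" unfolding G_def by linarith
   then show ?thesis using True by (simp only: indicator_simps mult_1_right)
  qed (simp add: Gb)
 qed
 also have "... = (LINT w|M. G (exp (- tau w)))" unfolding A_def B_def by (rule tau_split[OF Gc \<theta>])
 also have "... \<le> (LINT w|M. d * indicator {w \<in> space M. \<bar>tau w - q\<bar> < dl} w)"
 proof (rule LINT_mono)
  show "integrable M (\<lambda>w. G (exp (- tau w)))"
   by (rule integrable_const_bound[where B = d]) (use Gb in \<open>auto intro!: AE_I2\<close>)
  show "integrable M (\<lambda>w. d * indicator {w \<in> space M. \<bar>tau w - q\<bar> < dl} w)"
   by (intro integrable_mult_right integrable_real_indicator) (measurable, simp add: emeasure_eq_measure)
  fix w assume "w \<in> space M"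
  then show "G (exp (- tau w)) \<le> d * indicator {w \<in> space M. \<bar>tau w - q\<bar> < dl} w"
   using dd[of "tau w"] Gb[of "exp (- tau w)"] by (cases "\<bar>exp (- tau w) - exp (- q)\<bar> < d") (auto simp: G_def indicator_def)
 qed
 also have "... = d * prob {w \<in> space M. \<bar>tau w - q\<bar> < dl}" by simp
 finally show "0 < prob {w \<in> space M. \<bar>tau w - (\<theta> powr \<alpha> + (1 - \<theta>) powr \<alpha>) * p\<bar> < dl}"
  using d unfolding q_def A_def B_def by (simp add: zero_less_mult_iff)
qed

text \<open>A bound q on \<tau> would give 1 - exp (- w x) \<le> q w^\<alpha>. Dividing by w and
  letting w tend to 0 yields x \<le> 0, because \<alpha> > 1.\<close>

lemma tau_unbounded: assumes q: "0 < q" shows "\<not> (AE v in M. tau v \<le> q)"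
proof
 assume b: "AE v in M. tau v \<le> q"
 have le: "1 - exp (- w * x) \<le> w powr \<alpha> * q" if w: "0 < w" for w
 proof -
  have i: "integrable M (\<lambda>v. exp (- (w powr \<alpha>) * tau v))"
   by (rule integrable_const_bound[where B = 1]) (use tau_nonneg in \<open>auto intro!: AE_I2\<close>)
  have "1 - w powr \<alpha> * q = (LINT v|M. 1 - w powr \<alpha> * q)" using prob_space by simp
  also have "... \<le> (LINT v|M. exp (- (w powr \<alpha>) * tau v))"
  proof (rule integral_mono_AE[OF _ i])
   show "AE v in M. 1 - w powr \<alpha> * q \<le> exp (- (w powr \<alpha>) * tau v)"
    using b
   proof eventually_elim
    case (elim v)
    have "1 - w powr \<alpha> * q \<le> 1 + - (w powr \<alpha>) * tau v" using elim by (simp add: mult_left_mono)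
    also have "... \<le> exp (- (w powr \<alpha>) * tau v)" by (rule exp_ge_add_one_self)
    finally show ?case .
   qed
  qed simp
  also have "... = exp (- w * x)" using laplace_tau[of "w powr \<alpha>"] w \<alpha>1 by (simp add: powr_powr)
  finally show ?thesis by simp
 qed
 have "x \<le> 0"
 proof (rule tendsto_le[of "at_right 0"])
  show "((\<lambda>w. (1 - exp (- w * x)) / w) \<longlongrightarrow> x) (at_right 0)" by real_asymp
  show "((\<lambda>w. w powr (\<alpha> - 1) * q) \<longlongrightarrow> 0) (at_right 0)" using \<alpha>1 by real_asymp
  show "\<forall>\<^sub>F w in at_right 0. (1 - exp (- w * x)) / w \<le> w powr (\<alpha> - 1) * q"
   using eventually_at_right_less[of 0]
  proof eventually_elim
   case (elim w)
   have "w powr \<alpha> = w powr (\<alpha> - 1) * w" using powr_add[of w "\<alpha> - 1" 1] elim by simp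
   then have "w powr (\<alpha> - 1) * q * w = w powr \<alpha> * q" by (simp only: mult.assoc mult.commute mult.left_commute)
   then show ?case unfolding pos_divide_le_eq[OF elim] using le[OF elim] by (simp only:)
  qed
 qed simp
 then show False using x_pos by simp
qed

text \<open>The factors \<theta>^\<alpha> + (1 - \<theta>)^\<alpha> fill the range from 2^(1 -
  \<alpha>) to 1. If q is outside the support, then so is every point between q and 2^(\<alpha> - 1)
  q, since a point of the support there could be scaled down to q; by iteration so is everything
  above q. Then \<tau> \<le> q almost surely, against \<open>tau_unbounded\<close>.\<close>

lemma all_in_support: assumes q: "0 < q" shows "in_support q"
proof (rule ccontr)
 assume n: "\<not> in_support q"
 define rh where "rh = 2 powr (\<alpha> - 1)"
 have rh: "1 < rh" using \<alpha>1 by (simp add: rh_def)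
 have step: "\<not> in_support r" if r: "\<not> in_support p" "0 < p" "p \<le> r" "r \<le> p * rh" for p r
 proof
  assume s: "in_support r"
  define h where "h \<theta> = \<theta> powr \<alpha> + (1 - \<theta>) powr \<alpha>" for \<theta> :: real
  have hc: "continuous_on {0..1/2} h" unfolding h_def using \<alpha>1 by (intro continuous_intros continuous_on_powr') auto
  have h0: "h 0 = 1" by (simp add: h_def)
  have "h (1/2) = 2 * (1/2) powr \<alpha>" by (simp add: h_def)
  also have "... = 1 / rh" by (simp add: rh_def powr_divide powr_diff)
  finally have hh: "h (1/2) = 1 / rh" .
  have "h (1/2) \<le> p / r" "p / r \<le> h 0" using r rh unfolding h0 hh by (auto simp: field_simps)
  then obtain \<theta> where \<theta>: "0 \<le> \<theta>" "\<theta> \<le> 1/2" "h \<theta> = p / r"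
   using IVT2'[of h "1/2" "p / r" 0] hc by auto
  show False
  proof (cases "\<theta> = 0")
   case True
   then have "p = r" using \<theta>(3) h0 r by simp
   then show False using s r by simp
  next
   case False
   have "in_support ((\<theta> powr \<alpha> + (1 - \<theta>) powr \<alpha>) * r)" using False \<theta> r by (intro in_support_scale[OF s]) auto
   moreover have "(\<theta> powr \<alpha> + (1 - \<theta>) powr \<alpha>) * r = p" using \<theta>(3) r unfolding h_def by simp
   ultimately show False using r by simp
  qed
 qed
 have all_n: "\<forall>r. q \<le> r \<and> r \<le> q * rh ^ k \<longrightarrow> \<not> in_support r" for k
 proof (induction k)
  case 0
  then show ?case using n by auto
 next
  case (Suc k)
  show ?case
  proof (intro allI impI)
   fix r assume r: "q \<le> r \<and> r \<le> q * rh ^ Suc k"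
   show "\<not> in_support r"
   proof (cases "r \<le> q * rh")
    case True
    then show ?thesis using step[OF n q] r by blast
   next
    case False
    have "q \<le> r / rh" "r / rh \<le> q * rh ^ k" using False r rh by (auto simp: field_simps)
    then have "\<not> in_support (r / rh)" using Suc by blast
    then show ?thesis by (rule step) (use r q rh in \<open>auto simp: field_simps\<close>)
   qed
  qed
 qed
 have none: "\<not> in_support r" if r: "q \<le> r" for r
 proof -
  obtain k where "r / q < rh ^ k" using real_arch_pow[OF rh] by blast
  then have "r \<le> q * rh ^ k" using q by (simp add: field_simps)
  then show ?thesis using all_n r by blast
 qed
 \<comment> \<open>The null balls cover the complement of the support, and a countable subfamily
   with the same union makes that union null.\<close>
 define F where "F = {ball r dl | r dl. 0 < dl \<and> prob {v \<in> space M. \<bar>tau v - r\<bar> < dl} = 0}"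
 have "\<And>S. S \<in> F \<Longrightarrow> open S" by (auto simp: F_def)
 then obtain F' where F': "F' \<subseteq> F" "countable F'" "\<Union>F' = \<Union>F" using Lindelof[of F] by metis
 have "AE v in M. tau v \<notin> S" if SF: "S \<in> F'" for S
 proof -
  obtain r dl where S: "S = ball r dl" "prob {v \<in> space M. \<bar>tau v - r\<bar> < dl} = 0" using subsetD[OF F'(1) SF] unfolding F_def by blast
  then have "AE v in M. v \<notin> {v \<in> space M. \<bar>tau v - r\<bar> < dl}" by (intro AE_not_in) (simp add: null_sets_def emeasure_eq_measure)
  then show ?thesis using AE_space by eventually_elim (auto simp: S dist_real_def abs_minus_commute)
 qed
 then have "AE v in M. \<forall>S\<in>F'. tau v \<notin> S" using F'(2) by (subst AE_ball_countable) auto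
 then have "AE v in M. tau v \<le> q"
 proof eventually_elim
  case (elim v)
  show ?case
  proof (rule ccontr)
   assume "\<not> tau v \<le> q"
   then have "\<not> in_support (tau v)" by (intro none) simp
   then obtain dl where "0 < dl" "\<not> 0 < prob {w \<in> space M. \<bar>tau w - tau v\<bar> < dl}" unfolding in_support_def by blast
   then have "ball (tau v) dl \<in> F" "tau v \<in> ball (tau v) dl" unfolding F_def by (auto simp: zero_less_measure_iff)
   then show False using elim F'(3) by blast
  qed
 qed
 then show False using tau_unbounded[OF q] by blast
qed

text \<open>Conditional expectations are compared through integrals over sets of passage times.
  Continuity at p and positive mass of every neighbourhood of p transfer the comparison to the
  single value p.\<close>

lemma less_at_support:
 assumes p: "0 < p" and d: "0 < d" and G: "isCont G1 p" "isCont G2 p" "\<And>r. 0 \<le> G1 r"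
  and le: "\<And>dl. 0 < dl \<Longrightarrow> dl \<le> d \<Longrightarrow> (\<integral>\<^sup>+w. ennreal (G2 (tau w)) * indicator {r. \<bar>r - p\<bar> < dl} (tau w) \<partial>M) \<le> (\<integral>\<^sup>+w. ennreal (G1 (tau w)) * indicator {r. \<bar>r - p\<bar> < dl} (tau w) \<partial>M)"
 shows "G2 p \<le> G1 p"
proof (rule ccontr)
 assume "\<not> G2 p \<le> G1 p"
 then obtain c1 c2 where c: "G1 p < c1" "c1 < c2" "c2 < G2 p" using dense by (metis not_le)
 have c0: "0 < c1" using c(1) G(3)[of p] by linarith
 have "\<forall>\<^sub>F r in nhds p. G1 r < c1 \<and> c2 < G2 r"
  using G(1,2) c unfolding isCont_def tendsto_at_iff_tendsto_nhds by (intro eventually_conj order_tendstoD)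
 then obtain e where e: "0 < e" "\<And>r. dist r p < e \<Longrightarrow> G1 r < c1 \<and> c2 < G2 r" unfolding eventually_nhds_metric by blast
 define dl where "dl = min e d"
 have dl: "0 < dl" "dl \<le> d" "dl \<le> e" using e d by (auto simp: dl_def)
 define E where "E = {w \<in> space M. \<bar>tau w - p\<bar> < dl}"
 have E: "E \<in> sets M" unfolding E_def by measurable
 have pE: "0 < prob E" using all_in_support[OF p] dl(1) unfolding in_support_def E_def by blast
 have e3: "G1 r \<le> c1" "c2 \<le> G2 r" if "\<bar>r - p\<bar> < dl" for r
  using e(2)[of r] that dl(3) by (auto simp: dist_real_def)
 have "ennreal c2 * emeasure M E = (\<integral>\<^sup>+w. ennreal c2 * indicator E w \<partial>M)" by (rule nn_integral_cmult_indicator[OF E, symmetric])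
 also have "... \<le> (\<integral>\<^sup>+w. ennreal (G2 (tau w)) * indicator {r. \<bar>r - p\<bar> < dl} (tau w) \<partial>M)"
  by (intro nn_integral_mono) (auto simp: indicator_def E_def intro!: ennreal_leI e3)
 also have "... \<le> (\<integral>\<^sup>+w. ennreal (G1 (tau w)) * indicator {r. \<bar>r - p\<bar> < dl} (tau w) \<partial>M)" by (rule le[OF dl(1,2)])
 also have "... \<le> (\<integral>\<^sup>+w. ennreal c1 * indicator E w \<partial>M)"
  by (intro nn_integral_mono) (auto simp: indicator_def E_def intro!: ennreal_leI e3)
 also have "... = ennreal c1 * emeasure M E" by (rule nn_integral_cmult_indicator[OF E])
 finally have "c2 * prob E \<le> c1 * prob E" using c c0 by (simp add: emeasure_eq_measure ennreal_mult''[symmetric])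
 then show False using pE c by simp
qed

text \<open>Extends the defining property of the kernel from events to functions of the path and its
  passage time, with the measurable \<open>tau\<close> in place of \<open>hitting_time_0\<close> on
  the completion. The joint law of path and passage time is identified on products of measurable
  sets, which generate.\<close>

lemma disintegration:
 assumes kp: "cond_kernel_T0 M kp" and F: "F \<in> borel_measurable (path_space {0..} \<Otimes>\<^sub>M borel)"
 shows "(\<integral>\<^sup>+v. F (v, tau v) \<partial>M) = (\<integral>\<^sup>+v. (\<integral>\<^sup>+w. F (w, tau v) \<partial>kp (ereal (tau v))) \<partial>M)"
proof -
 let ?S = "path_space {0..}" and ?C = "completion M"
 have km: "kp \<in> borel \<rightarrow>\<^sub>M subprob_algebra ?S" using kp measurable_prob_algebraD unfolding cond_kernel_T0_def by blast
 define k where "k v = kp (ereal (tau v))" for v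
 have kM[measurable]: "k \<in> M \<rightarrow>\<^sub>M subprob_algebra ?S" unfolding k_def by (rule measurable_compose[OF _ km]) measurable
 have ks1: "sets (k v) = sets ?S" for v unfolding k_def by (rule sets_kernel[OF km]) simp
 note ks = ks1 sets_eq_imp_space_eq[OF ks1]
 have idS[measurable]: "(\<lambda>v. v) \<in> M \<rightarrow>\<^sub>M ?S" by (rule measurable_ident_sets[OF sets_M])
 define J where "J v = distr (k v) (?S \<Otimes>\<^sub>M borel) (\<lambda>w. (w, tau v))" for v
 have Jm: "J \<in> M \<rightarrow>\<^sub>M subprob_algebra (?S \<Otimes>\<^sub>M borel)"
  unfolding J_def by (rule measurable_distr2[OF _ kM]) measurable
 have pm: "(\<lambda>w. (w, t)) \<in> k v \<rightarrow>\<^sub>M ?S \<Otimes>\<^sub>M borel" for t :: real and v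
  by (rule measurable_Pair[OF measurable_ident_sets[OF ks1] measurable_const]) simp
 have hM: "hitting_time_0 \<in> borel_measurable ?C" by (rule hitting_time_measurable)
 have AEC: "AE v in ?C. hitting_time_0 v = ereal (tau v)"
 proof (rule AE_completion)
  show "AE v in M. hitting_time_0 v = ereal (tau v)" using AE_hitting_time by eventually_elim blast
 qed
 have rect: "emeasure M {v \<in> space M. v \<in> A \<and> tau v \<in> B} = (\<integral>\<^sup>+v. emeasure (k v) A * indicator B (tau v) \<partial>M)"
  if A: "A \<in> sets ?S" and B: "B \<in> sets (borel :: real measure)" for A B
 proof -
  have AM: "A \<in> sets M" using A sets_M by simp
  \<comment> \<open>The kernel is indexed by \<open>ereal\<close>, so a Borel set of real times is
    embedded there.\<close>
  have B': "ereal ` B \<in> sets borel"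
  proof -
   have "ereal ` B = (real_of_ereal -` B \<inter> space borel) \<inter> {- \<infinity><..<\<infinity>}"
   proof (intro equalityI subsetI)
    fix r assume "r \<in> (real_of_ereal -` B \<inter> space borel) \<inter> {- \<infinity><..<\<infinity>}"
    then show "r \<in> ereal ` B" by (cases r) auto
   qed auto
   also have "... \<in> sets borel" by (intro sets.Int measurable_sets[OF borel_measurable_real_of_ereal[OF measurable_ident_sets[OF refl]] B]) auto
   finally show ?thesis .
  qed
  have ind: "indicator (ereal ` B) (ereal t) = (indicator B t :: ennreal)" for t by (auto simp: indicator_def)
  have BM: "{v \<in> space M. v \<in> A \<and> tau v \<in> B} \<in> sets M" using AM B by measurable
  have HS: "A \<inter> {v \<in> space M. hitting_time_0 v \<in> ereal ` B} \<in> sets ?C"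
  proof -
   have "hitting_time_0 -` (ereal ` B) \<inter> space ?C \<in> sets ?C" by (rule measurable_sets[OF hM B'])
   moreover have "A \<in> sets ?C" using AM by (rule sets_completionI_sets)
   moreover have "A \<inter> {v \<in> space M. hitting_time_0 v \<in> ereal ` B} = A \<inter> (hitting_time_0 -` (ereal ` B) \<inter> space ?C)" by auto
   ultimately show ?thesis by auto
  qed
  have "emeasure M {v \<in> space M. v \<in> A \<and> tau v \<in> B} = (\<integral>\<^sup>+v. indicator {v \<in> space M. v \<in> A \<and> tau v \<in> B} v \<partial>?C)"
   unfolding nn_integral_completion by (rule nn_integral_indicator[OF BM, symmetric])
  also have "... = (\<integral>\<^sup>+v. indicator (A \<inter> {v \<in> space M. hitting_time_0 v \<in> ereal ` B}) v \<partial>?C)"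
   by (rule nn_integral_cong_AE) (use AEC in eventually_elim, auto simp: indicator_def)
  also have "... = emeasure ?C (A \<inter> {v \<in> space M. hitting_time_0 v \<in> ereal ` B})" by (rule nn_integral_indicator[OF HS])
  also have "... = (\<integral>\<^sup>+ r \<in> ereal ` B. emeasure (kp r) A \<partial>distr ?C borel hitting_time_0)"
   using kp A B' unfolding cond_kernel_T0_def by blast
  also have "... = (\<integral>\<^sup>+v. emeasure (kp (hitting_time_0 v)) A * indicator (ereal ` B) (hitting_time_0 v) \<partial>?C)"
  proof (rule nn_integral_distr[OF hM])
   have "(\<lambda>r. emeasure (kp r) A) \<in> borel_measurable borel"
    by (rule measurable_compose[OF km measurable_emeasure_subprob_algebra[OF A]])
   then have "(\<lambda>r. emeasure (kp r) A * indicator (ereal ` B) r) \<in> borel_measurable borel" using B' by measurable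
   then show "(\<lambda>r. emeasure (kp r) A * indicator (ereal ` B) r) \<in> borel_measurable (distr ?C borel hitting_time_0)" by simp
  qed
  also have "... = (\<integral>\<^sup>+v. emeasure (k v) A * indicator B (tau v) \<partial>?C)"
   by (rule nn_integral_cong_AE) (use AEC in eventually_elim, simp add: k_def ind)
  finally show ?thesis by (simp only: nn_integral_completion)
 qed
 have gm: "(\<lambda>v. (v, tau v)) \<in> M \<rightarrow>\<^sub>M ?S \<Otimes>\<^sub>M borel" by measurable
 have "distr M (?S \<Otimes>\<^sub>M borel) (\<lambda>v. (v, tau v)) = M \<bind> J"
 proof (rule measure_eqI_generator_eq[where \<Omega> = "space ?S \<times> space borel" and E = "{a \<times> b | a b. a \<in> sets ?S \<and> b \<in> sets (borel::real measure)}" and A = "\<lambda>_. space ?S \<times> space borel"])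
  show "Int_stable {a \<times> b | a b. a \<in> sets ?S \<and> b \<in> sets (borel::real measure)}" by (rule Int_stable_pair_measure_generator)
  show "{a \<times> b | a b. a \<in> sets ?S \<and> b \<in> sets (borel::real measure)} \<subseteq> Pow (space ?S \<times> space borel)" by (rule pair_measure_closed)
  show "sets (distr M (?S \<Otimes>\<^sub>M borel) (\<lambda>v. (v, tau v))) = sigma_sets (space ?S \<times> space borel) {a \<times> b | a b. a \<in> sets ?S \<and> b \<in> sets (borel::real measure)}"
   by (simp add: sets_pair_measure)
  show "sets (M \<bind> J) = sigma_sets (space ?S \<times> space borel) {a \<times> b | a b. a \<in> sets ?S \<and> b \<in> sets (borel::real measure)}"
   using sets_bind_measurable[OF Jm not_empty] by (simp only: sets_pair_measure)
  show "range (\<lambda>_. space ?S \<times> space borel) \<subseteq> {a \<times> b | a b. a \<in> sets ?S \<and> b \<in> sets (borel::real measure)}" by blast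
  show "(\<Union>i::nat. space ?S \<times> space borel) = space ?S \<times> space (borel::real measure)" by simp
  show "emeasure (distr M (?S \<Otimes>\<^sub>M borel) (\<lambda>v. (v, tau v))) (space ?S \<times> space borel) \<noteq> \<infinity>"
  proof -
   interpret D: prob_space "distr M (?S \<Otimes>\<^sub>M borel) (\<lambda>v. (v, tau v))" by (rule prob_space_distr[OF gm])
   show ?thesis by simp
  qed
  fix X assume "X \<in> {a \<times> b | a b. a \<in> sets ?S \<and> b \<in> sets (borel::real measure)}"
  then obtain A B where X: "X = A \<times> B" and A: "A \<in> sets ?S" and B: "B \<in> sets (borel :: real measure)" by blast
  have XS: "X \<in> sets (?S \<Otimes>\<^sub>M borel)" unfolding X by (rule pair_measureI[OF A B])
  have "emeasure (distr M (?S \<Otimes>\<^sub>M borel) (\<lambda>v. (v, tau v))) X = emeasure M {v \<in> space M. v \<in> A \<and> tau v \<in> B}"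
   by (subst emeasure_distr[OF gm XS]) (auto simp: X intro!: arg_cong[where f = "emeasure M"])
  also have "... = (\<integral>\<^sup>+v. emeasure (k v) A * indicator B (tau v) \<partial>M)" by (rule rect[OF A B])
  also have "... = (\<integral>\<^sup>+v. emeasure (J v) X \<partial>M)"
  proof (rule nn_integral_cong)
   fix v
   have "emeasure (J v) X = emeasure (k v) ((\<lambda>w. (w, tau v)) -` X \<inter> space (k v))"
    unfolding J_def by (rule emeasure_distr[OF pm XS])
   also have "(\<lambda>w. (w, tau v)) -` X \<inter> space (k v) = (if tau v \<in> B then A else {})"
    using sets.sets_into_space[OF A] by (auto simp: X ks)
   finally show "emeasure (k v) A * indicator B (tau v) = emeasure (J v) X" by simp
  qed
  also have "... = emeasure (M \<bind> J) X" by (rule emeasure_bind[OF not_empty Jm XS, symmetric])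
  finally show "emeasure (distr M (?S \<Otimes>\<^sub>M borel) (\<lambda>v. (v, tau v))) X = emeasure (M \<bind> J) X" .
 qed
 note eq = this
 have "(\<integral>\<^sup>+v. F (v, tau v) \<partial>M) = (\<integral>\<^sup>+z. F z \<partial>distr M (?S \<Otimes>\<^sub>M borel) (\<lambda>v. (v, tau v)))"
  by (rule nn_integral_distr[OF gm, symmetric]) (use F in simp)
 also have "... = (\<integral>\<^sup>+v. \<integral>\<^sup>+z. F z \<partial>J v \<partial>M)" unfolding eq by (rule nn_integral_bind[OF F Jm])
 also have "... = (\<integral>\<^sup>+v. (\<integral>\<^sup>+w. F (w, tau v) \<partial>k v) \<partial>M)"
 proof (rule nn_integral_cong)
  fix v
  show "(\<integral>\<^sup>+z. F z \<partial>J v) = (\<integral>\<^sup>+w. F (w, tau v) \<partial>k v)"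
   unfolding J_def by (rule nn_integral_distr[OF pm]) (use F in simp)
 qed
 finally show ?thesis unfolding k_def .
qed

end

section \<open>The process started from a point\<close>

text \<open>The rotation by - pi sgn u exchanges \<i> u and - \<i> u within the principal range. The
  stated normalization is thus E exp (- z L) = exp (z^\<alpha>) read at z = - \<i> u.\<close>

lemma stable_exponent_eq:
 fixes u \<alpha> :: real
 shows "(\<i> * complex_of_real u) powr complex_of_real \<alpha> * exp (- \<i> * complex_of_real (pi * \<alpha> * sgn u)) = (- \<i> * complex_of_real u) powr complex_of_real \<alpha>"
proof -
 have L: "Ln (of_real r * \<i>) = of_real (ln r) + \<i> * of_real pi / 2" "Ln (of_real r * (- \<i>)) = of_real (ln r) - \<i> * of_real pi / 2" if "0 < r" for r :: real
 proof -
  have "Ln (of_real r * \<i>) = of_real (ln r) + Ln \<i>" using that by (subst Ln_times_of_real) (simp_all add: Ln_of_real)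
  moreover have "Ln (of_real r * (- \<i>)) = of_real (ln r) + Ln (- \<i>)" using that by (subst Ln_times_of_real) (simp_all add: Ln_of_real)
  ultimately show "Ln (of_real r * \<i>) = of_real (ln r) + \<i> * of_real pi / 2" "Ln (of_real r * (- \<i>)) = of_real (ln r) - \<i> * of_real pi / 2"
   unfolding Ln_ii Ln_minus_ii by simp_all
 qed
 consider "u = 0" | "0 < u" | "u < 0" by linarith
 then show ?thesis
 proof cases
  case 2
  have e: "\<i> * complex_of_real u = of_real u * \<i>" "- \<i> * complex_of_real u = of_real u * (- \<i>)" by simp_all
  have n: "of_real u * \<i> \<noteq> 0" "of_real u * (- \<i>) \<noteq> 0" using 2 by simp_all
  have s: "sgn u = 1" using 2 by simp
  show ?thesis unfolding e powr_def L[OF 2] s using n by (simp add: exp_add[symmetric] algebra_simps)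
 next
  case 3
  then have m: "0 < - u" by simp
  have e: "\<i> * complex_of_real u = of_real (- u) * (- \<i>)" "- \<i> * complex_of_real u = of_real (- u) * \<i>" by simp_all
  have n: "of_real (- u) * \<i> \<noteq> 0" "of_real (- u) * (- \<i>) \<noteq> 0" using 3 by simp_all
  have s: "sgn u = - 1" using 3 by simp
  show ?thesis unfolding e powr_def L[OF m] s using n by (simp add: exp_add[symmetric] algebra_simps)
 qed simp
qed

text \<open>Independent stationary increments fix the characteristic function at time 1 / n up to an
  n-th root of unity. Its ratio to the expected value is continuous in u and takes finitely many
  values, hence is constant, and it is 1 at u = 0. Rational times follow by taking powers and all
  times by right-continuity.\<close>

lemma stable_start_law:
 assumes \<alpha>: "1 < \<alpha>" "\<alpha> \<le> 2" and P: "spectrally_positive_stable_law \<alpha> P"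
 shows "stable_start \<alpha> P 0"
proof -
 have lev: "levy_law P" and nj: "AE v in P. \<forall>t>0. Lim (at_left t) v \<le> v t"
  and ch1: "\<And>u. char (distr P borel (\<lambda>v. v 1)) u = exp ((- \<i> * of_real u) powr of_real \<alpha>)"
  using P unfolding spectrally_positive_stable_law_def stable_exponent_eq by auto
 interpret P: prob_space P using lev by (simp add: levy_law_def)
 have sP: "sets P = sets (path_space {0..})" and st: "AE v in P. v 0 = 0"
  and ind: "\<And>t :: nat \<Rightarrow> real. 0 \<le> t 0 \<Longrightarrow> mono t \<Longrightarrow> P.indep_vars (\<lambda>_. borel) (\<lambda>i v. v (t (Suc i)) - v (t i)) UNIV"
  and stat: "\<And>s t. 0 \<le> s \<Longrightarrow> s \<le> t \<Longrightarrow> distr P borel (\<lambda>v. v t - v s) = distr P borel (\<lambda>v. v (t - s))"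
  using lev by (auto simp: levy_law_def)
 have cm[measurable]: "(\<lambda>v. v t) \<in> borel_measurable P" for t by (rule measurable_coord[OF sP])
 define ph where "ph t u = char (distr P borel (\<lambda>v. v t)) u" for t u
 define ps where "ps u = (- \<i> * complex_of_real u) powr complex_of_real \<alpha>" for u :: real
 have pw: "ph (real n * h) u = ph h u ^ n" if h: "0 \<le> h" for n h u
 proof -
  define t where "t i = real i * h" for i
  define X where "X i v = v (t (Suc i)) - v (t i)" for i and v :: "real \<Rightarrow> real"
  have mt: "mono t" unfolding t_def by (intro monoI mult_right_mono) (use h in auto)
  have "P.indep_vars (\<lambda>_. borel) X UNIV" unfolding X_def[abs_def] by (rule ind[OF _ mt]) (simp add: t_def)
  then have iv: "P.indep_vars (\<lambda>_. borel) X {..<n}" by (rule P.indep_vars_subset) simp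
  have "ph (real n * h) u = char (distr P borel (\<lambda>v. v (real n * h) - v 0)) u"
   using stat[of 0 "real n * h"] h by (simp add: ph_def)
  also have "(\<lambda>v. v (real n * h) - v 0) = (\<lambda>v. \<Sum>i<n. X i v)"
  proof
   fix v :: "real \<Rightarrow> real"
   show "v (real n * h) - v 0 = (\<Sum>i<n. X i v)"
    using sum_lessThan_telescope[of "\<lambda>i. v (t i)" n] by (simp add: X_def t_def)
  qed
  also have "char (distr P borel (\<lambda>v. \<Sum>i<n. X i v)) u = (\<Prod>i<n. char (distr P borel (X i)) u)" by (rule P.char_distr_sum[OF iv])
  also have "... = (\<Prod>i<n. ph h u)"
  proof (rule prod.cong[OF refl])
   fix i
   have ti: "0 \<le> t i" "t i \<le> t (Suc i)" using h by (auto simp: t_def mult_right_mono)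
   have "t (Suc i) - t i = h" by (simp add: t_def algebra_simps)
   then show "char (distr P borel (X i)) u = ph h u" unfolding X_def[abs_def] ph_def using stat[OF ti] by simp
  qed
  finally show ?thesis by simp
 qed
 have rd: "real_distribution (distr P borel (\<lambda>v. v t))" for t by (intro P.real_distribution_distr) simp
 have cph: "continuous_on UNIV (ph t)" for t
  unfolding ph_def[abs_def] using real_distribution.isCont_char[OF rd] by (simp add: continuous_on_eq_continuous_at)
 have ph0: "ph t 0 = 1" for t unfolding ph_def by (rule real_distribution.char_zero[OF rd])
 have ps0: "ps 0 = 0" using \<alpha> by (simp add: ps_def)
 have cps: "continuous_on UNIV ps"
  unfolding ps_def
 proof (rule continuous_on_powr_complex)
  show "UNIV \<subseteq> {u. 0 \<le> Re (- \<i> * complex_of_real u) \<or> Im (- \<i> * complex_of_real u) \<noteq> 0}" by auto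
 qed (use \<alpha> in \<open>auto intro!: continuous_intros\<close>)
 have root: "ph (1 / real n) u = exp (ps u / of_nat n)" if n: "0 < n" for n u
 proof -
  define r where "r u = ph (1 / real n) u * exp (- ps u / of_nat n)" for u
  have "r u ^ n = 1" for u
  proof -
   have "ph (1 / real n) u ^ n = exp (ps u)" using pw[of "1 / real n" n u] n ch1[of u] by (simp add: ph_def ps_def)
   moreover have "exp (- ps u / of_nat n) ^ n = exp (- ps u)" using n by (simp add: exp_of_nat_mult[symmetric])
   ultimately show ?thesis by (simp add: r_def power_mult_distrib exp_add[symmetric])
  qed
  then have "range r \<subseteq> {z. z ^ n = 1}" by auto
  then have fin: "finite (range r)" by (rule finite_subset) (rule finite_roots_unity, use n in simp)
  have "continuous_on UNIV r" unfolding r_def using n by (intro continuous_intros cph cps) simp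
  then have "r constant_on UNIV" using fin by (intro continuous_finite_range_constant) auto
  then obtain y where "\<And>x. r x = y" unfolding constant_on_def by blast
  then have "r u = r 0" by simp
  then have "r u = 1" by (simp add: r_def ph0 ps0)
  then show ?thesis by (simp add: r_def exp_minus field_simps)
 qed
 have main: "ph t u = exp (of_real t * ps u)" if t: "0 \<le> t" for t u
 proof -
  \<comment> \<open>The added 1 makes the rational times approach t from the right, the side on
    which paths are continuous.\<close>
  define m where "m k = nat \<lfloor>t * real (Suc k)\<rfloor> + 1" for k
  define \<tau> where "\<tau> k = real (m k) * (1 / real (Suc k))" for k
  have \<tau>: "t \<le> \<tau> k" "\<tau> k \<le> t + 1 / real (Suc k)" for k
  proof -
   have "0 \<le> t * real (Suc k)" using t by simp
   then have "t * real (Suc k) \<le> real (m k)" "real (m k) \<le> t * real (Suc k) + 1" unfolding m_def by linarith+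
   then show "t \<le> \<tau> k" "\<tau> k \<le> t + 1 / real (Suc k)"
    unfolding \<tau>_def by (simp_all add: field_simps del: of_nat_Suc)
  qed
  have lim: "\<tau> \<longlonglongrightarrow> t"
  proof (rule tendsto_sandwich[where f = "\<lambda>_. t" and h = "\<lambda>k. t + 1 / real (Suc k)"])
   show "(\<lambda>k. t + 1 / real (Suc k)) \<longlonglongrightarrow> t"
    using tendsto_add[OF tendsto_const LIMSEQ_inverse_real_of_nat, of t] by (simp add: inverse_eq_divide)
  qed (use \<tau> in \<open>auto intro!: always_eventually simp del: of_nat_Suc\<close>)
  have e: "ph (\<tau> k) u = exp (of_real (\<tau> k) * ps u)" for k
  proof -
   have "ph (\<tau> k) u = exp (ps u / of_nat (Suc k)) ^ m k" unfolding \<tau>_def using pw[of "1 / real (Suc k)" "m k" u] root[of "Suc k" u] by simp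
   also have "... = exp (of_nat (m k) * (ps u / of_nat (Suc k)))" by (rule exp_of_nat_mult[symmetric])
   also have "of_nat (m k) * (ps u / of_nat (Suc k)) = of_real (\<tau> k) * ps u" by (simp add: \<tau>_def del: of_nat_Suc)
   finally show ?thesis .
  qed
  have "(\<lambda>k. ph (\<tau> k) u) \<longlonglongrightarrow> ph t u"
  proof -
   have c: "ph s u = (LINT v|P. iexp (u * v s))" for s unfolding ph_def char_def by (simp add: integral_distr)
   show ?thesis
    unfolding c
   proof (rule integral_dominated_convergence[where w = "\<lambda>_. 1"])
    show "AE v in P. (\<lambda>k. iexp (u * v (\<tau> k))) \<longlonglongrightarrow> iexp (u * v t)"
     using AE_space
    proof eventually_elim
     case (elim v)
     then have "cadlag_on {0..} v" using sets_eq_imp_space_eq[OF sP] by (simp add: cadlag_paths_def)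
     then have "(\<lambda>k. v (\<tau> k)) \<longlonglongrightarrow> v t" by (rule cadlag_right_sequence) (use t lim \<tau> in auto)
     then show ?case by (intro tendsto_exp tendsto_mult tendsto_const tendsto_of_real)
    qed
   qed auto
  qed
  moreover have "(\<lambda>k. ph (\<tau> k) u) \<longlonglongrightarrow> exp (of_real t * ps u)"
   unfolding e by (intro tendsto_intros lim)
  ultimately show ?thesis by (rule LIMSEQ_unique)
 qed
 show ?thesis
 proof unfold_locales
  show "1 < \<alpha>" "\<alpha> \<le> 2" by fact+
  show "char (distr P borel (\<lambda>v. v t - v s)) u = exp (of_real (t - s) * (- \<i> * of_real u) powr of_real \<alpha>)" if "0 \<le> s" "s \<le> t" for s t u
   unfolding stat[OF that] using main[of "t - s" u] that unfolding ph_def ps_def by simp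
 qed (use sP st nj ind in auto)
qed

lemma started_at_eq_affine_path: "started_at x P = distr P (path_space {0..}) (affine_path x 1 1)"
 unfolding started_at_def affine_path_def by simp

lemma stable_start_started_at:
 assumes "stable_start \<alpha> P 0" shows "stable_start \<alpha> (started_at x P) x"
 using stable_start.stable_start_affine[OF assms, of 1 1 x] unfolding started_at_eq_affine_path by simp

section \<open>The conditioned process\<close>

text \<open>The closed interval fits \<open>path_space {0..s}\<close>, on which weak convergence is
  formulated; the half-open \<open>area\<close> fits the grids and the time before passage.\<close>

abbreviation carea :: "real \<Rightarrow> (real \<Rightarrow> real) \<Rightarrow> real" where
 "carea s w \<equiv> LBINT t:{0..s}. w t"

lemma cadlag_on_restrict:
 assumes c: "cadlag_on I w" and J: "J \<subseteq> I"
 shows "restrict w J \<in> cadlag_paths J"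
proof -
 have "cadlag_on J (restrict w J)"
  unfolding cadlag_on_def
 proof (intro ballI conjI)
  fix t assume t: "t \<in> J"
  then obtain l where l: "(w \<longlongrightarrow> w t) (at t within (I \<inter> {t<..}))" "(w \<longlongrightarrow> l) (at t within (I \<inter> {..<t}))"
   using c J unfolding cadlag_on_def by blast
  have tr: "(restrict w J \<longlongrightarrow> y) (at t within (J \<inter> S))" if "(w \<longlongrightarrow> y) (at t within (I \<inter> S))" for y S
  proof (rule Lim_transform_eventually)
   show "(w \<longlongrightarrow> y) (at t within (J \<inter> S))" by (rule tendsto_within_subset[OF that]) (use J in blast)
   show "\<forall>\<^sub>F u in at t within (J \<inter> S). w u = restrict w J u" by (simp add: eventually_at_filter)
  qed
  show "(restrict w J \<longlongrightarrow> restrict w J t) (at t within (J \<inter> {t<..}))" using tr[OF l(1)] t by simp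
  show "\<exists>l. (restrict w J \<longlongrightarrow> l) (at t within (J \<inter> {..<t}))" using tr[OF l(2)] by blast
 qed
 then show ?thesis by (simp add: cadlag_paths_def)
qed

lemma measurable_restrict_path:
 assumes N: "sets N = sets (path_space I)" and s: "{0..s} \<subseteq> I"
 shows "(\<lambda>w. restrict w {0..s}) \<in> N \<rightarrow>\<^sub>M path_space {0..s}"
proof (rule measurable_into_path_space)
 fix w assume "w \<in> space N"
 then have "cadlag_on I w" using sets_eq_imp_space_eq[OF N] by (simp add: cadlag_paths_def)
 then show "restrict w {0..s} \<in> cadlag_paths {0..s}" by (rule cadlag_on_restrict[OF _ s])
next
 fix t assume "t \<in> {0..s}"
 then show "(\<lambda>w. restrict w {0..s} t) \<in> borel_measurable N" using measurable_coord[OF N] by simp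
qed

lemma carea_restrict: "carea s (restrict w {0..s}) = carea s w"
 by (intro set_lebesgue_integral_cong) auto

lemma measurable_carea:
 assumes N: "sets N = sets (path_space I)" and s: "{0..s} \<subseteq> I" "0 < s"
 shows "(\<lambda>w. carea s w) \<in> borel_measurable N"
 using measurable_compose[OF measurable_restrict_path[OF N s(1)] measurable_area[OF s(2)]] by (simp only: carea_restrict)

lemma integral_law_upto_carea:
 fixes f :: "real \<Rightarrow> real"
 assumes N: "sets N = sets (path_space I)" and s: "{0..s} \<subseteq> I" "0 < s" and f: "continuous_on UNIV f"
 shows "(\<integral>w. f (carea s w) \<partial>law_upto s N) = (\<integral>w. f (carea s w) \<partial>N)"
proof -
 have m: "(\<lambda>w. f (carea s w)) \<in> borel_measurable (path_space {0..s})"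
  by (rule measurable_compose[OF measurable_area[OF s(2)] borel_measurable_continuous_onI[OF f]])
 show ?thesis unfolding law_upto_def
  by (subst integral_distr[OF measurable_restrict_path[OF N s(1)] m]) (simp only: carea_restrict)
qed

lemma weak_limit_upto_carea:
 fixes f :: "real \<Rightarrow> real"
 assumes w: "weak_limit_upto s K N F" and f: "continuous_on UNIV f" "\<And>a. 0 \<le> f a \<and> f a \<le> 1" and s: "0 < s"
  and N: "sets N = sets (path_space I)" "{0..s} \<subseteq> I" and K: "\<forall>\<^sub>F i in F. sets (K i) = sets (path_space {0..})"
 shows "((\<lambda>i. \<integral>v. f (carea s v) \<partial>K i) \<longlongrightarrow> (\<integral>v. f (carea s v) \<partial>N)) F"
proof -
 have "bounded ((\<lambda>v. f (carea s v)) ` cadlag_paths {0..s})"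
  unfolding bounded_iff using f(2) by (intro exI[of _ 1]) (simp add: abs_le_iff, smt (verit))
 then have "((\<lambda>i. \<integral>v. f (carea s v) \<partial>law_upto s (K i)) \<longlongrightarrow> (\<integral>v. f (carea s v) \<partial>law_upto s N)) F"
  using w continuous_map_area[OF f(1), of s] unfolding weak_limit_upto_def by blast
 moreover have "(\<integral>v. f (carea s v) \<partial>law_upto s N) = (\<integral>v. f (carea s v) \<partial>N)" by (rule integral_law_upto_carea[OF N s f(1)])
 moreover have "\<forall>\<^sub>F i in F. (\<integral>v. f (carea s v) \<partial>law_upto s (K i)) = (\<integral>v. f (carea s v) \<partial>K i)"
  using K by eventually_elim (rule integral_law_upto_carea[OF _ _ s f(1)], auto)
 ultimately show ?thesis using Lim_transform_eventually by fastforce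
qed

lemma borel_measurable_path:
 assumes "w \<in> cadlag_paths {0..}" shows "w \<in> borel_measurable borel"
proof -
 have "(\<lambda>t. (t, w)) \<in> borel \<rightarrow>\<^sub>M borel \<Otimes>\<^sub>M path_space {0..}"
  by (rule measurable_Pair[OF measurable_ident_sets[OF refl] measurable_const]) (use assms in simp)
 from measurable_compose[OF this measurable_coord_joint[OF refl]] show ?thesis by simp
qed

lemma carea_eq_area: "w \<in> cadlag_paths {0..} \<Longrightarrow> carea s w = (area s w)"
 using LBINT_atLeastLessThan[OF borel_measurable_path, of w 0 s] by simp

lemma set_integrable_cadlag:
 assumes c: "cadlag_on {0..s} w" shows "set_integrable lborel {0..s} w"
proof -
 obtain C where C: "\<And>t. t \<in> {0..s} \<Longrightarrow> \<bar>w t\<bar> \<le> C" using cadlag_on_bounded[OF c] by blast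
 show ?thesis
  unfolding set_integrable_def
 proof (rule Lintegrable_bound)
  show "integrable lborel (\<lambda>t. C * indicator {0..s} t :: real)" by (intro integrable_mult_right integrable_real_indicator) (auto simp: emeasure_lborel_Icc_eq)
  show "(\<lambda>t. indicator {0..s} t *\<^sub>R w t) \<in> borel_measurable lborel" using borel_measurable_cadlag[OF c] by simp
  show "AE t in lborel. norm (indicator {0..s} t *\<^sub>R w t) \<le> norm (C * indicator {0..s} t :: real)"
  proof (rule AE_I2)
   fix t
   show "norm (indicator {0..s} t *\<^sub>R w t) \<le> norm (C * indicator {0..s} t :: real)"
    using C[of t] by (cases "t \<in> {0..s}") auto
  qed
 qed
qed

lemma carea_tendsto:
 assumes c: "cadlag_on {0..T} v" and s: "s \<longlonglongrightarrow> T" "\<And>n. s n \<le> T"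
 shows "(\<lambda>n. carea (s n) v) \<longlonglongrightarrow> carea T v"
proof -
 have i: "set_integrable lborel {0..T} v" by (rule set_integrable_cadlag[OF c])
 have m: "(\<lambda>t. indicator {0..T} t *\<^sub>R v t) \<in> borel_measurable lborel" using borel_measurable_cadlag[OF c] by simp
 have e: "indicator {0..s n} t *\<^sub>R v t = indicator {0..s n} t *\<^sub>R (indicator {0..T} t *\<^sub>R v t)" for n t
  using s(2)[of n] by (auto simp: indicator_def)
 show ?thesis
  unfolding set_lebesgue_integral_def
 proof (rule integral_dominated_convergence[where w = "\<lambda>t. norm (indicator {0..T} t *\<^sub>R v t)"])
  show "(\<lambda>t. indicator {0..s n} t *\<^sub>R v t) \<in> borel_measurable lborel" for n
   unfolding e by (intro borel_measurable_scaleR m) measurable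
  show "integrable lborel (\<lambda>t. norm (indicator {0..T} t *\<^sub>R v t))" using i unfolding set_integrable_def by (rule integrable_norm)
  show "AE t in lborel. norm (indicator {0..s n} t *\<^sub>R v t) \<le> norm (indicator {0..T} t *\<^sub>R v t)" for n
   using s(2)[of n] by (intro AE_I2) (auto simp: indicator_def)
  show "AE t in lborel. (\<lambda>n. indicator {0..s n} t *\<^sub>R v t) \<longlonglongrightarrow> indicator {0..T} t *\<^sub>R v t"
   using AE_lborel_singleton[of T]
  proof eventually_elim
   case (elim t)
   show ?case
   proof (cases "t < T")
    case True
    have "\<forall>\<^sub>F n in sequentially. t < s n" using order_tendstoD(1)[OF s(1) True] .
    then have "\<forall>\<^sub>F n in sequentially. indicator {0..T} t *\<^sub>R v t = indicator {0..s n} t *\<^sub>R v t"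
     by eventually_elim (use True in \<open>auto simp: indicator_def\<close>)
    then show ?thesis by (rule Lim_transform_eventually[OF tendsto_const])
   next
    case False
    then have "indicator {0..s n} t = (0::real)" "indicator {0..T} t = (0::real)" for n using elim s(2)[of n] by (auto simp: indicator_def)
    then show ?thesis by simp
   qed
  qed
 qed (rule m)
qed

lemma tau_affine_path:
 assumes p: "passage w = ereal (tau w)" and b: "0 < b" and c: "0 < c"
 shows "tau (affine_path 0 c b w) = tau w / b"
proof -
 have "passage (affine_path 0 c b w) = ereal (tau w / b)"
  unfolding passage_def
 proof (rule antisym)
  show "(INF t\<in>{t. 0 \<le> t \<and> affine_path 0 c b w t < 0}. ereal t) \<le> ereal (tau w / b)"
  proof (rule ereal_le_epsilon2)
   fix e :: real assume e: "0 < e"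
   then have "passage w < ereal (tau w + b * e)" using p b by simp
   then obtain t where t: "0 \<le> t" "w t < 0" "t < tau w + b * e" unfolding passage_less_iff by auto
   have "(INF t\<in>{t. 0 \<le> t \<and> affine_path 0 c b w t < 0}. ereal t) \<le> ereal (t / b)"
    by (rule INF_lower) (use t b c in \<open>auto simp: affine_path_def mult_less_0_iff\<close>)
   also have "t / b \<le> tau w / b + e" using t b by (simp add: field_simps)
   finally show "(INF t\<in>{t. 0 \<le> t \<and> affine_path 0 c b w t < 0}. ereal t) \<le> ereal (tau w / b) + ereal e" by simp
  qed
  show "ereal (tau w / b) \<le> (INF t\<in>{t. 0 \<le> t \<and> affine_path 0 c b w t < 0}. ereal t)"
  proof (rule INF_greatest)
   fix t assume t: "t \<in> {t. 0 \<le> t \<and> affine_path 0 c b w t < 0}"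
   then have "0 \<le> b * t" "w (b * t) < 0" using b c by (auto simp: affine_path_def mult_less_0_iff)
   then have "passage w \<le> ereal (b * t)" by (rule passage_le)
   then show "ereal (tau w / b) \<le> ereal t" using p b by (simp add: field_simps)
  qed
 qed
 then show ?thesis by (simp add: tau_def)
qed

lemma carea_affine_path:
 assumes b: "0 < b" and s: "0 \<le> s"
 shows "carea s (affine_path 0 c b w) = c / b * carea (b * s) w"
proof -
 have "carea (b * s) w = (\<integral>t. indicator {0..b * s} t *\<^sub>R w t \<partial>lborel)" by (simp only: set_lebesgue_integral_def)
 also have "... = \<bar>b\<bar> *\<^sub>R (\<integral>t. indicator {0..b * s} (0 + b * t) *\<^sub>R w (0 + b * t) \<partial>lborel)"
  using b by (intro lborel_integral_real_affine) simp
 also have "(\<lambda>t. indicator {0..b * s} (0 + b * t) *\<^sub>R w (0 + b * t)) = (\<lambda>t. indicator {0..s} t *\<^sub>R w (b * t))"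
  using b by (auto simp: fun_eq_iff indicator_def zero_le_mult_iff)
 finally have "carea (b * s) w = b * (\<integral>t. indicator {0..s} t *\<^sub>R w (b * t) \<partial>lborel)" using b by simp
 moreover have "carea s (affine_path 0 c b w) = (\<integral>t. c * (indicator {0..s} t *\<^sub>R w (b * t)) \<partial>lborel)"
  unfolding set_lebesgue_integral_def by (intro LINT_cong) (auto simp: affine_path_def indicator_def)
 ultimately show ?thesis using b by simp
qed

lemma (in positive_start) AE_area_nonneg:
 assumes "0 \<le> s" "s \<le> 1"
 shows "AE w in M. 0 \<le> (area (s * tau w) w)"
 using AE_passage_finite
proof eventually_elim
 case (elim w)
 have st: "0 \<le> s * tau w" "s * tau w \<le> tau w" using assms elim by (auto simp: mult_left_le_one_le)
 have fn: "first_neg (s * tau w) w = s * tau w" unfolding first_neg_def using elim st by (simp add: min_def)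
 show ?case by (rule area_nonneg[OF st(1)]) (simp only: fn order_refl)
qed

text \<open>The conditional laws enter through whole kernels: \<open>kp x\<close> is a version that
  is weakly continuous in the time, and its value at time 1 is the law that converges to Q. The
  members of \<open>Mx\<close> are tied together by \<open>stable_start_unique\<close>.\<close>

locale excursion_limit = airy_param \<alpha> for \<alpha> :: real +
 fixes Mx :: "real \<Rightarrow> (real \<Rightarrow> real) measure" and kp :: "real \<Rightarrow> ereal \<Rightarrow> (real \<Rightarrow> real) measure" and Q :: "(real \<Rightarrow> real) measure"
 assumes pos: "0 < x \<Longrightarrow> positive_start \<alpha> (Mx x) x"
  and ker: "0 < x \<Longrightarrow> cond_kernel_T0 (Mx x) (kp x)"
  and wc: "0 < x \<Longrightarrow> 0 \<le> s \<Longrightarrow> s < t \<Longrightarrow> weak_limit_upto s (\<lambda>u. kp x (ereal u)) (kp x (ereal t)) (at t)"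
  and Qp: "prob_space Q" and Qs: "sets Q = sets (path_space {0..1})"
  and lim: "0 \<le> s \<Longrightarrow> s < 1 \<Longrightarrow> weak_limit_upto s (\<lambda>x. kp x (ereal 1)) Q (at_right 0)"
begin

text \<open>The truncation s is an absolute time; continuity in the passage time r is available for
  s < r only.\<close>

definition G :: "real \<Rightarrow> real \<Rightarrow> real \<Rightarrow> (real \<Rightarrow> real) \<Rightarrow> real" where
 "G x r s f = (\<integral>w. f (carea s w) \<partial>kp x (ereal r))"

lemma kernel:
 assumes "0 < x"
 shows "kp x \<in> borel \<rightarrow>\<^sub>M prob_algebra (path_space {0..})" "sets (kp x r) = sets (path_space {0..})" "prob_space (kp x r)"
proof -
 show k: "kp x \<in> borel \<rightarrow>\<^sub>M prob_algebra (path_space {0..})" using ker[OF assms] by (simp add: cond_kernel_T0_def)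
 have "kp x r \<in> space (prob_algebra (path_space {0..}))" using measurable_space[OF k, of r] by simp
 then show "sets (kp x r) = sets (path_space {0..})" "prob_space (kp x r)" by (auto simp: space_prob_algebra)
qed

lemma G_bounds:
 assumes "0 < x" "\<And>a. 0 \<le> f a \<and> f a \<le> 1" shows "0 \<le> G x r s f" "G x r s f \<le> 1"
proof -
 interpret prob_space "kp x (ereal r)" by (rule kernel[OF assms(1)])
 show "0 \<le> G x r s f" unfolding G_def using assms(2) by (intro LINT_nonneg) auto
 show "G x r s f \<le> 1" unfolding G_def
  by (cases "integrable (kp x (ereal r)) (\<lambda>w. f (carea s w))") (use assms(2) in \<open>auto intro!: integral_le_const simp: not_integrable_integral_eq\<close>)
qed

lemma nn_integral_carea_kernel:
 fixes f :: "real \<Rightarrow> real"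
 assumes x: "0 < x" and s: "0 < s" and f: "continuous_on UNIV f" "\<And>a. 0 \<le> f a \<and> f a \<le> 1"
 shows "(\<integral>\<^sup>+w. ennreal (f (carea s w)) \<partial>kp x (ereal r)) = ennreal (G x r s f)"
proof -
 interpret prob_space "kp x (ereal r)" by (rule kernel[OF x])
 have m: "(\<lambda>w. f (carea s w)) \<in> borel_measurable (kp x (ereal r))"
  by (rule measurable_compose[OF measurable_carea[OF kernel(2)[OF x] _ s] borel_measurable_continuous_onI[OF f(1)]]) auto
 show ?thesis unfolding G_def
  by (rule nn_integral_eq_integral) (use f(2) m in \<open>auto intro!: integrable_const_bound[where B = 1]\<close>)
qed

lemma measurable_G:
 fixes f :: "real \<Rightarrow> real"
 assumes x: "0 < x" and s: "0 < s" and f: "continuous_on UNIV f" "\<And>a. 0 \<le> f a \<and> f a \<le> 1"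
 shows "(\<lambda>r. G x r s f) \<in> borel_measurable borel"
proof -
 have m: "(\<lambda>w. ennreal (f (carea s w))) \<in> borel_measurable (path_space {0..})"
  by (rule measurable_compose[OF measurable_compose[OF measurable_carea[OF refl _ s] borel_measurable_continuous_onI[OF f(1)]] measurable_ennreal]) auto
 have "(\<lambda>r. \<integral>\<^sup>+w. ennreal (f (carea s w)) \<partial>kp x (ereal r)) \<in> borel_measurable borel"
  by (rule measurable_compose[OF measurable_compose[OF borel_measurable_ereal[OF measurable_ident_sets[OF refl]] measurable_prob_algebraD[OF kernel(1)[OF x]]] nn_integral_measurable_subprob_algebra[OF m]])
 then have "(\<lambda>r. enn2real (ennreal (G x r s f))) \<in> borel_measurable borel"
  unfolding nn_integral_carea_kernel[OF x s f] by measurable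
 then show ?thesis using G_bounds(1)[of x f, OF x f(2)] by simp
qed

lemma isCont_G:
 fixes f :: "real \<Rightarrow> real"
 assumes x: "0 < x" and s: "0 < s" "s < t" and f: "continuous_on UNIV f" "\<And>a. 0 \<le> f a \<and> f a \<le> 1"
 shows "isCont (\<lambda>r. G x r s f) t"
 unfolding isCont_def G_def
 by (rule weak_limit_upto_carea[OF wc[OF x _ s(2)] f s(1) kernel(2)[OF x]]) (use s kernel(2)[OF x] in auto)

lemma G_tendsto:
 fixes f :: "real \<Rightarrow> real"
 assumes s: "0 < s" "s < 1" and f: "continuous_on UNIV f" "\<And>a. 0 \<le> f a \<and> f a \<le> 1"
 shows "((\<lambda>x. G x 1 s f) \<longlongrightarrow> (\<integral>w. f (carea s w) \<partial>Q)) (at_right 0)"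
 unfolding G_def
proof (rule weak_limit_upto_carea[OF lim[OF _ s(2)] f s(1) Qs])
 show "\<forall>\<^sub>F x in at_right 0. sets (kp x (ereal 1)) = sets (path_space {0..})"
  using eventually_at_right_less[of 0] by eventually_elim (rule kernel(2))
qed (use s in auto)

lemma disintegration_area:
 fixes f :: "real \<Rightarrow> real"
 assumes x: "0 < x" and s: "0 < s" and f: "continuous_on UNIV f" "\<And>a. 0 \<le> f a \<and> f a \<le> 1" and B: "B \<in> sets borel"
 shows "(\<integral>\<^sup>+v. ennreal (f (carea s v)) * indicator B (tau v) \<partial>Mx x) = (\<integral>\<^sup>+v. ennreal (G x (tau v) s f) * indicator B (tau v) \<partial>Mx x)"
proof -
 interpret positive_start \<alpha> "Mx x" x by (rule pos[OF x])
 have m: "(\<lambda>v. ennreal (f (carea s v))) \<in> borel_measurable (path_space {0..})"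
  by (rule measurable_compose[OF measurable_compose[OF measurable_carea[OF refl _ s] borel_measurable_continuous_onI[OF f(1)]] measurable_ennreal]) auto
 define F where "F p = ennreal (f (carea s (fst p))) * indicator B (snd p)" for p :: "(real \<Rightarrow> real) \<times> real"
 have "F \<in> borel_measurable (path_space {0..} \<Otimes>\<^sub>M borel)"
  unfolding F_def[abs_def] by (intro borel_measurable_times_ennreal measurable_compose[OF measurable_fst m] measurable_compose[OF measurable_snd borel_measurable_indicator[OF B]])
 note d = disintegration[OF ker[OF x] this]
 have inner: "(\<integral>\<^sup>+w. ennreal (f (carea s w)) * indicator B t \<partial>kp x (ereal t)) = ennreal (G x t s f) * indicator B t" for t
 proof -
  have "(\<lambda>v. ennreal (f (carea s v))) \<in> borel_measurable (kp x (ereal t))"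
   using m measurable_cong_sets[OF kernel(2)[OF x] refl] by blast
  then show ?thesis by (simp only: nn_integral_multc nn_integral_carea_kernel[OF x s f])
 qed
 show ?thesis using d unfolding F_def fst_conv snd_conv inner .
qed

text \<open>Scaling relates the two conditional expectations after integration over arbitrary sets
  of passage times. Both are continuous at the time in question, and the passage time charges every
  neighbourhood of 1, so \<open>less_at_support\<close> in both directions forces equality at the
  single time 1.\<close>

lemma scaling_identity:
 fixes f :: "real \<Rightarrow> real"
 assumes x: "0 < x" and u: "0 < u" and s: "0 < s" "s < 1" and f: "continuous_on UNIV f" "\<And>a. 0 \<le> f a \<and> f a \<le> 1"
 shows "G (x * u powr (- (1 / \<alpha>))) 1 s f = G x u (u * s) (\<lambda>a. f (u powr (- (1 + 1 / \<alpha>)) * a))"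
proof -
 \<comment> \<open>The space factor that belongs to the time factor u: a rescaled path has passage
   time \<tau> / u and area multiplied by c / u.\<close>
 define c where "c = u powr (- (1 / \<alpha>))"
 have c: "0 < c" "u * c powr \<alpha> = 1"
 proof -
  show "0 < c" using u by (simp add: c_def)
  have "c powr \<alpha> = u powr (- 1)" unfolding c_def powr_powr using \<alpha>1 by simp
  then show "u * c powr \<alpha> = 1" using u by (simp add: powr_neg_one)
 qed
 have cu: "c / u = u powr (- (1 + 1 / \<alpha>))"
 proof -
  have e: "- (1 + 1 / \<alpha>) = - (1 / \<alpha>) - 1" by simp
  show ?thesis unfolding e c_def powr_diff using u by simp
 qed
 define y where "y = c * x"
 have y: "0 < y" using c x by (simp add: y_def)
 interpret X: positive_start \<alpha> "Mx x" x by (rule pos[OF x])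
 interpret Y: positive_start \<alpha> "Mx y" y by (rule pos[OF y])
 let ?D = "affine_path 0 c u"
 have D: "?D \<in> Mx x \<rightarrow>\<^sub>M path_space {0..}" by (rule measurable_affine_path[OF X.sets_M u])
 have "stable_start \<alpha> (distr (Mx x) (path_space {0..}) ?D) y" using X.stable_start_affine[OF u c, of 0] by (simp add: y_def)
 then have MD: "Mx y = distr (Mx x) (path_space {0..}) ?D" by (rule stable_start_unique[OF Y.stable_start_axioms])
 have tauD: "AE w in Mx x. tau (?D w) = tau w / u"
  using X.AE_passage_finite by eventually_elim (use tau_affine_path[OF _ u c(1)] in blast)
 define f' where "f' a = f (c / u * a)" for a
 have f': "continuous_on UNIV f'" "\<And>a. 0 \<le> f' a \<and> f' a \<le> 1"
 proof -
  show "continuous_on UNIV f'" unfolding f'_def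
   by (rule continuous_on_compose2[OF f(1), of UNIV "\<lambda>a. c / u * a"]) (rule continuous_on_mult_left[OF continuous_on_id], simp)
  show "0 \<le> f' a \<and> f' a \<le> 1" for a unfolding f'_def by (rule f(2))
 qed
 have us: "0 < u * s" using u s by simp
 have eq: "(\<integral>\<^sup>+w. ennreal (G y (tau w) s f) * indicator B (tau w) \<partial>Mx y) = (\<integral>\<^sup>+w. ennreal (G x (u * tau w) (u * s) f') * indicator B (tau w) \<partial>Mx y)"
  if B: "B \<in> sets borel" for B
 proof -
  have tm: "tau \<in> borel_measurable (path_space {0..})"
   unfolding tau_def[abs_def] using measurable_passage[of "path_space {0..}"] by measurable
  have m: "(\<lambda>w. ennreal (f (carea s w))) \<in> borel_measurable (path_space {0..})"
   by (rule measurable_compose[OF measurable_compose[OF measurable_carea[OF refl _ s(1)] borel_measurable_continuous_onI[OF f(1)]] measurable_ennreal]) auto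
  have iB: "(\<lambda>w. indicator B (tau w) :: ennreal) \<in> borel_measurable (path_space {0..})" by (rule measurable_compose[OF tm borel_measurable_indicator[OF B]])
  define B' where "B' = (\<lambda>r. r / u) -` B \<inter> space borel"
  have B': "B' \<in> sets borel" unfolding B'_def by (rule measurable_sets[OF _ B]) measurable
  have ind: "indicator B (r / u) = (indicator B' r :: ennreal)" for r by (simp add: B'_def indicator_def)
  have "(\<integral>\<^sup>+w. ennreal (G y (tau w) s f) * indicator B (tau w) \<partial>Mx y) = (\<integral>\<^sup>+w. ennreal (f (carea s w)) * indicator B (tau w) \<partial>Mx y)"
   by (rule disintegration_area[OF y s(1) f B, symmetric])
  also have "... = (\<integral>\<^sup>+w. ennreal (f (carea s (?D w))) * indicator B (tau (?D w)) \<partial>Mx x)"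
   unfolding MD by (rule nn_integral_distr[OF D]) (use m iB in simp)
  also have "... = (\<integral>\<^sup>+w. ennreal (f' (carea (u * s) w)) * indicator B' (tau w) \<partial>Mx x)"
   by (rule nn_integral_cong_AE) (use tauD in eventually_elim, use s in \<open>simp add: carea_affine_path[OF u] f'_def ind\<close>)
  also have "... = (\<integral>\<^sup>+w. ennreal (G x (tau w) (u * s) f') * indicator B' (tau w) \<partial>Mx x)"
   by (rule disintegration_area[OF x us f' B'])
  also have "... = (\<integral>\<^sup>+w. ennreal (G x (u * tau (?D w)) (u * s) f') * indicator B (tau (?D w)) \<partial>Mx x)"
   by (rule nn_integral_cong_AE) (use tauD in eventually_elim, use u in \<open>simp add: ind\<close>)
  also have "... = (\<integral>\<^sup>+w. ennreal (G x (u * tau w) (u * s) f') * indicator B (tau w) \<partial>Mx y)"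
  proof -
   have "(\<lambda>w. u * tau w) \<in> borel_measurable (path_space {0..})" using tm by measurable
   from measurable_compose[OF measurable_compose[OF this measurable_G[OF x us f']] measurable_ennreal]
   have "(\<lambda>w. ennreal (G x (u * tau w) (u * s) f')) \<in> borel_measurable (path_space {0..})" .
   then show ?thesis unfolding MD by (intro nn_integral_distr[OF D, symmetric]) (use iB in simp)
  qed
  finally show ?thesis .
 qed
 have cont1: "isCont (\<lambda>r. G y r s f) 1" by (rule isCont_G[OF y s f])
 have "isCont (\<lambda>r. G x r (u * s) f') (u * 1)" by (rule isCont_G[OF x us _ f']) (use u s in simp)
 then have cont2: "isCont (\<lambda>r. G x (u * r) (u * s) f') 1" by (rule isCont_o2[rotated]) (intro continuous_intros)
 have Bd: "{r. \<bar>r - 1\<bar> < dl} \<in> sets borel" for dl :: real by measurable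
 have "G y 1 s f \<le> G x (u * 1) (u * s) f'"
  by (rule Y.less_at_support[OF zero_less_one zero_less_one cont2 cont1 G_bounds(1)[OF x f'(2)]]) (simp add: eq[OF Bd])
 moreover have "G x (u * 1) (u * s) f' \<le> G y 1 s f"
  by (rule Y.less_at_support[OF zero_less_one zero_less_one cont1 cont2 G_bounds(1)[OF y f(2)]]) (simp add: eq[OF Bd])
 ultimately have "G y 1 s f = G x u (u * s) f'" by simp
 then show ?thesis unfolding y_def f'_def cu by (simp add: c_def mult.commute)
qed

text \<open>Conditioned on a passage near 1, a path is nonnegative up to s, so a bounded test
  function that detects negative area integrates to 0. \<open>less_at_support\<close> carries this
  to passage exactly at 1, and the weak limit keeps it.\<close>

lemma AE_carea_nonneg:
 assumes s: "0 < s" "s < 1" shows "AE w in Q. 0 \<le> carea s w"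
proof -
 interpret Q: prob_space Q by (rule Qp)
 define f where "f a = min 1 (max 0 (- a))" for a :: real
 have f: "continuous_on UNIV f" "\<And>a. 0 \<le> f a \<and> f a \<le> 1" unfolding f_def by (auto intro!: continuous_intros)
 have G0: "G x 1 s f = 0" if x: "0 < x" for x
 proof (rule antisym)
  interpret X: positive_start \<alpha> "Mx x" x by (rule pos[OF x])
  \<comment> \<open>Passage times within 1 - s of 1 lie beyond s, so the part of the path up to s
    precedes the passage.\<close>
  have d: "0 < 1 - s" using s by simp
  show "G x 1 s f \<le> 0"
  proof (rule X.less_at_support[OF zero_less_one d _ isCont_G[OF x s f], where ?G1.0 = "\<lambda>_. 0"])
   fix dl assume dl: "0 < dl" "dl \<le> 1 - s"
   have "(\<integral>\<^sup>+w. ennreal (G x (tau w) s f) * indicator {r. \<bar>r - 1\<bar> < dl} (tau w) \<partial>Mx x) = (\<integral>\<^sup>+w. ennreal (f (carea s w)) * indicator {r. \<bar>r - 1\<bar> < dl} (tau w) \<partial>Mx x)"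
    by (rule disintegration_area[OF x s(1) f, symmetric]) measurable
   also have "... = (\<integral>\<^sup>+w. 0 \<partial>Mx x)"
   proof (rule nn_integral_cong_AE)
    show "AE w in Mx x. ennreal (f (carea s w)) * indicator {r. \<bar>r - 1\<bar> < dl} (tau w) = 0"
     using X.AE_passage_finite AE_space
    proof eventually_elim
     case (elim w)
     show ?case
     proof (cases "\<bar>tau w - 1\<bar> < dl")
      case True
      then have "s \<le> tau w" using dl by linarith
      then have fn: "first_neg s w = s" unfolding first_neg_def using elim(1) s by (simp add: min_def)
      have "0 \<le> (area s w)"
      proof (rule X.area_nonneg)
       show "0 \<le> s" using s by simp
       show "s \<le> first_neg s w" unfolding fn by (rule order_refl)
      qed
      moreover have "carea s w = (area s w)" using elim(2) sets_eq_imp_space_eq[OF X.sets_M] by (intro carea_eq_area) simp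
      ultimately show ?thesis by (simp add: f_def)
     qed simp
    qed
   qed
   finally show "(\<integral>\<^sup>+w. ennreal (G x (tau w) s f) * indicator {r. \<bar>r - 1\<bar> < dl} (tau w) \<partial>Mx x) \<le> (\<integral>\<^sup>+w. ennreal 0 * indicator {r. \<bar>r - 1\<bar> < dl} (tau w) \<partial>Mx x)" by simp
  qed auto
  show "0 \<le> G x 1 s f" by (rule G_bounds(1)[OF x f(2)])
 qed
 have "((\<lambda>x. G x 1 s f) \<longlongrightarrow> 0) (at_right 0)"
 proof (rule Lim_transform_eventually[OF tendsto_const])
  show "\<forall>\<^sub>F x in at_right 0. 0 = G x 1 s f" using eventually_at_right_less[of 0] by eventually_elim (simp add: G0)
 qed
 from tendsto_unique[OF _ G_tendsto[OF s f] this] have "(\<integral>w. f (carea s w) \<partial>Q) = 0" by simp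
 moreover have m: "(\<lambda>w. f (carea s w)) \<in> borel_measurable Q"
  by (rule measurable_compose[OF measurable_carea[OF Qs _ s(1)] borel_measurable_continuous_onI[OF f(1)]]) (use s in auto)
 moreover have "integrable Q (\<lambda>w. f (carea s w))" by (rule Q.integrable_const_bound[where B = 1]) (use f(2) m in auto)
 ultimately have "AE w in Q. f (carea s w) = 0" using f(2) by (subst (asm) integral_nonneg_eq_0_iff_AE) auto
 then show ?thesis by eventually_elim (auto simp: f_def min_def max_def split: if_splits)
qed

end

text \<open>The estimate is uniform in a because c a exp (- c a) is at most 1; this gives
  equicontinuity in the parameter c although the areas have no common bound.\<close>

lemma exp_mult_diff_le:
 assumes "0 < c" "c \<le> d" "0 \<le> (a::real)"
 shows "0 \<le> exp (- c * a) - exp (- d * a)" "exp (- c * a) - exp (- d * a) \<le> (d - c) / c"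
proof -
 show "0 \<le> exp (- c * a) - exp (- d * a)" using assms by (simp add: mult_right_mono)
 have "exp (- c * a) - exp (- d * a) = exp (- c * a) * (1 - exp (- ((d - c) * a)))" by (simp add: right_diff_distrib left_diff_distrib exp_add[symmetric])
 also have "... \<le> exp (- c * a) * ((d - c) * a)"
  using exp_ge_add_one_self[of "- ((d - c) * a)"] by (intro mult_left_mono) (linarith, simp)
 also have "... = (d - c) / c * ((c * a) * exp (- (c * a)))" using assms by simp
 also have "... \<le> (d - c) / c * 1"
 proof (rule mult_left_mono)
  have "c * a \<le> exp (c * a)" using exp_ge_add_one_self[of "c * a"] by linarith
  then have "(c * a) * exp (- (c * a)) \<le> exp (c * a) * exp (- (c * a))" by (rule mult_right_mono) simp
  then show "(c * a) * exp (- (c * a)) \<le> 1" by (simp add: exp_add[symmetric])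
 qed (use assms in simp)
 finally show "exp (- c * a) - exp (- d * a) \<le> (d - c) / c" by simp
qed

section \<open>Comparing the conditioned areas with the excursion\<close>

context excursion_limit
begin

text \<open>Absolute value and positive part give a continuous function into [0, 1] on all of the
  reals, as test functions have to be; for nonnegative c and a it is exp (- c a).\<close>

definition fe :: "real \<Rightarrow> real \<Rightarrow> real" where "fe c a = exp (- (\<bar>c\<bar> * max 0 a))"

lemma fe: "continuous_on UNIV (fe c)" "0 \<le> fe c a \<and> fe c a \<le> 1"
 unfolding fe_def by (auto intro!: continuous_intros)

definition H :: "real \<Rightarrow> real \<Rightarrow> real" where "H s c = (\<integral>w. fe c (carea s w) \<partial>Q)"

text \<open>The conditional mean of exp (- area up to s r), given passage at time r from x, brought
  to passage time 1 by scaling: the starting point becomes x r^(-1/\<alpha>) and the area is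
  multiplied by r^(1 + 1/\<alpha>). See \<open>g_eq\<close>.\<close>

definition g :: "real \<Rightarrow> real \<Rightarrow> real \<Rightarrow> real" where
 "g s x r = G (x * r powr (- (1 / \<alpha>))) 1 s (fe (r powr (1 + 1 / \<alpha>)))"

lemma g_eq:
 assumes "0 < x" "0 < r" "0 < s" "s < 1" shows "g s x r = G x r (r * s) (fe 1)"
proof -
 have "(\<lambda>a. fe (r powr (1 + 1 / \<alpha>)) (r powr (- (1 + 1 / \<alpha>)) * a)) = fe 1"
 proof
  fix a
  have p: "0 < r powr (1 + 1 / \<alpha>)" using assms by simp
  have "r powr (1 + 1 / \<alpha>) * max 0 (r powr (- (1 + 1 / \<alpha>)) * a) = max 0 a"
  proof -
   have "r powr (1 + 1 / \<alpha>) * max 0 (r powr (- (1 + 1 / \<alpha>)) * a) = max (r powr (1 + 1 / \<alpha>) * 0) (r powr (1 + 1 / \<alpha>) * (r powr (- (1 + 1 / \<alpha>)) * a))"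
    using p by (intro max_mult_distrib_left[THEN trans]) simp
   also have "r powr (1 + 1 / \<alpha>) * (r powr (- (1 + 1 / \<alpha>)) * a) = a"
    using assms powr_add[of r "1 + 1 / \<alpha>" "- (1 + 1 / \<alpha>)"] by (simp add: mult.assoc[symmetric])
   finally show ?thesis by simp
  qed
  then show "fe (r powr (1 + 1 / \<alpha>)) (r powr (- (1 + 1 / \<alpha>)) * a) = fe 1 a" by (simp add: fe_def)
 qed
 then show ?thesis unfolding g_def using scaling_identity[OF assms fe] by simp
qed

lemma Hm: assumes "0 < s" "s \<le> 1" shows "(\<lambda>w. fe c (carea s w)) \<in> borel_measurable Q"
 by (rule measurable_compose[OF measurable_carea[OF Qs _ assms(1)] borel_measurable_continuous_onI[OF fe(1)]]) (use assms in auto)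

lemma H_bounds: "0 \<le> H s c" "H s c \<le> 1"
proof -
 interpret Q: prob_space Q by (rule Qp)
 show "0 \<le> H s c" unfolding H_def using fe(2) by (intro LINT_nonneg) auto
 show "H s c \<le> 1" unfolding H_def
  by (cases "integrable Q (\<lambda>w. fe c (carea s w))") (use fe(2) in \<open>auto intro!: Q.integral_le_const simp: not_integrable_integral_eq\<close>)
qed

lemma continuous_H: assumes s: "0 < s" "s \<le> 1" shows "continuous_on UNIV (H s)"
proof -
 interpret Q: prob_space Q by (rule Qp)
 have "isCont (H s) c" for c
  unfolding continuous_at_sequentially o_def H_def
 proof (intro allI impI)
  fix X :: "nat \<Rightarrow> real" assume X: "X \<longlonglongrightarrow> c"
  show "(\<lambda>n. \<integral>v. fe (X n) (carea s v) \<partial>Q) \<longlonglongrightarrow> (\<integral>v. fe c (carea s v) \<partial>Q)"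
  proof (rule integral_dominated_convergence[where w = "\<lambda>_. 1"])
   show "AE v in Q. (\<lambda>n. fe (X n) (carea s v)) \<longlonglongrightarrow> fe c (carea s v)"
    unfolding fe_def by (intro AE_I2 tendsto_intros X)
  qed (use Hm[OF s] fe(2) in auto)
 qed
 then show ?thesis by (simp add: continuous_on_eq_continuous_at)
qed

lemma G_fe_diff:
 assumes x: "0 < x" and s: "0 < s" and c: "0 < c" "c \<le> d"
 shows "0 \<le> G x r s (fe c) - G x r s (fe d)" "G x r s (fe c) - G x r s (fe d) \<le> (d - c) / c"
proof -
 interpret K: prob_space "kp x (ereal r)" by (rule kernel[OF x])
 have i: "integrable (kp x (ereal r)) (\<lambda>w. fe c (carea s w))" for c
  by (rule K.integrable_const_bound[where B = 1])
   (use fe(2) in auto, rule measurable_compose[OF measurable_carea[OF kernel(2)[OF x] _ s] borel_measurable_continuous_onI[OF fe(1)]], auto)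
 have e: "G x r s (fe c) - G x r s (fe d) = (\<integral>w. fe c (carea s w) - fe d (carea s w) \<partial>kp x (ereal r))"
  unfolding G_def by (rule LINT_diff[OF i i, symmetric])
 have b: "0 \<le> fe c a - fe d a" "fe c a - fe d a \<le> (d - c) / c" for a
  using exp_mult_diff_le[OF c, of "max 0 a"] c by (simp_all add: fe_def)
 show "0 \<le> G x r s (fe c) - G x r s (fe d)" unfolding e using b(1) by (intro LINT_nonneg) auto
 show "G x r s (fe c) - G x r s (fe d) \<le> (d - c) / c" unfolding e
  by (rule K.integral_le_const) (use b(2) i in \<open>auto intro!: Lintegrable_diff\<close>)
qed

text \<open>Weak convergence treats each c separately. \<open>G_fe_diff\<close> makes the functions
  equicontinuous in c on [c0, c1], so finitely many parameters suffice; a step of e c0 / 4 keeps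
  each variation below e / 4.\<close>

lemma G_fe_uniform:
 assumes s: "0 < s" "s < 1" and c: "0 < c0" "c0 \<le> c1" and e: "0 < e"
 shows "\<exists>y0>0. \<forall>y c. 0 < y \<and> y < y0 \<and> c0 \<le> c \<and> c \<le> c1 \<longrightarrow> \<bar>G y 1 s (fe c) - H s c\<bar> \<le> e"
proof -
 define d where "d = e * c0 / 4"
 have d: "0 < d" using e c by (simp add: d_def)
 obtain n :: nat where n: "(c1 - c0) / d < real n" using reals_Archimedean2 by blast
 define p where "p k = c0 + real k * d" for k
 have "\<forall>\<^sub>F y in at_right 0. \<forall>k\<in>{..n}. \<bar>G y 1 s (fe (p k)) - H s (p k)\<bar> < e / 4"
 proof (rule eventually_ball_finite)
  show "\<forall>k\<in>{..n}. \<forall>\<^sub>F y in at_right 0. \<bar>G y 1 s (fe (p k)) - H s (p k)\<bar> < e / 4"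
  proof
   fix k
   have "\<forall>\<^sub>F y in at_right 0. dist (G y 1 s (fe (p k))) (\<integral>w. fe (p k) (carea s w) \<partial>Q) < e / 4"
    by (rule tendstoD[OF G_tendsto[OF s fe]]) (use e in simp)
   then show "\<forall>\<^sub>F y in at_right 0. \<bar>G y 1 s (fe (p k)) - H s (p k)\<bar> < e / 4" by (simp only: H_def dist_real_def)
  qed
 qed simp
 then obtain y0 where y0: "0 < y0" "\<And>y k. 0 < y \<Longrightarrow> y < y0 \<Longrightarrow> k \<le> n \<Longrightarrow> \<bar>G y 1 s (fe (p k)) - H s (p k)\<bar> < e / 4"
  unfolding eventually_at_right_field by auto
 have Hd: "0 \<le> H s c - H s d'" "H s c - H s d' \<le> (d' - c) / c" if "0 < c" "c \<le> d'" for c d'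
 proof -
  have ev: "\<forall>\<^sub>F x in at_right (0::real). 0 < x" by (rule eventually_at_right_less)
  have l: "((\<lambda>x. G x 1 s (fe c) - G x 1 s (fe d')) \<longlongrightarrow> H s c - H s d') (at_right 0)"
   unfolding H_def by (intro tendsto_diff G_tendsto s fe)
  show "0 \<le> H s c - H s d'"
   by (rule tendsto_lowerbound[OF l]) (use ev in eventually_elim, rule G_fe_diff(1)[OF _ s(1) that], auto)
  show "H s c - H s d' \<le> (d' - c) / c"
   by (rule tendsto_upperbound[OF l]) (use ev in eventually_elim, rule G_fe_diff(2)[OF _ s(1) that], auto)
 qed
 have "\<bar>G y 1 s (fe c) - H s c\<bar> \<le> e" if y: "0 < y" "y < y0" and cc: "c0 \<le> c" "c \<le> c1" for y c
 proof -
  define k where "k = nat \<lfloor>(c - c0) / d\<rfloor>"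
  have q: "0 \<le> (c - c0) / d" using cc d by simp
  then have k: "real k \<le> (c - c0) / d" "(c - c0) / d < real k + 1" unfolding k_def by linarith+
  have "(c - c0) / d \<le> (c1 - c0) / d" using cc d by (simp add: divide_right_mono)
  then have kn: "k \<le> n" using k(1) n by linarith
  have pk: "p k \<le> c" "c - p k \<le> d" using k d by (simp_all add: p_def field_simps)
  have p0: "c0 \<le> p k" using d by (simp add: p_def)
  then have pp: "0 < p k" using c by linarith
  have "(c - p k) / p k \<le> d / c0" by (rule frac_le) (use pk p0 c d in auto)
  also have "d / c0 = e / 4" using c by (simp add: d_def)
  finally have b: "(c - p k) / p k \<le> e / 4" .
  show ?thesis
   using y0(2)[OF y kn] G_fe_diff[OF y(1) s(1) pp pk(1), of 1] Hd[OF pp pk(1)] b by linarith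
 qed
 then show ?thesis using y0(1) by blast
qed

text \<open>The cut s \<tau> moves with the passage time, so that after scaling every path is cut at
  the same proportion s of its lifetime and \<open>g\<close> appears.\<close>

lemma G_joint_J:
 assumes x: "0 < x" and s: "0 < s" "s < 1" and w: "w \<in> borel_measurable borel" "\<And>r. 0 \<le> w r"
 shows "(\<integral>\<^sup>+y. ennreal (w (tau y) * exp (- (area (s * tau y) y))) \<partial>Mx x) = (\<integral>\<^sup>+y. ennreal (w (tau y) * g s x (tau y)) \<partial>Mx x)"
proof -
 interpret X: positive_start \<alpha> "Mx x" x by (rule pos[OF x])
 define F where "F p = ennreal (w (snd p)) * ennreal (fe 1 (LBINT t:{0..<s * snd p}. fst p t))" for p :: "(real \<Rightarrow> real) \<times> real"
 have "(\<lambda>p. (s * snd p, fst p)) \<in> path_space {0..} \<Otimes>\<^sub>M borel \<rightarrow>\<^sub>M borel \<Otimes>\<^sub>M path_space {0..}" by measurable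
 from measurable_compose[OF this measurable_area_joint[OF refl]]
 have a: "(\<lambda>p. LBINT t:{0..<s * snd p}. fst p t) \<in> borel_measurable (path_space {0..} \<Otimes>\<^sub>M borel)" by (simp add: case_prod_unfold)
 have Fm: "F \<in> borel_measurable (path_space {0..} \<Otimes>\<^sub>M borel)"
  unfolding F_def[abs_def]
  by (intro borel_measurable_times_ennreal measurable_compose[OF _ measurable_ennreal] measurable_compose[OF measurable_snd w(1)]
    measurable_compose[OF a borel_measurable_continuous_onI[OF fe(1)]])
 have "(\<integral>\<^sup>+y. ennreal (w (tau y) * exp (- (area (s * tau y) y))) \<partial>Mx x) = (\<integral>\<^sup>+y. F (y, tau y) \<partial>Mx x)"
 proof (rule nn_integral_cong_AE)
  show "AE y in Mx x. ennreal (w (tau y) * exp (- (area (s * tau y) y))) = F (y, tau y)"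
   using X.AE_area_nonneg[OF less_imp_le[OF s(1)] less_imp_le[OF s(2)]]
  proof eventually_elim
   case (elim y)
   then show ?case unfolding F_def fst_conv snd_conv fe_def by (simp add: ennreal_mult'[OF w(2)])
  qed
 qed
 also have "... = (\<integral>\<^sup>+y. (\<integral>\<^sup>+v. F (v, tau y) \<partial>kp x (ereal (tau y))) \<partial>Mx x)" by (rule X.disintegration[OF ker[OF x] Fm])
 also have "... = (\<integral>\<^sup>+y. ennreal (w (tau y) * g s x (tau y)) \<partial>Mx x)"
 proof (rule nn_integral_cong_AE)
  show "AE y in Mx x. (\<integral>\<^sup>+v. F (v, tau y) \<partial>kp x (ereal (tau y))) = ennreal (w (tau y) * g s x (tau y))"
   using X.AE_passage_finite
  proof eventually_elim
   case (elim y)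
   then have t: "0 < tau y" by blast
   have st: "0 < tau y * s" using t s by simp
   let ?K = "kp x (ereal (tau y))"
   have m: "(\<lambda>v. ennreal (fe 1 (carea (tau y * s) v))) \<in> borel_measurable ?K"
    by (rule measurable_compose[OF measurable_compose[OF measurable_carea[OF kernel(2)[OF x] _ st] borel_measurable_continuous_onI[OF fe(1)]] measurable_ennreal]) auto
   have "(\<integral>\<^sup>+v. F (v, tau y) \<partial>?K) = (\<integral>\<^sup>+v. ennreal (w (tau y)) * ennreal (fe 1 (carea (tau y * s) v)) \<partial>?K)"
   proof (rule nn_integral_cong)
    fix v assume "v \<in> space ?K"
    then have "v \<in> cadlag_paths {0..}" using sets_eq_imp_space_eq[OF kernel(2)[OF x]] by simp
    from carea_eq_area[OF this, of "tau y * s"] show "F (v, tau y) = ennreal (w (tau y)) * ennreal (fe 1 (carea (tau y * s) v))"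
     unfolding F_def fst_conv snd_conv by (simp only: mult.commute)
   qed
   also have "... = ennreal (w (tau y)) * ennreal (G x (tau y) (tau y * s) (fe 1))"
    unfolding nn_integral_cmult[OF m] nn_integral_carea_kernel[OF x st fe] ..
   finally show ?case unfolding g_eq[OF x t s] by (simp only: ennreal_mult'[OF w(2)])
  qed
 qed
 finally show ?thesis .
qed

end

section \<open>The limit at the origin\<close>

lemma cadlag_on_mono: "cadlag_on I w \<Longrightarrow> J \<subseteq> I \<Longrightarrow> cadlag_on J w"
 unfolding cadlag_on_def by (meson Int_mono order_refl subsetD tendsto_within_subset)

context excursion_limit
begin

text \<open>C / x times the law of \<tau> under the start x tends to r^(- 1 - 1/\<alpha>) dr as x
  tends to 0, in the weighted sense of \<open>weight_limit\<close>.\<close>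

definition C :: real where "C = \<alpha> * Gamma (1 - 1 / \<alpha>)"

lemma C_pos: "0 < C"
 unfolding C_def using \<alpha>1 by (intro mult_pos_pos Gamma_real_pos) auto

definition xia :: "nat \<Rightarrow> real" where "xia n = 1 / (real n + 1)"

lemma xia_pos: "0 < xia n" by (simp add: xia_def)

abbreviation Mn :: "nat \<Rightarrow> (real \<Rightarrow> real) measure" where "Mn n \<equiv> Mx (xia n)"

lemma xia_lim: "xia \<longlonglongrightarrow> 0" unfolding xia_def by real_asymp

text \<open>The limit density made integrable: the difference of exponentials is of order r at the
  origin. The parameter a > 0 provides the exponential decay that \<open>Jn_tendsto\<close> splits
  off and \<open>last_area_bound\<close> integrates.\<close>

definition W0 :: "real \<Rightarrow> real \<Rightarrow> real \<Rightarrow> real" where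
 "W0 a b r = indicator {0<..} r * ((exp (- a * r) - exp (- b * r)) * r powr (- (1 + 1 / \<alpha>)))"

lemma W0:
 assumes "0 < a" "a < b"
 shows "integrable lborel (W0 a b)" "(LINT r|lborel. W0 a b r) = C * (b powr (1 / \<alpha>) - a powr (1 / \<alpha>))" "0 \<le> W0 a b r"
proof -
 have h: "has_bochner_integral lborel (W0 a b) (C * (b powr (1 / \<alpha>) - a powr (1 / \<alpha>)))"
  unfolding W0_def[abs_def] C_def by (rule levy_measure_integral[OF assms \<alpha>1])
 show "integrable lborel (W0 a b)" "(LINT r|lborel. W0 a b r) = C * (b powr (1 / \<alpha>) - a powr (1 / \<alpha>))"
  using h by (auto simp: has_bochner_integral_iff)
 show "0 \<le> W0 a b r" using assms by (auto simp: W0_def indicator_def intro!: mult_nonneg_nonneg)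
qed

definition Wn :: "real \<Rightarrow> real \<Rightarrow> nat \<Rightarrow> (real \<Rightarrow> real) \<Rightarrow> real" where
 "Wn a b n w = C / xia n * (exp (- a * tau w) - exp (- b * tau w))"

lemma Wn_nonneg: assumes "0 < a" "a < b" shows "0 \<le> Wn a b n w"
proof -
 have "exp (- b * tau w) \<le> exp (- a * tau w)" using assms tau_nonneg[of w] by (simp add: mult_right_mono)
 then show ?thesis unfolding Wn_def using C_pos xia_pos[of n] by (intro mult_nonneg_nonneg) auto
qed

lemma Wn_integrable: assumes "0 < a" "a < b" shows "integrable (Mn n) (Wn a b n)"
proof -
 interpret X: positive_start \<alpha> "Mn n" "xia n" by (rule pos[OF xia_pos])
 have "integrable (Mn n) (\<lambda>w. exp (- q * tau w))" if "0 < q" for q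
  by (rule X.integrable_const_bound[where B = 1]) (use that tau_nonneg in \<open>auto intro!: AE_I2\<close>)
 then show ?thesis unfolding Wn_def[abs_def] using assms by (intro integrable_mult_right Lintegrable_diff) auto
qed

text \<open>A factor exp (- k r) merely shifts a and b by k, so every moment is a difference of
  Laplace transforms of \<tau> on one side and an instance of \<open>levy_measure_integral\<close>
  on the other.\<close>

lemma weight_limit:
 fixes f :: "real \<Rightarrow> real"
 assumes ab: "0 < a" "a < b" and f: "continuous_on UNIV f"
 shows "(\<lambda>n. LINT w|Mn n. Wn a b n w * f (exp (- tau w))) \<longlonglongrightarrow> (LINT r|lborel. W0 a b r * f (exp (- \<bar>r\<bar>)))"
proof (rule moments_tendsto[OF Wn_integrable[OF ab] Wn_nonneg[OF ab] _ _ W0(1,3)[OF ab] _ _ _ f])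
 show "(\<lambda>w. exp (- tau w)) \<in> borel_measurable (Mn n)" for n
 proof -
  interpret X: positive_start \<alpha> "Mn n" "xia n" by (rule pos[OF xia_pos])
  show ?thesis by measurable
 qed
 show "(\<lambda>r::real. exp (- \<bar>r\<bar>)) \<in> borel_measurable lborel" by measurable
 show "0 \<le> exp (- tau w) \<and> exp (- tau w) \<le> 1" for w using tau_nonneg by simp
 show "0 \<le> exp (- \<bar>r\<bar>) \<and> exp (- \<bar>r\<bar>) \<le> 1" for r :: real by simp
 fix k :: nat
 define A B where "A = (a + real k) powr (1 / \<alpha>)" and "B = (b + real k) powr (1 / \<alpha>)"
 have ee: "exp (- c * t) * exp (- t) ^ k = exp (- (c + real k) * t)" for c t :: real
  unfolding exp_of_nat_mult[symmetric] exp_add[symmetric] by (simp add: algebra_simps)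
 have e: "(LINT w|Mn n. Wn a b n w * exp (- tau w) ^ k) = C * ((exp (- A * xia n) - exp (- B * xia n)) / xia n)" for n
 proof -
  interpret X: positive_start \<alpha> "Mn n" "xia n" by (rule pos[OF xia_pos])
  have i: "integrable (Mn n) (\<lambda>w. exp (- q * tau w))" if "0 < q" for q
   by (rule X.integrable_const_bound[where B = 1]) (use that tau_nonneg in \<open>auto intro!: AE_I2\<close>)
  have "(LINT w|Mn n. Wn a b n w * exp (- tau w) ^ k) = (LINT w|Mn n. C / xia n * (exp (- (a + real k) * tau w) - exp (- (b + real k) * tau w)))"
   by (simp only: Wn_def mult.assoc left_diff_distrib ee)
  also have "... = C / xia n * (LINT w|Mn n. exp (- (a + real k) * tau w) - exp (- (b + real k) * tau w))" by (rule integral_mult_right_zero)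
  also have "(LINT w|Mn n. exp (- (a + real k) * tau w) - exp (- (b + real k) * tau w)) = (LINT w|Mn n. exp (- (a + real k) * tau w)) - (LINT w|Mn n. exp (- (b + real k) * tau w))"
   by (rule LINT_diff) (rule i, use ab in linarith)+
  finally have "(LINT w|Mn n. Wn a b n w * exp (- tau w) ^ k) = C / xia n * ((LINT w|Mn n. exp (- (a + real k) * tau w)) - (LINT w|Mn n. exp (- (b + real k) * tau w)))" .
  moreover have "0 < a + real k" "0 < b + real k" using ab by linarith+
  ultimately show ?thesis unfolding A_def B_def by (simp only: X.laplace_tau times_divide_eq_left times_divide_eq_right)
 qed
 have "(\<lambda>n. (exp (- A * xia n) - exp (- B * xia n)) / xia n) \<longlonglongrightarrow> B - A" unfolding xia_def by real_asymp
 then have "(\<lambda>n. LINT w|Mn n. Wn a b n w * exp (- tau w) ^ k) \<longlonglongrightarrow> C * (B - A)"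
  unfolding e by (intro tendsto_mult tendsto_const)
 moreover have "(\<lambda>r. W0 a b r * exp (- \<bar>r\<bar>) ^ k) = W0 (a + real k) (b + real k)"
 proof
  fix r :: real
  show "W0 a b r * exp (- \<bar>r\<bar>) ^ k = W0 (a + real k) (b + real k) r"
  proof (cases "0 < r")
   case True
   have "W0 a b r * exp (- r) ^ k = W0 (a + real k) (b + real k) r"
    unfolding W0_def ee[symmetric] left_diff_distrib[symmetric] by (simp only: mult_ac)
   then show ?thesis using True by (simp only: abs_of_pos)
  qed (simp add: W0_def)
 qed
 ultimately show "(\<lambda>n. LINT w|Mn n. Wn a b n w * exp (- tau w) ^ k) \<longlonglongrightarrow> (LINT r|lborel. W0 a b r * exp (- \<bar>r\<bar>) ^ k)"
  using W0(2)[of "a + real k" "b + real k"] ab by (simp add: A_def B_def)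
qed

text \<open>A majorant, polynomial in u = exp (- r), for errors that are uniformly small only on
  compact sets of r > 0: u^k takes care of r near 0 and (1 - u)^k of large r. Being continuous in u
  it can be integrated by \<open>weight_limit\<close>, and it tends to 0 for every r > 0.\<close>

definition E :: "nat \<Rightarrow> real \<Rightarrow> real" where "E k u = 1 / real k + 2 * (u ^ k + (1 - u) ^ k)"

lemma g_bounds: assumes "0 < x" "0 < r" shows "0 \<le> g s x r" "g s x r \<le> 1"
 unfolding g_def by (rule G_bounds[OF _ fe(2)]; use assms in simp)+

text \<open>For r between ln 2 / k and a large N the convergence is uniform. Outside, the trivial
  bound 1 is covered by the factor 2 in \<open>E\<close>, since u^k is at least 1 / 2 for small r
  and (1 - u)^k for large r.\<close>

lemma g_H_error:
 assumes s: "0 < s" "s < 1" and k: "0 < k"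
 shows "\<forall>\<^sub>F n in sequentially. \<forall>r>0. \<bar>g s (xia n) r - H s (r powr (1 + 1 / \<alpha>))\<bar> \<le> E k (exp (- r))"
proof -
 define et where "et = ln 2 / real k"
 have et: "0 < et" using k by (simp add: et_def)
 have "((\<lambda>N::real. (1 - exp (- N)) ^ k) \<longlongrightarrow> (1 - 0) ^ k) at_top"
  by (intro tendsto_power tendsto_diff tendsto_const) real_asymp
 then have "\<forall>\<^sub>F N::real in at_top. 1 / 2 < (1 - exp (- N)) ^ k" by (rule order_tendstoD(1)) simp
 then have "\<forall>\<^sub>F N::real in at_top. 1 / 2 < (1 - exp (- N)) ^ k \<and> et < N" using eventually_gt_at_top by (rule eventually_conj)
 then obtain N where N: "1 / 2 < (1 - exp (- N)) ^ k" "et < N" using eventually_happens'[OF trivial_limit_at_top_linorder] by blast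
 define bta where "bta = 1 + 1 / \<alpha>"
 have bta: "0 < bta" using \<alpha>1 by (simp add: bta_def add_pos_pos)
 have c: "0 < et powr bta" "et powr bta \<le> N powr bta" using et N bta by (auto intro!: powr_mono2)
 obtain y0 where y0: "0 < y0" "\<And>y c. 0 < y \<Longrightarrow> y < y0 \<Longrightarrow> et powr bta \<le> c \<Longrightarrow> c \<le> N powr bta \<Longrightarrow> \<bar>G y 1 s (fe c) - H s c\<bar> \<le> 1 / real k"
  using G_fe_uniform[OF s c, of "1 / real k"] k by auto
 have "(\<lambda>n. xia n * et powr (- (1 / \<alpha>))) \<longlonglongrightarrow> 0 * et powr (- (1 / \<alpha>))" by (intro tendsto_mult xia_lim tendsto_const)
 then have "\<forall>\<^sub>F n in sequentially. xia n * et powr (- (1 / \<alpha>)) < y0" by (rule order_tendstoD(2)) (use y0 in simp)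
 then show ?thesis
 proof eventually_elim
  case (elim n)
  show ?case
  proof (intro allI impI)
   fix r :: real assume r: "0 < r"
   have u: "0 < exp (- r)" "exp (- r) < 1" using r by auto
   then have p: "0 \<le> exp (- r) ^ k" "0 \<le> (1 - exp (- r)) ^ k" by auto
   have triv: "\<bar>g s (xia n) r - H s (r powr (1 + 1 / \<alpha>))\<bar> \<le> 1" using g_bounds[OF xia_pos[of n] r, of s] H_bounds[of s "r powr (1 + 1 / \<alpha>)"] by linarith
   have k1: "0 \<le> 1 / real k" by simp
   have lin: "d \<le> e + 2 * (p + q)" if "d \<le> 1" "1 / 2 \<le> p \<or> 1 / 2 \<le> q \<or> d \<le> e" "0 \<le> p" "0 \<le> q" "0 \<le> e" for d e p q :: real
    using that unfolding distrib_left by (elim disjE) linarith+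
   consider "r < et" | "N < r" | "et \<le> r" "r \<le> N" by linarith
   then show "\<bar>g s (xia n) r - H s (r powr (1 + 1 / \<alpha>))\<bar> \<le> E k (exp (- r))"
   proof cases
    case 1
    have "real k * r < ln 2" using 1 k by (simp add: et_def field_simps)
    then have "exp (- ln 2) \<le> exp (- (real k * r))" by (simp only: exp_le_cancel_iff)
    then have "1 / 2 \<le> exp (- (real k * r))" by (simp add: exp_minus)
    also have "exp (- (real k * r)) = exp (- r) ^ k" by (simp add: exp_of_nat_mult[symmetric])
    finally show ?thesis unfolding E_def by (intro lin[OF triv _ p k1] disjI1)
   next
    case 2
    have "(1 - exp (- N)) ^ k \<le> (1 - exp (- r)) ^ k" using 2 et N(2) by (intro power_mono) auto
    then have "1 / 2 \<le> (1 - exp (- r)) ^ k" by (rule order_trans[OF less_imp_le[OF N(1)]])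
    then show ?thesis unfolding E_def by (intro lin[OF triv _ p k1] disjI2 disjI1)
   next
    case 3
    have "r powr (- (1 / \<alpha>)) \<le> et powr (- (1 / \<alpha>))" using 3 et \<alpha>1 by (intro powr_mono2') auto
    then have "xia n * r powr (- (1 / \<alpha>)) \<le> xia n * et powr (- (1 / \<alpha>))" using xia_pos[of n] by (intro mult_left_mono) auto
    then have y: "xia n * r powr (- (1 / \<alpha>)) < y0" using elim by linarith
    have y': "0 < xia n * r powr (- (1 / \<alpha>))" using xia_pos[of n] r by simp
    have "\<bar>g s (xia n) r - H s (r powr bta)\<bar> \<le> 1 / real k"
     unfolding g_def bta_def[symmetric] by (rule y0(2)[OF y' y]) (use 3 et bta in \<open>auto intro!: powr_mono2\<close>)
    then show ?thesis unfolding E_def bta_def by (intro lin[OF triv _ p k1] disjI2)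
   qed
  qed
 qed
qed

definition Jn :: "real \<Rightarrow> real \<Rightarrow> real \<Rightarrow> nat \<Rightarrow> real" where
 "Jn a b s n = (LINT w|Mn n. Wn a b n w * exp (- (area (s * tau w) w)))"

lemma error_integral_tendsto:
 assumes ab: "0 < a" "a < b"
 shows "(\<lambda>k. LINT r|lborel. W0 a b r * E k (exp (- \<bar>r\<bar>))) \<longlonglongrightarrow> 0"
proof -
 have "(\<lambda>k. LINT r|lborel. W0 a b r * E k (exp (- \<bar>r\<bar>))) \<longlonglongrightarrow> (LINT r|(lborel :: real measure). (0::real))"
 proof (rule integral_dominated_convergence[where w = "\<lambda>r. 5 * W0 a b r"])
  have m: "W0 a b \<in> borel_measurable lborel" using W0(1)[OF ab] by (rule borel_measurable_integrable)
  then show "(\<lambda>r. W0 a b r * E k (exp (- \<bar>r\<bar>))) \<in> borel_measurable lborel" for k unfolding E_def by measurable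
  show "integrable lborel (\<lambda>r. 5 * W0 a b r)" by (intro integrable_mult_right W0 ab)
  show "AE r in lborel. norm (W0 a b r * E k (exp (- \<bar>r\<bar>))) \<le> 5 * W0 a b r" for k
  proof (rule AE_I2)
   fix r :: real
   have u: "0 \<le> exp (- \<bar>r\<bar>)" "exp (- \<bar>r\<bar>) \<le> 1" by auto
   have "0 \<le> exp (- \<bar>r\<bar>) ^ k" "exp (- \<bar>r\<bar>) ^ k \<le> 1" "0 \<le> (1 - exp (- \<bar>r\<bar>)) ^ k" "(1 - exp (- \<bar>r\<bar>)) ^ k \<le> 1"
    using u by (auto intro!: power_le_one)
   moreover have "0 \<le> 1 / real k" "1 / real k \<le> 1" by (cases k; simp)+
   ultimately have "0 \<le> E k (exp (- \<bar>r\<bar>))" "E k (exp (- \<bar>r\<bar>)) \<le> 5" unfolding E_def distrib_left by linarith+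
   then have "\<bar>E k (exp (- \<bar>r\<bar>))\<bar> \<le> 5" by linarith
   from mult_left_mono[OF this W0(3)[OF ab, of r]] show "norm (W0 a b r * E k (exp (- \<bar>r\<bar>))) \<le> 5 * W0 a b r"
    using W0(3)[OF ab, of r] by (simp add: abs_mult mult.commute)
  qed
  show "AE r in lborel. (\<lambda>k. W0 a b r * E k (exp (- \<bar>r\<bar>))) \<longlonglongrightarrow> 0"
  proof (rule AE_I2)
   fix r :: real
   show "(\<lambda>k. W0 a b r * E k (exp (- \<bar>r\<bar>))) \<longlonglongrightarrow> 0"
   proof (cases "0 < r")
    case True
    then have u: "0 < exp (- \<bar>r\<bar>)" "exp (- \<bar>r\<bar>) < 1" by auto
    have "(\<lambda>k. W0 a b r * E k (exp (- \<bar>r\<bar>))) \<longlonglongrightarrow> W0 a b r * (0 + 2 * (0 + 0))"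
     unfolding E_def by (intro tendsto_mult tendsto_add tendsto_const lim_1_over_n LIMSEQ_power_zero) (use u in auto)
    then show ?thesis by simp
   qed (simp add: W0_def)
  qed
 qed simp
 then show ?thesis by simp
qed

text \<open>Part of the exponential decay is moved from the weight to the integrand, so that the
  latter, as a function of u = exp (- r), is continuous also at u = 0, that is, at infinite r.
  Replacing the conditional means by H then costs at most the weighted integral of
  \<open>E k\<close>, which is small for large k.\<close>

lemma Jn_tendsto:
 assumes ab: "0 < a" "a < b" and s: "0 < s" "s < 1"
 shows "Jn a b s \<longlonglongrightarrow> (LINT r|lborel. W0 a b r * H s (r powr (1 + 1 / \<alpha>)))" (is "_ \<longlonglongrightarrow> ?La")
proof (rule tendstoI)
 fix e :: real assume e: "0 < e"
 \<comment> \<open>b' is determined by exp (- a r) - exp (- b r) = (exp (- a' r) - exp (- b' r)) exp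
   (- a' r).\<close>
 define a' b' where "a' = a / 2" and "b' = b - a / 2"
 have ab': "0 < a'" "a' < b'" using ab by (auto simp: a'_def b'_def)
 define f where "f u = max 0 u powr a' * H s (max 0 (- ln (max 0 u)) powr (1 + 1 / \<alpha>))" for u :: real
 have Hc: "isCont (H s) c" for c using continuous_H[of s] s by (simp add: continuous_on_eq_continuous_at)
 have pc: "isCont (\<lambda>u::real. max 0 u powr a') u" for u
  using continuous_on_powr'[of UNIV "\<lambda>u::real. max 0 u" "\<lambda>_. a'"] ab' by (auto simp: continuous_on_eq_continuous_at intro!: continuous_intros)
 have pc2: "isCont (\<lambda>v::real. max 0 v powr (1 + 1 / \<alpha>)) v" for v
  using continuous_on_powr'[of UNIV "\<lambda>u::real. max 0 u" "\<lambda>_. 1 + 1 / \<alpha>"] add_pos_pos[OF zero_less_one, of "1 / \<alpha>"] \<alpha>1 by (auto simp: continuous_on_eq_continuous_at intro!: continuous_intros)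
 have fb: "\<bar>f u\<bar> \<le> max 0 u powr a'" for u
 proof -
  have "f u \<le> max 0 u powr a' * 1" unfolding f_def by (rule mult_left_mono[OF H_bounds(2)]) simp
  moreover have "0 \<le> f u" unfolding f_def by (intro mult_nonneg_nonneg H_bounds) simp
  ultimately show ?thesis by simp
 qed
 have fc: "continuous_on UNIV f"
 proof (intro continuous_at_imp_continuous_on ballI)
  fix u :: real
  show "isCont f u"
  proof (cases "0 < u")
   case True
   have "isCont (\<lambda>u. - ln (max 0 u)) u" using True by (intro continuous_minus continuous_ln continuous_max continuous_const continuous_ident) simp
   from isCont_o2[OF isCont_o2[OF this pc2] Hc] show ?thesis unfolding f_def by (intro continuous_mult pc)
  next
   case False
   then have z: "f u = 0" "max 0 u powr a' = 0" unfolding f_def by (auto simp: max_def)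
   have "((\<lambda>v. max 0 v powr a') \<longlongrightarrow> 0) (at u)" using pc[of u] z(2) unfolding isCont_def by simp
   then have "(f \<longlongrightarrow> 0) (at u)" by (rule Lim_null_comparison[rotated]) (use fb in auto)
   then show ?thesis unfolding isCont_def z .
  qed
 qed
 have Ec: "continuous_on UNIV (E k)" for k unfolding E_def[abs_def] by (intro continuous_intros)
 have fexp: "f (exp (- r)) = exp (- a' * r) * H s (r powr (1 + 1 / \<alpha>))" if "0 < r" for r
  using that by (simp add: f_def powr_def max_def)
 have wsplit: "exp (- a * r) - exp (- b * r) = (exp (- a' * r) - exp (- b' * r)) * exp (- a' * r)" for r :: real
  by (simp add: a'_def b'_def left_diff_distrib exp_add[symmetric] algebra_simps)
 have L0: "?La = (LINT r|lborel. W0 a' b' r * f (exp (- \<bar>r\<bar>)))"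
 proof (rule LINT_cong[OF refl])
  fix r :: real
  show "W0 a b r * H s (r powr (1 + 1 / \<alpha>)) = W0 a' b' r * f (exp (- \<bar>r\<bar>))"
  proof (cases "0 < r")
   case True
   then show ?thesis unfolding W0_def wsplit by (simp add: fexp)
  qed (simp add: W0_def)
 qed
 have Wsplit: "Wn a b n y = Wn a' b' n y * exp (- a' * tau y)" for n y unfolding Wn_def wsplit by (simp only: mult.assoc)
 have "\<forall>\<^sub>F k in sequentially. (LINT r|lborel. W0 a' b' r * E k (exp (- \<bar>r\<bar>))) < e / 2 \<and> 0 < k"
  by (intro eventually_conj order_tendstoD(2)[OF error_integral_tendsto[OF ab']] eventually_gt_at_top) (use e in simp)
 then obtain k where k: "(LINT r|lborel. W0 a' b' r * E k (exp (- \<bar>r\<bar>))) < e / 2" "0 < k"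
  using eventually_happens'[OF sequentially_bot] by blast
 define L R where "L n = (LINT y|Mn n. Wn a' b' n y * f (exp (- tau y)))" and "R n = (LINT y|Mn n. Wn a' b' n y * E k (exp (- tau y)))" for n
 have evL: "\<forall>\<^sub>F n in sequentially. dist (L n) ?La < e / 2"
  unfolding L0 L_def by (rule tendstoD[OF weight_limit[OF ab' fc]]) (use e in simp)
 have evR: "\<forall>\<^sub>F n in sequentially. R n < e / 2"
  unfolding R_def by (rule order_tendstoD(2)[OF weight_limit[OF ab' Ec] k(1)])
 show "\<forall>\<^sub>F n in sequentially. dist (Jn a b s n) ?La < e"
  using evL evR g_H_error[OF s k(2)]
 proof eventually_elim
  case (elim n)
  interpret X: positive_start \<alpha> "Mn n" "xia n" by (rule pos[OF xia_pos])
  let ?U = "\<lambda>y. Wn a' b' n y * f (exp (- tau y))" and ?V = "\<lambda>y. Wn a' b' n y * E k (exp (- tau y))"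
  have Wm: "Wn a b n \<in> borel_measurable (Mn n)" using Wn_integrable[OF ab] by (rule borel_measurable_integrable)
  have am: "(\<lambda>y. LBINT t:{0..<s * tau y}. y t) \<in> borel_measurable (Mn n)" by (rule measurable_area_at[OF X.sets_M]) measurable
  have pre: "AE y in Mn n. 0 < tau y" using X.AE_passage_finite by eventually_elim blast
  have anon: "AE y in Mn n. 0 \<le> (area (s * tau y) y)" using s by (intro X.AE_area_nonneg) auto
  have iJ: "integrable (Mn n) (\<lambda>y. Wn a b n y * exp (- (area (s * tau y) y)))"
  proof (rule Lintegrable_bound[OF Wn_integrable[OF ab]])
   show "(\<lambda>y. Wn a b n y * exp (- (area (s * tau y) y))) \<in> borel_measurable (Mn n)" using Wm am by measurable
   show "AE y in Mn n. norm (Wn a b n y * exp (- (area (s * tau y) y))) \<le> norm (Wn a b n y)"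
    using anon by eventually_elim (simp add: abs_mult mult_left_le)
  qed
  have nJ: "ennreal (Jn a b s n) = (\<integral>\<^sup>+y. ennreal (Wn a b n y * g s (xia n) (tau y)) \<partial>Mn n)"
  proof -
   define w where "w r = C / xia n * (exp (- a * \<bar>r\<bar>) - exp (- b * \<bar>r\<bar>))" for r
   have w0: "0 \<le> w r" for r
   proof -
    have "exp (- b * \<bar>r\<bar>) \<le> exp (- a * \<bar>r\<bar>)" using ab by (simp add: mult_right_mono)
    then show ?thesis unfolding w_def using C_pos xia_pos[of n] by (intro mult_nonneg_nonneg) auto
   qed
   have wW: "w (tau y) = Wn a b n y" for y using tau_nonneg[of y] by (simp add: w_def Wn_def)
   have "ennreal (Jn a b s n) = (\<integral>\<^sup>+y. ennreal (Wn a b n y * exp (- (area (s * tau y) y))) \<partial>Mn n)"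
    unfolding Jn_def by (rule nn_integral_eq_integral[OF iJ, symmetric]) (use Wn_nonneg[OF ab] in simp)
   also have "... = (\<integral>\<^sup>+y. ennreal (Wn a b n y * g s (xia n) (tau y)) \<partial>Mn n)"
   proof -
    have "w \<in> borel_measurable borel" unfolding w_def[abs_def] by measurable
    from G_joint_J[OF xia_pos[of n] s this w0] show ?thesis unfolding wW .
   qed
   finally show ?thesis .
  qed
  have Wp: "0 \<le> Wn a' b' n y" for y by (rule Wn_nonneg[OF ab'])
  have tauM: "(\<lambda>y. exp (- tau y)) \<in> borel_measurable (Mn n)" by measurable
  have z01: "0 \<le> exp (- tau y) \<and> exp (- tau y) \<le> 1" for y using tau_nonneg by simp
  have iL: "integrable (Mn n) (\<lambda>y. ?U y)" by (rule integrable_mult_continuous[OF Wn_integrable[OF ab'] tauM z01 fc])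
  have iR: "integrable (Mn n) (\<lambda>y. ?V y)" by (rule integrable_mult_continuous[OF Wn_integrable[OF ab'] tauM z01 Ec])
  have key: "\<bar>exp (- a' * r) * g s (xia n) r - f (exp (- r))\<bar> \<le> E k (exp (- r))" if r: "0 < r" for r
  proof -
   have "exp (- a' * r) * g s (xia n) r - f (exp (- r)) = exp (- a' * r) * (g s (xia n) r - H s (r powr (1 + 1 / \<alpha>)))"
    unfolding fexp[OF r] by (simp only: right_diff_distrib)
   then have "\<bar>exp (- a' * r) * g s (xia n) r - f (exp (- r))\<bar> = exp (- a' * r) * \<bar>g s (xia n) r - H s (r powr (1 + 1 / \<alpha>))\<bar>"
    by (simp only: abs_mult abs_exp_cancel)
   also have "... \<le> 1 * \<bar>g s (xia n) r - H s (r powr (1 + 1 / \<alpha>))\<bar>" using ab' r by (intro mult_right_mono) auto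
   finally show ?thesis using elim(3) r by fastforce
  qed
  have up: "Wn a b n y * g s (xia n) (tau y) \<le> ?U y + ?V y"
   and lo: "?U y - ?V y \<le> Wn a b n y * g s (xia n) (tau y)" if t: "0 < tau y" for y
  proof -
   have e: "Wn a b n y * g s (xia n) (tau y) = Wn a' b' n y * (exp (- a' * tau y) * g s (xia n) (tau y))" unfolding Wsplit by (simp only: mult.assoc)
   have "exp (- a' * tau y) * g s (xia n) (tau y) \<le> f (exp (- tau y)) + E k (exp (- tau y))" using key[OF t] by linarith
   from mult_left_mono[OF this Wp[of y]] show "Wn a b n y * g s (xia n) (tau y) \<le> ?U y + ?V y"
    unfolding e by (simp only: distrib_left)
   have "f (exp (- tau y)) - E k (exp (- tau y)) \<le> exp (- a' * tau y) * g s (xia n) (tau y)" using key[OF t] by linarith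
   from mult_left_mono[OF this Wp[of y]] show "?U y - ?V y \<le> Wn a b n y * g s (xia n) (tau y)"
    unfolding e by (simp only: right_diff_distrib)
  qed
  have J0: "0 \<le> Jn a b s n" unfolding Jn_def using Wn_nonneg[OF ab] by (intro LINT_nonneg) auto
  have E0: "0 \<le> E k u" if "0 \<le> u" "u \<le> 1" for u using that unfolding E_def by (intro add_nonneg_nonneg mult_nonneg_nonneg) auto
  have f0: "0 \<le> f u" for u unfolding f_def by (intro mult_nonneg_nonneg H_bounds) simp
  have LR0: "0 \<le> L n + R n"
   unfolding L_def R_def using Wp f0 E0 z01 by (intro add_nonneg_nonneg LINT_nonneg mult_nonneg_nonneg) auto
  have "ennreal (Jn a b s n) \<le> (\<integral>\<^sup>+y. ennreal (?U y + ?V y) \<partial>Mn n)"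
   unfolding nJ by (rule nn_integral_mono_AE) (use pre in eventually_elim, intro ennreal_leI up)
  also have "... = ennreal (LINT y|Mn n. ?U y + ?V y)"
   by (rule nn_integral_eq_integral) (use iL iR Wp f0 E0 z01 in \<open>auto intro!: add_nonneg_nonneg mult_nonneg_nonneg\<close>)
  also have "(LINT y|Mn n. ?U y + ?V y) = L n + R n"
   unfolding L_def R_def by (rule LINT_add[OF iL iR])
  finally have u1: "Jn a b s n \<le> L n + R n" using LR0 by (simp add: ennreal_le_iff)
  have iD: "integrable (Mn n) (\<lambda>y. ?U y - ?V y)" by (rule Lintegrable_diff[OF iL iR])
  \<comment> \<open>The lower bound may be negative while the comparison runs through
    \<open>ennreal\<close>, so it is replaced by its positive part.\<close>
  have iM: "integrable (Mn n) (\<lambda>y. max 0 (?U y - ?V y))" by (intro integrable_max iD) simp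
  have "L n - R n = (LINT y|Mn n. ?U y - ?V y)"
   unfolding L_def R_def by (rule LINT_diff[OF iL iR, symmetric])
  also have "... \<le> (LINT y|Mn n. max 0 (?U y - ?V y))"
   by (rule LINT_mono[OF iD iM]) simp
  also have "... \<le> Jn a b s n"
  proof -
   have "ennreal (LINT y|Mn n. max 0 (?U y - ?V y)) = (\<integral>\<^sup>+y. ennreal (max 0 (?U y - ?V y)) \<partial>Mn n)"
    by (rule nn_integral_eq_integral[OF iM, symmetric]) simp
   also have "... \<le> ennreal (Jn a b s n)"
    unfolding nJ
   proof (rule nn_integral_mono_AE)
    show "AE y in Mn n. ennreal (max 0 (?U y - ?V y)) \<le> ennreal (Wn a b n y * g s (xia n) (tau y))"
     using pre
    proof eventually_elim
     case (elim y)
     have "0 \<le> Wn a b n y * g s (xia n) (tau y)" by (intro mult_nonneg_nonneg Wn_nonneg[OF ab] g_bounds(1)[OF xia_pos elim])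
     with lo[OF elim] show ?case by (intro ennreal_leI) simp
    qed
   qed
   finally show ?thesis using J0 by (simp add: ennreal_le_iff)
  qed
  finally have l1: "L n - R n \<le> Jn a b s n" .
  show ?case using u1 l1 elim(1,2) unfolding dist_real_def by linarith
 qed
qed

end

section \<open>Identification of the limit and removal of the cutoffs\<close>

context excursion_limit
begin

text \<open>\<open>feynman_kac\<close> with c = 0 writes \<Phi> y as \<Phi> 0 times the mean of a
  strictly positive variable.\<close>

lemma M_Wright_pos: assumes "0 \<le> y" shows "0 < M_Wright \<alpha> y"
proof (cases "y = 0")
 case True
 then show ?thesis using M_Wright_0_pos by simp
next
 case False
 then have y: "0 < y" using assms by simp
 interpret X: positive_start \<alpha> "Mx y" y by (rule pos[OF y])
 define A where "A w = (area (tau w) w)" for w :: "real \<Rightarrow> real"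
 have Am: "A \<in> borel_measurable (Mx y)" unfolding A_def[abs_def] by (rule measurable_area_at[OF X.sets_M]) measurable
 have A0: "AE w in Mx y. 0 \<le> A w"
  using X.AE_area_nonneg[of 1] unfolding A_def by simp
 have i: "integrable (Mx y) (\<lambda>w. exp (- A w))"
 proof (rule X.integrable_const_bound[where B = 1])
  show "AE w in Mx y. norm (exp (- A w)) \<le> 1" using A0 by eventually_elim simp
 qed (use Am in measurable)
 have "(LINT w|Mx y. exp (- A w)) \<noteq> 0"
 proof
  assume "(LINT w|Mx y. exp (- A w)) = 0"
  then have "AE w in Mx y. exp (- A w) = 0" using i by (subst (asm) integral_nonneg_eq_0_iff_AE) auto
  then have "AE w in Mx y. False" by simp
  then show False using X.AE_False by blast
 qed
 moreover have "0 \<le> (LINT w|Mx y. exp (- A w))" by (rule LINT_nonneg) simp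
 ultimately have "0 < (LINT w|Mx y. exp (- A w))" by linarith
 moreover have "M_Wright \<alpha> y = M_Wright \<alpha> 0 * (LINT w|Mx y. exp (- A w))"
  using X.feynman_kac[of 0] unfolding A_def by simp
 ultimately show ?thesis using M_Wright_0_pos by simp
qed

definition K :: "real \<Rightarrow> real" where "K a = deriv (M_Wright \<alpha>) a / M_Wright \<alpha> a"

definition In :: "real \<Rightarrow> real \<Rightarrow> nat \<Rightarrow> real" where
 "In a b n = (LINT w|Mn n. Wn a b n w * exp (- (area (tau w) w)))"

text \<open>By \<open>feynman_kac\<close> the two exponential means are \<Phi> (c + x) / \<Phi> c
  for c = a and c = b. In their difference the limit value 1 cancels, and division by x leaves
  difference quotients of \<Phi>.\<close>

lemma In_tendsto:
 assumes ab: "0 < a" "a < b"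
 shows "In a b \<longlonglongrightarrow> C * (K a - K b)"
proof -
 have e: "In a b n = C * ((M_Wright \<alpha> (a + xia n) - M_Wright \<alpha> a) / xia n / M_Wright \<alpha> a - (M_Wright \<alpha> (b + xia n) - M_Wright \<alpha> b) / xia n / M_Wright \<alpha> b)" for n
 proof -
  interpret X: positive_start \<alpha> "Mn n" "xia n" by (rule pos[OF xia_pos])
  define A where "A w = (area (tau w) w)" for w :: "real \<Rightarrow> real"
  have Am: "A \<in> borel_measurable (Mn n)" unfolding A_def[abs_def] by (rule measurable_area_at[OF X.sets_M]) measurable
  have A0: "AE w in Mn n. 0 \<le> A w"
   using X.AE_area_nonneg[of 1] unfolding A_def by simp
  have i: "integrable (Mn n) (\<lambda>w. exp (- c * tau w - A w))" if "0 < c" for c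
  proof (rule X.integrable_const_bound[where B = 1])
   show "AE w in Mn n. norm (exp (- c * tau w - A w)) \<le> 1"
    using A0
   proof eventually_elim
    case (elim w)
    have "0 \<le> c * tau w" using that tau_nonneg by simp
    then have "- c * tau w - A w \<le> 0" using elim by simp
    then show ?case by simp
   qed
  qed (use Am in measurable)
  have v: "(LINT w|Mn n. exp (- c * tau w - A w)) = M_Wright \<alpha> (c + xia n) / M_Wright \<alpha> c" if "0 < c" for c
   using X.feynman_kac[of c] M_Wright_pos[of c] that unfolding A_def by (simp add: add.commute)
  have s: "exp (- c * tau w) * exp (- A w) = exp (- c * tau w - A w)" for c w by (simp add: exp_add[symmetric])
  have "In a b n = (LINT w|Mn n. C / xia n * (exp (- a * tau w - A w) - exp (- b * tau w - A w)))"
   unfolding In_def A_def[symmetric] by (simp only: Wn_def mult.assoc left_diff_distrib s)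
  also have "... = C / xia n * (LINT w|Mn n. exp (- a * tau w - A w) - exp (- b * tau w - A w))" by (rule integral_mult_right_zero)
  also have "(LINT w|Mn n. exp (- a * tau w - A w) - exp (- b * tau w - A w)) = M_Wright \<alpha> (a + xia n) / M_Wright \<alpha> a - M_Wright \<alpha> (b + xia n) / M_Wright \<alpha> b"
   using ab by (subst LINT_diff) (simp_all only: i v less_trans[OF ab])
  finally have 1: "In a b n = C / xia n * (M_Wright \<alpha> (a + xia n) / M_Wright \<alpha> a - M_Wright \<alpha> (b + xia n) / M_Wright \<alpha> b)" .
  have alg: "C / x * (p / fa - q / fb) = C * ((p - fa) / x / fa - (q - fb) / x / fb)" if "x \<noteq> 0" "fa \<noteq> 0" "fb \<noteq> 0" for x p fa q fb :: real
   using that by (simp add: field_simps)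
  show ?thesis unfolding 1 by (rule alg) (use xia_pos[of n] M_Wright_pos[of a] M_Wright_pos[of b] ab in auto)
 qed
 have d: "(\<lambda>n. (M_Wright \<alpha> (c + xia n) - M_Wright \<alpha> c) / xia n) \<longlonglongrightarrow> deriv (M_Wright \<alpha>) c" for c
 proof -
  have "((\<lambda>h. (M_Wright \<alpha> (c + h) - M_Wright \<alpha> c) / h) \<longlongrightarrow> deriv (M_Wright \<alpha>) c) (at 0)" using deriv_M_Wright[of c] by (simp only: DERIV_def)
  moreover have "filterlim xia (at 0) sequentially"
   unfolding filterlim_at using xia_lim xia_pos by (auto intro!: always_eventually simp: less_imp_neq[symmetric])
  ultimately show ?thesis by (rule filterlim_compose)
 qed
 show ?thesis unfolding e K_def
  by (intro tendsto_mult tendsto_const tendsto_diff tendsto_divide d) (use M_Wright_pos[of a] M_Wright_pos[of b] ab in auto)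
qed

text \<open>The difference of the two exponentials is at most the area of the last piece, so
  \<open>last_area_bound\<close> applies; its linearity in the starting point cancels the division
  by \<open>xia n\<close>, which makes the bound uniform in n.\<close>

lemma Jn_In_bound:
 assumes ab: "0 < a" "a < b" and s: "0 < s" "s < 1"
 shows "\<bar>Jn a b s n - In a b n\<bar> \<le> C * (4 * exp 1 * (1 / s - 1) powr (1 / \<alpha>) / a)"
proof -
 interpret X: positive_start \<alpha> "Mn n" "xia n" by (rule pos[OF xia_pos])
 define A B where "A w = (area (tau w) w)" and "B w = (area (s * tau w) w)" for w :: "real \<Rightarrow> real"
 have Wm: "Wn a b n \<in> borel_measurable (Mn n)" using Wn_integrable[OF ab] by (rule borel_measurable_integrable)
 have Am: "A \<in> borel_measurable (Mn n)" unfolding A_def[abs_def] by (rule measurable_area_at[OF X.sets_M]) measurable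
 have Bm: "B \<in> borel_measurable (Mn n)" unfolding B_def[abs_def] by (rule measurable_area_at[OF X.sets_M]) measurable
 have AB: "AE w in Mn n. 0 \<le> B w \<and> B w \<le> A w"
  using X.AE_passage_finite
 proof eventually_elim
  case (elim w)
  have st: "0 \<le> s * tau w" "s * tau w \<le> tau w" using s elim by (auto simp: mult_left_le_one_le)
  have fn: "first_neg (s * tau w) w = s * tau w" unfolding first_neg_def using elim st by (simp add: min_def)
  have nn: "0 \<le> w t" if "t \<in> {0..<tau w}" for t
   by (rule nonneg_before_passage) (use that elim in auto)
  have "cadlag_on {0..tau w} w" by (rule cadlag_on_mono[of "{0..}"]) (use elim in auto)
  then have "set_integrable lborel {0..tau w} w" by (rule set_integrable_cadlag)
  then have I: "set_integrable lborel {0..<tau w} w" "set_integrable lborel {0..<s * tau w} w"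
   using st by (auto intro: set_integrable_subset)
  have "B w \<le> A w"
   unfolding A_def B_def set_lebesgue_integral_def
  proof (rule LINT_mono)
   show "indicator {0..<s * tau w} t *\<^sub>R w t \<le> indicator {0..<tau w} t *\<^sub>R w t" for t
    using nn[of t] st by (auto simp: indicator_def)
  qed (use I in \<open>auto simp: set_integrable_def\<close>)
  moreover have "0 \<le> B w" unfolding B_def by (rule X.area_nonneg[OF st(1)]) (simp only: fn order_refl)
  ultimately show ?case by blast
 qed
 have iA: "integrable (Mn n) (\<lambda>w. Wn a b n w * exp (- A w))"
 proof (rule Lintegrable_bound[OF Wn_integrable[OF ab]])
  show "AE w in Mn n. norm (Wn a b n w * exp (- A w)) \<le> norm (Wn a b n w)"
   using AB by eventually_elim (simp add: abs_mult mult_left_le)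
 qed (use Wm Am in measurable)
 have iB: "integrable (Mn n) (\<lambda>w. Wn a b n w * exp (- B w))"
 proof (rule Lintegrable_bound[OF Wn_integrable[OF ab]])
  show "AE w in Mn n. norm (Wn a b n w * exp (- B w)) \<le> norm (Wn a b n w)"
   using AB by eventually_elim (simp add: abs_mult mult_left_le)
 qed (use Wm Bm in measurable)
 define D where "D w = Wn a b n w * exp (- B w) - Wn a b n w * exp (- A w)" for w
 have iD: "integrable (Mn n) D" unfolding D_def[abs_def] by (rule Lintegrable_diff[OF iB iA])
 have D0: "AE w in Mn n. 0 \<le> D w"
  using AB
 proof eventually_elim
  case (elim w)
  then have "exp (- A w) \<le> exp (- B w)" by simp
  from mult_left_mono[OF this Wn_nonneg[OF ab]] show ?case unfolding D_def by (simp only: diff_ge_0_iff_ge)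
 qed
 have JI: "Jn a b s n - In a b n = (LINT w|Mn n. D w)"
  unfolding Jn_def In_def D_def A_def[symmetric] B_def[symmetric] by (rule LINT_diff[OF iB iA, symmetric])
 have J0: "0 \<le> (LINT w|Mn n. D w)" by (rule integral_nonneg_AE[OF D0])
 have c0: "0 \<le> C / xia n" using C_pos xia_pos[of n] by simp
 let ?b = "4 * exp 1 * (1 / s - 1) powr (1 / \<alpha>) / a"
 have b0: "0 \<le> ?b" using ab by simp
 have km: "(\<lambda>w. ennreal (exp (- a * tau w) * (A w - B w))) \<in> borel_measurable (Mn n)"
  using Am Bm by measurable
 have "ennreal (LINT w|Mn n. D w) = (\<integral>\<^sup>+w. ennreal (D w) \<partial>Mn n)" by (rule nn_integral_eq_integral[OF iD D0, symmetric])
 also have "... \<le> (\<integral>\<^sup>+w. ennreal (C / xia n) * ennreal (exp (- a * tau w) * (A w - B w)) \<partial>Mn n)"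
 proof (rule nn_integral_mono_AE)
  show "AE w in Mn n. ennreal (D w) \<le> ennreal (C / xia n) * ennreal (exp (- a * tau w) * (A w - B w))"
   using AB
  proof eventually_elim
   case (elim w)
   have "exp (- B w) - exp (- A w) \<le> A w - B w" using elim by (intro exp_diff_le) auto
   moreover have "0 \<le> exp (- B w) - exp (- A w)" using elim by simp
   ultimately have "(exp (- a * tau w) - exp (- b * tau w)) * (exp (- B w) - exp (- A w)) \<le> exp (- a * tau w) * (A w - B w)"
    by (intro mult_mono) auto
   from mult_left_mono[OF this c0] have "D w \<le> C / xia n * (exp (- a * tau w) * (A w - B w))"
    unfolding D_def Wn_def right_diff_distrib[symmetric] by (simp only: mult.assoc)
   then show ?case using c0 by (simp only: ennreal_mult'[symmetric] ennreal_leI)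
  qed
 qed
 also have "... = ennreal (C / xia n) * (\<integral>\<^sup>+w. ennreal (exp (- a * tau w) * (A w - B w)) \<partial>Mn n)" by (rule nn_integral_cmult[OF km])
 also have "... \<le> ennreal (C / xia n) * ennreal (4 * exp 1 * xia n * (1 / s - 1) powr (1 / \<alpha>) / a)"
  unfolding A_def B_def by (intro mult_left_mono X.last_area_bound ab s) simp
 also have "... = ennreal (C / xia n * (4 * exp 1 * xia n * (1 / s - 1) powr (1 / \<alpha>) / a))" by (rule ennreal_mult'[OF c0, symmetric])
 also have "C / xia n * (4 * exp 1 * xia n * (1 / s - 1) powr (1 / \<alpha>) / a) = C * ?b" using xia_pos[of n] by simp
 finally have "(LINT w|Mn n. D w) \<le> C * ?b" using b0 C_pos by (simp only: ennreal_le_iff mult_nonneg_nonneg less_imp_le)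
 then show ?thesis unfolding JI using J0 by simp
qed

lemma H_tendsto_1:
 assumes s: "\<And>n. 0 < s n" "\<And>n. s n < 1" "s \<longlonglongrightarrow> 1" shows "(\<lambda>n. H (s n) c) \<longlonglongrightarrow> H 1 c"
 unfolding H_def
proof (rule integral_dominated_convergence[where w = "\<lambda>_. 1"])
 interpret Q: prob_space Q by (rule Qp)
 show "integrable Q (\<lambda>_. 1 :: real)" by simp
 show "(\<lambda>v. fe c (carea 1 v)) \<in> borel_measurable Q" by (rule Hm) auto
 show "(\<lambda>v. fe c (carea (s n) v)) \<in> borel_measurable Q" for n by (rule Hm) (use s(1,2)[of n] in auto)
 show "AE v in Q. norm (fe c (carea (s n) v)) \<le> 1" for n using fe(2) by simp
 have fc: "isCont (fe c) a" for a using fe(1)[of c] by (simp add: continuous_on_eq_continuous_at)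
 show "AE v in Q. (\<lambda>n. fe c (carea (s n) v)) \<longlonglongrightarrow> fe c (carea 1 v)"
  using AE_space
 proof eventually_elim
  case (elim v)
  then have "cadlag_on {0..1} v" using sets_eq_imp_space_eq[OF Qs] by (simp add: cadlag_paths_def)
  then have "(\<lambda>n. carea (s n) v) \<longlonglongrightarrow> carea 1 v" by (rule carea_tendsto) (use s less_imp_le in auto)
  then show ?case by (rule isCont_tendsto_compose[OF fc])
 qed
qed

text \<open>The truncation s tends to 1 after the starting point has gone to 0. This order is
  legitimate because the error in \<open>Jn_In_bound\<close> is uniform in the starting point and
  vanishes with 1 / s - 1.\<close>

lemma weighted_identity:
 assumes ab: "0 < a" "a < b"
 shows "integrable lborel (\<lambda>r. W0 a b r * H 1 (r powr (1 + 1 / \<alpha>)))"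
  "(LINT r|lborel. W0 a b r * H 1 (r powr (1 + 1 / \<alpha>))) = C * (K a - K b)"
proof -
 have m: "(\<lambda>r. W0 a b r * H s (r powr (1 + 1 / \<alpha>))) \<in> borel_measurable lborel" if "0 < s" "s \<le> 1" for s
 proof -
  have "(\<lambda>r. H s (r powr (1 + 1 / \<alpha>))) \<in> borel_measurable borel"
   by (rule measurable_compose[OF _ borel_measurable_continuous_onI[OF continuous_H[OF that]]]) measurable
  then show ?thesis using borel_measurable_integrable[OF W0(1)[OF ab]] by measurable
 qed
 have bd: "norm (W0 a b r * H s (r powr (1 + 1 / \<alpha>))) \<le> W0 a b r" for r s
  using mult_left_mono[OF H_bounds(2)[of s "r powr (1 + 1 / \<alpha>)"] W0(3)[OF ab, of r]] W0(3)[OF ab, of r] H_bounds(1)[of s "r powr (1 + 1 / \<alpha>)"]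
  by (simp add: abs_mult)
 show "integrable lborel (\<lambda>r. W0 a b r * H 1 (r powr (1 + 1 / \<alpha>)))"
  by (rule Lintegrable_bound[OF W0(1)[OF ab] m]) (use bd order_trans[OF bd abs_ge_self] in auto)
 define s where "s n = 1 - 1 / (real n + 2)" for n :: nat
 have s: "0 < s n" "s n < 1" for n by (simp_all add: s_def field_simps)
 have sl: "s \<longlonglongrightarrow> 1" unfolding s_def by real_asymp
 define La where "La s = (LINT r|lborel. W0 a b r * H s (r powr (1 + 1 / \<alpha>)))" for s
 have l1: "(\<lambda>n. La (s n)) \<longlonglongrightarrow> La 1"
  unfolding La_def
 proof (rule integral_dominated_convergence[where w = "W0 a b"])
  show "AE r in lborel. (\<lambda>n. W0 a b r * H (s n) (r powr (1 + 1 / \<alpha>))) \<longlonglongrightarrow> W0 a b r * H 1 (r powr (1 + 1 / \<alpha>))"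
   by (intro AE_I2 tendsto_mult tendsto_const H_tendsto_1 s sl)
  show "integrable lborel (W0 a b)" by (rule W0(1)[OF ab])
  show "(\<lambda>r. W0 a b r * H 1 (r powr (1 + 1 / \<alpha>))) \<in> borel_measurable lborel" by (rule m) auto
  show "(\<lambda>r. W0 a b r * H (s n) (r powr (1 + 1 / \<alpha>))) \<in> borel_measurable lborel" for n by (rule m) (use s[of n] in auto)
 qed (use bd in auto)
 have b: "\<bar>La (s n) - C * (K a - K b)\<bar> \<le> C * (4 * exp 1 * (1 / s n - 1) powr (1 / \<alpha>) / a)" for n
 proof (rule tendsto_upperbound)
  show "(\<lambda>k. \<bar>Jn a b (s n) k - In a b k\<bar>) \<longlonglongrightarrow> \<bar>La (s n) - C * (K a - K b)\<bar>"
   unfolding La_def by (intro tendsto_rabs tendsto_diff Jn_tendsto In_tendsto ab s)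
  show "\<forall>\<^sub>F k in sequentially. \<bar>Jn a b (s n) k - In a b k\<bar> \<le> C * (4 * exp 1 * (1 / s n - 1) powr (1 / \<alpha>) / a)"
   by (intro always_eventually allI Jn_In_bound ab s)
 qed simp
 have sn: "(\<lambda>n. 1 / s n - 1) \<longlonglongrightarrow> 0" unfolding s_def by real_asymp
 have "(\<lambda>n. (1 / s n - 1) powr (1 / \<alpha>)) \<longlonglongrightarrow> 0 powr (1 / \<alpha>)"
  by (rule tendsto_powr'[OF sn tendsto_const]) (use \<alpha>1 s in \<open>auto intro!: always_eventually less_imp_le simp: field_simps\<close>)
 then have "(\<lambda>n. C * (4 * exp 1 * (1 / s n - 1) powr (1 / \<alpha>) / a)) \<longlonglongrightarrow> C * (4 * exp 1 * 0 powr (1 / \<alpha>) / a)"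
  using ab by (intro tendsto_mult tendsto_divide tendsto_const) auto
 then have z: "(\<lambda>n. C * (4 * exp 1 * (1 / s n - 1) powr (1 / \<alpha>) / a)) \<longlonglongrightarrow> 0" by simp
 have "(\<lambda>n. La (s n) - C * (K a - K b)) \<longlonglongrightarrow> 0" by (rule Lim_null_comparison[OF _ z]) (use b in auto)
 then have "(\<lambda>n. La (s n)) \<longlonglongrightarrow> C * (K a - K b)" by (simp only: LIM_zero_iff)
 from LIMSEQ_unique[OF l1 this] show "(LINT r|lborel. W0 a b r * H 1 (r powr (1 + 1 / \<alpha>))) = C * (K a - K b)" unfolding La_def .
qed

text \<open>The area up to 1 is a limit of the nonnegative areas up to times below 1, so the
  positive part in \<open>fe\<close> changes nothing almost surely.\<close>

lemma H_1_eq: assumes "0 \<le> c" shows "H 1 c = (\<integral>w. exp (- c * path_area w) \<partial>Q)"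
proof -
 interpret Q: prob_space Q by (rule Qp)
 define s where "s n = 1 - 1 / (real n + 2)" for n :: nat
 have s: "0 < s n" "s n < 1" for n by (simp_all add: s_def field_simps)
 have sl: "s \<longlonglongrightarrow> 1" unfolding s_def by real_asymp
 have all: "AE w in Q. \<forall>n. 0 \<le> carea (s n) w" using AE_carea_nonneg[OF s] by (simp add: AE_all_countable)
 have nn: "AE w in Q. 0 \<le> carea 1 w"
  using all AE_space
 proof eventually_elim
  case (elim w)
  then have "cadlag_on {0..1} w" using sets_eq_imp_space_eq[OF Qs] by (simp add: cadlag_paths_def)
  then have "(\<lambda>n. carea (s n) w) \<longlonglongrightarrow> carea 1 w" by (rule carea_tendsto) (use s sl less_imp_le in auto)
  then show ?case by (rule tendsto_lowerbound) (use elim in auto)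
 qed
 have m1: "(\<lambda>w. carea 1 w) \<in> borel_measurable Q" by (rule measurable_carea[OF Qs]) auto
 have m2: "(\<lambda>w. exp (- c * carea 1 w)) \<in> borel_measurable Q" using m1 by measurable
 show ?thesis unfolding H_def path_area_def
 proof (rule integral_cong_AE[OF Hm m2])
  show "AE w in Q. fe c (carea 1 w) = exp (- c * carea 1 w)" using nn by eventually_elim (use assms in \<open>simp add: fe_def\<close>)
 qed auto
qed

text \<open>Monotone convergence as the lower parameter decreases to 0 and the weight increases to 1
  - exp (- l r); on the other side \<Phi>' / \<Phi> is continuous at 0.\<close>

lemma excursion_area_identity:
 assumes l: "0 < l"
 shows "((\<lambda>t. (1 - exp (- l * t)) * (\<integral>w. exp (- (t powr (1 + 1 / \<alpha>)) * path_area w) \<partial>Q) * t powr (- (1 + 1 / \<alpha>)))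
  has_integral C * (K 0 - K l)) {0<..}"
proof -
 \<comment> \<open>The denominator n + 2 keeps a n strictly between 0 and l also at n = 0.\<close>
 define a where "a n = l / (real n + 2)" for n :: nat
 have a: "0 < a n" "a n < l" for n
 proof -
  show "0 < a n" using l by (simp add: a_def)
  have "l / (real n + 2) < l / 1" by (rule divide_strict_left_mono) (use l in auto)
  then show "a n < l" by (simp add: a_def)
 qed
 have al: "a \<longlonglongrightarrow> 0" unfolding a_def by real_asymp
 have am: "a m \<le> a n" if "n \<le> m" for m n unfolding a_def using l that by (intro divide_left_mono) auto
 define F where "F n r = W0 (a n) l r * H 1 (r powr (1 + 1 / \<alpha>))" for n r
 define u where "u r = indicator {0<..} r * ((1 - exp (- l * r)) * r powr (- (1 + 1 / \<alpha>))) * H 1 (r powr (1 + 1 / \<alpha>))" for r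
 have iF: "integrable lborel (F n)" "(LINT r|lborel. F n r) = C * (K (a n) - K l)" for n
  unfolding F_def[abs_def] by (rule weighted_identity[OF a])+
 have Kc: "isCont K 0" unfolding K_def[abs_def]
  by (intro continuous_divide isCont_deriv_M_Wright DERIV_isCont[OF deriv_M_Wright]) (use M_Wright_0_pos in auto)
 have Klim: "(\<lambda>n. LINT r|lborel. F n r) \<longlonglongrightarrow> C * (K 0 - K l)"
  unfolding iF(2) by (intro tendsto_mult tendsto_const tendsto_diff isCont_tendsto_compose[OF Kc] al)
 have mon: "AE r in lborel. mono (\<lambda>n. F n r)"
 proof (intro AE_I2 monoI)
  fix r :: real and n m :: nat assume nm: "n \<le> m"
  show "F n r \<le> F m r" unfolding F_def
  proof (rule mult_right_mono[OF _ H_bounds(1)])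
   show "W0 (a n) l r \<le> W0 (a m) l r"
   proof (cases "0 < r")
    case True
    have "exp (- a n * r) \<le> exp (- a m * r)" using am[OF nm] True by (simp add: mult_right_mono)
    then show ?thesis using True by (simp add: W0_def mult_right_mono)
   qed (simp add: W0_def)
  qed
 qed
 have pt: "AE r in lborel. (\<lambda>n. F n r) \<longlonglongrightarrow> u r"
 proof (rule AE_I2)
  fix r :: real
  have "(\<lambda>n. F n r) \<longlonglongrightarrow> indicator {0<..} r * ((exp (- 0 * r) - exp (- l * r)) * r powr (- (1 + 1 / \<alpha>))) * H 1 (r powr (1 + 1 / \<alpha>))"
   unfolding F_def W0_def by (intro tendsto_mult tendsto_const tendsto_diff tendsto_exp tendsto_minus al)
  then show "(\<lambda>n. F n r) \<longlonglongrightarrow> u r" by (simp add: u_def)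
 qed
 have Hm1: "(\<lambda>r. H 1 (r powr (1 + 1 / \<alpha>))) \<in> borel_measurable borel"
  by (rule measurable_compose[OF _ borel_measurable_continuous_onI[OF continuous_H[of 1]]]) auto
 have um: "u \<in> borel_measurable lborel" unfolding u_def[abs_def] using Hm1 by measurable
 have iu: "integrable lborel u" by (rule integrable_monotone_convergence[OF iF(1) mon pt Klim um])
 have "(LINT r|lborel. u r) = C * (K 0 - K l)" by (rule integral_monotone_convergence[OF iF(1) mon pt Klim um])
 with has_integral_integral_lborel[OF iu] have "(u has_integral C * (K 0 - K l)) UNIV" by simp
 moreover have "u = (\<lambda>t. if t \<in> {0<..} then (1 - exp (- l * t)) * (\<integral>w. exp (- (t powr (1 + 1 / \<alpha>)) * path_area w) \<partial>Q) * t powr (- (1 + 1 / \<alpha>)) else 0)"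
  by (simp add: fun_eq_iff u_def H_1_eq)
 ultimately show ?thesis by (simp only: has_integral_restrict_UNIV)
qed

end

text \<open>Each starting point comes with a kernel of its own; choosing one for every x gives the
  family that \<open>excursion_limit\<close> fixes.\<close>

lemma cond_law_choice:
 assumes "\<And>x. 0 < x \<Longrightarrow> cond_law_T0 (N x) 1 (R x)"
 shows "\<exists>kp. \<forall>x::real. 0 < x \<longrightarrow> cond_kernel_T0 (N x) (kp x) \<and>
  (\<forall>s t. 0 \<le> s \<and> s < t \<longrightarrow> weak_limit_upto s (\<lambda>u. kp x (ereal u)) (kp x (ereal t)) (at t)) \<and> R x = kp x (ereal 1)"
proof (rule choice, rule allI)
 fix x :: real
 show "\<exists>k. 0 < x \<longrightarrow> cond_kernel_T0 (N x) k \<and> (\<forall>s t. 0 \<le> s \<and> s < t \<longrightarrow> weak_limit_upto s (\<lambda>u. k (ereal u)) (k (ereal t)) (at t)) \<and> R x = k (ereal 1)"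
  using assms[of x] unfolding cond_law_T0_def by blast
qed

theorem theorem1:
 fixes \<alpha> l :: real and P Q :: "(real \<Rightarrow> real) measure"
 assumes "1 < \<alpha>" and "\<alpha> \<le> 2"
  and "spectrally_positive_stable_law \<alpha> P"
  and "normalized_excursion_law P Q"
  and "0 \<le> l"
 shows "((\<lambda>t. (1 - exp (- l * t)) *
      (\<integral>\<omega>. exp (- (t powr (1 + 1 / \<alpha>)) * path_area \<omega>) \<partial>Q) * t powr (- (1 + 1 / \<alpha>)))
     has_integral
      \<alpha> * Gamma (1 - 1 / \<alpha>) *
      (deriv (M_Wright \<alpha>) 0 / M_Wright \<alpha> 0 - deriv (M_Wright \<alpha>) l / M_Wright \<alpha> l)) {0<..}"
proof (cases "l = 0")
 \<comment> \<open>The weights ask for 0 < a < l, so l = 0 is treated apart; both sides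
   vanish.\<close>
 case True
 then show ?thesis by simp
next
 case False
 then have l: "0 < l" using assms(5) by simp
 have Q: "prob_space Q" "sets Q = sets (path_space {0..1})" using assms(4) by (auto simp: normalized_excursion_law_def)
 obtain R where R: "\<And>x. 0 < x \<Longrightarrow> cond_law_T0 (started_at x P) 1 (R x)" "\<And>s. 0 \<le> s \<Longrightarrow> s < 1 \<Longrightarrow> weak_limit_upto s R Q (at_right 0)"
  using assms(4) unfolding normalized_excursion_law_def by blast
 obtain kp where k: "\<forall>x::real. 0 < x \<longrightarrow> cond_kernel_T0 (started_at x P) (kp x) \<and>
  (\<forall>s t. 0 \<le> s \<and> s < t \<longrightarrow> weak_limit_upto s (\<lambda>u. kp x (ereal u)) (kp x (ereal t)) (at t)) \<and> R x = kp x (ereal 1)"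
  using cond_law_choice[where N = "\<lambda>x. started_at x P" and R = R, OF R(1)] by (rule exE)
 have kp: "cond_kernel_T0 (started_at x P) (kp x)"
  "\<forall>s t. 0 \<le> s \<and> s < t \<longrightarrow> weak_limit_upto s (\<lambda>u. kp x (ereal u)) (kp x (ereal t)) (at t)"
  "R x = kp x (ereal 1)" if "0 < x" for x
 proof -
  note c = mp[OF spec[OF k] that]
  show "cond_kernel_T0 (started_at x P) (kp x)" by (rule conjunct1[OF c])
  show "\<forall>s t. 0 \<le> s \<and> s < t \<longrightarrow> weak_limit_upto s (\<lambda>u. kp x (ereal u)) (kp x (ereal t)) (at t)" by (rule conjunct1[OF conjunct2[OF c]])
  show "R x = kp x (ereal 1)" by (rule conjunct2[OF conjunct2[OF c]])
 qed
 have S: "stable_start \<alpha> P 0" by (rule stable_start_law[OF assms(1-3)])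
 interpret excursion_limit \<alpha> "\<lambda>x. started_at x P" kp Q
 proof (intro excursion_limit.intro airy_param.intro excursion_limit_axioms.intro)
  show "1 < \<alpha>" "\<alpha> \<le> 2" by fact+
  show "prob_space Q" "sets Q = sets (path_space {0..1})" by (rule Q)+
  show "cond_kernel_T0 (started_at x P) (kp x)" if "0 < x" for x by (rule kp(1)[OF that])
  show "weak_limit_upto s (\<lambda>u. kp x (ereal u)) (kp x (ereal t)) (at t)" if "0 < x" "0 \<le> s" "s < t" for x s t
   using kp(2)[OF that(1)] that(2,3) by (elim allE impE) (rule conjI)
  show "positive_start \<alpha> (started_at x P) x" if "0 < x" for x
   using stable_start_started_at[OF S, of x] that by (simp add: positive_start_def positive_start_axioms_def)
  show "weak_limit_upto s (\<lambda>x. kp x (ereal 1)) Q (at_right 0)" if s: "0 \<le> s" "s < 1" for s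
   unfolding weak_limit_upto_def
  proof (intro allI impI)
   fix f :: "(real \<Rightarrow> real) \<Rightarrow> real"
   assume f: "continuous_map (skorokhod_topology s) euclideanreal f \<and> bounded (f ` cadlag_paths {0..s})"
   have "((\<lambda>x. \<integral>w. f w \<partial>law_upto s (R x)) \<longlongrightarrow> (\<integral>w. f w \<partial>law_upto s Q)) (at_right 0)"
    using R(2)[OF s] f unfolding weak_limit_upto_def by blast
   moreover have "\<forall>\<^sub>F x in at_right 0. (\<integral>w. f w \<partial>law_upto s (R x)) = (\<integral>w. f w \<partial>law_upto s (kp x (ereal 1)))"
    using eventually_at_right_less[of 0] by eventually_elim (simp only: kp(3))
   ultimately show "((\<lambda>x. \<integral>w. f w \<partial>law_upto s (kp x (ereal 1))) \<longlongrightarrow> (\<integral>w. f w \<partial>law_upto s Q)) (at_right 0)"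
    by (rule Lim_transform_eventually)
  qed
 qed
 show ?thesis using excursion_area_identity[OF l] unfolding C_def K_def .
qed

end
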